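(* Assume the standing setting below, and: (i) for every $\delta>0$ there exists $\nu_\delta>0$ such that for all $\theta\in\Theta$, $A_\theta(x)\ge \nu_\delta I$ for all $x\in\Sigma_\delta^C:=\{x:\operatorname{dist}(x,\Sigma)>\delta\}$; (ii) there exists $\mu_0>1$ such that, with $c$ the ergodic constant: (a) $H_\theta(x,\mu p)-\mu H_\theta(x,p)\ge (1-\mu)c$ for all $(x,p)\in\mathbb T^N\times\mathbb R^N$, $\theta\in\Theta$, $1<\mu<\mu_0$; (b) there exists a (possibly empty) compact set $K\subset\Sigma$ such that $H_\theta(x,p)\ge c$ for all $(x,p)\in K\times\mathbb R^N$, $\theta\in\Theta$, and for all $x\in\Sigma$ with $\operatorname{dist}(x,K)\ne0$, all $p\ne0$ and all $1<\mu\le\mu_0$, $\inf_{\theta\in\Theta}\{H_\theta(x,\mu p)-\mu H_\theta(x,p)\}>(1-\mu)c$. Then $u(\cdot,t)+ct\to u_\infty$ uniformly on $\mathbb T^N$ as $t\to+\infty$, where $u$ is the solution of (E) and $u_\infty$ is a viscosity solution of (S).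
   Context: Standing setting. $\mathbb T^N=\mathbb R^N/\mathbb Z^N$ is the flat torus, $\Theta$ is a metric space and $C>0$ is a fixed constant. For every $\theta\in\Theta$: $\sigma_\theta\in W^{1,\infty}(\mathbb T^N;\mathcal M_N)$ with $|\sigma_\theta|,|D\sigma_\theta|\le C$, and $A_\theta=\sigma_\theta\sigma_\theta^T$; $H_\theta\in W^{1,\infty}_{\rm loc}(\mathbb T^N\times\mathbb R^N)$ with $|H_\theta(x,0)|\le C$, and for every $R>0$ there is $C_R>0$ independent of $\theta$ with $|H_\theta(x,p)-H_\theta(y,q)|\le C_R(|x-y|+|p-q|)$ for $x,y\in\mathbb T^N$, $|p|,|q|\le R$. Consider (E) $u_t+\sup_{\theta\in\Theta}\{-\mathrm{tr}(A_\theta(x)D^2u)+H_\theta(x,Du)\}=0$ in $\mathbb T^N\times(0,\infty)$, $u(x,0)=u_0(x)$; (E$_\lambda$) $\lambda v_\lambda+\sup_{\theta}\{-\mathrm{tr}(A_\theta(x)D^2v_\lambda)+H_\theta(x,Dv_\lambda)\}=0$ in $\mathbb T^N$, $\lambda>0$; (S) $\sup_{\theta}\{-\mathrm{tr}(A_\theta(x)D^2v)+H_\theta(x,Dv)\}=c$ in $\mathbb T^N$. It is assumed that there exist viscosity solutions $u\in C(\mathbb T^N\times[0,\infty))$ of (E) and $v_\lambda\in C(\mathbb T^N)$ of (E$_\lambda$) for all $\lambda>0$ with $|u(x,t)-u(y,t)|,|v_\lambda(x)-v_\lambda(y)|\le C|x-y|$ for all $x,y,t,\lambda$. Under this assumption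 a comparison principle holds for (E) and (E$_\lambda$), there is a unique constant $c\in\mathbb R$ (the ergodic constant) for which (S) has a solution $v\in W^{1,\infty}(\mathbb T^N)$, and $u+ct$ is bounded. All solutions are viscosity solutions. $\Sigma:=\{x\in\mathbb T^N: A_\theta(x)=0\text{ for all }\theta\in\Theta\}$ (possibly empty). *)

theory Defs
  imports "HOL-Analysis.Analysis"
begin

text \<open>The flat torus T^N is represented by Z^N-periodic objects on real^'n (N = CARD('n)).\<close>

definition int_vec :: "real^'n \<Rightarrow> bool" where
  "int_vec k \<longleftrightarrow> (\<forall>i. k $ i \<in> \<int>)"

definition periodic_fun :: "(real^'n \<Rightarrow> 'b) \<Rightarrow> bool" where
  "periodic_fun f \<longleftrightarrow> (\<forall>x k. int_vec k \<longrightarrow> f (x + k) = f x)"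

definition periodic_set :: "(real^'n) set \<Rightarrow> bool" where
  "periodic_set S \<longleftrightarrow> (\<forall>x k. int_vec k \<longrightarrow> (x + k \<in> S \<longleftrightarrow> x \<in> S))"

definition Amat :: "('th \<Rightarrow> real^'n \<Rightarrow> real^'n^'n) \<Rightarrow> 'th \<Rightarrow> real^'n \<Rightarrow> real^'n^'n" where
  "Amat \<sigma> \<theta> x = \<sigma> \<theta> x ** transpose (\<sigma> \<theta> x)"

definition Bellman :: "('th \<Rightarrow> real^'n \<Rightarrow> real^'n^'n) \<Rightarrow> ('th \<Rightarrow> real^'n \<Rightarrow> real^'n \<Rightarrow> real)
    \<Rightarrow> real^'n \<Rightarrow> real^'n \<Rightarrow> real^'n^'n \<Rightarrow> real" where
  "Bellman \<sigma> H x p X = (SUP \<theta>. - trace (Amat \<sigma> \<theta> x ** X) + H \<theta> x p)"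

definition Sigma_set :: "('th \<Rightarrow> real^'n \<Rightarrow> real^'n^'n) \<Rightarrow> (real^'n) set" where
  "Sigma_set \<sigma> = {x. \<forall>\<theta>. Amat \<sigma> \<theta> x = 0}"

text \<open>dist(x,S) > delta, with the convention dist(x,{}) = +infinity\<close>
definition dist_gt :: "real^'n \<Rightarrow> (real^'n) set \<Rightarrow> real \<Rightarrow> bool" where
  "dist_gt x S \<delta> \<longleftrightarrow> S = {} \<or> infdist x S > \<delta>"

definition C2_test :: "(real^'n \<Rightarrow> real) \<Rightarrow> (real^'n \<Rightarrow> real^'n) \<Rightarrow> (real^'n \<Rightarrow> real^'n^'n) \<Rightarrow> bool" where
  "C2_test \<phi> D\<phi> D2\<phi> \<longleftrightarrow>
     (\<forall>x. (\<phi> has_derivative (\<lambda>h. D\<phi> x \<bullet> h)) (at x)) \<and>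
     (\<forall>x. (D\<phi> has_derivative (\<lambda>h. D2\<phi> x *v h)) (at x)) \<and>
     continuous_on UNIV D2\<phi>"

definition C21_test :: "(real^'n \<Rightarrow> real \<Rightarrow> real) \<Rightarrow> (real^'n \<Rightarrow> real \<Rightarrow> real)
     \<Rightarrow> (real^'n \<Rightarrow> real \<Rightarrow> real^'n) \<Rightarrow> (real^'n \<Rightarrow> real \<Rightarrow> real^'n^'n) \<Rightarrow> bool" where
  "C21_test \<phi> \<phi>t D\<phi> D2\<phi> \<longleftrightarrow>
     (\<forall>x t. ((\<lambda>(y,s). \<phi> y s) has_derivative (\<lambda>(h,k). D\<phi> x t \<bullet> h + \<phi>t x t * k)) (at (x,t))) \<and>
     continuous_on UNIV (\<lambda>(x,t). \<phi>t x t) \<and>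
     continuous_on UNIV (\<lambda>(x,t). D\<phi> x t) \<and>
     (\<forall>x t. ((\<lambda>y. D\<phi> y t) has_derivative (\<lambda>h. D2\<phi> x t *v h)) (at x)) \<and>
     continuous_on UNIV (\<lambda>(x,t). D2\<phi> x t)"

definition visc_sub :: "(real^'n \<Rightarrow> real \<Rightarrow> real^'n \<Rightarrow> real^'n^'n \<Rightarrow> real) \<Rightarrow> (real^'n \<Rightarrow> real) \<Rightarrow> bool" where
  "visc_sub F v \<longleftrightarrow> continuous_on UNIV v \<and> periodic_fun v \<and>
     (\<forall>x0 \<phi> D\<phi> D2\<phi>. C2_test \<phi> D\<phi> D2\<phi> \<and>
        (\<exists>\<epsilon>>0. \<forall>y. dist y x0 < \<epsilon> \<longrightarrow> v y - \<phi> y \<le> v x0 - \<phi> x0)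
        \<longrightarrow> F x0 (v x0) (D\<phi> x0) (D2\<phi> x0) \<le> 0)"

definition visc_super :: "(real^'n \<Rightarrow> real \<Rightarrow> real^'n \<Rightarrow> real^'n^'n \<Rightarrow> real) \<Rightarrow> (real^'n \<Rightarrow> real) \<Rightarrow> bool" where
  "visc_super F v \<longleftrightarrow> continuous_on UNIV v \<and> periodic_fun v \<and>
     (\<forall>x0 \<phi> D\<phi> D2\<phi>. C2_test \<phi> D\<phi> D2\<phi> \<and>
        (\<exists>\<epsilon>>0. \<forall>y. dist y x0 < \<epsilon> \<longrightarrow> v y - \<phi> y \<ge> v x0 - \<phi> x0)
        \<longrightarrow> F x0 (v x0) (D\<phi> x0) (D2\<phi> x0) \<ge> 0)"

definition visc_sol :: "(real^'n \<Rightarrow> real \<Rightarrow> real^'n \<Rightarrow> real^'n^'n \<Rightarrow> real) \<Rightarrow> (real^'n \<Rightarrow> real) \<Rightarrow> bool" where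
  "visc_sol F v \<longleftrightarrow> visc_sub F v \<and> visc_super F v"

definition ergodic_sol :: "('th \<Rightarrow> real^'n \<Rightarrow> real^'n^'n) \<Rightarrow> ('th \<Rightarrow> real^'n \<Rightarrow> real^'n \<Rightarrow> real)
    \<Rightarrow> real \<Rightarrow> (real^'n \<Rightarrow> real) \<Rightarrow> bool" where
  "ergodic_sol \<sigma> H c v \<longleftrightarrow> visc_sol (\<lambda>x r p X. Bellman \<sigma> H x p X - c) v"

definition discounted_sol :: "('th \<Rightarrow> real^'n \<Rightarrow> real^'n^'n) \<Rightarrow> ('th \<Rightarrow> real^'n \<Rightarrow> real^'n \<Rightarrow> real)
    \<Rightarrow> real \<Rightarrow> (real^'n \<Rightarrow> real) \<Rightarrow> bool" where
  "discounted_sol \<sigma> H lam v \<longleftrightarrow> visc_sol (\<lambda>x r p X. lam * r + Bellman \<sigma> H x p X) v"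

definition cauchy_sol :: "('th \<Rightarrow> real^'n \<Rightarrow> real^'n^'n) \<Rightarrow> ('th \<Rightarrow> real^'n \<Rightarrow> real^'n \<Rightarrow> real)
    \<Rightarrow> (real^'n \<Rightarrow> real) \<Rightarrow> (real^'n \<Rightarrow> real \<Rightarrow> real) \<Rightarrow> bool" where
  "cauchy_sol \<sigma> H u0 u \<longleftrightarrow>
     continuous_on (UNIV \<times> {0..}) (\<lambda>(x,t). u x t) \<and>
     (\<forall>t. periodic_fun (\<lambda>x. u x t)) \<and>
     (\<forall>x. u x 0 = u0 x) \<and>
     (\<forall>x0 t0 \<phi> \<phi>t D\<phi> D2\<phi>. t0 > 0 \<and> C21_test \<phi> \<phi>t D\<phi> D2\<phi> \<and>
        (\<exists>\<epsilon>>0. \<forall>y s. dist y x0 < \<epsilon> \<and> \<bar>s - t0\<bar> < \<epsilon> \<and> s > 0 \<longrightarrow> u y s - \<phi> y s \<le> u x0 t0 - \<phi> x0 t0)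
        \<longrightarrow> \<phi>t x0 t0 + Bellman \<sigma> H x0 (D\<phi> x0 t0) (D2\<phi> x0 t0) \<le> 0) \<and>
     (\<forall>x0 t0 \<phi> \<phi>t D\<phi> D2\<phi>. t0 > 0 \<and> C21_test \<phi> \<phi>t D\<phi> D2\<phi> \<and>
        (\<exists>\<epsilon>>0. \<forall>y s. dist y x0 < \<epsilon> \<and> \<bar>s - t0\<bar> < \<epsilon> \<and> s > 0 \<longrightarrow> u y s - \<phi> y s \<ge> u x0 t0 - \<phi> x0 t0)
        \<longrightarrow> \<phi>t x0 t0 + Bellman \<sigma> H x0 (D\<phi> x0 t0) (D2\<phi> x0 t0) \<ge> 0)"

end

(* Put w = u + c t. A subsequence of the translates w(., . + t_n) converges uniformly to a bounded
   solution Z. For 1 < mu < mu0 the function mu w(., . + r) is a supersolution of an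
   equation with smaller Hamiltonian, so max (w(., t) - mu w(., t + r)) decreases in t and the
   corresponding maximum m(r) for Z does not depend on t. Penalise by eta r and suppose that
   m(r) - eta r has a positive maximum (beyond an error of order mu - 1) at some r > 0. By the strong
   maximum principle, in force off Sigma, the maximum is attained at a point of Sigma; it is not
   in K, where Z is constant in time. There the diffusion vanishes, and doubling the time variable
   produces a gradient p with H(x,p) - c <= eta and mu (H(x,p/mu) - c) >= eta up to small errors,
   against hypothesis (ii)(b). If Sigma is empty, the strong maximum principle is applied with the
   sublevel set of a point where Z is minimal instead. Letting mu tend to 1 and eta to 0, Z is
   nondecreasing in time, hence converges, and by contraction so does w.

   The comparison and maximum principles rest on a theorem on sums proved by Lasry--Lions
   regularisation and a perturbation argument in the style of Jensen; second derivatives are those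
   of Rademacher's theorem applied to the Lipschitz gradient, so that Alexandrov's theorem is not
   needed. *)

theory Submission
  imports Defs "HOL-Complex_Analysis.Great_Picard"
begin

section \<open>Rademacher's theorem\<close>

text \<open>The index set has no compactness, so the supremum in the Bellman operator need not be
  attained and the index produced by a supersolution cannot be passed to a limit. All estimates are
  therefore uniform in \<theta>, and \<open>visc_difference\<close> delivers, for each error
  \<kappa>, one nearby point, one slope and one index at which the linearised inequality holds up to
  \<kappa>. Space and time are doubled together, as one variable of
  \<open>real^'n \<times> real\<close>, so that an elliptic theorem on sums suffices. Lipschitz
  bounds replace the usual o(1) arguments: the slopes are bounded, hence the doubled points are O(e)
  apart and |\<sigma>(x) - \<sigma>(y)|^2/e is O(e). Passing to the limit Z matters because a
  quantity that is monotone for w is constant for Z: the maximum of the difference is then attained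
  at every time, in particular at an interior one, where the strong maximum principle and the
  touching argument apply.\<close>

definition dquot :: "('a::real_vector \<Rightarrow> real) \<Rightarrow> 'a \<Rightarrow> 'a \<Rightarrow> nat \<Rightarrow> real" where
  "dquot f h x n = real (Suc n) * (f (x + h /\<^sub>R real (Suc n)) - f x)"

text \<open>The levels are rational so that the set where the quotients diverge becomes a countable
  union of sets on which one fixed gap is crossed infinitely often.\<close>

lemma not_convergent_bounded_oscillates:
  fixes X :: "nat \<Rightarrow> real"
  assumes "Bseq X" "\<not> convergent X"
  obtains p q where "p \<in> \<rat>" "q \<in> \<rat>" "p < q" "\<forall>m. \<exists>n\<ge>m. X n < p" "\<forall>m. \<exists>n\<ge>m. X n > q"
proof -
  let ?Y = "\<lambda>n. ereal (X n)"
  obtain B where B: "\<And>n. \<bar>X n\<bar> \<le> B" using assms(1) by (auto simp: Bseq_def)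
  have lo: "liminf ?Y \<ge> ereal (-B)"
    by (rule Liminf_bounded) (use B in \<open>auto simp: abs_le_iff intro!: always_eventually, smt (verit)\<close>)
  have hi: "limsup ?Y \<le> ereal B"
    by (rule Limsup_bounded) (use B in \<open>auto simp: abs_le_iff\<close>)
  have le: "liminf ?Y \<le> limsup ?Y" by (rule Liminf_le_Limsup) simp
  obtain l where l: "liminf ?Y = ereal l" using lo hi le by (cases "liminf ?Y") auto
  have "liminf ?Y \<noteq> limsup ?Y"
  proof
    assume eq: "liminf ?Y = limsup ?Y"
    have "(?Y \<longlongrightarrow> ereal l) sequentially"
      using eq l by (simp add: tendsto_iff_Liminf_eq_Limsup)
    hence "X \<longlonglongrightarrow> l" by simp
    thus False using assms(2) by (auto simp: convergent_def)
  qed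
  with le have "liminf ?Y < limsup ?Y" by auto
  then obtain a where a: "liminf ?Y < ereal a" "ereal a < limsup ?Y" using ereal_dense2 by blast
  obtain b where b: "ereal a < ereal b" "ereal b < limsup ?Y" using a(2) ereal_dense2 by blast
  obtain b' where b': "ereal b < ereal b'" "ereal b' < limsup ?Y" using b(2) ereal_dense2 by blast
  obtain p where p: "p \<in> \<rat>" "a < p" "p < b" using Rats_dense_in_real b(1) by (metis ereal_less(2) less_ereal.simps(1))
  obtain q where q: "q \<in> \<rat>" "b < q" "q < b'" using Rats_dense_in_real b'(1) by (metis less_ereal.simps(1))
  have 1: "\<exists>n\<ge>m. X n < p" for m
  proof (rule ccontr)
    assume "\<not> ?thesis"
    hence "eventually (\<lambda>n. ereal p \<le> ?Y n) sequentially"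
      by (auto simp: eventually_sequentially not_less)
    hence "ereal p \<le> liminf ?Y" by (rule Liminf_bounded)
    thus False using a(1) p(2) by (metis ereal_less_eq(3) less_le_not_le order_trans)
  qed
  have 2: "\<exists>n\<ge>m. X n > q" for m
  proof (rule ccontr)
    assume "\<not> ?thesis"
    hence "eventually (\<lambda>n. ?Y n \<le> ereal q) sequentially"
      by (auto simp: eventually_sequentially not_less)
    hence "limsup ?Y \<le> ereal q" by (rule Limsup_bounded)
    thus False using b'(2) q(3) by (metis ereal_less_eq(3) less_le_not_le order_trans)
  qed
  show thesis using that[of p q] p q 1 2 by auto
qed

lemma dquot_bound:
  fixes f :: "'a::real_normed_vector \<Rightarrow> real"
  assumes lip: "\<And>x y. \<bar>f x - f y\<bar> \<le> L * norm (x - y)"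
  shows "\<bar>dquot f h x n\<bar> \<le> L * norm h"
proof -
  have "\<bar>f (x + h /\<^sub>R real (Suc n)) - f x\<bar> \<le> L * (norm h / real (Suc n))"
    using lip[of "x + h /\<^sub>R real (Suc n)" x] by (simp add: divide_inverse mult.commute)
  hence "real (Suc n) * \<bar>f (x + h /\<^sub>R real (Suc n)) - f x\<bar> \<le> real (Suc n) * (L * (norm h / real (Suc n)))"
    by (intro mult_left_mono) auto
  thus ?thesis by (simp add: dquot_def abs_mult)
qed

text \<open>The intervals have a point of E as left endpoint, not as centre. As balls about
  \<open>a i\<close> of radius \<open>r i\<close> they still form a fine cover of E, which is what
  the Vitali covering theorem asks for.\<close>

lemma Vitali_intervals:
  fixes E G :: "real set"
  assumes "open G" "E \<subseteq> G" and E: "\<And>x m. x \<in> E \<Longrightarrow> \<exists>n\<ge>m. P x (n::nat)"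
  obtains C where "countable C" "\<And>i. i \<in> C \<Longrightarrow> fst i \<in> E \<and> P (fst i) (snd i) \<and> {fst i..fst i + 1 / real (Suc (snd i))} \<subseteq> G"
    "disjoint_family_on (\<lambda>i. {fst i..fst i + 1 / real (Suc (snd i))}) C"
    "negligible (E - (\<Union>i\<in>C. {fst i..fst i + 1 / real (Suc (snd i))}))"
proof -
  define I where "I = (\<lambda>i::real\<times>nat. {fst i..fst i + 1 / real (Suc (snd i))})"
  define K where "K = {i. fst i \<in> E \<and> P (fst i) (snd i) \<and> I i \<subseteq> G}"
  define r where "r = (\<lambda>i::real\<times>nat. 1 / real (Suc (snd i)) / 2)"
  define a where "a = (\<lambda>i::real\<times>nat. fst i + r i)"
  have I: "cball (a i) (r i) = I i" for i
    by (simp add: I_def a_def r_def cball_eq_atLeastAtMost add_divide_distrib[symmetric] del: of_nat_Suc)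
  have cov: "\<exists>i. i \<in> K \<and> x \<in> cball (a i) (r i) \<and> r i < d" if xd: "x \<in> E" "0 < d" for x d
  proof -
    obtain e where e: "e > 0" "cball x e \<subseteq> G" using assms(1,2) xd(1) open_contains_cball[of G] by blast
    have "0 < min e d" using e xd by simp
    from reals_Archimedean[OF this] obtain m where m: "inverse (real (Suc m)) < min e d" ..
    obtain n where n: "n \<ge> m" "P x n" using E[OF xd(1)] by blast
    have le: "1 / real (Suc n) < min e d"
    proof -
      have "1 / real (Suc n) \<le> inverse (real (Suc m))"
        using n(1) by (simp add: inverse_eq_divide frac_le)
      thus ?thesis using m by simp
    qed
    have "I (x,n) \<subseteq> cball x e" using le by (auto simp: I_def dist_real_def)
    hence "(x,n) \<in> K" using e n xd by (auto simp: K_def)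
    moreover have "x \<in> I (x,n)" by (auto simp: I_def)
    moreover have "r (x,n) < d"
    proof -
      have "1 / real (Suc n) / 2 \<le> 1 / real (Suc n)" by (simp add: field_simps)
      thus ?thesis using le unfolding r_def by (simp add: min_def split: if_splits)
    qed
    ultimately show ?thesis using I by blast
  qed
  have rpos: "0 < r i" for i by (simp add: r_def)
  obtain C where "countable C" "C \<subseteq> K"
     "pairwise (\<lambda>i j. disjnt (cball (a i) (r i)) (cball (a j) (r j))) C"
     "negligible(E - (\<Union>i \<in> C. cball (a i) (r i)))"
    by (rule Vitali_covering_theorem_cballs[of K r E a, OF rpos cov])
  note C = this[unfolded I]
  show thesis
  proof (rule that[OF C(1)])
    show "disjoint_family_on (\<lambda>i. {fst i..fst i + 1 / real (Suc (snd i))}) C"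
      using C(3) unfolding disjoint_family_on_def pairwise_def disjnt_def I_def by blast
    show "negligible (E - (\<Union>i\<in>C. {fst i..fst i + 1 / real (Suc (snd i))}))"
      using C(4) by (simp only: I_def)
  qed (use C(2) in \<open>auto simp only: K_def I_def\<close>)
qed


text \<open>\<open>inc\<close> makes F a bi-Lipschitz bijection, so the push-forward \<mu> of
  Lebesgue measure under its inverse is the Stieltjes measure of F, and \<open>dquot F 1 x n\<close>
  is the ratio of \<mu> to Lebesgue measure on the interval starting at x. Two Vitali covers of E,
  by intervals of ratio below p and of ratio above q, give q|E| \<le> \<mu>(E) \<le> p|E|.\<close>

lemma null_set_right_derivate_gap:
  fixes F :: "real \<Rightarrow> real"
  assumes lip: "\<And>x y. \<bar>F x - F y\<bar> \<le> M * \<bar>x - y\<bar>"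
    and inc: "\<And>x y. x \<le> y \<Longrightarrow> y - x \<le> F y - F x"
    and "p < q"
    and E: "E \<in> sets borel" "bounded E"
    and lo: "\<And>x m. x \<in> E \<Longrightarrow> \<exists>n\<ge>m. dquot F 1 x n < p"
    and hi: "\<And>x m. x \<in> E \<Longrightarrow> \<exists>n\<ge>m. dquot F 1 x n > q"
  shows "emeasure lborel E = 0"
proof -
  have M0: "M \<ge> 0" using lip[of 1 0] by simp
  have cont: "continuous_on UNIV F"
    by (rule lipschitz_on_continuous_on[of M]) (auto simp: lipschitz_on_def dist_real_def lip M0)
  have inj: "inj F"
    by (rule injI) (smt (verit) inc)
  have surj: "surj F"
  proof -
    have "\<exists>x. F x = y" for y
      proof -
      define a where "a = - \<bar>y - F 0\<bar>"
      have "F a \<le> y" using inc[of a 0] by (auto simp: a_def)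
      moreover have "y \<le> F (-a)" using inc[of 0 "-a"] by (auto simp: a_def)
      moreover have "a \<le> -a" by (simp add: a_def)
      ultimately show ?thesis
        using IVT'[of F a y "-a"] continuous_on_subset[OF cont] by blast
    qed
    thus ?thesis by (metis surjI)
  qed
  define g where "g = inv F"
  have Fg: "F (g y) = y" and gF: "g (F x) = x" for x y
    using inj surj by (auto simp: g_def surj_f_inv_f)
  have glip: "\<bar>g x - g y\<bar> \<le> \<bar>x - y\<bar>" for x y
    using inc[of "g x" "g y"] inc[of "g y" "g x"] by (simp add: Fg) linarith
  have gmeas[measurable]: "g \<in> borel_measurable borel"
    by (rule borel_measurable_continuous_onI, rule lipschitz_on_continuous_on[of 1])
      (auto simp: lipschitz_on_def dist_real_def glip)
  have gvim: "g -` A = F ` A" for A proof safe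
    fix x assume "g x \<in> A" thus "x \<in> F ` A" by (metis Fg imageI)
  qed (simp add: gF)
  define \<mu> where "\<mu> = distr lborel borel g"
  have mu: "emeasure \<mu> A = emeasure lborel (F ` A)" if "A \<in> sets borel" for A
    using that by (simp add: \<mu>_def emeasure_distr gvim)
  have Fsets: "F ` A \<in> sets borel" if "A \<in> sets borel" for A
    using measurable_sets[OF gmeas that] by (simp add: gvim)
  have Fle: "F x \<le> F y \<longleftrightarrow> x \<le> y" for x y
    using inc[of x y] inc[of y x] by linarith
  have Fint: "F ` {a..b} = {F a..F b}" for a b
  proof safe
    fix y assume "y \<in> {F a..F b}"
    hence "g y \<in> {a..b}" using Fle[of a "g y"] Fle[of "g y" b] by (simp add: Fg)
    thus "y \<in> F ` {a..b}" by (metis Fg imageI)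
  qed (auto simp: Fle)
  have setsmu[simp]: "sets \<mu> = sets borel" by (simp add: \<mu>_def)
  have dq0: "dquot F 1 x n \<ge> 0" for x n
    using Fle[of x "x + inverse (real (Suc n))"] by (simp add: dquot_def del: of_nat_Suc)
  have muI: "emeasure \<mu> {x..x + 1 / real (Suc n)} = ennreal (dquot F 1 x n) * emeasure lborel {x..x + 1 / real (Suc n)}" for x n
  proof -
    have le: "F x \<le> F (x + 1 / real (Suc n))" by (simp add: Fle)
    have "emeasure \<mu> {x..x + 1 / real (Suc n)} = ennreal (F (x + 1 / real (Suc n)) - F x)"
      using le by (simp add: mu Fint del: of_nat_Suc)
    also have "F (x + 1 / real (Suc n)) - F x = dquot F 1 x n * (1 / real (Suc n))"
      by (simp add: dquot_def inverse_eq_divide del: of_nat_Suc)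
    also have "ennreal \<dots> = ennreal (dquot F 1 x n) * ennreal (1 / real (Suc n))"
      using dq0 by (intro ennreal_mult) auto
    finally show ?thesis by (simp del: of_nat_Suc)
  qed
  \<comment> \<open>F is Lipschitz, so \<mu> does not charge the null set that a Vitali cover leaves
    out.\<close>
  have munull: "N \<in> sets borel \<Longrightarrow> negligible N \<Longrightarrow> emeasure \<mu> N = 0" for N
  proof -
    assume N: "N \<in> sets borel" "negligible N"
    have "negligible (F ` N)"
      by (rule negligible_locally_Lipschitz_image[of N F])
        (use N lip in \<open>auto intro!: exI[of _ UNIV] exI[of _ M]\<close>)
    thus "emeasure \<mu> N = 0"
      using Fsets[OF N(1)] N(1) by (simp add: mu negligible_iff_emeasure0 sets_completionI_sets)
  qed
  have meas: "(\<Union>i\<in>C. {fst i..fst i + 1 / real (Suc (snd i))}) \<in> sets borel" if "countable C" for C :: "(real \<times> nat) set"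
    using that by (intro sets.countable_UN') auto
  have fin: "emeasure lborel E < \<infinity>" using emeasure_bounded_finite[OF E(2)] by simp
  have 1: "emeasure \<mu> E \<le> ennreal p * emeasure lborel E"
  proof (cases "E = {}")
    case False
    then obtain x0 where "x0 \<in> E" by auto
    then obtain n0 where n0: "dquot F 1 x0 n0 < p" using lo by blast
    have p0: "p > 0" using n0 dq0[of x0 n0] by simp
    show ?thesis
    proof (rule ennreal_le_epsilon)
      fix e :: real assume "e > 0"
      \<comment> \<open>The excess of G over E is multiplied by p when the covering intervals are
        measured by \<mu>, hence e / p.\<close>
      have "e / p > 0" using \<open>e > 0\<close> p0 by simp
      then obtain G where G: "open G" "E \<subseteq> G" "emeasure lborel (G - E) < ennreal (e / p)"
        by (rule outer_regular_lborel[OF E(1)])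
      obtain C where C: "countable C" "\<And>i. i \<in> C \<Longrightarrow> fst i \<in> E \<and> dquot F 1 (fst i) (snd i) < p \<and> {fst i..fst i + 1 / real (Suc (snd i))} \<subseteq> G"
        "disjoint_family_on (\<lambda>i. {fst i..fst i + 1 / real (Suc (snd i))}) C"
        "negligible (E - (\<Union>i\<in>C. {fst i..fst i + 1 / real (Suc (snd i))}))"
        by (rule Vitali_intervals[OF G(1,2), of "\<lambda>x n. dquot F 1 x n < p"]) (use lo in auto)
      let ?I = "\<lambda>i. {fst i..fst i + 1 / real (Suc (snd i))}"
      let ?U = "\<Union>i\<in>C. ?I i"
      have "emeasure \<mu> E \<le> emeasure \<mu> (?U \<union> (E - ?U))"
        using meas[OF C(1)] E by (intro emeasure_mono) auto
      also have "\<dots> \<le> emeasure \<mu> ?U + emeasure \<mu> (E - ?U)"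
        using meas[OF C(1)] E by (intro emeasure_subadditive) auto
      also have "emeasure \<mu> (E - ?U) = 0"
        using meas[OF C(1)] E C(4) by (intro munull) auto
      also have "emeasure \<mu> ?U = (\<integral>\<^sup>+i. emeasure \<mu> (?I i) \<partial>count_space C)"
        by (rule emeasure_UN_countable) (use C in auto)
      also have "\<dots> \<le> (\<integral>\<^sup>+i. ennreal p * emeasure lborel (?I i) \<partial>count_space C)"
      proof (rule nn_integral_mono)
        fix i assume "i \<in> space (count_space C)"
        hence "dquot F 1 (fst i) (snd i) \<le> p" using C(2)[of i] by simp
        thus "emeasure \<mu> (?I i) \<le> ennreal p * emeasure lborel (?I i)"
          unfolding muI by (intro mult_right_mono ennreal_leI) auto
      qed
      also have "\<dots> = ennreal p * (\<integral>\<^sup>+i. emeasure lborel (?I i) \<partial>count_space C)"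
        by (rule nn_integral_cmult) simp
      also have "(\<integral>\<^sup>+i. emeasure lborel (?I i) \<partial>count_space C) = emeasure lborel ?U"
        by (rule emeasure_UN_countable[symmetric]) (use C in auto)
      also have "\<dots> \<le> emeasure lborel (E \<union> (G - E))"
      proof (rule emeasure_mono)
        show "?U \<subseteq> E \<union> (G - E)" using C(2) by blast
      qed (use E G in auto)
      also have "\<dots> \<le> emeasure lborel E + emeasure lborel (G - E)"
        using E G by (intro emeasure_subadditive) auto
      also have "\<dots> \<le> emeasure lborel E + ennreal (e / p)" using G(3) by (intro add_left_mono) auto
      also have "ennreal p * (emeasure lborel E + ennreal (e / p)) = ennreal p * emeasure lborel E + ennreal e"
        using p0 \<open>e > 0\<close> by (simp add: distrib_left ennreal_mult[symmetric])
      finally show "emeasure \<mu> E \<le> ennreal p * emeasure lborel E + ennreal e"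
        by (simp add: mult_left_mono)
    qed
  qed simp
  have 2: "ennreal q * emeasure lborel E \<le> emeasure \<mu> E"
  proof (rule ennreal_le_epsilon)
    fix e :: real assume "e > 0"
    \<comment> \<open>\<mu>(G) is the Lebesgue measure of F(G), so here the outer approximation is
      taken around the image F(E) and pulled back.\<close>
    obtain G' where G': "open G'" "F ` E \<subseteq> G'" "emeasure lborel (G' - F ` E) < ennreal e"
      by (rule outer_regular_lborel[OF Fsets[OF E(1)] \<open>e > 0\<close>])
    define G where "G = F -` G'"
    have G: "open G" "E \<subseteq> G" using G' cont by (auto simp: G_def open_vimage)
    have FG: "F ` G = G'" using surj by (auto simp: G_def image_vimage_eq)
    obtain C where C: "countable C" "\<And>i. i \<in> C \<Longrightarrow> fst i \<in> E \<and> dquot F 1 (fst i) (snd i) > q \<and> {fst i..fst i + 1 / real (Suc (snd i))} \<subseteq> G"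
      "disjoint_family_on (\<lambda>i. {fst i..fst i + 1 / real (Suc (snd i))}) C"
      "negligible (E - (\<Union>i\<in>C. {fst i..fst i + 1 / real (Suc (snd i))}))"
      by (rule Vitali_intervals[OF G, of "\<lambda>x n. dquot F 1 x n > q"]) (use hi in auto)
    let ?I = "\<lambda>i. {fst i..fst i + 1 / real (Suc (snd i))}"
    let ?U = "\<Union>i\<in>C. ?I i"
    have "emeasure lborel E \<le> emeasure lborel (?U \<union> (E - ?U))"
      using meas[OF C(1)] E by (intro emeasure_mono) auto
    also have "\<dots> \<le> emeasure lborel ?U + emeasure lborel (E - ?U)"
      using meas[OF C(1)] E by (intro emeasure_subadditive) auto
    also have "emeasure lborel (E - ?U) = 0"
      using meas[OF C(1)] E C(4) by (simp add: negligible_iff_emeasure0)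
    also have "emeasure lborel ?U = (\<integral>\<^sup>+i. emeasure lborel (?I i) \<partial>count_space C)"
      by (rule emeasure_UN_countable) (use C in auto)
    finally have "ennreal q * emeasure lborel E \<le> ennreal q * (\<integral>\<^sup>+i. emeasure lborel (?I i) \<partial>count_space C)"
      by (simp add: mult_left_mono)
    also have "\<dots> = (\<integral>\<^sup>+i. ennreal q * emeasure lborel (?I i) \<partial>count_space C)"
      by (rule nn_integral_cmult[symmetric]) simp
    also have "\<dots> \<le> (\<integral>\<^sup>+i. emeasure \<mu> (?I i) \<partial>count_space C)"
      proof (rule nn_integral_mono)
        fix i assume "i \<in> space (count_space C)"
        hence "q \<le> dquot F 1 (fst i) (snd i)" using C(2)[of i] by simp
        thus "ennreal q * emeasure lborel (?I i) \<le> emeasure \<mu> (?I i)"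
          unfolding muI by (intro mult_right_mono ennreal_leI) auto
      qed
    also have "\<dots> = emeasure \<mu> ?U"
      by (rule emeasure_UN_countable[symmetric]) (use C in auto)
    also have "\<dots> \<le> emeasure \<mu> G"
    proof (rule emeasure_mono)
      show "?U \<subseteq> G" using C(2) by blast
    qed (use G in auto)
    also have "\<dots> = emeasure lborel G'" using G by (simp add: mu FG)
    also have "\<dots> \<le> emeasure lborel (F ` E \<union> (G' - F ` E))"
      using G' Fsets[OF E(1)] by (intro emeasure_mono) auto
    also have "\<dots> \<le> emeasure lborel (F ` E) + emeasure lborel (G' - F ` E)"
      using G' Fsets[OF E(1)] by (intro emeasure_subadditive) auto
    also have "\<dots> \<le> emeasure \<mu> E + ennreal e" using G'(3) E by (simp add: mu add_left_mono less_imp_le)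
    finally show "ennreal q * emeasure lborel E \<le> emeasure \<mu> E + ennreal e" .
  qed
  have "ennreal q * emeasure lborel E \<le> ennreal p * emeasure lborel E" using 1 2 by (rule order_trans[rotated])
  moreover obtain m where m: "emeasure lborel E = ennreal m" "m \<ge> 0"
    using fin by (cases "emeasure lborel E") auto
  ultimately have le: "ennreal q * ennreal m \<le> ennreal p * ennreal m" by simp
  show ?thesis
  proof (cases "E = {}")
    case False
    then obtain x0 n0 where "dquot F 1 x0 n0 < p" using lo by blast
    hence "p > 0" "q > 0" using dq0[of x0 n0] \<open>p < q\<close> by auto
    hence "q * m \<le> p * m" using le m(2) by (simp add: ennreal_mult[symmetric])
    hence "m = 0" using \<open>p < q\<close> m(2) by (simp add: mult_le_cancel_right)
    thus ?thesis using m by simp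
  qed simp
qed

lemma dquot_meas[measurable]:
  fixes f :: "'a::euclidean_space \<Rightarrow> real"
  assumes "continuous_on UNIV f"
  shows "(\<lambda>x. dquot f h x n) \<in> borel_measurable borel"
proof -
  have [measurable]: "f \<in> borel_measurable borel" using assms by (rule borel_measurable_continuous_onI)
  show ?thesis unfolding dquot_def by measurable
qed

lemma lipschitz_imp_continuous:
  fixes f :: "'a::real_normed_vector \<Rightarrow> real"
  assumes lip: "\<And>x y. \<bar>f x - f y\<bar> \<le> L * norm (x - y)"
  shows "continuous_on UNIV f"
proof (rule lipschitz_on_continuous_on[of "\<bar>L\<bar>"], rule lipschitz_onI)
  fix x y :: 'a
  have "L * norm (x - y) \<le> \<bar>L\<bar> * norm (x - y)" by (intro mult_right_mono) auto
  thus "dist (f x) (f y) \<le> \<bar>L\<bar> * dist x y" using lip[of x y] by (simp add: dist_real_def dist_norm)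
qed simp

text \<open>Convergence along the countably many steps 1/(n+1) is a Borel condition, being the
  Cauchy property of a sequence of measurable functions. This is why \<open>dquot\<close> is indexed
  by n and not by real steps; Lipschitz continuity fills in the other steps in Rademacher's
  theorem.\<close>

lemma sets_not_convergent_dquot[measurable]:
  fixes f :: "'a::euclidean_space \<Rightarrow> real"
  assumes "continuous_on UNIV f"
  shows "{x. \<not> convergent (dquot f h x)} \<in> sets borel"
proof -
  have "{x \<in> space borel. Cauchy (dquot f h x)} \<in> sets borel"
    by (rule sets_Collect_Cauchy) (use dquot_meas[OF assms] in auto)
  hence "space borel - {x \<in> space borel. Cauchy (dquot f h x)} \<in> sets borel" by (rule sets.compl_sets)
  moreover have "space borel - {x \<in> space borel. Cauchy (dquot f h x)} = {x. \<not> convergent (dquot f h x)}"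
    using Cauchy_convergent_iff[where 'a=real] by auto
  ultimately show ?thesis by simp
qed

text \<open>A linear term shifts all quotients by L + 1 and makes the slope at least 1, as
  \<open>null_set_right_derivate_gap\<close> requires. The divergence set is then covered by
  countably many sets, one for each rational gap (p, q) and radius k.\<close>

lemma AE_convergent_dquot_real:
  fixes F :: "real \<Rightarrow> real"
  assumes lip: "\<And>x y. \<bar>F x - F y\<bar> \<le> L * \<bar>x - y\<bar>"
  shows "emeasure lborel {x. \<not> convergent (dquot F 1 x)} = 0"
proof -
  have L0: "L \<ge> 0" using lip[of 1 0] by simp
  define G where "G = (\<lambda>x. F x + (L + 1) * x)"
  have dG: "dquot G 1 x n = dquot F 1 x n + (L + 1)" for x n
    by (simp add: dquot_def G_def algebra_simps del: of_nat_Suc)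
  have cG: "convergent (dquot G 1 x) \<longleftrightarrow> convergent (dquot F 1 x)" for x

  proof -
    have "dquot G 1 x = (\<lambda>n. dquot F 1 x n + (L + 1))" using dG by auto
    thus ?thesis using convergent_add_const_right_iff[of "dquot F 1 x" "L + 1"] by simp
  qed
  have Glip: "\<bar>G x - G y\<bar> \<le> (2 * L + 1) * \<bar>x - y\<bar>" for x y
  proof -
    have "G x - G y = (F x - F y) + (L + 1) * (x - y)" by (simp add: G_def algebra_simps)
    hence "\<bar>G x - G y\<bar> \<le> \<bar>F x - F y\<bar> + \<bar>(L + 1) * (x - y)\<bar>" by linarith
    also have "\<dots> \<le> L * \<bar>x - y\<bar> + (L + 1) * \<bar>x - y\<bar>" using lip[of x y] L0 by (simp add: abs_mult)
    finally show ?thesis by (simp add: algebra_simps)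
  qed
  have Ginc: "y - x \<le> G y - G x" if "x \<le> y" for x y
    using lip[of x y] that by (simp add: G_def algebra_simps abs_le_iff)
  have Gcont: "continuous_on UNIV G" using lipschitz_imp_continuous[of G "2*L+1"] Glip by simp
  note [measurable] = dquot_meas[OF Gcont]
  define E where "E = (\<lambda>(p,q,k::nat). {x. norm x \<le> real k \<and> (\<forall>m. \<exists>n\<ge>m. dquot G 1 x n < p) \<and> (\<forall>m. \<exists>n\<ge>m. dquot G 1 x n > q)})"
  have Es: "E (p,q,k) \<in> sets borel" for p q k
  proof -
    have "{x \<in> space borel. norm x \<le> real k \<and> (\<forall>m. \<exists>n\<ge>m. dquot G 1 x n < p) \<and> (\<forall>m. \<exists>n\<ge>m. dquot G 1 x n > q)} \<in> sets borel"
      by measurable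
    thus ?thesis by (simp add: E_def)
  qed
  have E0: "E (p,q,k) \<in> null_sets lborel" if "p < q" for p q k
  proof -
    have "emeasure lborel (E (p,q,k)) = 0"
      by (rule null_set_right_derivate_gap[OF Glip Ginc that Es])
        (auto simp: E_def bounded_iff)
    thus ?thesis using Es by (simp add: null_sets_def)
  qed
  define I where "I = {(p,q,k::nat). p \<in> \<rat> \<and> q \<in> \<rat> \<and> p < (q::real)}"
  have "countable I"
    by (rule countable_subset[of _ "\<rat> \<times> \<rat> \<times> UNIV"]) (auto simp: I_def intro!: countable_SIGMA countable_rat)
  hence N: "(\<Union>i\<in>I. E i) \<in> null_sets lborel"
    by (rule null_sets_UN') (auto simp: I_def E0)
  have sub: "{x. \<not> convergent (dquot F 1 x)} \<subseteq> (\<Union>i\<in>I. E i)"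
  proof clarify
    fix x assume "\<not> convergent (dquot F 1 x)"
    hence nc: "\<not> convergent (dquot G 1 x)" by (simp add: cG)
    have B: "Bseq (dquot G 1 x)"
    proof (rule BseqI')
      fix n show "norm (dquot G 1 x n) \<le> 2*L+1" using dquot_bound[of G "2*L+1" 1 x n] Glip by simp
    qed
    obtain p q where pq: "p \<in> \<rat>" "q \<in> \<rat>" "p < q" "\<forall>m. \<exists>n\<ge>m. dquot G 1 x n < p" "\<forall>m. \<exists>n\<ge>m. dquot G 1 x n > q"
      using not_convergent_bounded_oscillates[OF B nc] .
    obtain k :: nat where "norm x \<le> real k" using real_arch_simple by blast
    thus "x \<in> (\<Union>i\<in>I. E i)" using pq by (intro UN_I[of "(p,q,k)"]) (auto simp: I_def E_def)
  qed
  have Fcont: "continuous_on UNIV F" using lipschitz_imp_continuous[of F L] lip by simp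
  have "{x. \<not> convergent (dquot F 1 x)} \<in> null_sets lborel"
    by (rule null_sets_subset[OF N _ sub]) (simp add: sets_not_convergent_dquot[OF Fcont])
  thus ?thesis by auto
qed

text \<open>Fubini along the lines in direction h, without a change of coordinates: by translation
  invariance |N| is the average over t in [0,1] of |N - t h|, and exchanging the integrals leaves
  one-dimensional slices, which are null.\<close>

lemma AE_convergent_dquot:
  fixes f :: "'a::euclidean_space \<Rightarrow> real"
  assumes lip: "\<And>x y. \<bar>f x - f y\<bar> \<le> L * norm (x - y)"
  shows "AE x in lborel. convergent (dquot f h x)"
proof -
  have cont: "continuous_on UNIV f" by (rule lipschitz_imp_continuous[OF lip])
  define N where "N = {x. \<not> convergent (dquot f h x)}"
  have N[measurable]: "N \<in> sets borel" unfolding N_def by (rule sets_not_convergent_dquot[OF cont])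
  have line: "emeasure lborel {t. x + t *\<^sub>R h \<in> N} = 0" for x
  proof -
    define F where "F = (\<lambda>t::real. f (x + t *\<^sub>R h))"
    have "dquot F 1 t = dquot f h (x + t *\<^sub>R h)" for t
      by (rule ext) (simp add: dquot_def F_def algebra_simps)
    hence "{t. x + t *\<^sub>R h \<in> N} = {t. \<not> convergent (dquot F 1 t)}" by (simp add: N_def)
    also have "emeasure lborel \<dots> = 0"
    proof (rule AE_convergent_dquot_real)
      fix s t show "\<bar>F s - F t\<bar> \<le> (L * norm h) * \<bar>s - t\<bar>"
        using lip[of "x + s *\<^sub>R h" "x + t *\<^sub>R h"]
        by (simp add: F_def scaleR_diff_left[symmetric] mult_ac)
    qed
    finally show ?thesis .
  qed
  have "emeasure lborel N = (\<integral>\<^sup>+t. emeasure lborel N * indicator {0..1::real} t \<partial>lborel)"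
    by (simp add: nn_integral_cmult_indicator)
  also have "\<dots> = (\<integral>\<^sup>+t. (\<integral>\<^sup>+x. indicator N (x + t *\<^sub>R h) * indicator {0..1} t \<partial>lborel) \<partial>lborel)"
  proof (rule nn_integral_cong)
    fix t :: real
    have "(\<integral>\<^sup>+x. indicator N x \<partial>lborel) = (\<integral>\<^sup>+x. indicator N (t *\<^sub>R h + x) \<partial>lborel)"
      by (subst lborel_distr_plus[of "t *\<^sub>R h", symmetric], subst nn_integral_distr) auto
    hence "emeasure lborel N = (\<integral>\<^sup>+x. indicator N (x + t *\<^sub>R h) \<partial>lborel)"
      by (simp add: add.commute)
    thus "emeasure lborel N * indicator {0..1} t = (\<integral>\<^sup>+x. indicator N (x + t *\<^sub>R h) * indicator {0..1} t \<partial>lborel)"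
      by (simp add: nn_integral_multc)
  qed
  also have "\<dots> = (\<integral>\<^sup>+x. (\<integral>\<^sup>+t. indicator N (x + t *\<^sub>R h) * indicator {0..1} t \<partial>lborel) \<partial>lborel)"
    by (rule lborel_pair.Fubini') measurable
  also have "\<dots> = (\<integral>\<^sup>+x. 0 \<partial>(lborel::'a measure))"
  proof (rule nn_integral_cong)
    fix x
    have "(\<integral>\<^sup>+t. indicator N (x + t *\<^sub>R h) * indicator {0..1::real} t \<partial>lborel) \<le> (\<integral>\<^sup>+t. indicator {t. x + t *\<^sub>R h \<in> N} t \<partial>lborel)"
      by (rule nn_integral_mono) (auto simp: indicator_def)
    also have "\<dots> = emeasure lborel {t. x + t *\<^sub>R h \<in> N}"
    proof (rule nn_integral_indicator)
      have "{t \<in> space borel. x + t *\<^sub>R h \<in> N} \<in> sets borel" by measurable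
      thus "{t. x + t *\<^sub>R h \<in> N} \<in> sets lborel" by simp
    qed
    finally show "(\<integral>\<^sup>+t. indicator N (x + t *\<^sub>R h) * indicator {0..1::real} t \<partial>lborel) = 0"
      by (simp add: line)
  qed
  finally have "emeasure lborel N = 0" by simp
  hence "N \<in> null_sets lborel" by (simp add: null_sets_def)
  thus ?thesis by (rule AE_I') (auto simp: N_def)
qed

text \<open>Off the frontier the translated indicator eventually equals the original one, and the
  frontier of a convex set is null; dominated convergence does the rest.\<close>

lemma tendsto_emeasure_translate_box:
  fixes h :: "'a::euclidean_space"
  shows "(\<lambda>n. \<integral>x. \<bar>indicator (box l u) (x - h /\<^sub>R real (Suc n)) - indicator (box l u) x :: real\<bar> \<partial>lborel) \<longlonglongrightarrow> 0"
proof -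
  let ?i = "indicator (box l u) :: 'a \<Rightarrow> real"
  obtain R where R: "R > 0" "\<And>x. x \<in> box l u \<Longrightarrow> norm x \<le> R"
    using bounded_box[of l u] unfolding bounded_pos by auto
  have "(\<lambda>n. \<integral>x. \<bar>?i (x - h /\<^sub>R real (Suc n)) - ?i x\<bar> \<partial>lborel) \<longlonglongrightarrow> (\<integral>x. 0 \<partial>(lborel::'a measure))"
  proof (rule integral_dominated_convergence[where w="\<lambda>x. indicator (cball 0 (R + norm h)) x"])
    have "negligible (frontier (box l u))" by (rule negligible_convex_frontier) (rule convex_box)
    hence "frontier (box l u) \<in> null_sets lborel"
      by (simp add: negligible_iff_null_sets null_sets_completion_iff)
    moreover have "(\<lambda>n. \<bar>?i (x - h /\<^sub>R real (Suc n)) - ?i x\<bar>) \<longlonglongrightarrow> 0" if x: "x \<notin> frontier (box l u)" for x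
    proof -
      have lim: "(\<lambda>n. x - h /\<^sub>R real (Suc n)) \<longlonglongrightarrow> x"
      proof -
        have "(\<lambda>n. x - inverse (real (Suc n)) *\<^sub>R h) \<longlonglongrightarrow> x - 0 *\<^sub>R h"
          by (intro tendsto_intros LIMSEQ_inverse_real_of_nat)
        thus ?thesis by simp
      qed
      have "x \<in> box l u \<or> x \<in> - closure (box l u)"
        using x by (auto simp: frontier_def interior_open[OF open_box])
      hence "eventually (\<lambda>n. \<bar>?i (x - h /\<^sub>R real (Suc n)) - ?i x\<bar> = 0) sequentially"
      proof
        assume "x \<in> box l u"
        thus ?thesis using topological_tendstoD[OF lim open_box, of l u]
          by (auto elim!: eventually_mono simp: indicator_def)
      next
        assume a: "x \<in> - closure (box l u)"
        have "x \<notin> box l u" using a closure_subset by blast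
        moreover have "eventually (\<lambda>n. x - h /\<^sub>R real (Suc n) \<in> - closure (box l u)) sequentially"
          using topological_tendstoD[OF lim, of "- closure (box l u)"] a by auto
        hence "eventually (\<lambda>n. x - h /\<^sub>R real (Suc n) \<notin> box l u) sequentially"
          by (rule eventually_mono) (use closure_subset in blast)
        ultimately show ?thesis by (auto elim!: eventually_mono simp: indicator_def)
      qed
      thus ?thesis by (rule tendsto_eventually)
    qed
    ultimately show "AE x in lborel. (\<lambda>n. \<bar>?i (x - h /\<^sub>R real (Suc n)) - ?i x\<bar>) \<longlonglongrightarrow> 0"
      by (intro AE_I'[of "frontier (box l u)"]) auto
  next
    show "AE x in lborel. norm \<bar>?i (x - h /\<^sub>R real (Suc n)) - ?i x\<bar> \<le> indicator (cball 0 (R + norm h)) x" for n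
    proof (rule AE_I2)
      fix x :: 'a
      have hn: "norm (h /\<^sub>R real (Suc n)) \<le> norm h"
        by (simp add: divide_simps mult_le_cancel_left1)
      show "norm \<bar>?i (x - h /\<^sub>R real (Suc n)) - ?i x\<bar> \<le> indicator (cball 0 (R + norm h)) x"
      proof (cases "x \<in> cball 0 (R + norm h)")
        case False
        hence x: "norm x > R + norm h" by simp
        hence "x \<notin> box l u" using R(2)[of x] norm_ge_zero[of h] by fastforce
        moreover have "norm (x - h /\<^sub>R real (Suc n)) > R"
          using x hn norm_triangle_ineq2[of x "h /\<^sub>R real (Suc n)"] by linarith
        hence "x - h /\<^sub>R real (Suc n) \<notin> box l u" using R(2) by fastforce
        ultimately show ?thesis by (simp add: indicator_def)
      qed (simp add: indicator_def)
    qed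
    show "integrable lborel (indicator (cball 0 (R + norm h)) :: 'a \<Rightarrow> real)"
      using emeasure_lborel_cball_finite[of "0::'a" "R + norm h"] by (intro integrable_real_indicator) auto
  qed auto
  thus ?thesis by simp
qed

text \<open>The defect of additivity is a first difference of a bounded function, so its integral over
  a box reduces to boundary layers and vanishes in the limit.\<close>

lemma AE_dquot_add:
  fixes f :: "'a::euclidean_space \<Rightarrow> real"
  assumes lip: "\<And>x y. \<bar>f x - f y\<bar> \<le> L * norm (x - y)"
  shows "AE x in lborel. lim (dquot f (h + k) x) = lim (dquot f h x) + lim (dquot f k x)"
proof -
  have cont: "continuous_on UNIV f" by (rule lipschitz_imp_continuous[OF lip])
  note [measurable] = dquot_meas[OF cont]
  define M where "M = 2 * (\<bar>L\<bar> * norm k)"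
  have M0: "M \<ge> 0" by (simp add: M_def)
  define B where "B = (\<lambda>x n. dquot f (h + k) x n - dquot f h x n - dquot f k x n)"
  have kb: "\<bar>dquot f k x n\<bar> \<le> \<bar>L\<bar> * norm k" for x n
    using dquot_bound[OF lip, of k x n] mult_right_mono[OF abs_ge_self[of L] norm_ge_zero[of k]] by linarith
  \<comment> \<open>The increment along h + k is split at the point x + h/(n+1); the first half
    cancels against the h-quotient.\<close>
  have Bk: "B x n = dquot f k (x + h /\<^sub>R real (Suc n)) n - dquot f k x n" for x n
    by (simp add: B_def dquot_def algebra_simps del: of_nat_Suc)
  have Bb: "\<bar>B x n\<bar> \<le> M" for x n
    using kb[of "x + h /\<^sub>R real (Suc n)" n] kb[of x n] unfolding Bk M_def by linarith
  define b where "b = (\<lambda>x. lim (B x))"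
  have Bm[measurable]: "(\<lambda>x. B x n) \<in> borel_measurable borel" for n
    unfolding B_def by measurable
  have bm[measurable]: "b \<in> borel_measurable borel"
    unfolding b_def by (rule borel_measurable_lim_metric) measurable
  have conv: "AE x in lborel. convergent (dquot f h x) \<and> convergent (dquot f k x) \<and> convergent (dquot f (h + k) x)"
    using AE_convergent_dquot[OF lip, of h] AE_convergent_dquot[OF lip, of k] AE_convergent_dquot[OF lip, of "h+k"]
    by auto
  have Blim: "AE x in lborel. (\<lambda>n. B x n) \<longlonglongrightarrow> b x"
    using conv
  proof eventually_elim
    case (elim x)
    have "convergent (B x)" unfolding B_def using elim by (intro convergent_diff) auto
    thus ?case by (simp add: b_def convergent_LIMSEQ_iff)
  qed
  have bb: "AE x in lborel. \<bar>b x\<bar> \<le> M"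
    using Blim
  proof eventually_elim
    case (elim x)
    have "(\<lambda>n. \<bar>B x n\<bar>) \<longlonglongrightarrow> \<bar>b x\<bar>" using elim by (intro tendsto_intros)
    thus ?case by (rule LIMSEQ_le_const2) (use Bb in auto)
  qed
  have int_ind: "integrable lborel (indicator (box l u) :: 'a \<Rightarrow> real)" for l u :: 'a
    using emeasure_lborel_box_finite[of l u] by (intro integrable_real_indicator) auto
  have int_tr: "integrable lborel (\<lambda>x. indicator (box l u) (x - v) * dquot f k x n)"
    "integrable lborel (\<lambda>x. indicator (box l u) (x - v) :: real)"for l u v :: 'a and n
  proof -
    have e: "indicator (box l u) (x - v) = (indicator (box (l + v) (u + v)) x :: real)" for x
      by (auto simp: indicator_def mem_box algebra_simps)
    show "integrable lborel (\<lambda>x. indicator (box l u) (x - v) * dquot f k x n)" unfolding e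
      by (rule Bochner_Integration.integrable_bound[OF integrable_mult_right[OF int_ind[of "l+v" "u+v"], of "\<bar>L\<bar> * norm k"]])
        (use kb in \<open>auto simp: indicator_def abs_mult\<close>)
    show "integrable lborel (\<lambda>x. indicator (box l u) (x - v) :: real)" unfolding e by (rule int_ind)
  qed
  have zero: "(\<integral>x. indicator (box l u) x * b x \<partial>lborel) = 0" for l u :: 'a
  proof -
    let ?i = "indicator (box l u) :: 'a \<Rightarrow> real"
    have l1: "(\<lambda>n. \<integral>x. ?i x * B x n \<partial>lborel) \<longlonglongrightarrow> (\<integral>x. ?i x * b x \<partial>lborel)"
    proof (rule integral_dominated_convergence[where w="\<lambda>x. M * ?i x"])
      show "AE x in lborel. (\<lambda>n. ?i x * B x n) \<longlonglongrightarrow> ?i x * b x"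
        using Blim by eventually_elim (intro tendsto_intros)
      show "integrable lborel (\<lambda>x. M * ?i x)" using int_ind by simp
      show "AE x in lborel. norm (?i x * B x n) \<le> M * ?i x" for n
        using Bb M0 by (auto simp: indicator_def abs_mult)
    qed auto
    \<comment> \<open>Summation by parts: the translation moves from the quotient to the indicator
      of the box.\<close>
    have eq: "(\<integral>x. ?i x * B x n \<partial>lborel) = (\<integral>x. (?i (x - h /\<^sub>R real (Suc n)) - ?i x) * dquot f k x n \<partial>lborel)" for n
    proof -
      let ?v = "h /\<^sub>R real (Suc n)"
      have "(\<integral>x. ?i (x - ?v) * dquot f k x n \<partial>lborel) = (\<integral>x. ?i (?v + x - ?v) * dquot f k (?v + x) n \<partial>lborel)"
        by (subst lborel_distr_plus[of ?v, symmetric], subst integral_distr) auto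
      hence sh: "(\<integral>x. ?i (x - ?v) * dquot f k x n \<partial>lborel) = (\<integral>x. ?i x * dquot f k (x + ?v) n \<partial>lborel)"
        by (simp add: add.commute)
      have i2: "integrable lborel (\<lambda>x. ?i x * dquot f k (x + ?v) n)"
        by (rule Bochner_Integration.integrable_bound[OF integrable_mult_right[OF int_ind[of l u], of "\<bar>L\<bar> * norm k"]])
          (use kb in \<open>auto simp: indicator_def abs_mult\<close>)
      have i1: "integrable lborel (\<lambda>x. ?i x * dquot f k x n)" using int_tr(1)[of l u 0 n] by simp
      have "(\<integral>x. ?i x * B x n \<partial>lborel) = (\<integral>x. ?i x * dquot f k (x + ?v) n - ?i x * dquot f k x n \<partial>lborel)"
        by (simp add: Bk right_diff_distrib)
      also have "\<dots> = (\<integral>x. ?i x * dquot f k (x + ?v) n \<partial>lborel) - (\<integral>x. ?i x * dquot f k x n \<partial>lborel)"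
        by (rule Bochner_Integration.integral_diff[OF i2 i1])
      also have "\<dots> = (\<integral>x. ?i (x - ?v) * dquot f k x n - ?i x * dquot f k x n \<partial>lborel)"
        unfolding sh[symmetric] by (rule Bochner_Integration.integral_diff[symmetric, OF int_tr(1) i1])
      finally show ?thesis by (simp add: left_diff_distrib)
    qed
    have l2: "(\<lambda>n. \<integral>x. ?i x * B x n \<partial>lborel) \<longlonglongrightarrow> 0"
    proof (rule Lim_null_comparison)
      show "(\<lambda>n. (\<bar>L\<bar> * norm k) * (\<integral>x. \<bar>?i (x - h /\<^sub>R real (Suc n)) - ?i x\<bar> \<partial>lborel)) \<longlonglongrightarrow> 0"
        by (rule tendsto_mult_right_zero[OF tendsto_emeasure_translate_box])
      show "\<forall>\<^sub>F n in sequentially. norm (\<integral>x. ?i x * B x n \<partial>lborel) \<le> (\<bar>L\<bar> * norm k) * (\<integral>x. \<bar>?i (x - h /\<^sub>R real (Suc n)) - ?i x\<bar> \<partial>lborel)"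
      proof (rule always_eventually, rule allI)
        fix n
        let ?d = "\<lambda>x. ?i (x - h /\<^sub>R real (Suc n)) - ?i x"
        have id: "integrable lborel ?d" using int_tr(2) int_ind by (intro Bochner_Integration.integrable_diff) auto
        have "norm (\<integral>x. ?d x * dquot f k x n \<partial>lborel) \<le> (\<integral>x. (\<bar>L\<bar> * norm k) * \<bar>?d x\<bar> \<partial>lborel)"
        proof (rule Bochner_Integration.integral_norm_bound_integral)
          show "integrable lborel (\<lambda>x. ?d x * dquot f k x n)"
            using int_tr(1)[of l u "h /\<^sub>R real (Suc n)" n] int_tr(1)[of l u 0 n] by (simp add: left_diff_distrib del: of_nat_Suc)
          show "integrable lborel (\<lambda>x. (\<bar>L\<bar> * norm k) * \<bar>?d x\<bar>)" using id by (intro integrable_mult_right integrable_abs)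
          show "norm (?d x * dquot f k x n) \<le> (\<bar>L\<bar> * norm k) * \<bar>?d x\<bar>" for x
            using mult_left_mono[OF kb[of x n], of "\<bar>?d x\<bar>"] by (simp add: abs_mult mult.commute)
        qed
        thus "norm (\<integral>x. ?i x * B x n \<partial>lborel) \<le> (\<bar>L\<bar> * norm k) * (\<integral>x. \<bar>?d x\<bar> \<partial>lborel)"
          using id by (simp add: eq)
      qed
    qed
    show ?thesis using LIMSEQ_unique[OF l1 l2] .
  qed
  \<comment> \<open>A bounded function with zero integral over every box vanishes a.e.: 1 + b/(M+1)
    is a density whose measure agrees with Lebesgue measure on boxes, hence is Lebesgue measure.
    Division by M + 1 makes the density nonnegative.\<close>
  define D where "D = (\<lambda>x. 1 + b x / (M + 1))"
  have Dm[measurable]: "D \<in> borel_measurable borel" unfolding D_def by measurable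
  have D0: "AE x in lborel. 0 \<le> D x" using bb
  proof eventually_elim
    case (elim x)
    have "- b x \<le> M + 1" using elim by linarith
    hence "- b x / (M + 1) \<le> 1" using M0 by (subst pos_divide_le_eq) auto
    thus ?case by (simp add: D_def)
  qed
  have "lborel = density lborel (\<lambda>x. ennreal (D x))"
  proof (rule lborel_eqI)
    fix l u :: 'a assume lu: "\<And>b. b \<in> Basis \<Longrightarrow> l \<bullet> b \<le> u \<bullet> b"
    let ?i = "indicator (box l u) :: 'a \<Rightarrow> real"
    have ib: "integrable lborel (\<lambda>x. ?i x * b x)"
      by (rule Bochner_Integration.integrable_bound[OF integrable_mult_right[OF int_ind[of l u], of M]])
        (use bb M0 in \<open>auto simp: indicator_def abs_mult\<close>)
    have iD: "integrable lborel (\<lambda>x. ?i x * D x)"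
      using ib int_ind[of l u] by (simp add: D_def distrib_left)
    have "emeasure (density lborel (\<lambda>x. ennreal (D x))) (box l u) = (\<integral>\<^sup>+x. ennreal (D x) * indicator (box l u) x \<partial>lborel)"
      by (rule emeasure_density) auto
    also have "\<dots> = (\<integral>\<^sup>+x. ennreal (?i x * D x) \<partial>lborel)"
      by (rule nn_integral_cong) (auto simp: indicator_def)
    also have "\<dots> = ennreal (\<integral>x. ?i x * D x \<partial>lborel)"
      by (rule nn_integral_eq_integral[OF iD]) (use D0 in \<open>auto simp: indicator_def\<close>)
    also have "(\<integral>x. ?i x * D x \<partial>lborel) = (\<integral>x. ?i x + (?i x * b x) / (M + 1) \<partial>lborel)"
      by (simp add: D_def distrib_left)
    also have "\<dots> = (\<integral>x. ?i x \<partial>lborel)"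
      using zero[of l u] ib int_ind[of l u] by simp
    also have "\<dots> = measure lborel (box l u)" by simp
    also have "ennreal \<dots> = emeasure lborel (box l u)"
      using emeasure_lborel_box_finite[of l u] by (simp add: emeasure_eq_ennreal_measure)
    also have "\<dots> = ennreal (\<Prod>b\<in>Basis. (u - l) \<bullet> b)" using lu by (rule emeasure_lborel_box)
    finally show "emeasure (density lborel (\<lambda>x. ennreal (D x))) (box l u) = ennreal (\<Prod>b\<in>Basis. (u - l) \<bullet> b)" .
  qed simp
  hence "density lborel (\<lambda>x. ennreal (D x)) = density lborel (\<lambda>_. 1)" by (simp add: density_1)
  hence "AE x in lborel. ennreal (D x) = 1"
    by (intro sigma_finite_measure.density_unique[OF sigma_finite_lborel]) auto
  thus ?thesis using conv D0
  proof eventually_elim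
    case (elim x)
    have "D x = 1" using elim(1,3) by (metis ennreal_eq_1 )
    hence "b x = 0" using M0 by (simp add: D_def)
    moreover have "B x \<longlonglongrightarrow> lim (dquot f (h + k) x) - lim (dquot f h x) - lim (dquot f k x)"
      unfolding B_def using elim(2) by (intro tendsto_intros) (auto simp: convergent_LIMSEQ_iff)
    hence "b x = lim (dquot f (h + k) x) - lim (dquot f h x) - lim (dquot f k x)"
      unfolding b_def by (rule limI)
    ultimately show ?case by simp
  qed
qed


lemma countable_lattice:
  "countable {h::'a::euclidean_space. \<forall>b\<in>Basis. h \<bullet> b \<in> \<int>}"
proof (rule countable_subset)
  show "{h::'a. \<forall>b\<in>Basis. h \<bullet> b \<in> \<int>} \<subseteq> (\<lambda>c. \<Sum>b\<in>Basis. of_int (c b) *\<^sub>R b) ` (PiE Basis (\<lambda>_. UNIV))"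
  proof
    fix h :: 'a assume "h \<in> {h. \<forall>b\<in>Basis. h \<bullet> b \<in> \<int>}"
    hence e: "of_int \<lfloor>h \<bullet> b\<rfloor> = h \<bullet> b" if "b \<in> Basis" for b
      using that by (metis (no_types, lifting) Ints_cases mem_Collect_eq of_int_floor_cancel)
    have "h = (\<Sum>b\<in>Basis. (h \<bullet> b) *\<^sub>R b)" by (simp add: euclidean_representation)
    also have "\<dots> = (\<Sum>b\<in>Basis. of_int (restrict (\<lambda>b. \<lfloor>h \<bullet> b\<rfloor>) Basis b) *\<^sub>R b)"
      by (rule sum.cong) (simp_all add: e del: of_int_floor_cancel)
    finally have "h = (\<Sum>b\<in>Basis. of_int (restrict (\<lambda>b. \<lfloor>h \<bullet> b\<rfloor>) Basis b) *\<^sub>R b)" .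
    thus "h \<in> (\<lambda>c. \<Sum>b\<in>Basis. of_int (c b) *\<^sub>R b) ` (PiE Basis (\<lambda>_. UNIV))"
      by (intro image_eqI[where x="restrict (\<lambda>b. \<lfloor>h \<bullet> b\<rfloor>) Basis"], assumption) simp
  qed
qed (intro countable_image countable_PiE, auto)

text \<open>Lattice directions are used because on them additivity alone gives linearity: every
  coordinate is an integer, so D is determined by induction from its values on the basis.\<close>

lemma lattice_additive_representation:
  fixes D :: "'a::euclidean_space \<Rightarrow> real"
  defines "S \<equiv> {h::'a. \<forall>b\<in>Basis. h \<bullet> b \<in> \<int>}"
  assumes add: "\<And>h k. h \<in> S \<Longrightarrow> k \<in> S \<Longrightarrow> D (h + k) = D h + D k" and h: "h \<in> S"
  shows "D h = (\<Sum>b\<in>Basis. (h \<bullet> b) * D b)"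
proof -
  have Sadd: "u \<in> S \<Longrightarrow> v \<in> S \<Longrightarrow> u + v \<in> S" for u v by (simp add: S_def inner_add_left)
  have Ssc: "b \<in> Basis \<Longrightarrow> of_int m *\<^sub>R b \<in> S" for b m by (auto simp: S_def inner_Basis)
  have D0: "D 0 = 0" using add[of 0 0] by (simp add: S_def)
  have nat: "D (real n *\<^sub>R b) = real n * D b" if b: "b \<in> Basis" for n b
  proof (induction n)
    case (Suc n)
    have "real n *\<^sub>R b \<in> S" "b \<in> S" using Ssc[OF b, of "int n"] Ssc[OF b, of 1] by auto
    thus ?case using Suc add[of "real n *\<^sub>R b" b] by (simp add: algebra_simps)
  qed (simp add: D0)
  have int: "D (of_int m *\<^sub>R b) = of_int m * D b" if b: "b \<in> Basis" for m b
  proof (cases "m \<ge> 0")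
    case True
    thus ?thesis using nat[OF b, of "nat m"] by simp
  next
    case False
    have "D (of_int m *\<^sub>R b + of_int (-m) *\<^sub>R b) = D (of_int m *\<^sub>R b) + D (of_int (-m) *\<^sub>R b)"
      by (intro add Ssc b)
    moreover have "of_int m *\<^sub>R b + of_int (-m) *\<^sub>R b = 0" by (simp add: scaleR_add_left[symmetric])
    moreover have "D (of_int (-m) *\<^sub>R b) = - of_int m * D b" using nat[OF b, of "nat (-m)"] False by simp
    ultimately show ?thesis using D0 by simp
  qed
  have sum: "D (\<Sum>b\<in>A. of_int (c b) *\<^sub>R b) = (\<Sum>b\<in>A. of_int (c b) * D b) \<and> (\<Sum>b\<in>A. of_int (c b) *\<^sub>R b) \<in> S"
    if "finite A" "A \<subseteq> Basis" for A c
    using that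
  proof (induction A rule: finite_induct)
    case empty thus ?case by (simp add: D0 S_def)
  next
    case (insert a A)
    thus ?case using add[of "of_int (c a) *\<^sub>R a"] Ssc[of a "c a"] Sadd int[of a "c a"] by simp
  qed
  have e: "of_int \<lfloor>h \<bullet> b\<rfloor> = h \<bullet> b" if "b \<in> Basis" for b
    using that h unfolding S_def by (metis (no_types, lifting) Ints_cases mem_Collect_eq of_int_floor_cancel)
  have "h = (\<Sum>b\<in>Basis. (h \<bullet> b) *\<^sub>R b)" by (simp add: euclidean_representation)
  hence "h = (\<Sum>b\<in>Basis. of_int \<lfloor>h \<bullet> b\<rfloor> *\<^sub>R b)" by (simp add: e)
  moreover have "D (\<Sum>b\<in>Basis. of_int \<lfloor>h \<bullet> b\<rfloor> *\<^sub>R b) = (\<Sum>b\<in>Basis. of_int \<lfloor>h \<bullet> b\<rfloor> * D b)"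
    using sum[of Basis "\<lambda>b. \<lfloor>h \<bullet> b\<rfloor>"] by simp
  ultimately have "D h = (\<Sum>b\<in>Basis. of_int \<lfloor>h \<bullet> b\<rfloor> * D b)" by simp
  also have "\<dots> = (\<Sum>b\<in>Basis. (h \<bullet> b) * D b)" by (intro sum.cong) (auto simp: e)
  finally show ?thesis .
qed

text \<open>A vector \<open>v\<close> is approximated by \<open>h / m\<close> with \<open>m\<close> large and \<open>h\<close> from a fixed
  finite set of lattice vectors, with an error small compared with \<open>norm v\<close>.\<close>

lemma lattice_approx:
  fixes v :: "'a::euclidean_space"
  assumes N: "N > 0" and v: "v \<noteq> 0" and small: "norm v * (2 * real N + 2) \<le> 1"
  obtains h m where "\<forall>b\<in>Basis. h \<bullet> b \<in> \<int> \<and> \<bar>h \<bullet> b\<bar> \<le> real N" "real N / norm v \<le> real (Suc m)"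
    "1 / real (Suc m) \<le> norm v" "norm (v - h /\<^sub>R real (Suc m)) \<le> 2 * real DIM('a) / real N * norm v"
proof -
  define r where "r = norm v"
  have r0: "r > 0" using v by (simp add: r_def)
  define z where "z = (\<lambda>b. real N * (v \<bullet> b) / r)"
  \<comment> \<open>Rounding towards zero keeps |c b| at most N, so that h stays in a finite
    set.\<close>
  define c where "c = (\<lambda>b. if v \<bullet> b \<ge> 0 then \<lfloor>z b\<rfloor> else \<lceil>z b\<rceil>)"
  define h where "h = (\<Sum>b\<in>Basis. of_int (c b) *\<^sub>R b :: 'a)"
  have hb: "h \<bullet> b = of_int (c b)" if "b \<in> Basis" for b
    using that by (simp add: h_def inner_sum_left inner_Basis if_distrib sum.delta' cong: if_cong)
  have cz: "\<bar>of_int (c b) - z b\<bar> \<le> 1" for b unfolding c_def by (simp; linarith)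
  have zN: "\<bar>z b\<bar> \<le> real N" if "b \<in> Basis" for b
  proof -
    have "\<bar>v \<bullet> b\<bar> \<le> r" using Basis_le_norm[OF that, of v] by (simp add: r_def)
    hence "real N * \<bar>v \<bullet> b\<bar> \<le> real N * r" by (intro mult_left_mono) auto
    thus ?thesis using r0 by (simp add: z_def abs_mult divide_le_eq)
  qed
  have cN: "\<bar>of_int (c b)\<bar> \<le> real N" if "b \<in> Basis" for b
  proof (cases "v \<bullet> b \<ge> 0")
    case True
    hence "z b \<ge> 0" using r0 by (simp add: z_def)
    thus ?thesis using True zN[OF that] by (simp add: c_def; linarith)
  next
    case False
    hence "z b \<le> 0" using r0 by (simp add: z_def mult_nonneg_nonpos divide_nonpos_pos)
    hence "\<lceil>z b\<rceil> \<le> 0" by (simp add: ceiling_le_zero)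
    moreover have "of_int \<lceil>z b\<rceil> \<ge> z b" by simp
    moreover have "real_of_int \<lceil>z b\<rceil> \<le> 0" using \<open>\<lceil>z b\<rceil> \<le> 0\<close> by simp
    ultimately show ?thesis using False zN[OF that] by (simp add: c_def; linarith)
  qed
  \<comment> \<open>Thus \<open>Suc m\<close> is the ceiling of N / r, which matches the
    \<open>Suc n\<close> in \<open>dquot\<close>.\<close>
  define m where "m = nat \<lceil>real N / r\<rceil> - 1"
  have Nr: "real N / r > 0" using N r0 by simp
  hence "nat \<lceil>real N / r\<rceil> \<ge> 1" by (simp add: Suc_le_eq)
  hence Sm: "real (Suc m) = of_int \<lceil>real N / r\<rceil>" using Nr by (simp add: m_def of_nat_diff)
  have m1: "real N / r \<le> real (Suc m)" and m2: "real (Suc m) \<le> real N / r + 1" unfolding Sm by linarith+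
  define \<rho> where "\<rho> = 1 / real (Suc m)"
  have rho: "\<rho> \<le> r / real N"
    using m1 r0 N by (simp add: \<rho>_def field_simps)
  have rN: "r / real N \<le> r" using N r0 by (simp add: field_simps)
  have rho_lo: "r / real N - \<rho> \<le> r / (real N * real N)"
  proof -
    have "\<rho> \<ge> 1 / (real N / r + 1)" unfolding \<rho>_def using m2 Nr by (intro divide_left_mono mult_pos_pos) auto
    moreover have "1 / (real N / r + 1) = r / (real N + r)" using r0 N by (simp add: field_simps)
    ultimately have "r / real N - \<rho> \<le> r / real N - r / (real N + r)" by simp
    also have "\<dots> = r * r / (real N * (real N + r))" using r0 N by (simp add: field_simps)
    also have "\<dots> \<le> r * 1 / (real N * real N)"
    proof (rule frac_le)
      have "r * (2 * real N + 2) \<ge> r * 2" using r0 by (intro mult_left_mono) auto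
      hence "r \<le> 1" using small r0 unfolding r_def by linarith
      thus "r * r \<le> r * 1" using r0 by simp
      show "real N * real N \<le> real N * (real N + r)" using r0 N by (simp add: algebra_simps)
    qed (use r0 N in auto)
    finally show ?thesis by simp
  qed
  have "norm (v - h /\<^sub>R real (Suc m)) \<le> (\<Sum>b\<in>Basis. \<bar>(v - h /\<^sub>R real (Suc m)) \<bullet> b\<bar>)"
    by (rule norm_le_l1)
  also have "\<dots> \<le> (\<Sum>b\<in>(Basis::'a set). 2 / real N * r)"
  proof (rule sum_mono)
    fix b :: 'a assume b: "b \<in> Basis"
    have "v \<bullet> b = z b * (r / real N)" using r0 N by (simp add: z_def)
    hence "(v - h /\<^sub>R real (Suc m)) \<bullet> b = (z b - of_int (c b)) * (r / real N) + of_int (c b) * (r / real N - \<rho>)"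
      using hb[OF b] by (simp add: inner_diff_left \<rho>_def inverse_eq_divide algebra_simps del: of_nat_Suc)
    hence "\<bar>(v - h /\<^sub>R real (Suc m)) \<bullet> b\<bar> \<le> \<bar>z b - of_int (c b)\<bar> * \<bar>r / real N\<bar> + \<bar>of_int (c b)\<bar> * \<bar>r / real N - \<rho>\<bar>"
      by (metis abs_mult abs_triangle_ineq)
    also have "\<dots> \<le> 1 * (r / real N) + real N * (r / (real N * real N))"
    proof (intro add_mono mult_mono)
      show "\<bar>r / real N - \<rho>\<bar> \<le> r / (real N * real N)" using rho rho_lo by linarith
    qed (use cz[of b] cN[OF b] r0 N in \<open>auto simp: abs_minus_commute\<close>)
    also have "\<dots> = 2 / real N * r" using N by (simp add: field_simps)
    finally show "\<bar>(v - h /\<^sub>R real (Suc m)) \<bullet> b\<bar> \<le> 2 / real N * r" .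
  qed
  finally have "norm (v - h /\<^sub>R real (Suc m)) \<le> 2 * real DIM('a) / real N * norm v" by (simp add: r_def mult_ac)
  moreover have "\<forall>b\<in>Basis. h \<bullet> b \<in> \<int> \<and> \<bar>h \<bullet> b\<bar> \<le> real N" using hb cN by auto
  ultimately show thesis using that[of h m] m1 rho rN by (simp add: r_def \<rho>_def del: of_nat_Suc)
qed

text \<open>At a point where all lattice quotients converge and their limits are additive, these
  limits come from a linear map T. For a given error only the finitely many directions in
  \<open>SN\<close> are involved, so their convergence is uniform; \<open>lattice_approx\<close> and
  the Lipschitz bounds of f and T carry the estimate to every increment.\<close>

theorem Rademacher:
  fixes f :: "'a::euclidean_space \<Rightarrow> real"
  assumes lip: "\<And>x y. \<bar>f x - f y\<bar> \<le> L * norm (x - y)"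
  shows "negligible {x. \<not> f differentiable (at x)}"
proof -
  define S where "S = {h::'a. \<forall>b\<in>Basis. h \<bullet> b \<in> \<int>}"
  have cS: "countable S" unfolding S_def by (rule countable_lattice)
  have 1: "AE x in lborel. \<forall>h\<in>S. convergent (dquot f h x)"
    using cS AE_convergent_dquot[OF lip] by (subst AE_ball_countable) auto
  have 2: "AE x in lborel. \<forall>h\<in>S. \<forall>k\<in>S. lim (dquot f (h + k) x) = lim (dquot f h x) + lim (dquot f k x)"
    using cS AE_dquot_add[OF lip] by (subst AE_ball_countable, simp, subst AE_ball_countable) auto
  have "AE x in lborel. f differentiable (at x)"
    using 1 2
  proof eventually_elim
    case (elim x)
    define D where "D = (\<lambda>h. lim (dquot f h x))"
    have lim: "dquot f h x \<longlonglongrightarrow> D h" if "h \<in> S" for h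
      using elim(1) that by (simp add: D_def convergent_LIMSEQ_iff)
    define T where "T = (\<lambda>v. \<Sum>b\<in>Basis. (v \<bullet> b) * D b)"
    have T: "bounded_linear T" unfolding T_def
      by (intro bounded_linear_sum bounded_linear_mult_left[THEN bounded_linear_compose] bounded_linear_inner_left)
    have DT: "D h = T h" if "h \<in> S" for h
      unfolding T_def by (rule lattice_additive_representation)
        (use elim(2) that in \<open>auto simp: S_def D_def\<close>)
    obtain K where K: "\<And>v. norm (T v) \<le> norm v * K" using bounded_linear.bounded[OF T] by blast
    define d where "d = real DIM('a)"
    have "(f has_derivative T) (at x)"
      unfolding has_derivative_at_alt
    proof (intro conjI allI impI T)
      fix e :: real assume e: "e > 0"
      \<comment> \<open>N makes the lattice error, weighted by the Lipschitz constants of f and T,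
        at most half of e; the other half is left for the quotients.\<close>
      obtain N :: nat where N: "(\<bar>L\<bar> + \<bar>K\<bar>) * (2 * d) / (e / 2) < real N" "N > 0"
      proof -
        obtain N0 :: nat where "(\<bar>L\<bar> + \<bar>K\<bar>) * (2 * d) / (e / 2) < real N0" using reals_Archimedean2 by blast
        thus thesis using that[of "Suc N0"] by simp
      qed
      have Nsm: "(\<bar>L\<bar> + \<bar>K\<bar>) * (2 * d / real N) \<le> e / 2"
        using N e by (simp add: field_simps)
      define SN where "SN = {h::'a. \<forall>b\<in>Basis. h \<bullet> b \<in> \<int> \<and> \<bar>h \<bullet> b\<bar> \<le> real N}"
      have SNS: "SN \<subseteq> S" by (auto simp: SN_def S_def)
      have fin: "finite SN"
      proof (rule finite_subset)
        show "SN \<subseteq> (\<lambda>c. \<Sum>b\<in>Basis. of_int (c b) *\<^sub>R b) ` (PiE Basis (\<lambda>_. {- int N..int N}))"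
        proof
          fix h assume "h \<in> SN"
          hence e: "of_int \<lfloor>h \<bullet> b\<rfloor> = h \<bullet> b \<and> \<bar>h \<bullet> b\<bar> \<le> real N" if "b \<in> Basis" for b
            using that unfolding SN_def by (metis (no_types, lifting) Ints_cases mem_Collect_eq of_int_floor_cancel)
          have "h = (\<Sum>b\<in>Basis. (h \<bullet> b) *\<^sub>R b)" by (simp add: euclidean_representation)
          also have "\<dots> = (\<Sum>b\<in>Basis. of_int (restrict (\<lambda>b. \<lfloor>h \<bullet> b\<rfloor>) Basis b) *\<^sub>R b)"
            by (rule sum.cong) (simp_all add: e del: of_int_floor_cancel)
          finally have eq: "h = (\<Sum>b\<in>Basis. of_int (restrict (\<lambda>b. \<lfloor>h \<bullet> b\<rfloor>) Basis b) *\<^sub>R b)" .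
          have "restrict (\<lambda>b. \<lfloor>h \<bullet> b\<rfloor>) Basis \<in> PiE Basis (\<lambda>_. {- int N..int N})"
          proof (rule restrict_PiE_iff[THEN iffD2], rule ballI)
            fix b :: 'a assume "b \<in> Basis"
            from e[OF this] have "\<bar>real_of_int \<lfloor>h \<bullet> b\<rfloor>\<bar> \<le> real N" by metis
            hence "\<bar>\<lfloor>h \<bullet> b\<rfloor>\<bar> \<le> int N" by linarith
            thus "\<lfloor>h \<bullet> b\<rfloor> \<in> {- int N..int N}" by auto
          qed
          thus "h \<in> (\<lambda>c. \<Sum>b\<in>Basis. of_int (c b) *\<^sub>R b) ` (PiE Basis (\<lambda>_. {- int N..int N}))"
            using eq by (intro image_eqI[where x="restrict (\<lambda>b. \<lfloor>h \<bullet> b\<rfloor>) Basis"])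
        qed
      qed (intro finite_imageI finite_PiE, auto)
      have "\<forall>h\<in>SN. \<forall>\<^sub>F n in sequentially. \<bar>dquot f h x n - D h\<bar> < e / 2"
      proof
        fix h assume "h \<in> SN"
        hence "dquot f h x \<longlonglongrightarrow> D h" using lim SNS by blast
        from tendstoD[OF this, of "e / 2"] e show "\<forall>\<^sub>F n in sequentially. \<bar>dquot f h x n - D h\<bar> < e / 2"
          by (simp add: dist_real_def)
      qed
      hence "\<forall>\<^sub>F n in sequentially. \<forall>h\<in>SN. \<bar>dquot f h x n - D h\<bar> < e / 2"
        using fin by (simp add: eventually_ball_finite)
      then obtain n0 where n0: "\<And>n h. n \<ge> n0 \<Longrightarrow> h \<in> SN \<Longrightarrow> \<bar>dquot f h x n - D h\<bar> < e / 2"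
        by (auto simp: eventually_sequentially)
      \<comment> \<open>The first bound is the smallness condition of \<open>lattice_approx\<close>;
        the second forces the index m obtained there to be at least n0.\<close>
      define \<delta> where "\<delta> = min (1 / (2 * real N + 2)) (real N / real (Suc n0))"
      have d1: "\<delta> > 0" using N by (simp add: \<delta>_def)
      show "\<exists>\<delta>>0. \<forall>y. norm (y - x) < \<delta> \<longrightarrow> norm (f y - f x - T (y - x)) \<le> e * norm (y - x)"
      proof (intro exI[of _ \<delta>] conjI d1 allI impI)
        fix y assume y: "norm (y - x) < \<delta>"
        define v where "v = y - x"
        show "norm (f y - f x - T (y - x)) \<le> e * norm (y - x)"
        proof (cases "v = 0")
          case True
          thus ?thesis using linear_0[OF bounded_linear.linear[OF T]] by (simp add: v_def)
        next
          case False
          have v0: "norm v > 0" using False by simp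
          have v1: "norm v < 1 / (2 * real N + 2)" "norm v < real N / real (Suc n0)" using y by (auto simp: v_def \<delta>_def)
          have "norm v * (2 * real N + 2) \<le> 1"
            using v1(1) by (subst (asm) pos_less_divide_eq) auto
          then obtain h m where
            h: "\<forall>b\<in>Basis. h \<bullet> b \<in> \<int> \<and> \<bar>h \<bullet> b\<bar> \<le> real N" and m: "real N / norm v \<le> real (Suc m)"
            "1 / real (Suc m) \<le> norm v" and a: "norm (v - h /\<^sub>R real (Suc m)) \<le> 2 * d / real N * norm v"
            unfolding d_def by (rule lattice_approx[OF N(2) False])
          have hS: "h \<in> SN" "h \<in> S" using h by (auto simp: SN_def S_def)
          have "real (Suc n0) * norm v < real N" using v1(2) by (simp add: field_simps)
          hence "real (Suc n0) < real N / norm v" using v0 by (simp add: field_simps)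
          hence mn: "m \<ge> n0" using m(1) by linarith
          let ?w = "h /\<^sub>R real (Suc m)"
          have "f (x + ?w) - f x - T ?w = (dquot f h x m - D h) / real (Suc m)"
            using DT[OF hS(2)] linear_scale[OF bounded_linear.linear[OF T], of "inverse (real (Suc m))" h]
            by (simp add: dquot_def field_simps del: of_nat_Suc)
          hence 3: "\<bar>f (x + ?w) - f x - T ?w\<bar> \<le> (e / 2) * norm v"
          proof -
            assume eq: "f (x + ?w) - f x - T ?w = (dquot f h x m - D h) / real (Suc m)"
            have "\<bar>(dquot f h x m - D h) / real (Suc m)\<bar> = \<bar>dquot f h x m - D h\<bar> * (1 / real (Suc m))" by (simp del: of_nat_Suc)
            also have "\<dots> \<le> (e / 2) * norm v"
              using n0[OF mn hS(1)] m(2) e by (intro mult_mono) auto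
            finally show ?thesis using eq by simp
          qed
          have "T v - T ?w = T (v - ?w)" using linear_diff[OF bounded_linear.linear[OF T]] by simp
          hence 4: "\<bar>T v - T ?w\<bar> \<le> \<bar>K\<bar> * norm (v - ?w)"
            using K[of "v - ?w"] mult_left_mono[OF abs_ge_self[of K] norm_ge_zero[of "v - ?w"]] by (simp add: mult.commute)
          have 5: "\<bar>f y - f (x + ?w)\<bar> \<le> \<bar>L\<bar> * norm (v - ?w)"
            using lip[of y "x + ?w"] mult_right_mono[OF abs_ge_self[of L] norm_ge_zero[of "v - ?w"]] by (simp add: v_def algebra_simps)
          have "\<bar>f y - f x - T v\<bar> \<le> \<bar>f y - f (x + ?w)\<bar> + \<bar>f (x + ?w) - f x - T ?w\<bar> + \<bar>T v - T ?w\<bar>"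
            by linarith
          also have "\<dots> \<le> \<bar>L\<bar> * norm (v - ?w) + (e / 2) * norm v + \<bar>K\<bar> * norm (v - ?w)"
            using 3 4 5 by (intro add_mono)
          also have "\<dots> = (\<bar>L\<bar> + \<bar>K\<bar>) * norm (v - ?w) + (e / 2) * norm v" by (simp add: distrib_right)
          also have "\<dots> \<le> (\<bar>L\<bar> + \<bar>K\<bar>) * (2 * d / real N * norm v) + (e / 2) * norm v"
            using a by (intro add_right_mono mult_left_mono) auto
          also have "\<dots> \<le> (e / 2) * norm v + (e / 2) * norm v"
          proof -
            have "(\<bar>L\<bar> + \<bar>K\<bar>) * (2 * d / real N * norm v) = (\<bar>L\<bar> + \<bar>K\<bar>) * (2 * d / real N) * norm v" by simp
            thus ?thesis using mult_right_mono[OF Nsm, of "norm v"] by simp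
          qed
          finally show ?thesis by (simp add: v_def)
        qed
      qed
    qed
    thus ?case by (auto simp: differentiable_def)
  qed
  then obtain Z where "Z \<in> null_sets lborel" "{x. \<not> f differentiable (at x)} \<subseteq> Z"
    by (auto elim!: AE_E simp: null_sets_def)
  thus ?thesis
    by (meson negligible_iff_null_sets negligible_subset null_sets_completionI)
qed

section \<open>Functions with Lipschitz gradient and their second-order expansions\<close>

lemma linear_le_quadratic_imp_zero:
  fixes a :: "'a::real_inner"
  assumes "\<And>h. a \<bullet> h \<le> K * (norm h)\<^sup>2"
  shows "a = 0"
proof (rule ccontr)
  assume "a \<noteq> 0"
  hence n: "norm a > 0" by simp
  define t where "t = 1 / (2 * (\<bar>K\<bar> + 1))"
  have t: "t > 0" by (simp add: t_def add_nonneg_pos)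
  have "a \<bullet> (t *\<^sub>R a) \<le> K * (norm (t *\<^sub>R a))\<^sup>2" by (rule assms)
  hence "t * (norm a)\<^sup>2 \<le> K * (t * t * (norm a)\<^sup>2)"
    by (simp add: power2_norm_eq_inner[symmetric] power_mult_distrib power2_eq_square mult_ac)
  hence "(t * (norm a)\<^sup>2) * 1 \<le> (t * (norm a)\<^sup>2) * (K * t)" by (simp add: mult_ac)
  moreover have "t * (norm a)\<^sup>2 > 0" using t n by simp
  ultimately have "1 \<le> K * t" using mult_le_cancel_left_pos by blast
  moreover have "K * t \<le> \<bar>K\<bar> * t" using t by (intro mult_right_mono) auto
  moreover have "\<bar>K\<bar> * t < 1" by (simp add: t_def divide_less_eq)
  ultimately show False by linarith
qed

text \<open>Expand at x with increments d and d + h, and at y = x + d with increment h: the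
  combination isolates the product of \<open>P x - P y\<close> with h. Taking h parallel to it and
  of length |d| gives the bound; 6 is 4 + 1 + 1, the 4 coming from |d + h| \<le> 2|d|.\<close>

lemma gradient_lipschitz:
  fixes f :: "'a::euclidean_space \<Rightarrow> real"
  assumes pinch: "\<And>z. \<exists>p. \<forall>h. \<bar>f (z + h) - f z - p \<bullet> h\<bar> \<le> K * (norm h)\<^sup>2" and K: "K \<ge> 0"
  obtains P where "\<And>z h. \<bar>f (z + h) - f z - P z \<bullet> h\<bar> \<le> K * (norm h)\<^sup>2"
    "\<And>x y. norm (P x - P y) \<le> (6 * K) * norm (x - y)"
proof -
  obtain P where P: "\<And>z h. \<bar>f (z + h) - f z - P z \<bullet> h\<bar> \<le> K * (norm h)\<^sup>2"
    using pinch by metis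
  have "norm (P x - P y) \<le> (6 * K) * norm (x - y)" for x y
  proof (cases "P x = P y \<or> x = y")
    case True thus ?thesis using K by auto
  next
    case False
    define d where "d = y - x"
    define g where "g = P x - P y"
    define n where "n = norm d"
    have n0: "n > 0" and g0: "norm g > 0" using False by (auto simp: n_def d_def g_def)
    define h where "h = (n / norm g) *\<^sub>R g"
    have hn: "norm h = n" using n0 g0 by (simp add: h_def)
    have gh: "g \<bullet> h = n * norm g" using g0 by (simp add: h_def power2_norm_eq_inner[symmetric] power2_eq_square)
    have a1: "\<bar>f (x + (d + h)) - f x - P x \<bullet> (d + h)\<bar> \<le> K * (norm (d + h))\<^sup>2" by (rule P)
    have a2: "\<bar>f (x + d) - f x - P x \<bullet> d\<bar> \<le> K * (norm d)\<^sup>2" by (rule P)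
    have a3: "\<bar>f (y + h) - f y - P y \<bullet> h\<bar> \<le> K * (norm h)\<^sup>2" by (rule P)
    have "norm (d + h) \<le> 2 * n" using norm_triangle_ineq[of d h] hn by (simp add: n_def)
    hence "(norm (d + h))\<^sup>2 \<le> (2 * n)\<^sup>2" by (intro power_mono) auto
    hence a4: "K * (norm (d + h))\<^sup>2 \<le> 4 * (K * n\<^sup>2)" using mult_left_mono[OF _ K] by (fastforce simp: power_mult_distrib)
    have xy: "x + d = y" "x + (d + h) = y + h" by (auto simp: d_def)
    have "g \<bullet> h = P x \<bullet> (d + h) - P x \<bullet> d - P y \<bullet> h"
      by (simp add: g_def inner_diff_left inner_add_right)
    hence "g \<bullet> h \<le> 6 * (K * n\<^sup>2)"
      using a1 a2 a3 a4 unfolding xy hn n_def[symmetric] by linarith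
    hence "norm g * n \<le> (6 * K * n) * n" unfolding gh by (simp add: power2_eq_square mult_ac)
    hence "norm g \<le> 6 * K * n" using n0 by (simp add: mult_le_cancel_right)
    thus ?thesis by (simp add: g_def n_def d_def norm_minus_commute)
  qed
  thus thesis using P that by blast
qed

text \<open>The mean value theorem is applied along the segment to f minus its quadratic model,
  whose derivative is controlled by the differentiability of P at z. X is not known to be symmetric,
  but only its quadratic form enters.\<close>

lemma second_order_expansion:
  fixes f :: "'a::euclidean_space \<Rightarrow> real"
  assumes pinch: "\<And>z h. \<bar>f (z + h) - f z - P z \<bullet> h\<bar> \<le> K * (norm h)\<^sup>2"
    and X: "(P has_derivative X) (at z)" and \<eta>: "\<eta> > 0"
  shows "\<exists>d>0. \<forall>h. norm h < d \<longrightarrow> \<bar>f (z + h) - f z - P z \<bullet> h - (X h \<bullet> h) / 2\<bar> \<le> \<eta> * (norm h)\<^sup>2"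
proof -
  have fd: "(f has_derivative (\<lambda>h. P x \<bullet> h)) (at x)" for x
    unfolding has_derivative_at_alt
  proof (intro conjI allI impI bounded_linear_inner_right)
    fix e :: real assume e: "e > 0"
    show "\<exists>d>0. \<forall>y. norm (y - x) < d \<longrightarrow> norm (f y - f x - P x \<bullet> (y - x)) \<le> e * norm (y - x)"
    proof (intro exI[of _ "e / (\<bar>K\<bar> + 1)"] conjI allI impI)
      fix y assume "norm (y - x) < e / (\<bar>K\<bar> + 1)"
      hence le: "norm (y - x) * (\<bar>K\<bar> + 1) \<le> e" by (simp add: pos_less_divide_eq add_nonneg_pos less_imp_le)
      have "\<bar>f y - f x - P x \<bullet> (y - x)\<bar> \<le> K * (norm (y - x))\<^sup>2" using pinch[of x "y - x"] by simp
      also have "\<dots> \<le> (\<bar>K\<bar> + 1) * (norm (y - x))\<^sup>2" by (intro mult_right_mono) auto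
      also have "\<dots> = (norm (y - x) * (\<bar>K\<bar> + 1)) * norm (y - x)" by (simp add: power2_eq_square)
      also have "\<dots> \<le> e * norm (y - x)" using le by (intro mult_right_mono) auto
      finally show "norm (f y - f x - P x \<bullet> (y - x)) \<le> e * norm (y - x)" by simp
    qed (use e in \<open>simp add: add_nonneg_pos\<close>)
  qed
  have lX: "linear X" using X by (simp add: has_derivative_linear)
  obtain d where d: "d > 0" "\<And>y. norm (y - z) < d \<Longrightarrow> norm (P y - P z - X (y - z)) \<le> \<eta> * norm (y - z)"
    using X \<eta> unfolding has_derivative_at_alt by blast
  show ?thesis
  proof (intro exI[of _ d] conjI allI impI d(1))
    fix h :: 'a assume h: "norm h < d"
    define \<phi> where "\<phi> = (\<lambda>t::real. f (z + t *\<^sub>R h) - t * (P z \<bullet> h) - t\<^sup>2 / 2 * (X h \<bullet> h))"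
    have der: "(\<phi> has_real_derivative ((P (z + t *\<^sub>R h) - P z - X (t *\<^sub>R h)) \<bullet> h)) (at t)" for t
    proof -
      have "((\<lambda>t. f (z + t *\<^sub>R h)) has_derivative (\<lambda>s. P (z + t *\<^sub>R h) \<bullet> (s *\<^sub>R h))) (at t)"
        by (rule has_derivative_compose[OF _ fd, of "\<lambda>t. z + t *\<^sub>R h" "\<lambda>s. s *\<^sub>R h"])
          (auto intro!: derivative_eq_intros)
      hence "((\<lambda>t. f (z + t *\<^sub>R h)) has_real_derivative (P (z + t *\<^sub>R h) \<bullet> h)) (at t)"
        by (simp add: has_field_derivative_def mult_commute_abs)
      moreover have "((\<lambda>t. t * (P z \<bullet> h) + t\<^sup>2 / 2 * (X h \<bullet> h)) has_real_derivative (P z \<bullet> h + t * (X h \<bullet> h))) (at t)"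
        by (auto intro!: derivative_eq_intros)
      ultimately have "((\<lambda>t. f (z + t *\<^sub>R h) - (t * (P z \<bullet> h) + t\<^sup>2 / 2 * (X h \<bullet> h))) has_real_derivative
          (P (z + t *\<^sub>R h) \<bullet> h - (P z \<bullet> h + t * (X h \<bullet> h)))) (at t)"
        by (rule DERIV_diff)
      thus ?thesis by (simp add: \<phi>_def linear_scale[OF lX] inner_diff_left algebra_simps)
    qed
    obtain t where t: "0 < t" "t < 1" "\<phi> 1 - \<phi> 0 = (1 - 0) * ((P (z + t *\<^sub>R h) - P z - X (t *\<^sub>R h)) \<bullet> h)"
      using MVT2[of 0 1 \<phi> "\<lambda>t. (P (z + t *\<^sub>R h) - P z - X (t *\<^sub>R h)) \<bullet> h"] der by auto
    have th: "norm (t *\<^sub>R h) \<le> norm h" using t by (simp add: mult_left_le_one_le)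
    have "norm (P (z + t *\<^sub>R h) - P z - X (t *\<^sub>R h)) \<le> \<eta> * norm (t *\<^sub>R h)"
      using d(2)[of "z + t *\<^sub>R h"] th h by simp
    also have "\<dots> \<le> \<eta> * norm h" using th \<eta> by (intro mult_left_mono) auto
    finally have "norm (P (z + t *\<^sub>R h) - P z - X (t *\<^sub>R h)) * norm h \<le> (\<eta> * norm h) * norm h"
      by (intro mult_right_mono) auto
    moreover have "\<bar>(P (z + t *\<^sub>R h) - P z - X (t *\<^sub>R h)) \<bullet> h\<bar> \<le> norm (P (z + t *\<^sub>R h) - P z - X (t *\<^sub>R h)) * norm h"
      by (rule Cauchy_Schwarz_ineq2)
    ultimately have "\<bar>\<phi> 1 - \<phi> 0\<bar> \<le> \<eta> * (norm h)\<^sup>2" using t(3) by (simp add: power2_eq_square)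
    thus "\<bar>f (z + h) - f z - P z \<bullet> h - (X h \<bullet> h) / 2\<bar> \<le> \<eta> * (norm h)\<^sup>2" by (simp add: \<phi>_def algebra_simps)
  qed
qed

lemma negligible_not_differentiable_lipschitz:
  fixes P :: "'a::euclidean_space \<Rightarrow> 'b::euclidean_space"
  assumes lip: "\<And>x y. norm (P x - P y) \<le> L * norm (x - y)"
  shows "negligible {z. \<not> P differentiable (at z)}"
proof -
  have "negligible (\<Union>b\<in>Basis. {z. \<not> (\<lambda>x. P x \<bullet> b) differentiable (at z)})"
  proof (rule negligible_Union)
    fix S assume "S \<in> (\<lambda>b. {z. \<not> (\<lambda>x. P x \<bullet> b) differentiable (at z)}) ` Basis"
    then obtain b :: 'b where b: "b \<in> Basis" "S = {z. \<not> (\<lambda>x. P x \<bullet> b) differentiable (at z)}" by blast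
    show "negligible S" unfolding b(2)
    proof (rule Rademacher)
      fix x y show "\<bar>P x \<bullet> b - P y \<bullet> b\<bar> \<le> L * norm (x - y)"
        using Basis_le_norm[OF b(1), of "P x - P y"] lip[of x y] by (simp add: inner_diff_left)
    qed
  qed auto
  moreover have "{z. \<not> P differentiable (at z)} \<subseteq> (\<Union>b\<in>Basis. {z. \<not> (\<lambda>x. P x \<bullet> b) differentiable (at z)})"
    by (subst differentiable_componentwise_within) auto
  ultimately show ?thesis by (rule negligible_subset)
qed

lemma negligible_times_UNIV:
  fixes A :: "'a::euclidean_space set"
  assumes "negligible A"
  shows "negligible (A \<times> (UNIV :: 'b::euclidean_space set))" "negligible ((UNIV :: 'b::euclidean_space set) \<times> A)"
proof -
  obtain B where B: "A \<subseteq> B" "B \<in> null_sets lborel"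
    using assms unfolding negligible_iff_null_sets by (auto simp: null_sets_completion_iff2)
  have "B \<times> (UNIV :: 'b set) \<in> null_sets (lborel \<Otimes>\<^sub>M lborel)"
    by (rule lborel.times_in_null_sets1) (use B in auto)
  moreover have "(UNIV :: 'b set) \<times> B \<in> null_sets (lborel \<Otimes>\<^sub>M lborel)"
    by (rule lborel.times_in_null_sets2) (use B in auto)
  ultimately have 1: "negligible (B \<times> (UNIV :: 'b set))" "negligible ((UNIV :: 'b set) \<times> B)"
    unfolding negligible_iff_null_sets lborel_prod by (auto intro: null_sets_completionI)
  show "negligible (A \<times> (UNIV :: 'b set))" by (rule negligible_subset[OF 1(1)]) (use B in auto)
  show "negligible ((UNIV :: 'b set) \<times> A)" by (rule negligible_subset[OF 1(2)]) (use B in auto)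
qed

section \<open>Lasry--Lions regularisation and the theorem on sums\<close>

text \<open>\<open>sup_conv U e\<close> is the sup-convolution of \<open>U\<close> with parameter \<open>2e\<close>, and \<open>env U e\<close> its
  Lasry--Lions regularisation, which is \<open>C\<^sup>1\<^sup>,\<^sup>1\<close>.\<close>

definition sup_conv :: "('a::real_normed_vector \<Rightarrow> real) \<Rightarrow> real \<Rightarrow> 'a \<Rightarrow> real" where
  "sup_conv U e w = (SUP y. U y - (norm (y - w))\<^sup>2 / (4 * e))"

definition env :: "('a::real_normed_vector \<Rightarrow> real) \<Rightarrow> real \<Rightarrow> 'a \<Rightarrow> real" where
  "env U e z = (INF w. sup_conv U e w + (norm (w - z))\<^sup>2 / (2 * e))"

lemma norm_sq_add: "(norm (a + b))\<^sup>2 = (norm a)\<^sup>2 + 2 * (a \<bullet> b) + (norm (b::'a::real_inner))\<^sup>2"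
  by (simp add: power2_norm_eq_inner inner_add_left inner_add_right inner_commute)

lemma norm_sq_diff: "(norm (a - b))\<^sup>2 = (norm a)\<^sup>2 - 2 * (a \<bullet> b) + (norm (b::'a::real_inner))\<^sup>2"
  by (simp add: power2_norm_eq_inner inner_diff_left inner_diff_right inner_commute)

lemma norm_sq_add_le: "(norm (a + b))\<^sup>2 \<le> 2 * (norm a)\<^sup>2 + 2 * (norm (b::'a::real_inner))\<^sup>2"
  using norm_sq_add[of a b] norm_sq_diff[of a b] zero_le_power2[of "norm (a - b)"] by linarith

context
  fixes U :: "'a::euclidean_space \<Rightarrow> real" and e C :: real
  assumes e: "e > 0" and UC: "\<And>y. U y \<le> C"
begin

lemma sup_conv_bdd: "bdd_above (range (\<lambda>y. U y - (norm (y - w))\<^sup>2 / (4 * e)))"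
proof (rule bdd_aboveI2)
  fix y show "U y - (norm (y - w))\<^sup>2 / (4 * e) \<le> C"
  proof -
    have "0 \<le> (norm (y - w))\<^sup>2 / (4 * e)" using e by (intro divide_nonneg_nonneg) auto
    thus ?thesis using UC[of y] by linarith
  qed
qed

lemma sup_conv_ge: "U y - (norm (y - w))\<^sup>2 / (4 * e) \<le> sup_conv U e w"
  unfolding sup_conv_def by (rule cSUP_upper[OF _ sup_conv_bdd]) simp

lemma sup_conv_le: "(\<And>y. U y \<le> b + (norm (y - w))\<^sup>2 / (4 * e)) \<Longrightarrow> sup_conv U e w \<le> b"
  unfolding sup_conv_def by (rule cSUP_least) (auto simp: algebra_simps)

text \<open>Here the denominators 4e and 2e fit together: the infimum in \<open>env\<close> is
  bounded below by the sup-convolution with denominator 2e.\<close>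

lemma env_aux: "U y - (norm (y - z))\<^sup>2 / (2 * e) \<le> sup_conv U e w + (norm (w - z))\<^sup>2 / (2 * e)"
proof -
  have "(norm (y - w))\<^sup>2 \<le> 2 * (norm (y - z))\<^sup>2 + 2 * (norm (w - z))\<^sup>2"
    using norm_sq_add_le[of "y - z" "z - w"] by (simp add: norm_minus_commute)
  hence "(norm (y - w))\<^sup>2 / (4 * e) \<le> (2 * (norm (y - z))\<^sup>2 + 2 * (norm (w - z))\<^sup>2) / (4 * e)"
    using e by (intro divide_right_mono) auto
  also have "\<dots> = (norm (y - z))\<^sup>2 / (2 * e) + (norm (w - z))\<^sup>2 / (2 * e)" using e by (simp add: field_simps)
  finally show ?thesis using sup_conv_ge[of y w] by linarith
qed

lemma env_bdd: "bdd_below (range (\<lambda>w. sup_conv U e w + (norm (w - z))\<^sup>2 / (2 * e)))"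
  by (rule bdd_belowI2[of _ "U z"]) (use env_aux[of z z] in simp)

lemma env_ge: "U y - (norm (y - z))\<^sup>2 / (2 * e) \<le> env U e z"
  unfolding env_def by (rule cINF_greatest) (auto simp: env_aux)

lemma env_le: "env U e z \<le> sup_conv U e w + (norm (w - z))\<^sup>2 / (2 * e)"
  unfolding env_def by (rule cINF_lower[OF env_bdd]) simp

lemma env_approx: "\<delta> > 0 \<Longrightarrow> \<exists>w. sup_conv U e w + (norm (w - z))\<^sup>2 / (2 * e) < env U e z + \<delta>"
  using cINF_less_iff[OF _ env_bdd, of z "env U e z + \<delta>"] unfolding env_def by auto

text \<open>\<open>env\<close> lies above the sup-convolution with denominator 2e, yet a paraboloid
  of the same opening that dominates this sup-convolution dominates \<open>env\<close> as well. This
  allows a maximum of a doubled functional of U to be read as a maximum for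
  \<open>env U\<close>.\<close>

lemma env_le_paraboloid:
  assumes le: "\<And>y z. U y - (norm (y - z))\<^sup>2 / (2 * e) \<le> c + (norm (z - w))\<^sup>2 / (2 * e) + l \<bullet> z"
  shows "env U e z \<le> c + (norm (z - w))\<^sup>2 / (2 * e) + l \<bullet> z"
proof -
  \<comment> \<open>Completing the square: \<omega> is the vertex of the given paraboloid.\<close>
  define \<omega> where "\<omega> = w - e *\<^sub>R l"
  define b where "b = c + ((norm w)\<^sup>2 - (norm \<omega>)\<^sup>2) / (2 * e)"
  have eq: "c + (norm (z - w))\<^sup>2 / (2 * e) + l \<bullet> z = b + (norm (z - \<omega>))\<^sup>2 / (2 * e)" for z
    using e unfolding norm_sq_diff b_def \<omega>_def
    by (simp add: field_simps inner_diff_right inner_commute)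
  have "sup_conv U e \<omega> \<le> b"
  proof (rule sup_conv_le)
    fix y
    \<comment> \<open>At the midpoint the two squares with denominator 2e add up to the single
      square with denominator 4e.\<close>
    define z where "z = (1/2) *\<^sub>R (y + \<omega>)"
    have 1: "y - z = (1/2) *\<^sub>R (y - \<omega>)" "z - \<omega> = (1/2) *\<^sub>R (y - \<omega>)"
      by (simp_all add: z_def algebra_simps) (simp_all add: scaleR_add_left[symmetric])
    have "U y \<le> b + (norm (z - \<omega>))\<^sup>2 / (2 * e) + (norm (y - z))\<^sup>2 / (2 * e)"
      using le[of y z] unfolding eq by linarith
    moreover have "(norm (z - \<omega>))\<^sup>2 = (norm (y - \<omega>))\<^sup>2 / 4" "(norm (y - z))\<^sup>2 = (norm (y - \<omega>))\<^sup>2 / 4"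
      unfolding 1 by (simp_all only: norm_scaleR) (simp_all add: power2_eq_square)
    moreover have "a / 4 / (2 * e) + a / 4 / (2 * e) = a / (4 * e)" for a
      using e by (simp add: field_simps)
    ultimately show "U y \<le> b + (norm (y - \<omega>))\<^sup>2 / (4 * e)" by (simp add: add.assoc)
  qed
  thus ?thesis unfolding eq using env_le[of z \<omega>] by (simp add: norm_minus_commute)
qed

text \<open>After adding the square of z, the function under the infimum is jointly convex in (w,
  z): \<Gamma> is a supremum of affine functions and the rest is the square of the norm of a linear
  map. An infimum over w preserves convexity; near-minimisers replace minimisers.\<close>

lemma env_semiconvex: "convex_on UNIV (\<lambda>z. env U e z + (norm z)\<^sup>2 / (2 * e))"
proof (rule convex_onI)
  define \<Gamma> where "\<Gamma> = (\<lambda>w. sup_conv U e w + (norm w)\<^sup>2 / (4 * e))"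
  have \<Gamma>: "convex_on UNIV \<Gamma>"
  proof (rule convex_onI)
    fix t :: real and x y :: 'a assume t: "0 < t" "t < 1"
    let ?m = "(1 - t) *\<^sub>R x + t *\<^sub>R y"
    have "sup_conv U e ?m \<le> (1 - t) * \<Gamma> x + t * \<Gamma> y - (norm ?m)\<^sup>2 / (4 * e)"
    proof (rule sup_conv_le)
      fix u
      have aff: "U u - (norm (u - w))\<^sup>2 / (4 * e) + (norm w)\<^sup>2 / (4 * e) = U u - (norm u)\<^sup>2 / (4 * e) + (u \<bullet> w) / (2 * e)" for w
        using e unfolding norm_sq_diff by (simp add: field_simps)
      have "U u - (norm u)\<^sup>2 / (4 * e) + (u \<bullet> w) / (2 * e) \<le> \<Gamma> w" for w
        using sup_conv_ge[of u w] aff[of w] by (simp add: \<Gamma>_def)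
      hence "(1 - t) * (U u - (norm u)\<^sup>2 / (4 * e) + (u \<bullet> x) / (2 * e)) + t * (U u - (norm u)\<^sup>2 / (4 * e) + (u \<bullet> y) / (2 * e)) \<le> (1 - t) * \<Gamma> x + t * \<Gamma> y"
        using t by (intro add_mono mult_left_mono) auto
      moreover have "(1 - t) * (U u - (norm u)\<^sup>2 / (4 * e) + (u \<bullet> x) / (2 * e)) + t * (U u - (norm u)\<^sup>2 / (4 * e) + (u \<bullet> y) / (2 * e))
          = U u - (norm u)\<^sup>2 / (4 * e) + (u \<bullet> ?m) / (2 * e)"
      proof -
        have "u \<bullet> ?m = (1 - t) * (u \<bullet> x) + t * (u \<bullet> y)" by (simp only: inner_add_right inner_scaleR_right)
        thus ?thesis by (simp add: add_divide_distrib diff_divide_distrib algebra_simps)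
      qed
      ultimately show "U u \<le> (1 - t) * \<Gamma> x + t * \<Gamma> y - (norm ?m)\<^sup>2 / (4 * e) + (norm (u - ?m))\<^sup>2 / (4 * e)"
        using aff[of ?m] by linarith
    qed
    thus "\<Gamma> ?m \<le> (1 - t) * \<Gamma> x + t * \<Gamma> y" by (simp add: \<Gamma>_def)
  qed simp
  have J: "sup_conv U e w + (norm (w - z))\<^sup>2 / (2 * e) + (norm z)\<^sup>2 / (2 * e) = \<Gamma> w + (norm ((1/2) *\<^sub>R w - z))\<^sup>2 / e" for w z
    using e unfolding \<Gamma>_def norm_sq_diff by (simp add: field_simps power2_eq_square)
  fix t :: real and x y :: 'a assume t: "0 < t" "t < 1"
  let ?m = "(1 - t) *\<^sub>R x + t *\<^sub>R y"
  let ?k = "\<lambda>z. env U e z + (norm z)\<^sup>2 / (2 * e)"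
  show "?k ?m \<le> (1 - t) * ?k x + t * ?k y"
  proof (rule field_le_epsilon)
    fix \<delta> :: real assume \<delta>: "\<delta> > 0"
    obtain w1 where w1: "sup_conv U e w1 + (norm (w1 - x))\<^sup>2 / (2 * e) < env U e x + \<delta>" using env_approx[OF \<delta>] by blast
    obtain w2 where w2: "sup_conv U e w2 + (norm (w2 - y))\<^sup>2 / (2 * e) < env U e y + \<delta>" using env_approx[OF \<delta>] by blast
    let ?w = "(1 - t) *\<^sub>R w1 + t *\<^sub>R w2"
    let ?a = "(1/2) *\<^sub>R w1 - x" and ?b = "(1/2) *\<^sub>R w2 - y"
    have "?k ?m \<le> \<Gamma> ?w + (norm ((1/2) *\<^sub>R ?w - ?m))\<^sup>2 / e"
      using env_le[of ?m ?w] J[of ?w ?m] by linarith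
    also have "\<Gamma> ?w \<le> (1 - t) * \<Gamma> w1 + t * \<Gamma> w2" using convex_onD[OF \<Gamma>] t by auto
    also have "(1/2) *\<^sub>R ?w - ?m = (1 - t) *\<^sub>R ?a + t *\<^sub>R ?b" by (simp add: scaleR_right_distrib scaleR_right_diff_distrib mult.commute)
    also have "(norm ((1 - t) *\<^sub>R ?a + t *\<^sub>R ?b))\<^sup>2 \<le> (1 - t) * (norm ?a)\<^sup>2 + t * (norm ?b)\<^sup>2"
    proof -
      have "(1 - t) * (norm ?a)\<^sup>2 + t * (norm ?b)\<^sup>2 - (norm ((1 - t) *\<^sub>R ?a + t *\<^sub>R ?b))\<^sup>2 = t * (1 - t) * (norm (?a - ?b))\<^sup>2"
        unfolding norm_sq_add norm_sq_diff[of ?a ?b] by (simp add: power_mult_distrib) algebra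
      moreover have "t * (1 - t) * (norm (?a - ?b))\<^sup>2 \<ge> 0" using t by simp
      ultimately show ?thesis by linarith
    qed
    finally have "?k ?m \<le> (1 - t) * \<Gamma> w1 + t * \<Gamma> w2 + ((1 - t) * (norm ?a)\<^sup>2 + t * (norm ?b)\<^sup>2) / e"
      using e by (simp add: divide_right_mono)
    also have "\<dots> = (1 - t) * (\<Gamma> w1 + (norm ?a)\<^sup>2 / e) + t * (\<Gamma> w2 + (norm ?b)\<^sup>2 / e)"
      by (simp only: add_divide_distrib distrib_left times_divide_eq_right)
    also have "\<dots> \<le> (1 - t) * (?k x + \<delta>) + t * (?k y + \<delta>)"
    proof -
      have "\<Gamma> w1 + (norm ?a)\<^sup>2 / e \<le> ?k x + \<delta>" "\<Gamma> w2 + (norm ?b)\<^sup>2 / e \<le> ?k y + \<delta>"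
        using w1 w2 J[of w1 x] J[of w2 y] by linarith+
      thus ?thesis using t by (intro add_mono[of "_ * _" "_ * _"] mult_left_mono) auto
    qed
    also have "\<dots> = (1 - t) * ?k x + t * ?k y + \<delta>" by (simp add: algebra_simps)
    finally show "?k ?m \<le> (1 - t) * ?k x + t * ?k y + \<delta>" .
  qed
qed simp

text \<open>An infimum of paraboloids of opening 1/e is touched from above by one of them. The
  infimum over w is coercive because 1/(2e) beats the 1/(4e) hidden in \<open>sup_conv\<close>, so
  near-minimisers accumulate at a point l, and the slope is (z - l)/e.\<close>

lemma env_touched_above: "\<exists>p. \<forall>h. env U e (z + h) \<le> env U e z + p \<bullet> h + (norm h)\<^sup>2 / (2 * e)"
proof -
  define w where "w = (\<lambda>n. SOME w. sup_conv U e w + (norm (w - z))\<^sup>2 / (2 * e) < env U e z + inverse (real (Suc n)))"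
  have w: "sup_conv U e (w n) + (norm (w n - z))\<^sup>2 / (2 * e) < env U e z + inverse (real (Suc n))" for n
    unfolding w_def by (rule someI_ex, rule env_approx) simp
  have "bounded (range w)"
  proof (rule boundedI)
    fix v assume "v \<in> range w"
    then obtain n where n: "v = w n" by blast
    have a: "U z - (norm (z - w n))\<^sup>2 / (4 * e) \<le> sup_conv U e (w n)" by (rule sup_conv_ge)
    have "inverse (real (Suc n)) \<le> 1" by (simp add: inverse_le_1_iff)
    hence "(norm (w n - z))\<^sup>2 / (2 * e) - (norm (w n - z))\<^sup>2 / (4 * e) \<le> env U e z + 1 - U z"
      using w[of n] a by (simp add: norm_minus_commute)
    moreover have "(norm (w n - z))\<^sup>2 / (2 * e) - (norm (w n - z))\<^sup>2 / (4 * e) = (norm (w n - z))\<^sup>2 / (4 * e)"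
      using e by (simp add: field_simps)
    ultimately have le: "(norm (w n - z))\<^sup>2 \<le> (env U e z + 1 - U z) * (4 * e)"
      using e by (simp add: divide_le_eq)
    have "norm (w n - z) \<le> sqrt ((env U e z + 1 - U z) * (4 * e))" by (rule real_le_rsqrt[OF le])
    thus "norm v \<le> norm z + sqrt ((env U e z + 1 - U z) * (4 * e))"
      unfolding n using norm_triangle_ineq2[of "w n" z] by linarith
  qed
  then obtain l r where r: "strict_mono r" "(w \<circ> r) \<longlonglongrightarrow> l" using bounded_imp_convergent_subsequence by blast
  show ?thesis
  proof (intro exI[of _ "(1/e) *\<^sub>R (z - l)"] allI)
    fix h
    have 1: "env U e (z + h) \<le> env U e z + inverse (real (Suc (r n))) + ((1/e) *\<^sub>R (z - w (r n))) \<bullet> h + (norm h)\<^sup>2 / (2 * e)" for n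
    proof -
      have "(norm (w (r n) - (z + h)))\<^sup>2 = (norm (w (r n) - z))\<^sup>2 + 2 * ((z - w (r n)) \<bullet> h) + (norm h)\<^sup>2"
        using norm_sq_diff[of "w (r n) - z" h] by (simp add: diff_diff_eq inner_diff_left)
      hence "(norm (w (r n) - (z + h)))\<^sup>2 / (2 * e) = (norm (w (r n) - z))\<^sup>2 / (2 * e) + ((z - w (r n)) \<bullet> h) / e + (norm h)\<^sup>2 / (2 * e)"
        using e by (simp add: field_simps)
      moreover have "((1/e) *\<^sub>R (z - w (r n))) \<bullet> h = ((z - w (r n)) \<bullet> h) / e" by simp
      ultimately have "(norm (w (r n) - (z + h)))\<^sup>2 / (2 * e) = (norm (w (r n) - z))\<^sup>2 / (2 * e) + ((1/e) *\<^sub>R (z - w (r n))) \<bullet> h + (norm h)\<^sup>2 / (2 * e)"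
        by simp
      thus ?thesis using env_le[of "z + h" "w (r n)"] w[of "r n"] by linarith
    qed
    have "(\<lambda>n. env U e z + inverse (real (Suc (r n))) + ((1/e) *\<^sub>R (z - w (r n))) \<bullet> h + (norm h)\<^sup>2 / (2 * e)) \<longlonglongrightarrow>
       env U e z + 0 + ((1/e) *\<^sub>R (z - l)) \<bullet> h + (norm h)\<^sup>2 / (2 * e)"
      using LIMSEQ_subseq_LIMSEQ[OF LIMSEQ_inverse_real_of_nat r(1)] r(2)
      by (intro tendsto_intros) (auto simp: o_def)
    hence "env U e (z + h) \<le> env U e z + 0 + ((1/e) *\<^sub>R (z - l)) \<bullet> h + (norm h)\<^sup>2 / (2 * e)"
      by (rule LIMSEQ_le_const) (use 1 in auto)
    thus "env U e (z + h) \<le> env U e z + ((1/e) *\<^sub>R (z - l)) \<bullet> h + (norm h)\<^sup>2 / (2 * e)" by simp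
  qed
qed

text \<open>A convex function touched from above by a paraboloid at z lies above the corresponding
  tangent plane; for \<open>env\<close> plus |z|^2/(2e) this yields the missing lower bound.\<close>

lemma env_pinch: "\<exists>p. \<forall>h. \<bar>env U e (z + h) - env U e z - p \<bullet> h\<bar> \<le> 1 / (2 * e) * (norm h)\<^sup>2"
proof -
  obtain p where p: "\<And>h. env U e (z + h) \<le> env U e z + p \<bullet> h + (norm h)\<^sup>2 / (2 * e)"
    using env_touched_above by blast
  define k where "k = (\<lambda>z. env U e z + (norm z)\<^sup>2 / (2 * e))"
  define q where "q = p + (1/e) *\<^sub>R z"
  have qh: "q \<bullet> h = p \<bullet> h + (z \<bullet> h) / e" for h by (simp add: q_def inner_add_left)
  have ksq: "(norm (z + h))\<^sup>2 / (2 * e) = (norm z)\<^sup>2 / (2 * e) + (z \<bullet> h) / e + (norm h)\<^sup>2 / (2 * e)" for h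
    using e unfolding norm_sq_add by (simp add: field_simps)
  have dbl: "(norm h)\<^sup>2 / (2 * e) + (norm h)\<^sup>2 / (2 * e) = (norm h)\<^sup>2 / e" for h :: 'a using e by (simp add: field_simps)
  have kup: "k (z + h) \<le> k z + q \<bullet> h + (norm h)\<^sup>2 / e" for h
    using p[of h] dbl[of h] unfolding k_def qh ksq by linarith
  have klo: "k (z + h) \<ge> k z + q \<bullet> h" for h
  proof (rule field_le_epsilon)
    fix \<delta> :: real assume \<delta>: "\<delta> > 0"
    \<comment> \<open>Convexity on the segment from z - t h to z + h, with the upper bound inserted
      at z - t h, costs an error t|h|^2/e; this t makes it at most \<delta>.\<close>
    define t where "t = min 1 (\<delta> * e / ((norm h)\<^sup>2 + 1))"
    have n1: "(norm h)\<^sup>2 + 1 > 0" by (simp add: add_nonneg_pos)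
    have t: "0 < t" "t \<le> 1" using \<delta> e n1 by (auto simp: t_def)
    have "t \<le> \<delta> * e / ((norm h)\<^sup>2 + 1)" by (simp add: t_def)
    hence "t * ((norm h)\<^sup>2 + 1) \<le> \<delta> * e" using n1 by (simp add: pos_le_divide_eq)
    hence th: "t * (norm h)\<^sup>2 / e \<le> \<delta>" using t e by (simp add: divide_le_eq algebra_simps)
    define s where "s = t / (1 + t)"
    have s: "0 < s" "s < 1" "1 - s = 1 / (1 + t)" using t by (auto simp: s_def field_simps)
    have zz: "(1 - s) *\<^sub>R (z - t *\<^sub>R h) + s *\<^sub>R (z + h) = z"
    proof -
      have "(1 - s) * t = s" using s(3) by (simp add: s_def)
      moreover have "(1 - s) *\<^sub>R (z - t *\<^sub>R h) + s *\<^sub>R (z + h) = z + (s - (1 - s) * t) *\<^sub>R h"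
        by (simp add: algebra_simps)
      ultimately show ?thesis by simp
    qed
    have "k z \<le> (1 - s) * k (z - t *\<^sub>R h) + s * k (z + h)"
      using convex_onD[OF env_semiconvex, of s "z - t *\<^sub>R h" "z + h"] s zz by (simp add: k_def)
    also have "k (z - t *\<^sub>R h) \<le> k z - t * (q \<bullet> h) + t\<^sup>2 * (norm h)\<^sup>2 / e"
      using kup[of "- t *\<^sub>R h"] by (simp add: power_mult_distrib)
    finally have "k z \<le> (1 - s) * (k z - t * (q \<bullet> h) + t\<^sup>2 * (norm h)\<^sup>2 / e) + s * k (z + h)"
      using s(1,2) by simp
    hence "k z * (1 + t) \<le> ((1 - s) * (k z - t * (q \<bullet> h) + t\<^sup>2 * (norm h)\<^sup>2 / e) + s * k (z + h)) * (1 + t)"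
      using t by (intro mult_right_mono) auto
    also have "\<dots> = (k z - t * (q \<bullet> h) + t\<^sup>2 * (norm h)\<^sup>2 / e) + t * k (z + h)"
    proof -
      have "(1 - s) * (1 + t) = 1" "s * (1 + t) = t" using t s(3) by (simp_all add: s_def)
      thus ?thesis by (simp add: distrib_right mult.assoc mult.commute mult.left_commute) algebra
    qed
    finally have "t * (k z + q \<bullet> h) \<le> t * (k (z + h) + t * (norm h)\<^sup>2 / e)"
      using e by (simp add: algebra_simps power2_eq_square)
    hence "k z + q \<bullet> h \<le> k (z + h) + t * (norm h)\<^sup>2 / e" using t by simp
    thus "k z + q \<bullet> h \<le> k (z + h) + \<delta>" using th by linarith
  qed
  have "env U e (z + h) - env U e z - p \<bullet> h \<ge> - (1 / (2 * e) * (norm h)\<^sup>2)" for h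
    using klo[of h] unfolding k_def qh ksq by simp
  thus ?thesis using p by (intro exI[of _ p] allI) (simp add: abs_le_iff algebra_simps)
qed

end


text \<open>Jensen's lemma: the gradient map of the regularised difference is Lipschitz, hence maps the
  null set of bad points to a null set, and almost every linear perturbation avoids it.\<close>

theorem theorem_on_sums:
  fixes U V :: "'a::euclidean_space \<Rightarrow> real"
  assumes contU: "continuous_on UNIV U" and contV: "continuous_on UNIV V"
    and Ub: "\<And>z. U z \<le> CU - \<gamma> * (norm z)\<^sup>2" and \<gamma>: "\<gamma> > 0" and Vb: "\<And>z. V z \<ge> - CV"
    and e: "e > 0" and \<kappa>: "\<kappa> > 0"
  obtains z w p q X Y where "linear X" "linear Y"
    "\<And>\<eta>. \<eta> > 0 \<Longrightarrow> \<exists>d>0. \<forall>h. norm h < d \<longrightarrow> U (z + h) \<le> U z + p \<bullet> h + (X h \<bullet> h) / 2 + \<eta> * (norm h)\<^sup>2"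
    "\<And>\<eta>. \<eta> > 0 \<Longrightarrow> \<exists>d>0. \<forall>h. norm h < d \<longrightarrow> V (w + h) \<ge> V w + q \<bullet> h + (Y h \<bullet> h) / 2 - \<eta> * (norm h)\<^sup>2"
    "\<And>h k. X h \<bullet> h - Y k \<bullet> k \<le> (norm (h - k))\<^sup>2 / e"
    "norm (p - q) \<le> \<kappa>" "norm (z - w - (3 * e) *\<^sub>R p) \<le> \<kappa>"
    "U z - V w - (norm (z - w))\<^sup>2 / (6 * e) \<ge> U z0 - V z0 - \<kappa>"
proof -
  define V' where "V' = (\<lambda>z. - V z)"
  have UC: "U z \<le> CU" for z
  proof -
    have "0 \<le> \<gamma> * (norm z)\<^sup>2" using \<gamma> by simp
    thus ?thesis using Ub[of z] by linarith
  qed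
  have VC: "V' z \<le> CV" for z using Vb[of z] by (simp add: V'_def)
  have K0: "0 \<le> 1 / (2 * e)" using e by simp
  let ?f = "env U e" and ?g = "env V' e"
  obtain P where P: "\<And>z h. \<bar>?f (z + h) - ?f z - P z \<bullet> h\<bar> \<le> 1 / (2 * e) * (norm h)\<^sup>2"
    and PL: "\<And>x y. norm (P x - P y) \<le> (6 * (1 / (2 * e))) * norm (x - y)"
    by (rule gradient_lipschitz[OF env_pinch[where U=U and C=CU, OF e UC] K0], rule that)
  obtain Q where Q: "\<And>z h. \<bar>?g (z + h) - ?g z - Q z \<bullet> h\<bar> \<le> 1 / (2 * e) * (norm h)\<^sup>2"
    and QL: "\<And>x y. norm (Q x - Q y) \<le> (6 * (1 / (2 * e))) * norm (x - y)"
    by (rule gradient_lipschitz[OF env_pinch[where U=V' and C=CV, OF e VC] K0], rule that)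
  define L where "L = 6 * (1 / (2 * e))"
  define N where "N = {z. \<not> P differentiable (at z)} \<times> UNIV \<union> UNIV \<times> {w. \<not> Q differentiable (at w)}"
  have N: "negligible N" unfolding N_def
    by (intro negligible_Un negligible_times_UNIV negligible_not_differentiable_lipschitz[OF PL] negligible_not_differentiable_lipschitz[OF QL])
  \<comment> \<open>The gradient of f(z) + g(w) - |z - w|^2/(2e), where f and g are the two
    regularisations; at a maximum of that function minus the linear form (q1, q2) it takes the value
    (q1, q2).\<close>
  define \<Gamma> where "\<Gamma> = (\<lambda>(z,w). (P z - (1/e) *\<^sub>R (z - w), Q w + (1/e) *\<^sub>R (z - w)))"
  have negl: "negligible (\<Gamma> ` N)"
  proof (rule negligible_locally_Lipschitz_image[OF order_refl N])
    fix a :: "'a \<times> 'a"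
    show "\<exists>T B. open T \<and> a \<in> T \<and> (\<forall>b\<in>N \<inter> T. norm (\<Gamma> b - \<Gamma> a) \<le> B * norm (b - a))"
    proof (intro exI[of _ UNIV] exI[of _ "2 * (L + 2 * (1/e))"] conjI ballI)
      fix b :: "'a \<times> 'a"
      obtain z w where a: "a = (z, w)" by (cases a)
      obtain z' w' where b: "b = (z', w')" by (cases b)
      define n where "n = norm (b - a)"
      have nz: "norm (z' - z) \<le> n" "norm (w' - w) \<le> n"
        unfolding n_def a b using norm_fst_le[where x="z' - z" and y="w' - w"] norm_snd_le[where x="z' - z" and y="w' - w"] by auto
      have L0: "L \<ge> 0" using e by (simp add: L_def)
      have zw: "norm ((1/e) *\<^sub>R ((z' - w') - (z - w))) \<le> (1/e) * (2 * n)"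
      proof -
        have "norm ((z' - w') - (z - w)) \<le> norm (z' - z) + norm (w' - w)"
          using norm_triangle_ineq4[of "z' - z" "w' - w"] by (simp add: algebra_simps)
        hence "norm ((z' - w') - (z - w)) \<le> 2 * n" using nz by linarith
        thus ?thesis using e by (simp add: divide_right_mono)
      qed
      have Pn: "norm (P z' - P z) \<le> L * n" "norm (Q w' - Q w) \<le> L * n"
        using order_trans[OF PL mult_left_mono[OF nz(1)]] order_trans[OF QL mult_left_mono[OF nz(2)]] L0
        by (auto simp: L_def)
      have "norm (fst (\<Gamma> b - \<Gamma> a)) \<le> L * n + (1/e) * (2 * n)"
        using norm_triangle_ineq4[of "P z' - P z" "(1/e) *\<^sub>R ((z' - w') - (z - w))"] Pn zw
        by (simp add: \<Gamma>_def a b algebra_simps)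
      moreover have "norm (snd (\<Gamma> b - \<Gamma> a)) \<le> L * n + (1/e) * (2 * n)"
        using norm_triangle_ineq[of "Q w' - Q w" "(1/e) *\<^sub>R ((z' - w') - (z - w))"] Pn zw
        by (simp add: \<Gamma>_def a b algebra_simps)
      moreover have "norm (\<Gamma> b - \<Gamma> a) \<le> norm (fst (\<Gamma> b - \<Gamma> a)) + norm (snd (\<Gamma> b - \<Gamma> a))"
        by (metis norm_Pair_le prod.collapse)
      ultimately show "norm (\<Gamma> b - \<Gamma> a) \<le> 2 * (L + 2 * (1/e)) * norm (b - a)"
        by (simp add: n_def algebra_simps)
    qed auto
  qed
  define M0 where "M0 = U z0 - V z0"
  define R0 where "R0 = CU + CV - M0 + 2 / \<gamma> + 5 * e + 2 * norm z0"
  \<comment> \<open>A chain of three quadratic links joining y1, z, w and y2: maximising over y1 and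
    y2 produces sup-convolutions, which \<open>env_le_paraboloid\<close> replaces by
    \<open>env\<close>. The forms q1 and q2 are the perturbation.\<close>
  define T where "T = (\<lambda>q1 q2 y1 z w y2. U y1 - V y2 - ((norm (y1 - z))\<^sup>2 + (norm (z - w))\<^sup>2 + (norm (w - y2))\<^sup>2) / (2 * e)
     - q1 \<bullet> (z - z0) - q2 \<bullet> (w - z0))"
  define RA where "RA = sqrt (2 * \<bar>R0\<bar> / \<gamma>)"
  define RB where "RB = sqrt (4 * e * \<bar>R0\<bar>)"
  \<comment> \<open>Coercivity, uniform in |q1|, |q2| \<le> 1: the term -\<gamma>|y1|^2 bounds y1,
    the links bound the distances, and together they absorb the linear perturbation.\<close>
  have bound: "norm y1 \<le> RA \<and> norm (y1 - z) \<le> RB \<and> norm (z - w) \<le> RB \<and> norm (w - y2) \<le> RB"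
    if q: "norm q1 \<le> 1" "norm q2 \<le> 1" and T0: "T q1 q2 y1 z w y2 \<ge> M0" for q1 q2 y1 z w y2
  proof -
    define a b c d where "a = norm y1" and "b = norm (y1 - z)" and "c = norm (z - w)" and "d = norm (w - y2)"
    have nz: "norm z \<le> a + b" using norm_triangle_ineq4[of y1 "y1 - z"] by (simp add: a_def b_def)
    have nw: "norm w \<le> a + b + c" using norm_triangle_ineq4[of z "z - w"] nz by (simp add: c_def)
    have "- (q1 \<bullet> (z - z0)) \<le> norm (z - z0)"
      using norm_cauchy_schwarz[of "- q1" "z - z0"] mult_right_mono[OF q(1) norm_ge_zero[of "z - z0"]] by simp
    hence l1: "- (q1 \<bullet> (z - z0)) \<le> a + b + norm z0" using nz norm_triangle_ineq4[of z z0] by linarith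
    have "- (q2 \<bullet> (w - z0)) \<le> norm (w - z0)"
      using norm_cauchy_schwarz[of "- q2" "w - z0"] mult_right_mono[OF q(2) norm_ge_zero[of "w - z0"]] by simp
    hence l2: "- (q2 \<bullet> (w - z0)) \<le> a + b + c + norm z0" using nw norm_triangle_ineq4[of w z0] by linarith
    have main: "M0 \<le> CU - \<gamma> * a\<^sup>2 + CV - (b\<^sup>2 + c\<^sup>2 + d\<^sup>2) / (2 * e) + 2 * a + 2 * b + c + 2 * norm z0"
      using T0 l1 l2 Ub[of y1] Vb[of y2] unfolding T_def a_def[symmetric] b_def[symmetric] c_def[symmetric] d_def[symmetric]
      by linarith
    have s1: "2 * a - \<gamma> * a\<^sup>2 / 2 \<le> 2 / \<gamma>"
    proof -
      have "0 \<le> (\<gamma> * a - 2)\<^sup>2 / (2 * \<gamma>)" using \<gamma> by simp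
      also have "\<dots> = \<gamma> * a\<^sup>2 / 2 - 2 * a + 2 / \<gamma>" using \<gamma> by (simp add: field_simps power2_eq_square)
      finally show ?thesis by linarith
    qed
    have s2: "2 * b - b\<^sup>2 / (4 * e) \<le> 4 * e"
    proof -
      have "0 \<le> (b - 4 * e)\<^sup>2 / (4 * e)" using e by simp
      also have "\<dots> = b\<^sup>2 / (4 * e) - 2 * b + 4 * e" using e by (simp add: field_simps power2_eq_square)
      finally show ?thesis by linarith
    qed
    have s3: "c - c\<^sup>2 / (4 * e) \<le> e"
    proof -
      have "0 \<le> (c - 2 * e)\<^sup>2 / (4 * e)" using e by simp
      also have "\<dots> = c\<^sup>2 / (4 * e) - c + e" using e by (simp add: field_simps power2_eq_square)
      finally show ?thesis by linarith
    qed
    have sp: "(b\<^sup>2 + c\<^sup>2 + d\<^sup>2) / (2 * e) = b\<^sup>2 / (4 * e) + c\<^sup>2 / (4 * e) + d\<^sup>2 / (4 * e) + b\<^sup>2 / (4 * e) + c\<^sup>2 / (4 * e) + d\<^sup>2 / (4 * e)"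
      using e by (simp add: field_simps)
    have nn: "b\<^sup>2 / (4 * e) \<ge> 0" "c\<^sup>2 / (4 * e) \<ge> 0" "d\<^sup>2 / (4 * e) \<ge> 0" "\<gamma> * a\<^sup>2 / 2 \<ge> 0" using e \<gamma> by auto
    have tot: "\<gamma> * a\<^sup>2 / 2 + b\<^sup>2 / (4 * e) + c\<^sup>2 / (4 * e) + d\<^sup>2 / (4 * e) \<le> \<bar>R0\<bar>"
      using main s1 s2 s3 nn unfolding sp R0_def by linarith
    have "a\<^sup>2 \<le> 2 * \<bar>R0\<bar> / \<gamma>" using tot nn \<gamma> by (simp add: pos_le_divide_eq mult.commute)
    moreover have "b\<^sup>2 / (4 * e) \<le> \<bar>R0\<bar>" "c\<^sup>2 / (4 * e) \<le> \<bar>R0\<bar>" "d\<^sup>2 / (4 * e) \<le> \<bar>R0\<bar>" using tot nn by linarith+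
    hence "b\<^sup>2 \<le> 4 * e * \<bar>R0\<bar>" "c\<^sup>2 \<le> 4 * e * \<bar>R0\<bar>" "d\<^sup>2 \<le> 4 * e * \<bar>R0\<bar>"
      using e by (simp_all add: pos_divide_le_eq mult_ac)
    ultimately show ?thesis unfolding RA_def RB_def a_def[symmetric] b_def[symmetric] c_def[symmetric] d_def[symmetric]
      by (auto intro: real_le_rsqrt)
  qed
  have RA0: "RA \<ge> 0" "RB \<ge> 0" using e \<gamma> by (auto simp: RA_def RB_def)
  define R where "R = RA + 3 * RB + norm z0 + 1"
  \<comment> \<open>The four bounds serve, in order, coercivity, the estimate of |p - q|, the
    relation between the two points and p, and the loss in the value.\<close>
  define r where "r = min 1 (min (\<kappa> / 2) (min (\<kappa> / (3 * e)) (\<kappa> / (4 * R))))"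
  have R0: "R > 0" using RA0 by (simp add: R_def add_nonneg_pos)
  have r0: "r > 0" using \<kappa> e R0 by (simp add: r_def)
  have "\<exists>q1 q2. norm q1 \<le> r \<and> norm q2 \<le> r \<and> (q1, q2) \<notin> \<Gamma> ` N"
  proof (rule ccontr)
    assume no: "\<not> ?thesis"
    have "ball 0 r \<subseteq> \<Gamma> ` N"
    proof
      fix q :: "'a \<times> 'a" assume "q \<in> ball 0 r"
      hence "norm q < r" by simp
      hence "norm (fst q) \<le> r" "norm (snd q) \<le> r"
        using norm_fst_le[where x="fst q" and y="snd q"] norm_snd_le[where x="fst q" and y="snd q"] by auto
      thus "q \<in> \<Gamma> ` N" using no by (cases q) auto
    qed
    hence "negligible (ball (0::'a\<times>'a) r)" using negl negligible_subset by blast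
    moreover have "ball (0::'a\<times>'a) r \<noteq> {}" using r0 by simp
    ultimately show False using open_not_negligible open_ball by blast
  qed
  then obtain q1 q2 where q: "norm q1 \<le> r" "norm q2 \<le> r" "(q1, q2) \<notin> \<Gamma> ` N" by blast
  have r_le: "r \<le> 1" "2 * r \<le> \<kappa>" "e * (3 * r) \<le> \<kappa>" "r * (4 * R) \<le> \<kappa>"
  proof -
    have "r \<le> \<kappa> / (3 * e)" "r \<le> \<kappa> / (4 * R)" by (auto simp: r_def)
    thus "e * (3 * r) \<le> \<kappa>" "r * (4 * R) \<le> \<kappa>" using e R0 by (simp_all add: pos_le_divide_eq mult_ac)
  qed (auto simp: r_def)
  have q1: "norm q1 \<le> 1" "norm q2 \<le> 1" using q r_le by linarith+
  define S where "S = cball (0::'a) R \<times> cball (0::'a) R \<times> cball (0::'a) R \<times> cball (0::'a) R"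
  have TM0: "T q1 q2 z0 z0 z0 z0 = M0" by (simp add: T_def M0_def)
  have inS: "(y1, z, w, y2) \<in> S" if "T q1 q2 y1 z w y2 \<ge> M0" for y1 z w y2
  proof -
    note b = bound[OF q1 that]
    have "norm z \<le> RA + RB" using norm_triangle_ineq4[of y1 "y1 - z"] b by simp
    moreover have "norm w \<le> norm z + RB" using norm_triangle_ineq4[of z "z - w"] b by simp
    moreover have "norm y2 \<le> norm w + RB" using norm_triangle_ineq4[of w "w - y2"] b by simp
    ultimately have "norm y1 \<le> R" "norm z \<le> R" "norm w \<le> R" "norm y2 \<le> R"
      using b RA0 norm_ge_zero[of z0] unfolding R_def by linarith+
    thus ?thesis by (simp add: S_def)
  qed
  have "\<exists>x\<in>S. \<forall>y\<in>S. (case y of (y1,z,w,y2) \<Rightarrow> T q1 q2 y1 z w y2) \<le> (case x of (y1,z,w,y2) \<Rightarrow> T q1 q2 y1 z w y2)"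
  proof (rule continuous_attains_sup)
    show "compact S" unfolding S_def by (intro compact_Times compact_cball)
    show "S \<noteq> {}" using inS[of z0 z0 z0 z0] TM0 by auto
    have cU: "continuous_on S (\<lambda>x. U (fst x))" "continuous_on S (\<lambda>x. V (snd (snd (snd x))))"
      by (rule continuous_on_compose2[OF contU], auto intro!: continuous_intros)
        (rule continuous_on_compose2[OF contV], auto intro!: continuous_intros)
    show "continuous_on S (\<lambda>y. case y of (y1,z,w,y2) \<Rightarrow> T q1 q2 y1 z w y2)"
      unfolding T_def case_prod_beta by (intro continuous_intros cU) (use e in auto)
  qed
  then obtain y1 z w y2 where max_S: "(y1,z,w,y2) \<in> S"
    "\<And>y1' z' w' y2'. (y1',z',w',y2') \<in> S \<Longrightarrow> T q1 q2 y1' z' w' y2' \<le> T q1 q2 y1 z w y2" by fastforce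
  define M where "M = T q1 q2 y1 z w y2"
  have MM0: "M0 \<le> M" using max_S(2)[OF inS[of z0 z0 z0 z0]] TM0 by (simp add: M_def)
  have max: "T q1 q2 y1' z' w' y2' \<le> M" for y1' z' w' y2'
    using max_S(2)[of y1' z' w' y2'] inS[of y1' z' w' y2'] MM0 unfolding M_def by (metis linorder_le_cases order_trans)
  \<comment> \<open>With w' and y2' frozen, maximality of T puts the sup-convolution of U below a
    paraboloid in z', hence also \<open>env U\<close>; \<open>step2\<close> repeats this in w' for
    the negative of V.\<close>
  have step1: "?f z' \<le> M - V' y2' + (norm (w' - y2'))\<^sup>2 / (2 * e) + q2 \<bullet> (w' - z0) - q1 \<bullet> z0 + (norm (z' - w'))\<^sup>2 / (2 * e) + q1 \<bullet> z'" for z' w' y2'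
  proof (rule env_le_paraboloid[where U=U and C=CU, OF e UC])
    fix y z'
    show "U y - (norm (y - z'))\<^sup>2 / (2 * e) \<le> M - V' y2' + (norm (w' - y2'))\<^sup>2 / (2 * e) + q2 \<bullet> (w' - z0) - q1 \<bullet> z0 + (norm (z' - w'))\<^sup>2 / (2 * e) + q1 \<bullet> z'"
      using max[of y z' w' y2'] unfolding T_def V'_def add_divide_distrib inner_diff_right by linarith
  qed
  have step2: "?g w' \<le> M - ?f z' + q1 \<bullet> (z' - z0) - q2 \<bullet> z0 + (norm (w' - z'))\<^sup>2 / (2 * e) + q2 \<bullet> w'" for z' w'
  proof (rule env_le_paraboloid[where U=V' and C=CV, OF e VC])
    fix y w'
    show "V' y - (norm (y - w'))\<^sup>2 / (2 * e) \<le> M - ?f z' + q1 \<bullet> (z' - z0) - q2 \<bullet> z0 + (norm (w' - z'))\<^sup>2 / (2 * e) + q2 \<bullet> w'"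
      using step1[of z' y w'] unfolding inner_diff_right by (simp add: norm_minus_commute)
  qed
  have fge: "?f z \<ge> U y1 - (norm (y1 - z))\<^sup>2 / (2 * e)" by (rule env_ge[where U=U and C=CU, OF e UC])
  have gge: "?g w \<ge> V' y2 - (norm (y2 - w))\<^sup>2 / (2 * e)" by (rule env_ge[where U=V' and C=CV, OF e VC])
  have Meq: "M = U y1 + V' y2 - (norm (y1 - z))\<^sup>2 / (2 * e) - (norm (z - w))\<^sup>2 / (2 * e) - (norm (y2 - w))\<^sup>2 / (2 * e) - q1 \<bullet> (z - z0) - q2 \<bullet> (w - z0)"
    by (simp add: M_def T_def V'_def add_divide_distrib norm_minus_commute)
  have feq: "?f z = U y1 - (norm (y1 - z))\<^sup>2 / (2 * e)" and geq: "?g w = V' y2 - (norm (y2 - w))\<^sup>2 / (2 * e)"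
    using step2[of w z] fge gge Meq unfolding inner_diff_right by (simp_all add: norm_minus_commute)
  define \<Phi> where "\<Phi> = (\<lambda>z' w'. ?f z' + ?g w' - (norm (z' - w'))\<^sup>2 / (2 * e) - q1 \<bullet> z' - q2 \<bullet> w')"
  have \<Phi>max: "\<Phi> z' w' \<le> \<Phi> z w" for z' w'
    using step2[of w' z'] feq geq Meq unfolding \<Phi>_def inner_diff_right by (simp add: norm_minus_commute)
  have sqh: "(norm (z + h - w))\<^sup>2 / (2 * e) = (norm (z - w))\<^sup>2 / (2 * e) + ((1/e) *\<^sub>R (z - w)) \<bullet> h + (norm h)\<^sup>2 / (2 * e)" for z w h :: 'a
    using norm_sq_add[of "z - w" h] e by (simp add: diff_add_eq add_divide_distrib)
  have half: "1 / (2 * e) * a = a / (2 * e)" "a / (2 * e) + a / (2 * e) = 1 / e * a" for a using e by (simp_all add: field_simps)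
  have Pz: "P z - (1/e) *\<^sub>R (z - w) = q1"
  proof -
    have "P z - (1/e) *\<^sub>R (z - w) - q1 = 0"
    proof (rule linear_le_quadratic_imp_zero[of _ "1/e"])
      fix h
      have "?f (z + h) - (norm (z + h - w))\<^sup>2 / (2 * e) - q1 \<bullet> (z + h) \<le> ?f z - (norm (z - w))\<^sup>2 / (2 * e) - q1 \<bullet> z"
        using \<Phi>max[of "z + h" w] by (simp add: \<Phi>_def)
      thus "(P z - (1/e) *\<^sub>R (z - w) - q1) \<bullet> h \<le> 1 / e * (norm h)\<^sup>2"
        using P[of z h] half(2)[of "(norm h)\<^sup>2"] unfolding sqh half(1) by (simp only: inner_diff_left inner_add_right abs_le_iff) linarith
    qed
    thus ?thesis by simp
  qed
  have Qw: "Q w + (1/e) *\<^sub>R (z - w) = q2"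
  proof -
    have "Q w - (1/e) *\<^sub>R (w - z) - q2 = 0"
    proof (rule linear_le_quadratic_imp_zero[of _ "1/e"])
      fix h
      have "?g (w + h) - (norm (w + h - z))\<^sup>2 / (2 * e) - q2 \<bullet> (w + h) \<le> ?g w - (norm (w - z))\<^sup>2 / (2 * e) - q2 \<bullet> w"
        using \<Phi>max[of z "w + h"] by (simp add: \<Phi>_def norm_minus_commute)
      thus "(Q w - (1/e) *\<^sub>R (w - z) - q2) \<bullet> h \<le> 1 / e * (norm h)\<^sup>2"
        using Q[of w h] half(2)[of "(norm h)\<^sup>2"] unfolding sqh half(1) by (simp only: inner_diff_left inner_add_right abs_le_iff) linarith
    qed
    thus ?thesis by (simp add: algebra_simps)
  qed
  \<comment> \<open>Where a downward paraboloid with vertex y touches F from below at x, the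
    gradient of F is that of the paraboloid.\<close>
  have touch: "W = (1/e) *\<^sub>R (y - x)"
    if "\<And>h. F (x + h) \<ge> a - (norm (y - (x + h)))\<^sup>2 / (2 * e)" "F x = a - (norm (y - x))\<^sup>2 / (2 * e)"
      "\<And>h. \<bar>F (x + h) - F x - W \<bullet> h\<bar> \<le> 1 / (2 * e) * (norm h)\<^sup>2" for F :: "'a \<Rightarrow> real" and a y x W
  proof -
    have "(1/e) *\<^sub>R (y - x) - W = 0"
    proof (rule linear_le_quadratic_imp_zero[of _ "1/e"])
      fix h
      have "(norm (y - (x + h)))\<^sup>2 / (2 * e) = (norm (y - x))\<^sup>2 / (2 * e) - ((1/e) *\<^sub>R (y - x)) \<bullet> h + (norm h)\<^sup>2 / (2 * e)"
        using norm_sq_diff[of "y - x" h] e by (simp add: diff_diff_eq add_divide_distrib diff_divide_distrib)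
      thus "((1/e) *\<^sub>R (y - x) - W) \<bullet> h \<le> 1 / e * (norm h)\<^sup>2"
        using that(1)[of h] that(2) that(3)[of h] half(2)[of "(norm h)\<^sup>2"] unfolding half(1)
        by (simp only: inner_diff_left abs_le_iff) linarith
    qed
    thus ?thesis by simp
  qed
  have Py: "P z = (1/e) *\<^sub>R (y1 - z)" by (rule touch[OF env_ge[where U=U and C=CU, OF e UC] feq P])
  have Qy: "Q w = (1/e) *\<^sub>R (y2 - w)" by (rule touch[OF env_ge[where U=V' and C=CV, OF e VC] geq Q])
  have diff: "P differentiable (at z)" "Q differentiable (at w)"
  proof -
    have "\<Gamma> (z, w) = (q1, q2)" using Pz Qw by (simp add: \<Gamma>_def)
    hence "(z, w) \<notin> N" using q(3) by (metis imageI)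
    thus "P differentiable (at z)" "Q differentiable (at w)" by (auto simp: N_def)
  qed
  obtain X where X: "(P has_derivative X) (at z)" using diff(1) by (auto simp: differentiable_def)
  obtain Y where Y: "(Q has_derivative Y) (at w)" using diff(2) by (auto simp: differentiable_def)
  have lX: "linear X" and lY: "linear Y" using X Y by (auto simp: has_derivative_linear)
  define Y' where "Y' = (\<lambda>h. - Y h)"
  have lY': "linear Y'" unfolding Y'_def by (rule linear_compose_neg[OF lY])
  note eX = second_order_expansion[OF P X] and eY = second_order_expansion[OF Q Y]
  \<comment> \<open>The touching inequality transports the upper expansion of \<open>env U\<close>
    at z to U at the shifted point y1, with the same slope and the same quadratic form.\<close>
  have jetU: "\<exists>d>0. \<forall>h. norm h < d \<longrightarrow> U (y1 + h) \<le> U y1 + P z \<bullet> h + (X h \<bullet> h) / 2 + \<eta> * (norm h)\<^sup>2" if \<eta>: "\<eta> > 0" for \<eta>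
  proof -
    have le: "U (y1 + h) \<le> ?f (z + h) + U y1 - ?f z" for h
      using env_ge[where U=U and C=CU, OF e UC, of "y1 + h" "z + h"] feq by simp
    obtain d where d: "d > 0" "\<And>h. norm h < d \<Longrightarrow> \<bar>?f (z + h) - ?f z - P z \<bullet> h - (X h \<bullet> h) / 2\<bar> \<le> \<eta> * (norm h)\<^sup>2"
      using eX[OF \<eta>] by blast
    show ?thesis
    proof (intro exI[of _ d] conjI d(1) allI impI)
      fix h :: 'a assume "norm h < d"
      from d(2)[OF this] le[of h] show "U (y1 + h) \<le> U y1 + P z \<bullet> h + (X h \<bullet> h) / 2 + \<eta> * (norm h)\<^sup>2" by linarith
    qed
  qed
  have jetV: "\<exists>d>0. \<forall>h. norm h < d \<longrightarrow> V (y2 + h) \<ge> V y2 + (- Q w) \<bullet> h + (Y' h \<bullet> h) / 2 - \<eta> * (norm h)\<^sup>2" if \<eta>: "\<eta> > 0" for \<eta>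
  proof -
    have le: "V' (y2 + h) \<le> ?g (w + h) + V' y2 - ?g w" for h
      using env_ge[where U=V' and C=CV, OF e VC, of "y2 + h" "w + h"] geq by simp
    obtain d where d: "d > 0" "\<And>h. norm h < d \<Longrightarrow> \<bar>?g (w + h) - ?g w - Q w \<bullet> h - (Y h \<bullet> h) / 2\<bar> \<le> \<eta> * (norm h)\<^sup>2"
      using eY[OF \<eta>] by blast
    show ?thesis
    proof (intro exI[of _ d] conjI d(1) allI impI)
      fix h :: 'a assume "norm h < d"
      from d(2)[OF this] le[of h] show "V (y2 + h) \<ge> V y2 + (- Q w) \<bullet> h + (Y' h \<bullet> h) / 2 - \<eta> * (norm h)\<^sup>2"
        by (simp add: V'_def Y'_def)
    qed
  qed
  \<comment> \<open>Second-order condition at the maximum of \<Phi>, tested with the increments s h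
    and s k; the first-order terms cancel by \<open>Pz\<close> and \<open>Qw\<close>.\<close>
  have mat: "X h \<bullet> h - Y' k \<bullet> k \<le> (norm (h - k))\<^sup>2 / e" for h k
  proof (rule field_le_epsilon)
    fix \<delta> :: real assume \<delta>: "\<delta> > 0"
    define \<eta> where "\<eta> = \<delta> / (2 * ((norm h)\<^sup>2 + (norm k)\<^sup>2 + 1))"
    have pos: "(norm h)\<^sup>2 + (norm k)\<^sup>2 + 1 > 0" by (simp add: add_nonneg_pos)
    have \<eta>: "\<eta> > 0" using \<delta> pos by (simp add: \<eta>_def)
    obtain d1 where d1: "d1 > 0" "\<And>h. norm h < d1 \<Longrightarrow> \<bar>?f (z + h) - ?f z - P z \<bullet> h - (X h \<bullet> h) / 2\<bar> \<le> \<eta> * (norm h)\<^sup>2"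
      using eX[OF \<eta>] by blast
    obtain d2 where d2: "d2 > 0" "\<And>h. norm h < d2 \<Longrightarrow> \<bar>?g (w + h) - ?g w - Q w \<bullet> h - (Y h \<bullet> h) / 2\<bar> \<le> \<eta> * (norm h)\<^sup>2"
      using eY[OF \<eta>] by blast
    define s where "s = min d1 d2 / (norm h + norm k + 1)"
    have npos: "norm h + norm k + 1 > 0" by (simp add: add_nonneg_pos)
    have s: "s > 0" using d1(1) d2(1) npos by (simp add: s_def)
    have ss: "s * (norm h + norm k + 1) = min d1 d2" using npos by (simp add: s_def)
    have "s * norm h < s * (norm h + norm k + 1)" "s * norm k < s * (norm h + norm k + 1)"
      using s norm_ge_zero[of h] norm_ge_zero[of k] by (intro mult_strict_left_mono; linarith)+
    hence sm: "norm (s *\<^sub>R h) < d1" "norm (s *\<^sub>R k) < d2" unfolding ss using s by auto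
    have "\<Phi> (z + s *\<^sub>R h) (w + s *\<^sub>R k) \<le> \<Phi> z w" by (rule \<Phi>max)
    moreover have "(norm (z + s *\<^sub>R h - (w + s *\<^sub>R k)))\<^sup>2 / (2 * e) = (norm (z - w))\<^sup>2 / (2 * e) + ((1/e) *\<^sub>R (z - w)) \<bullet> (s *\<^sub>R (h - k)) + (norm (s *\<^sub>R (h - k)))\<^sup>2 / (2 * e)"
      using sqh[of z "s *\<^sub>R (h - k)" w] by (simp add: algebra_simps)
    moreover have "P z \<bullet> (s *\<^sub>R h) = q1 \<bullet> (s *\<^sub>R h) + ((1/e) *\<^sub>R (z - w)) \<bullet> (s *\<^sub>R h)" using Pz by (metis diff_add_cancel inner_add_left)
    moreover have "Q w \<bullet> (s *\<^sub>R k) = q2 \<bullet> (s *\<^sub>R k) - ((1/e) *\<^sub>R (z - w)) \<bullet> (s *\<^sub>R k)" using Qw by (metis add_diff_cancel_right' inner_diff_left)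
    moreover have "((1/e) *\<^sub>R (z - w)) \<bullet> (s *\<^sub>R (h - k)) = ((1/e) *\<^sub>R (z - w)) \<bullet> (s *\<^sub>R h) - ((1/e) *\<^sub>R (z - w)) \<bullet> (s *\<^sub>R k)"
      by (simp only: scaleR_diff_right inner_diff_right)
    moreover note d1(2)[OF sm(1)] d2(2)[OF sm(2)]
    ultimately have "(X (s *\<^sub>R h) \<bullet> (s *\<^sub>R h)) / 2 + (Y (s *\<^sub>R k) \<bullet> (s *\<^sub>R k)) / 2 \<le> (norm (s *\<^sub>R (h - k)))\<^sup>2 / (2 * e) + \<eta> * (norm (s *\<^sub>R h))\<^sup>2 + \<eta> * (norm (s *\<^sub>R k))\<^sup>2"
      unfolding \<Phi>_def inner_add_right by linarith
    hence "s\<^sup>2 * ((X h \<bullet> h) / 2 + (Y k \<bullet> k) / 2) \<le> s\<^sup>2 * ((norm (h - k))\<^sup>2 / (2 * e) + \<eta> * ((norm h)\<^sup>2 + (norm k)\<^sup>2))"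
      by (simp add: linear_scale[OF lX] linear_scale[OF lY] power_mult_distrib power2_eq_square algebra_simps add_divide_distrib norm_scaleR del: scaleR_right_diff_distrib)
    hence "(X h \<bullet> h) / 2 + (Y k \<bullet> k) / 2 \<le> (norm (h - k))\<^sup>2 / (2 * e) + \<eta> * ((norm h)\<^sup>2 + (norm k)\<^sup>2)"
      using s by simp
    moreover have "\<eta> * ((norm h)\<^sup>2 + (norm k)\<^sup>2) \<le> \<delta> / 2"
    proof -
      have "\<eta> * ((norm h)\<^sup>2 + (norm k)\<^sup>2) \<le> \<eta> * ((norm h)\<^sup>2 + (norm k)\<^sup>2 + 1)" using \<eta> by simp
      also have "\<dots> = \<delta> / 2"
      proof -
        have "\<delta> / (2 * m) * m = \<delta> / 2" if "m > 0" for m using that by (simp add: field_simps)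
        from this[OF pos] show ?thesis unfolding \<eta>_def .
      qed
      finally show ?thesis .
    qed
    moreover have "2 * ((norm (h - k))\<^sup>2 / (2 * e)) = (norm (h - k))\<^sup>2 / e" using e by simp
    ultimately show "X h \<bullet> h - Y' k \<bullet> k \<le> (norm (h - k))\<^sup>2 / e + \<delta>" by (simp add: Y'_def)
  qed
  have pq: "norm (P z - - Q w) \<le> \<kappa>"
  proof -
    have "P z - - Q w = q1 + q2" unfolding Pz[symmetric] Qw[symmetric] by simp
    thus ?thesis using norm_triangle_ineq[of q1 q2] q r_le by simp
  qed
  \<comment> \<open>Each of the displacements y1 - z, z - w and w - y2 equals e times the slope up
    to the perturbation, hence the factor 3.\<close>
  have yy: "norm (y1 - y2 - (3 * e) *\<^sub>R P z) \<le> \<kappa>"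
  proof -
    have "y1 = z + e *\<^sub>R P z" using Py e by simp
    moreover have "y2 = w + e *\<^sub>R Q w" using Qy e by simp
    moreover have "P z = q1 + (1/e) *\<^sub>R (z - w)" using Pz by (metis diff_add_cancel)
    hence zw: "z - w = e *\<^sub>R (P z - q1)" using e by simp
    moreover have "Q w = q2 - (P z - q1)" using Qw unfolding Pz[symmetric] by (simp add: algebra_simps)
    ultimately have "y1 - y2 = (z - w) + e *\<^sub>R P z - e *\<^sub>R (q2 - (P z - q1))" by simp
    hence "y1 - y2 - (3 * e) *\<^sub>R P z = - (e *\<^sub>R (q1 + q1 + q2))"
    proof -
      have "(3 * e) *\<^sub>R P z = e *\<^sub>R P z + e *\<^sub>R P z + e *\<^sub>R P z" by (simp flip: scaleR_add_left)
      thus "y1 - y2 = (z - w) + e *\<^sub>R P z - e *\<^sub>R (q2 - (P z - q1)) \<Longrightarrow> ?thesis"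
        unfolding zw by (simp add: scaleR_right_distrib scaleR_right_diff_distrib)
    qed
    hence "norm (y1 - y2 - (3 * e) *\<^sub>R P z) = e * norm (q1 + q1 + q2)" using e by simp
    also have "\<dots> \<le> e * (3 * r)"
      using norm_triangle_ineq[of "q1 + q1" q2] norm_triangle_ineq[of q1 q1] q e by (intro mult_left_mono) auto
    finally show ?thesis using r_le by linarith
  qed
  \<comment> \<open>Three links of weight 1/(2e) in series act as a single one of weight
    1/(6e).\<close>
  have near: "U y1 - V y2 - (norm (y1 - y2))\<^sup>2 / (6 * e) \<ge> U z0 - V z0 - \<kappa>"
  proof -
    have nb: "norm (z - z0) \<le> 2 * R" "norm (w - z0) \<le> 2 * R"
      using max_S(1) norm_triangle_ineq4[of z z0] norm_triangle_ineq4[of w z0] RA0 by (auto simp: S_def R_def)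
    have "- (q1 \<bullet> (z - z0)) \<le> norm q1 * norm (z - z0)" using norm_cauchy_schwarz[of "- q1" "z - z0"] by simp
    also have "\<dots> \<le> r * (2 * R)" using q nb R0 r0 by (intro mult_mono) auto
    finally have i1: "- (q1 \<bullet> (z - z0)) \<le> \<kappa> / 2" using r_le by simp
    have "- (q2 \<bullet> (w - z0)) \<le> norm q2 * norm (w - z0)" using norm_cauchy_schwarz[of "- q2" "w - z0"] by simp
    also have "\<dots> \<le> r * (2 * R)" using q nb R0 r0 by (intro mult_mono) auto
    finally have i2: "- (q2 \<bullet> (w - z0)) \<le> \<kappa> / 2" using r_le by simp
    have sq3: "(norm (a + b + c))\<^sup>2 \<le> 3 * ((norm a)\<^sup>2 + (norm b)\<^sup>2 + (norm c)\<^sup>2)" for a b c :: 'a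
    proof -
      have "3 * ((norm a)\<^sup>2 + (norm b)\<^sup>2 + (norm c)\<^sup>2) - (norm (a + b + c))\<^sup>2 = (norm (a - b))\<^sup>2 + (norm (b - c))\<^sup>2 + (norm (a - c))\<^sup>2"
        by (simp add: norm_sq_add norm_sq_diff inner_add_left)
      thus ?thesis using zero_le_power2[of "norm (a - b)"] zero_le_power2[of "norm (b - c)"] zero_le_power2[of "norm (a - c)"] by linarith
    qed
    have "(norm (y1 - y2))\<^sup>2 \<le> 3 * ((norm (y1 - z))\<^sup>2 + (norm (z - w))\<^sup>2 + (norm (w - y2))\<^sup>2)"
      using sq3[of "y1 - z" "z - w" "w - y2"] by simp
    hence "(norm (y1 - y2))\<^sup>2 / (6 * e) \<le> 3 * ((norm (y1 - z))\<^sup>2 + (norm (z - w))\<^sup>2 + (norm (w - y2))\<^sup>2) / (6 * e)"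
      using e by (intro divide_right_mono) auto
    also have "\<dots> = ((norm (y1 - z))\<^sup>2 + (norm (z - w))\<^sup>2 + (norm (w - y2))\<^sup>2) / (2 * e)" using e by (simp add: field_simps)
    finally show ?thesis using MM0 i1 i2 unfolding M_def T_def M0_def by linarith
  qed
  show thesis by (rule that[OF lX lY' jetU jetV mat pq yy near])
qed

section \<open>Parabolic viscosity sub- and supersolutions\<close>

text \<open>The supremum over \<theta> is written as a condition on every \<theta>, so that the
  notion makes sense for any family G, in particular for H - c and its rescalings, before
  boundedness of the family is established.\<close>

definition par_sub :: "('th \<Rightarrow> real^'n \<Rightarrow> real^'n^'n) \<Rightarrow> ('th \<Rightarrow> real^'n \<Rightarrow> real^'n \<Rightarrow> real)
    \<Rightarrow> (real^'n \<Rightarrow> real \<Rightarrow> real) \<Rightarrow> bool" where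
  "par_sub \<sigma> G u \<longleftrightarrow> (\<forall>x0 t0 \<phi> \<phi>t D\<phi> D2\<phi>. t0 > 0 \<longrightarrow> C21_test \<phi> \<phi>t D\<phi> D2\<phi> \<longrightarrow>
     (\<exists>\<epsilon>>0. \<forall>y s. dist y x0 < \<epsilon> \<longrightarrow> \<bar>s - t0\<bar> < \<epsilon> \<longrightarrow> u y s - \<phi> y s \<le> u x0 t0 - \<phi> x0 t0) \<longrightarrow>
     (\<forall>\<theta>. \<phi>t x0 t0 - trace (Amat \<sigma> \<theta> x0 ** D2\<phi> x0 t0) + G \<theta> x0 (D\<phi> x0 t0) \<le> 0))"

text \<open>The error \<kappa> is there because the supremum over \<theta> need not be
  attained.\<close>

definition par_super :: "('th \<Rightarrow> real^'n \<Rightarrow> real^'n^'n) \<Rightarrow> ('th \<Rightarrow> real^'n \<Rightarrow> real^'n \<Rightarrow> real)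
    \<Rightarrow> (real^'n \<Rightarrow> real \<Rightarrow> real) \<Rightarrow> bool" where
  "par_super \<sigma> G v \<longleftrightarrow> (\<forall>x0 t0 \<phi> \<phi>t D\<phi> D2\<phi>. t0 > 0 \<longrightarrow> C21_test \<phi> \<phi>t D\<phi> D2\<phi> \<longrightarrow>
     (\<exists>\<epsilon>>0. \<forall>y s. dist y x0 < \<epsilon> \<longrightarrow> \<bar>s - t0\<bar> < \<epsilon> \<longrightarrow> v y s - \<phi> y s \<ge> v x0 t0 - \<phi> x0 t0) \<longrightarrow>
     (\<forall>\<kappa>>0. \<exists>\<theta>. \<phi>t x0 t0 - trace (Amat \<sigma> \<theta> x0 ** D2\<phi> x0 t0) + G \<theta> x0 (D\<phi> x0 t0) > - \<kappa>))"

definition loc_lip_ham :: "('th \<Rightarrow> real^'n \<Rightarrow> real^'n \<Rightarrow> real) \<Rightarrow> bool" where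
  "loc_lip_ham G \<longleftrightarrow> (\<forall>R>0. \<exists>CR>0. \<forall>\<theta> x y p q. norm p \<le> R \<longrightarrow> norm q \<le> R \<longrightarrow>
      \<bar>G \<theta> x p - G \<theta> y q\<bar> \<le> CR * (norm (x - y) + norm (p - q)))"

section \<open>Calculus of test functions and of the second-order term\<close>

lemma C21_test_add:
  assumes "C21_test f ft Df D2f" "C21_test g gt Dg D2g"
  shows "C21_test (\<lambda>x t. f x t + g x t) (\<lambda>x t. ft x t + gt x t) (\<lambda>x t. Df x t + Dg x t) (\<lambda>x t. D2f x t + D2g x t)"
  unfolding C21_test_def
proof (intro conjI allI)
  fix x t
  have "((\<lambda>z. (case z of (y,s) \<Rightarrow> f y s) + (case z of (y,s) \<Rightarrow> g y s)) has_derivative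
      (\<lambda>k. (case k of (h,k) \<Rightarrow> Df x t \<bullet> h + ft x t * k) + (case k of (h,k) \<Rightarrow> Dg x t \<bullet> h + gt x t * k))) (at (x,t))"
    using assms unfolding C21_test_def by (intro has_derivative_add) auto
  thus "((\<lambda>(y, s). f y s + g y s) has_derivative (\<lambda>(h, k). (Df x t + Dg x t) \<bullet> h + (ft x t + gt x t) * k)) (at (x, t))"
    unfolding case_prod_unfold by (simp add: algebra_simps)
  have "((\<lambda>y. Df y t + Dg y t) has_derivative (\<lambda>h. D2f x t *v h + D2g x t *v h)) (at x)"
    using assms unfolding C21_test_def by (intro has_derivative_add) auto
  thus "((\<lambda>y. Df y t + Dg y t) has_derivative (\<lambda>h. (D2f x t + D2g x t) *v h)) (at x)"
    by (simp add: matrix_vector_mult_add_rdistrib)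
qed (use assms in \<open>auto simp: C21_test_def case_prod_beta intro!: continuous_on_add\<close>)

lemma C21_test_affine:
  fixes f :: "real^'n \<Rightarrow> real \<Rightarrow> real"
  assumes f: "C21_test f ft Df D2f"
  shows "C21_test (\<lambda>x t. k * f x (t + r) + c * t) (\<lambda>x t. k * ft x (t + r) + c) (\<lambda>x t. k *\<^sub>R Df x (t + r)) (\<lambda>x t. k *\<^sub>R D2f x (t + r))"
  unfolding C21_test_def
proof (intro conjI allI)
  fix x :: "real^'n" and t :: real
  have 1: "((\<lambda>z :: (real^'n) \<times> real. (fst z, snd z + r)) has_derivative (\<lambda>z. (fst z, snd z))) (at (x, t))"
    by (auto intro!: derivative_eq_intros)
  have 2: "((\<lambda>(y,s). f y s) has_derivative (\<lambda>(h,k). Df x (t + r) \<bullet> h + ft x (t + r) * k)) (at (fst (x, t), snd (x, t) + r))"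
    using f unfolding C21_test_def by simp
  have "((\<lambda>z. f (fst z) (snd z + r)) has_derivative (\<lambda>z. Df x (t + r) \<bullet> fst z + ft x (t + r) * snd z)) (at (x, t))"
    using has_derivative_compose[OF 1 2] unfolding case_prod_unfold by simp
  hence "((\<lambda>z. k * f (fst z) (snd z + r) + c * snd z) has_derivative
      (\<lambda>z. k * (Df x (t + r) \<bullet> fst z + ft x (t + r) * snd z) + c * snd z)) (at (x,t))"
    by (intro has_derivative_add has_derivative_mult_right has_derivative_snd has_derivative_ident)
  thus "((\<lambda>(y, s). k * f y (s + r) + c * s) has_derivative (\<lambda>(h, k'). (k *\<^sub>R Df x (t + r)) \<bullet> h + (k * ft x (t + r) + c) * k')) (at (x, t))"
    unfolding case_prod_unfold by (simp add: algebra_simps)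
  have "((\<lambda>y. k *\<^sub>R Df y (t + r)) has_derivative (\<lambda>h. k *\<^sub>R (D2f x (t + r) *v h))) (at x)"
    using f unfolding C21_test_def by (intro has_derivative_scaleR_right) auto
  thus "((\<lambda>y. k *\<^sub>R Df y (t + r)) has_derivative (\<lambda>h. (k *\<^sub>R D2f x (t + r)) *v h)) (at x)"
    by (simp add: scaleR_matrix_vector_assoc)
next
  have c: "continuous_on UNIV (\<lambda>z. g (fst z) (snd z + r))" if "continuous_on UNIV (\<lambda>(x,t). g x t)"
    for g :: "real^'n \<Rightarrow> real \<Rightarrow> 'b::topological_space"
  proof -
    have "continuous_on UNIV (\<lambda>z :: (real^'n) \<times> real. (fst z, snd z + r))" by (intro continuous_intros)
    from continuous_on_compose2[OF that this] show ?thesis by (simp add: case_prod_unfold)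
  qed
  show "continuous_on UNIV (\<lambda>(x, t). k * ft x (t + r) + c)" "continuous_on UNIV (\<lambda>(x, t). k *\<^sub>R Df x (t + r))"
    "continuous_on UNIV (\<lambda>(x, t). k *\<^sub>R D2f x (t + r))"
    using f unfolding C21_test_def case_prod_beta
    by (auto intro!: continuous_intros c[unfolded case_prod_beta])
qed

text \<open>As a sum of the quadratic form over the columns of \<sigma>, the trace is accessible to
  the one-sided inequality of the theorem on sums, column by column.\<close>

lemma trace_Amat:
  "trace (Amat \<sigma> \<theta> x ** M) = (\<Sum>j\<in>UNIV. (M *v column j (\<sigma> \<theta> x)) \<bullet> column j (\<sigma> \<theta> x))"
proof -
  let ?s = "\<sigma> \<theta> x"
  have "trace (Amat \<sigma> \<theta> x ** M) = (\<Sum>i\<in>UNIV. \<Sum>k\<in>UNIV. \<Sum>j\<in>UNIV. ?s $ i $ j * ?s $ k $ j * M $ k $ i)"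
    by (simp add: trace_def Amat_def matrix_matrix_mult_def transpose_def sum_distrib_right)
  also have "\<dots> = (\<Sum>j\<in>UNIV. \<Sum>k\<in>UNIV. \<Sum>i\<in>UNIV. ?s $ i $ j * ?s $ k $ j * M $ k $ i)"
    by (subst sum.swap, subst (2) sum.swap, subst sum.swap) (rule refl)
  also have "\<dots> = (\<Sum>j\<in>UNIV. (M *v column j ?s) \<bullet> column j ?s)"
    by (simp add: inner_vec_def matrix_vector_mult_def column_def sum_distrib_right sum_distrib_left mult_ac)
  finally show ?thesis .
qed

lemma sum_column_norm: "(\<Sum>j\<in>UNIV. (norm (column j (M::real^'n^'m)))\<^sup>2) = (norm M)\<^sup>2"
proof -
  have "(\<Sum>j\<in>UNIV. (norm (column j M))\<^sup>2) = (\<Sum>j\<in>UNIV. \<Sum>i\<in>UNIV. M $ i $ j * M $ i $ j)"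
    by (simp add: power2_norm_eq_inner inner_vec_def column_def)
  also have "\<dots> = (\<Sum>i\<in>UNIV. \<Sum>j\<in>UNIV. M $ i $ j * M $ i $ j)" by (rule sum.swap)
  also have "\<dots> = (norm M)\<^sup>2" by (simp add: power2_norm_eq_inner inner_vec_def)
  finally show ?thesis .
qed

definition quad :: "((real^'n) \<times> real) \<Rightarrow> ((real^'n) \<times> real \<Rightarrow> (real^'n) \<times> real) \<Rightarrow> ((real^'n) \<times> real) \<Rightarrow> real^'n \<Rightarrow> real \<Rightarrow> real" where
  "quad p B \<zeta> x t = p \<bullet> ((x, t) - \<zeta>) + (B ((x, t) - \<zeta>) \<bullet> ((x, t) - \<zeta>)) / 2"

text \<open>The linear maps X and Y of the theorem on sums are not known to be symmetric. The
  Hessian of their quadratic form is the symmetric part, which leaves the form itself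
  unchanged.\<close>

definition sym_part :: "('a::euclidean_space \<Rightarrow> 'a) \<Rightarrow> 'a \<Rightarrow> 'a" where
  "sym_part B h = (1/2) *\<^sub>R (B h + adjoint B h)"

lemma sym_part:
  assumes "linear B"
  shows "linear (sym_part B)" "sym_part B h \<bullet> h = B h \<bullet> h" "sym_part B h \<bullet> k + sym_part B h \<bullet> k = B h \<bullet> k + B k \<bullet> h"
proof -
  have "linear (\<lambda>h. (1/2) *\<^sub>R (B h + adjoint B h))"
    by (intro linear_compose_scale_right linear_compose_add assms adjoint_linear)
  thus "linear (sym_part B)" by (simp add: sym_part_def[abs_def])
  have a: "adjoint B h \<bullet> k = B k \<bullet> h" for h k using adjoint_works[OF assms, of k h] by (simp add: inner_commute)
  show "sym_part B h \<bullet> h = B h \<bullet> h" "sym_part B h \<bullet> k + sym_part B h \<bullet> k = B h \<bullet> k + B k \<bullet> h"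
    by (simp_all add: sym_part_def inner_add_left a)
qed

text \<open>The spatial block is all that the equation sees of a second derivative in space and
  time.\<close>

definition xx_block :: "((real^'n) \<times> real \<Rightarrow> (real^'n) \<times> real) \<Rightarrow> real^'n^'n" where
  "xx_block B = matrix (\<lambda>h. fst (sym_part B (h, 0)))"

lemma xx_block_form:
  assumes "linear B"
  shows "xx_block B *v h = fst (sym_part B (h, 0))" "(xx_block B *v h) \<bullet> h = B (h, 0) \<bullet> (h, 0)"
proof -
  have "linear (\<lambda>h. fst (sym_part B (h, 0)))"
    using linear_compose[OF linear_compose[OF _ sym_part(1)[OF assms], of "\<lambda>h. (h, 0)"] linear_fst]
    by (simp add: o_def linear_iff)
  thus 1: "xx_block B *v h = fst (sym_part B (h, 0))" unfolding xx_block_def by (simp add: matrix_works)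
  have "fst (sym_part B (h, 0)) \<bullet> h = sym_part B (h, 0) \<bullet> (h, 0)" by (simp add: inner_prod_def)
  thus "(xx_block B *v h) \<bullet> h = B (h, 0) \<bullet> (h, 0)" using 1 sym_part(2)[OF assms] by simp
qed

lemma C21_test_quad:
  fixes p \<zeta> :: "(real^'n) \<times> real"
  assumes B: "linear B"
  shows "C21_test (quad p B \<zeta>) (\<lambda>x t. snd (p + sym_part B ((x, t) - \<zeta>))) (\<lambda>x t. fst (p + sym_part B ((x, t) - \<zeta>))) (\<lambda>x t. xx_block B)"
proof -
  have bl: "bounded_linear B" "bounded_linear (sym_part B)" using B sym_part(1)[OF B] by (simp_all add: linear_conv_bounded_linear)
  note cB = bounded_linear.continuous_on[OF bl(2)]
  show ?thesis
    unfolding C21_test_def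
  proof (intro conjI allI)
    fix x :: "real^'n" and t :: real
    define z where "z = (x, t)"
    have "((\<lambda>z. p \<bullet> (z - \<zeta>) + (B (z - \<zeta>) \<bullet> (z - \<zeta>)) / 2) has_derivative (\<lambda>h. p \<bullet> h + (B (z - \<zeta>) \<bullet> h + B h \<bullet> (z - \<zeta>)) / 2)) (at z)"
      by (auto intro!: derivative_eq_intros bounded_linear.has_derivative[OF bl(1)])
    moreover have "(B (z - \<zeta>) \<bullet> h + B h \<bullet> (z - \<zeta>)) / 2 = sym_part B (z - \<zeta>) \<bullet> h" for h
      using sym_part(3)[OF B, of "z - \<zeta>" h] by simp
    ultimately have "((\<lambda>z. p \<bullet> (z - \<zeta>) + (B (z - \<zeta>) \<bullet> (z - \<zeta>)) / 2) has_derivative (\<lambda>h. (p + sym_part B (z - \<zeta>)) \<bullet> h)) (at z)"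
      by (simp add: inner_add_left)
    thus "((\<lambda>(y, s). quad p B \<zeta> y s) has_derivative (\<lambda>(h, k). fst (p + sym_part B ((x, t) - \<zeta>)) \<bullet> h + snd (p + sym_part B ((x, t) - \<zeta>)) * k)) (at (x, t))"
      unfolding case_prod_unfold by (simp add: quad_def inner_prod_def z_def)
    have "((\<lambda>y. fst (p + sym_part B ((y, t) - \<zeta>))) has_derivative (\<lambda>h. fst (0 + sym_part B ((h, 0) - 0)))) (at x)"
      by (intro has_derivative_fst has_derivative_add has_derivative_const bounded_linear.has_derivative[OF bl(2)] has_derivative_diff has_derivative_Pair has_derivative_ident)
    thus "((\<lambda>y. fst (p + sym_part B ((y, t) - \<zeta>))) has_derivative (*v) (xx_block B)) (at x)"
      by (simp add: xx_block_form(1)[OF B, abs_def] xx_block_form(1)[OF B] eta_contract_eq)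
  qed (auto simp: case_prod_beta intro!: continuous_intros cB)
qed

lemma sym_part_scale: "sym_part (\<lambda>h. k *\<^sub>R h) = (\<lambda>h. k *\<^sub>R (h::'a::euclidean_space))"
proof -
  have "adjoint (\<lambda>h. k *\<^sub>R (h::'a)) = (\<lambda>h. k *\<^sub>R h)" by (rule adjoint_unique) simp
  thus ?thesis by (simp add: fun_eq_iff sym_part_def scaleR_add_left[symmetric])
qed

lemma quad_scale: "quad 0 (\<lambda>h. (2 * k) *\<^sub>R h) \<zeta> x t = k * (norm ((x, t) - \<zeta>))\<^sup>2"
  by (simp add: quad_def power2_norm_eq_inner)

text \<open>The term -\<gamma>|z|^2 and the lower bound of V keep z and |z - w|^2/e bounded, so z -
  w tends to 0 and V(z) - V(w) with it by uniform continuity; the strict maximum at z0 then forces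
  convergence.\<close>

lemma penalization_limit:
  fixes U V :: "'a::euclidean_space \<Rightarrow> real"
  assumes V: "continuous_on UNIV V" and Ub: "\<And>z. U z \<le> CU - \<gamma> * (norm z)\<^sup>2" and \<gamma>: "\<gamma> > 0" and Vb: "\<And>z. V z \<ge> - CV"
    and M: "\<And>z. U z - V z \<le> M - \<gamma> * (norm (z - z0))\<^sup>2"
    and e: "\<And>n. e n > 0" "e \<longlonglongrightarrow> 0" and \<kappa>: "\<kappa> \<longlonglongrightarrow> 0"
    and near: "\<And>n::nat. U (z n) - V (w n) - (norm (z n - w n))\<^sup>2 / (6 * e n) \<ge> M - \<kappa> n"
  shows "z \<longlonglongrightarrow> z0" "w \<longlonglongrightarrow> z0"
proof -
  have pos: "(norm (z n - w n))\<^sup>2 / (6 * e n) \<ge> 0" for n using e(1)[of n] by simp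
  obtain K where K: "\<And>n. \<bar>\<kappa> n\<bar> \<le> K" using convergent_imp_Bseq[OF convergentI[OF \<kappa>]] by (auto simp: Bseq_def)
  have zz: "\<gamma> * (norm (z n))\<^sup>2 + (norm (z n - w n))\<^sup>2 / (6 * e n) \<le> CU + CV - M + K" for n
    using near[of n] Ub[of "z n"] Vb[of "w n"] K[of n] by linarith
  define R where "R = sqrt ((CU + CV - M + K) / \<gamma>)"
  have zR: "norm (z n) \<le> R" for n
  proof -
    have "\<gamma> * (norm (z n))\<^sup>2 \<le> CU + CV - M + K" using zz[of n] pos[of n] by linarith
    hence "(norm (z n))\<^sup>2 \<le> (CU + CV - M + K) / \<gamma>" using \<gamma> by (simp add: pos_le_divide_eq mult.commute)
    thus ?thesis unfolding R_def by (rule real_le_rsqrt)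
  qed
  have "(\<lambda>n. (norm (z n - w n))\<^sup>2) \<longlonglongrightarrow> 0"
  proof (rule Lim_null_comparison)
    show "(\<lambda>n. (CU + CV - M + K) * 6 * e n) \<longlonglongrightarrow> 0" using e(2) by (rule tendsto_mult_right_zero)
    show "\<forall>\<^sub>F n in sequentially. norm ((norm (z n - w n))\<^sup>2) \<le> (CU + CV - M + K) * 6 * e n"
    proof (rule always_eventually, rule allI)
      fix n
      have "0 \<le> \<gamma> * (norm (z n))\<^sup>2" using \<gamma> by simp
      hence "(norm (z n - w n))\<^sup>2 / (6 * e n) \<le> CU + CV - M + K" using zz[of n] by linarith
      thus "norm ((norm (z n - w n))\<^sup>2) \<le> (CU + CV - M + K) * 6 * e n" using e(1)[of n] by (simp add: pos_divide_le_eq mult_ac)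
    qed
  qed
  hence "(\<lambda>n. sqrt ((norm (z n - w n))\<^sup>2)) \<longlonglongrightarrow> sqrt 0" by (rule tendsto_real_sqrt)
  hence d0: "(\<lambda>n. norm (z n - w n)) \<longlonglongrightarrow> 0" by simp
  obtain D where D: "\<And>n. norm (z n - w n) \<le> D" using convergent_imp_Bseq[OF convergentI[OF d0]] by (auto simp: Bseq_def)
  have wR: "norm (w n) \<le> R + D" for n using zR[of n] D[of n] norm_triangle_ineq4[of "z n" "z n - w n"] by simp
  have D0: "D \<ge> 0" using D[of 0] norm_ge_zero order_trans by blast
  have uc: "uniformly_continuous_on (cball 0 (R + D)) V"
    by (rule compact_uniformly_continuous[OF continuous_on_subset[OF V]]) auto
  have VV: "(\<lambda>n. V (z n) - V (w n)) \<longlonglongrightarrow> 0"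
  proof (rule LIMSEQ_I)
    fix r :: real assume "r > 0"
    then obtain d where d: "d > 0" "\<And>x y. x \<in> cball 0 (R + D) \<Longrightarrow> y \<in> cball 0 (R + D) \<Longrightarrow> dist y x < d \<Longrightarrow> dist (V y) (V x) < r"
      using uc unfolding uniformly_continuous_on_def by metis
    obtain N where N: "\<And>n. n \<ge> N \<Longrightarrow> norm (z n - w n) < d" using LIMSEQ_D[OF d0 d(1)] by auto
    show "\<exists>no. \<forall>n\<ge>no. norm (V (z n) - V (w n) - 0) < r"
    proof (intro exI[of _ N] allI impI)
      fix n assume "n \<ge> N"
      hence "dist (z n) (w n) < d" using N by (simp add: dist_norm)
      moreover have "z n \<in> cball 0 (R + D)" using zR[of n] D0 by simp
      ultimately have "dist (V (z n)) (V (w n)) < r" using d(2)[of "w n" "z n"] wR[of n] by simp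
      thus "norm (V (z n) - V (w n) - 0) < r" by (simp add: dist_norm)
    qed
  qed
  have "(\<lambda>n. (norm (z n - z0))\<^sup>2) \<longlonglongrightarrow> 0"
  proof (rule Lim_null_comparison)
    show "(\<lambda>n. (1/\<gamma>) * (\<kappa> n + (V (z n) - V (w n)))) \<longlonglongrightarrow> 0"
      using tendsto_mult_right_zero[OF tendsto_add[OF \<kappa> VV, simplified]] by blast
    show "\<forall>\<^sub>F n in sequentially. norm ((norm (z n - z0))\<^sup>2) \<le> (1/\<gamma>) * (\<kappa> n + (V (z n) - V (w n)))"
    proof (rule always_eventually, rule allI)
      fix n
      have "\<gamma> * (norm (z n - z0))\<^sup>2 \<le> \<kappa> n + (V (z n) - V (w n))" using M[of "z n"] near[of n] pos[of n] by linarith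
      thus "norm ((norm (z n - z0))\<^sup>2) \<le> (1/\<gamma>) * (\<kappa> n + (V (z n) - V (w n)))" using \<gamma> by (simp add: pos_le_divide_eq mult.commute)
    qed
  qed
  hence "(\<lambda>n. sqrt ((norm (z n - z0))\<^sup>2)) \<longlonglongrightarrow> sqrt 0" by (rule tendsto_real_sqrt)
  hence "(\<lambda>n. norm (z n - z0)) \<longlonglongrightarrow> 0" by simp
  thus z: "z \<longlonglongrightarrow> z0" by (simp add: tendsto_norm_zero_iff LIM_zero_iff)
  have "(\<lambda>n. z n - w n) \<longlonglongrightarrow> 0" using d0 by (rule tendsto_norm_zero_cancel)
  from tendsto_diff[OF z this] show "w \<longlonglongrightarrow> z0" by simp
qed

lemma penalization_small:
  fixes U V :: "'a::euclidean_space \<Rightarrow> real"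
  assumes V: "continuous_on UNIV V" and Ub: "\<And>z. U z \<le> CU - \<gamma> * (norm z)\<^sup>2" and \<gamma>: "\<gamma> > 0" and Vb: "\<And>z. V z \<ge> - CV"
    and M: "\<And>z. U z - V z \<le> M - \<gamma> * (norm (z - z0))\<^sup>2" and \<rho>: "\<rho> > 0"
  shows "\<exists>e0>0. \<forall>e z w. 0 < e \<longrightarrow> e < e0 \<longrightarrow> U z - V w - (norm (z - w))\<^sup>2 / (6 * e) \<ge> M - e \<longrightarrow>
    norm (z - z0) < \<rho> \<and> norm (w - z0) < \<rho>"
proof (rule ccontr)
  assume "\<not> ?thesis"
  hence "\<forall>n. \<exists>e z w. 0 < e \<and> e < inverse (real (Suc n)) \<and> U z - V w - (norm (z - w))\<^sup>2 / (6 * e) \<ge> M - e \<and>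
    \<not> (norm (z - z0) < \<rho> \<and> norm (w - z0) < \<rho>)" by (metis inverse_positive_iff_positive of_nat_0_less_iff zero_less_Suc)
  then obtain e z w where ezw: "\<And>n. 0 < e n" "\<And>n. e n < inverse (real (Suc n))"
    "\<And>n. U (z n) - V (w n) - (norm (z n - w n))\<^sup>2 / (6 * e n) \<ge> M - e n"
    "\<And>n. \<not> (norm (z n - z0) < \<rho> \<and> norm (w n - z0) < \<rho>)" by metis
  have e0: "e \<longlonglongrightarrow> 0"
    by (rule real_tendsto_sandwich[OF _ _ tendsto_const LIMSEQ_inverse_real_of_nat])
      (use ezw(1,2) in \<open>auto intro!: always_eventually less_imp_le simp del: of_nat_Suc\<close>)
  have "z \<longlonglongrightarrow> z0" "w \<longlonglongrightarrow> z0"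
    by (rule penalization_limit[OF V Ub \<gamma> Vb M ezw(1) e0 e0 ezw(3)])+
  hence "\<forall>\<^sub>F n in sequentially. norm (z n - z0) < \<rho>" "\<forall>\<^sub>F n in sequentially. norm (w n - z0) < \<rho>"
    using \<rho> by (auto simp: tendsto_iff dist_norm)
  hence "\<forall>\<^sub>F n in sequentially. False" by eventually_elim (use ezw(4) in blast)
  thus False by simp
qed

text \<open>Bounds the slope in a semijet of a Lipschitz function: short increments along a make the
  second-order term negligible, so the constant L is not spoilt.\<close>

lemma slope_le_lipschitz:
  fixes a :: "'a::real_inner"
  assumes d: "d > 0" and le: "\<And>h. norm h < d \<Longrightarrow> a \<bullet> h \<le> L * norm h + K * (norm h)\<^sup>2" and L: "L \<ge> 0"
  shows "norm a \<le> L"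
proof (rule ccontr)
  assume "\<not> norm a \<le> L"
  hence gt: "norm a > L" by simp
  hence a0: "norm a > 0" using L by linarith
  define t where "t = min (d / (2 * norm a)) ((norm a - L) / (2 * (\<bar>K\<bar> + 1) * norm a))"
  have t: "t > 0" using d gt a0 by (simp add: t_def add_nonneg_pos)
  have "t \<le> d / (2 * norm a)" by (simp add: t_def)
  hence "t * norm a \<le> d / 2" using a0 by (simp add: pos_le_divide_eq mult_ac)
  hence nt: "norm (t *\<^sub>R a) < d" using t d by simp
  have "t \<le> (norm a - L) / (2 * (\<bar>K\<bar> + 1) * norm a)" by (simp add: t_def)
  moreover have "2 * (\<bar>K\<bar> + 1) * norm a > 0" using a0 by (simp add: add_nonneg_pos)
  ultimately have "t * (2 * (\<bar>K\<bar> + 1) * norm a) \<le> norm a - L" by (simp only: pos_le_divide_eq)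
  hence kt: "2 * ((\<bar>K\<bar> + 1) * (t * norm a)) \<le> norm a - L" by (simp add: mult_ac)
  have "K * (t * norm a) \<le> (\<bar>K\<bar> + 1) * (t * norm a)" using t a0 by (intro mult_right_mono) auto
  hence small: "K * (t * norm a) < norm a - L" using kt gt by linarith
  have "a \<bullet> (t *\<^sub>R a) \<le> L * norm (t *\<^sub>R a) + K * (norm (t *\<^sub>R a))\<^sup>2" by (rule le[OF nt])
  hence "(t * norm a) * norm a \<le> (t * norm a) * (L + K * (t * norm a))"
    using t by (simp add: power2_norm_eq_inner[symmetric] power2_eq_square algebra_simps)
  moreover have "t * norm a > 0" using t a0 by simp
  ultimately have "norm a \<le> L + K * (t * norm a)" by (simp only: mult_le_cancel_left_pos)
  thus False using small by linarith
qed

lemma trace_Amat_add: "trace (Amat \<sigma> \<theta> x ** (M + N)) = trace (Amat \<sigma> \<theta> x ** M) + trace (Amat \<sigma> \<theta> x ** N)"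
  by (simp add: matrix_add_ldistrib trace_add)

lemma trace_Amat_xx_block:
  assumes "linear B"
  shows "trace (Amat \<sigma> \<theta> x ** xx_block B) = (\<Sum>j\<in>UNIV. B (column j (\<sigma> \<theta> x), 0) \<bullet> (column j (\<sigma> \<theta> x), 0))"
  by (simp add: trace_Amat xx_block_form(2)[OF assms])

lemma trace_Amat_xx_block_scale:
  "trace (Amat \<sigma> \<theta> x ** xx_block (\<lambda>h. k *\<^sub>R h)) = k * (norm (\<sigma> \<theta> x))\<^sup>2"
  by (simp add: trace_Amat_xx_block[OF linear_scale_self] sum_column_norm[symmetric] sum_distrib_left power2_norm_eq_inner)

text \<open>A pointwise substitute for the equation of u - v: where \<psi> touches it from above,
  the linearised inequality holds at a nearby point up to \<kappa>. As v is Lipschitz, the slope is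
  bounded, so the doubled points are at distance O(e); the difference of the traces is at most
  |\<sigma>(x) - \<sigma>(y)|^2/e = O(e), and both Hamiltonians can be moved to one point and one
  slope.\<close>

theorem visc_difference:
  fixes \<sigma> :: "'th \<Rightarrow> real^'n \<Rightarrow> real^'n^'n" and u v :: "real^'n \<Rightarrow> real \<Rightarrow> real"
  assumes \<sigma>_bd: "\<And>\<theta> x. norm (\<sigma> \<theta> x) \<le> C"
    and \<sigma>_lip: "\<And>\<theta> x y. norm (\<sigma> \<theta> x - \<sigma> \<theta> y) \<le> C * norm (x - y)"
    and G1: "loc_lip_ham G1" and G2: "loc_lip_ham G2"
    and sub: "par_sub \<sigma> G1 u" and super: "par_super \<sigma> G2 v"
    and cont: "continuous_on (UNIV \<times> {a..b}) (\<lambda>(x,t). u x t)" "continuous_on (UNIV \<times> {a..b}) (\<lambda>(x,t). v x t)"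
    and bd: "\<And>x t. t \<in> {a..b} \<Longrightarrow> \<bar>v x t\<bar> \<le> B"
    and lip: "\<And>x y t. t \<in> {a..b} \<Longrightarrow> \<bar>v x t - v y t\<bar> \<le> L * norm (x - y)"
    and a: "0 \<le> a" "a < t0" "t0 < b"
    and \<psi>: "C21_test \<psi> \<psi>t D\<psi> D2\<psi>"
    and max: "\<And>x t. t \<in> {a..b} \<Longrightarrow> u x t - v x t - \<psi> x t \<le> u x0 t0 - v x0 t0 - \<psi> x0 t0"
    and \<kappa>: "\<kappa> > 0"
  shows "\<exists>x t p \<theta>. norm (x - x0) < \<kappa> \<and> \<bar>t - t0\<bar> < \<kappa> \<and> norm p \<le> L \<and>
    \<psi>t x t - trace (Amat \<sigma> \<theta> x ** D2\<psi> x t) + G1 \<theta> x (p + D\<psi> x t) - G2 \<theta> x p \<le> \<kappa>"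
proof -
  have L0: "L \<ge> 0" using lip[of t0 "axis undefined 1" 0] a by (auto simp: norm_axis_1)
  have C0: "C \<ge> 0" using \<sigma>_bd norm_ge_zero order_trans by blast
  define z0 where "z0 = (x0, t0)"
  have "continuous_on UNIV (\<lambda>z. D\<psi> (fst z) (snd z))" using \<psi> unfolding C21_test_def case_prod_unfold by blast
  hence "isCont (\<lambda>z. D\<psi> (fst z) (snd z)) z0" by (simp add: continuous_on_eq_continuous_at z0_def)
  then obtain d0 where d0: "d0 > 0" "\<And>z. dist z z0 < d0 \<Longrightarrow> dist (D\<psi> (fst z) (snd z)) (D\<psi> (fst z0) (snd z0)) < 1"
    unfolding continuous_at_eps_delta by (metis zero_less_one)
  define R where "R = L + norm (D\<psi> x0 t0) + 4"
  have R: "R > 0" using L0 norm_ge_zero[of "D\<psi> x0 t0"] unfolding R_def by linarith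
  obtain CR1 where CR1: "CR1 > 0" "\<And>\<theta> x y p q. norm p \<le> R \<Longrightarrow> norm q \<le> R \<Longrightarrow> \<bar>G1 \<theta> x p - G1 \<theta> y q\<bar> \<le> CR1 * (norm (x - y) + norm (p - q))"
    using G1 R unfolding loc_lip_ham_def by metis
  obtain CR2 where CR2: "CR2 > 0" "\<And>\<theta> x y p q. norm p \<le> R \<Longrightarrow> norm q \<le> R \<Longrightarrow> \<bar>G2 \<theta> x p - G2 \<theta> y q\<bar> \<le> CR2 * (norm (x - y) + norm (p - q))"
    using G2 R unfolding loc_lip_ham_def by metis
  \<comment> \<open>\<gamma> weighs both the penalty that makes the maximum strict and the
    remainders of the two expansions; the factor 48 leaves room for all its occurrences in the final
    sum.\<close>
  define \<gamma> where "\<gamma> = min (1/2) (\<kappa> / (48 * (1 + C\<^sup>2 + CR1)))"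
  have den: "1 + C\<^sup>2 + CR1 > 0" using CR1(1) zero_le_power2[of C] by linarith
  have "\<kappa> / (48 * (1 + C\<^sup>2 + CR1)) > 0" using \<kappa> den by (intro divide_pos_pos) auto
  hence \<gamma>: "\<gamma> > 0" "\<gamma> \<le> 1/2" unfolding \<gamma>_def by linarith+
  have "\<gamma> \<le> \<kappa> / (48 * (1 + C\<^sup>2 + CR1))" by (simp add: \<gamma>_def)
  hence "\<gamma> * (48 * (1 + C\<^sup>2 + CR1)) \<le> \<kappa>" using den by (subst (asm) pos_le_divide_eq) auto
  hence \<gamma>sum: "48 * \<gamma> + 48 * (\<gamma> * C\<^sup>2) + 48 * (\<gamma> * CR1) \<le> \<kappa>" by (simp add: algebra_simps)
  have \<gamma>pos: "0 \<le> \<gamma> * C\<^sup>2" "0 \<le> \<gamma> * CR1" using \<gamma> CR1(1) by auto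
  \<comment> \<open>Clamping time to [a, b] extends the functions to the whole space, as the theorem
    on sums requires; near z0 it changes nothing.\<close>
  define cl where "cl = (\<lambda>t. max a (min b t))"
  have cl: "cl t \<in> {a..b}" and cl_id: "t \<in> {a..b} \<Longrightarrow> cl t = t" for t using a by (auto simp: cl_def)
  have ccl: "continuous_on UNIV (\<lambda>z :: (real^'n) \<times> real. (fst z, cl (snd z)))" unfolding cl_def by (intro continuous_intros)
  have rng: "range (\<lambda>z :: (real^'n) \<times> real. (fst z, cl (snd z))) \<subseteq> UNIV \<times> {a..b}" using cl by blast
  define U where "U = (\<lambda>z. u (fst z) (cl (snd z)) - \<psi> (fst z) (cl (snd z)) - \<gamma> * (norm (z - z0))\<^sup>2)"
  define V where "V = (\<lambda>z :: (real^'n) \<times> real. v (fst z) (cl (snd z)))"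
  have cpsi: "continuous_on UNIV (\<lambda>(x,t). \<psi> x t)"
    using \<psi> unfolding C21_test_def by (metis (no_types, lifting) UNIV_I continuous_at_imp_continuous_on has_derivative_continuous surj_pair)
  have contV: "continuous_on UNIV V"
    unfolding V_def using continuous_on_compose2[OF cont(2) ccl rng] by (simp add: case_prod_unfold)
  have contU: "continuous_on UNIV U"
    unfolding U_def using continuous_on_compose2[OF cont(1) ccl rng] continuous_on_compose2[OF cpsi ccl subset_UNIV]
    by (intro continuous_intros) (auto simp: case_prod_unfold)
  define M where "M = u x0 t0 - v x0 t0 - \<psi> x0 t0"
  have UV: "U z - V z \<le> M - \<gamma> * (norm (z - z0))\<^sup>2" for z
    using max[OF cl, of "fst z" "snd z"] unfolding U_def V_def M_def by linarith
  have UV0: "U z0 - V z0 = M" using a by (simp add: U_def V_def M_def z0_def cl_id)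
  have Vb: "V z \<ge> - B" for z using bd[OF cl, of "fst z" "snd z"] unfolding V_def by linarith
  have Vb': "V z \<le> B" for z using bd[OF cl, of "fst z" "snd z"] unfolding V_def by linarith
  have Ub: "U z \<le> (M + B + \<gamma> * (norm z0)\<^sup>2) - (\<gamma> / 2) * (norm z)\<^sup>2" for z
  proof -
    have "(norm z)\<^sup>2 \<le> 2 * (norm (z - z0))\<^sup>2 + 2 * (norm z0)\<^sup>2" using norm_sq_add_le[of "z - z0" z0] by simp
    hence "(\<gamma> / 2) * (norm z)\<^sup>2 \<le> (\<gamma> / 2) * (2 * (norm (z - z0))\<^sup>2 + 2 * (norm z0)\<^sup>2)" using \<gamma> by (intro mult_left_mono) auto
    thus ?thesis using UV[of z] Vb'[of z] by (simp add: algebra_simps)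
  qed
  have UV': "U z - V z \<le> M - (\<gamma> / 2) * (norm (z - z0))\<^sup>2" for z
  proof -
    have "(\<gamma> / 2) * (norm (z - z0))\<^sup>2 \<le> \<gamma> * (norm (z - z0))\<^sup>2" using \<gamma> by (intro mult_right_mono) auto
    thus ?thesis using UV[of z] by linarith
  qed
  have \<gamma>2: "\<gamma> / 2 > 0" using \<gamma> by simp
  define \<rho> where "\<rho> = min (min d0 1) (min \<kappa> (min (t0 - a) (b - t0)))"
  have \<rho>: "\<rho> > 0" using d0 \<kappa> a by (simp add: \<rho>_def)
  obtain e0 where e0: "e0 > 0" "\<And>e z w. 0 < e \<Longrightarrow> e < e0 \<Longrightarrow> U z - V w - (norm (z - w))\<^sup>2 / (6 * e) \<ge> M - e \<Longrightarrow>
      norm (z - z0) < \<rho> \<and> norm (w - z0) < \<rho>"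
    using penalization_small[OF contV Ub \<gamma>2 Vb UV' \<rho>] by blast
  \<comment> \<open>\<open>z - w\<close> equals 3e p up to an error e, and the spatial part of p is
    at most L + 1: the spatial distance is at most e(3(L + 1) + 1).\<close>
  define K where "K = 3 * L + 4"
  define E where "E = 1 + CR1 + CR2 * K + C\<^sup>2 * K\<^sup>2"
  have K0: "K > 0" using L0 by (simp add: K_def)
  have E1: "E > 0" "CR2 * K \<ge> 0" "C\<^sup>2 * K\<^sup>2 \<ge> 0" using CR1(1) CR2(1) K0 by (auto simp: E_def intro!: add_pos_nonneg mult_nonneg_nonneg)
  define e where "e = min (min 1 (e0 / 2)) (\<kappa> / (4 * E))"
  have "\<kappa> / (4 * E) > 0" using \<kappa> E1 by (intro divide_pos_pos) auto
  hence e: "e > 0" "e \<le> 1" "e < e0" using e0(1) unfolding e_def by linarith+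
  have "e \<le> \<kappa> / (4 * E)" by (simp add: e_def)
  hence "e * (4 * E) \<le> \<kappa>" using E1 by (subst (asm) pos_le_divide_eq) auto
  hence eE: "e + e * CR1 + e * (CR2 * K) + e * (C\<^sup>2 * K\<^sup>2) \<le> \<kappa> / 4" by (simp add: E_def algebra_simps)
  obtain z w p q X Y where lX: "linear X" and lY: "linear Y"
    and jU: "\<And>\<eta>. \<eta> > 0 \<Longrightarrow> \<exists>d>0. \<forall>h. norm h < d \<longrightarrow> U (z + h) \<le> U z + p \<bullet> h + (X h \<bullet> h) / 2 + \<eta> * (norm h)\<^sup>2"
    and jV: "\<And>\<eta>. \<eta> > 0 \<Longrightarrow> \<exists>d>0. \<forall>h. norm h < d \<longrightarrow> V (w + h) \<ge> V w + q \<bullet> h + (Y h \<bullet> h) / 2 - \<eta> * (norm h)\<^sup>2"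
    and mat: "\<And>h k. X h \<bullet> h - Y k \<bullet> k \<le> (norm (h - k))\<^sup>2 / e"
    and pq: "norm (p - q) \<le> e" and zw: "norm (z - w - (3 * e) *\<^sub>R p) \<le> e"
    and near: "U z - V w - (norm (z - w))\<^sup>2 / (6 * e) \<ge> U z0 - V z0 - e"
    by (rule theorem_on_sums[OF contU contV Ub \<gamma>2 Vb e(1) e(1), of z0], rule that)
  have zr: "norm (z - z0) < \<rho>" and wr: "norm (w - z0) < \<rho>"
    using e0(2)[OF e(1,3), of z w] near by (auto simp: UV0)
  have zr': "norm (z - z0) < d0" "norm (z - z0) < 1" "norm (z - z0) < \<kappa>" using zr by (auto simp: \<rho>_def)
  have comp: "norm (fst h) \<le> norm h" "\<bar>snd h\<bar> \<le> norm h" for h :: "(real^'n) \<times> real"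
    using norm_fst_le[where x="fst h" and y="snd h"] norm_snd_le[where x="fst h" and y="snd h"] by auto
  have ts: "snd z \<in> {a<..<b}" and ss: "snd w \<in> {a<..<b}"
    using comp(2)[of "z - z0"] comp(2)[of "w - z0"] zr wr by (auto simp: \<rho>_def z0_def)
  \<comment> \<open>The Lipschitz bound of v in x limits the spatial part of q; p inherits it up to
    e.\<close>
  have q_le: "norm (fst q) \<le> L"
  proof -
    obtain d where d: "d > 0" "\<And>h. norm h < d \<Longrightarrow> V (w + h) \<ge> V w + q \<bullet> h + (Y h \<bullet> h) / 2 - 1 * (norm h)\<^sup>2"
      using jV[of 1] by auto
    have "bounded_linear Y" using lY by (simp add: linear_conv_bounded_linear)
    then obtain KY where KY: "\<And>h. norm (Y h) \<le> norm h * KY" using bounded_linear.bounded by blast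
    show ?thesis
    proof (rule slope_le_lipschitz[OF d(1) _ L0, of _ "KY / 2 + 1"])
      fix h :: "real^'n" assume h: "norm h < d"
      have hn: "norm (h, 0::real) = norm h" by (simp add: norm_Pair)
      have "V (w + (h, 0)) \<le> V w + L * norm h"
        using lip[OF cl, of "fst w + h" "snd w" "fst w"] by (simp add: V_def)
      moreover have "V (w + (h, 0)) \<ge> V w + q \<bullet> (h, 0) + (Y (h, 0) \<bullet> (h, 0)) / 2 - 1 * (norm (h, 0::real))\<^sup>2"
        using d(2)[of "(h, 0)"] h hn by simp
      moreover have "- (Y (h, 0) \<bullet> (h, 0)) \<le> KY * (norm h)\<^sup>2"
      proof -
        have "\<bar>Y (h, 0) \<bullet> (h, 0)\<bar> \<le> norm (Y (h, 0)) * norm (h, 0::real)" by (rule Cauchy_Schwarz_ineq2)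
        also have "\<dots> \<le> (norm h * KY) * norm h" using KY[of "(h, 0)"] unfolding hn by (intro mult_right_mono) auto
        finally show ?thesis by (simp add: power2_eq_square mult_ac)
      qed
      moreover have "q \<bullet> (h, 0) = fst q \<bullet> h" by (simp add: inner_prod_def)
      ultimately show "fst q \<bullet> h \<le> L * norm h + (KY / 2 + 1) * (norm h)\<^sup>2" unfolding hn by (simp add: algebra_simps)
    qed
  qed
  have pq1: "norm (fst p - fst q) \<le> e" "\<bar>snd p - snd q\<bar> \<le> e" using comp[of "p - q"] pq by auto
  have p_le: "norm (fst p) \<le> L + 1" using norm_triangle_ineq2[of "fst p" "fst q"] pq1 q_le e by linarith
  have xy: "norm (fst z - fst w) \<le> e * K"
  proof -
    have "norm (fst z - fst w - (3 * e) *\<^sub>R fst p) \<le> e" using comp(1)[of "z - w - (3 * e) *\<^sub>R p"] zw by simp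
    moreover have "norm ((3 * e) *\<^sub>R fst p) \<le> 3 * e * (L + 1)" using p_le e by simp
    ultimately have "norm (fst z - fst w) \<le> e + 3 * e * (L + 1)"
      using norm_triangle_ineq2[of "fst z - fst w" "(3 * e) *\<^sub>R fst p"] by linarith
    thus ?thesis by (simp add: K_def algebra_simps)
  qed
  \<comment> \<open>\<open>quad 0 N z0\<close> undoes the penalty contained in U, while
    \<open>quad 0 N z\<close> and \<open>quad 0 N' w\<close> absorb the remainders \<gamma>|h|^2 of
    the expansions, so that genuine quadratic functions touch.\<close>
  define N where "N = (\<lambda>h :: (real^'n) \<times> real. (2 * \<gamma>) *\<^sub>R h)"
  have lN: "linear N" unfolding N_def by (rule linear_scale_self)
  define N' where "N' = (\<lambda>h :: (real^'n) \<times> real. (2 * - \<gamma>) *\<^sub>R h)"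
  have lN': "linear N'" unfolding N'_def by (rule linear_scale_self)
  note t1 = C21_test_add[OF C21_test_add[OF C21_test_add[OF \<psi> C21_test_quad[OF lX, of p z]] C21_test_quad[OF lN, of 0 z0]] C21_test_quad[OF lN, of 0 z]]
  note t2 = C21_test_add[OF C21_test_quad[OF lY, of q w] C21_test_quad[OF lN', of 0 w]]
  have quadN: "quad 0 N \<zeta> x t = \<gamma> * (norm ((x, t) - \<zeta>))\<^sup>2" "quad 0 N' \<zeta> x t = - (\<gamma> * (norm ((x, t) - \<zeta>))\<^sup>2)" for \<zeta> x t
    unfolding N_def N'_def quad_scale by simp_all
  have nbh: "norm ((y, s) - \<zeta>) < d" if "dist y (fst \<zeta>) < d / 2" "\<bar>s - snd \<zeta>\<bar> < d / 2" for y s d and \<zeta> :: "(real^'n) \<times> real"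
  proof -
    have "norm ((y, s) - \<zeta>) \<le> norm (y - fst \<zeta>) + norm (s - snd \<zeta>)"
      using norm_Pair_le[of "y - fst \<zeta>" "s - snd \<zeta>"] by (metis fst_diff snd_diff fst_conv snd_conv prod.collapse)
    thus ?thesis using that by (simp add: dist_norm)
  qed
  have sp0: "sym_part B 0 = 0" if "linear B" for B :: "(real^'n) \<times> real \<Rightarrow> (real^'n) \<times> real"
    by (rule linear_0[OF sym_part(1)[OF that]])
  have sN: "sym_part N h = (2 * \<gamma>) *\<^sub>R h" for h unfolding N_def by (simp add: sym_part_scale)
  have I1: "\<psi>t (fst z) (snd z) + snd p + 2 * \<gamma> * snd (z - z0)
      - (trace (Amat \<sigma> \<theta> (fst z) ** D2\<psi> (fst z) (snd z)) + trace (Amat \<sigma> \<theta> (fst z) ** xx_block X) + 4 * \<gamma> * (norm (\<sigma> \<theta> (fst z)))\<^sup>2)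
      + G1 \<theta> (fst z) (D\<psi> (fst z) (snd z) + fst p + (2 * \<gamma>) *\<^sub>R fst (z - z0)) \<le> 0" for \<theta>
  proof -
    obtain d where d: "d > 0" "\<And>h. norm h < d \<Longrightarrow> U (z + h) \<le> U z + p \<bullet> h + (X h \<bullet> h) / 2 + \<gamma> * (norm h)\<^sup>2"
      using jU[OF \<gamma>(1)] by blast
    define \<epsilon> where "\<epsilon> = min (d / 2) (min (snd z - a) (b - snd z))"
    have \<epsilon>: "\<epsilon> > 0" using d ts by (simp add: \<epsilon>_def)
    have "u y s - (\<psi> y s + quad p X z y s + quad 0 N z0 y s + quad 0 N z y s)
        \<le> u (fst z) (snd z) - (\<psi> (fst z) (snd z) + quad p X z (fst z) (snd z) + quad 0 N z0 (fst z) (snd z) + quad 0 N z (fst z) (snd z))"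
      if "dist y (fst z) < \<epsilon>" "\<bar>s - snd z\<bar> < \<epsilon>" for y s
    proof -
      have sI: "s \<in> {a..b}" using that(2) unfolding \<epsilon>_def by auto
      have "norm ((y, s) - z) < d" by (rule nbh) (use that in \<open>auto simp: \<epsilon>_def\<close>)
      from d(2)[OF this] have "U (y, s) \<le> U z + p \<bullet> ((y,s) - z) + (X ((y,s) - z) \<bullet> ((y,s) - z)) / 2 + \<gamma> * (norm ((y,s) - z))\<^sup>2" by simp
      thus ?thesis using sI ts linear_0[OF lX] unfolding quadN U_def by (simp add: quad_def cl_id)
    qed
    hence "\<exists>\<epsilon>>0. \<forall>y s. dist y (fst z) < \<epsilon> \<longrightarrow> \<bar>s - snd z\<bar> < \<epsilon> \<longrightarrow> u y s - (\<psi> y s + quad p X z y s + quad 0 N z0 y s + quad 0 N z y s)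
        \<le> u (fst z) (snd z) - (\<psi> (fst z) (snd z) + quad p X z (fst z) (snd z) + quad 0 N z0 (fst z) (snd z) + quad 0 N z (fst z) (snd z))"
      using \<epsilon> by blast
    moreover have "snd z > 0" using ts a by auto
    ultimately have "\<psi>t (fst z) (snd z) + snd (p + sym_part X ((fst z, snd z) - z)) + snd (0 + sym_part N ((fst z, snd z) - z0)) + snd (0 + sym_part N ((fst z, snd z) - z))
      - trace (Amat \<sigma> \<theta> (fst z) ** (D2\<psi> (fst z) (snd z) + xx_block X + xx_block N + xx_block N))
      + G1 \<theta> (fst z) (D\<psi> (fst z) (snd z) + fst (p + sym_part X ((fst z, snd z) - z)) + fst (0 + sym_part N ((fst z, snd z) - z0)) + fst (0 + sym_part N ((fst z, snd z) - z))) \<le> 0"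
      using sub[unfolded par_sub_def, rule_format, OF _ t1] by blast
    moreover have "trace (Amat \<sigma> \<theta> (fst z) ** xx_block N) = 2 * \<gamma> * (norm (\<sigma> \<theta> (fst z)))\<^sup>2"
      unfolding N_def by (rule trace_Amat_xx_block_scale)
    ultimately show ?thesis unfolding trace_Amat_add by (simp add: sp0[OF lX] sN)
  qed
  have \<kappa>8: "\<kappa> / 8 > 0" using \<kappa> by simp
  have "\<exists>\<theta>. snd (q + sym_part Y ((fst w, snd w) - w)) + snd (0 + sym_part N' ((fst w, snd w) - w))
      - trace (Amat \<sigma> \<theta> (fst w) ** (xx_block Y + xx_block N'))
      + G2 \<theta> (fst w) (fst (q + sym_part Y ((fst w, snd w) - w)) + fst (0 + sym_part N' ((fst w, snd w) - w))) > - (\<kappa> / 8)"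
  proof -
    obtain d where d: "d > 0" "\<And>h. norm h < d \<Longrightarrow> V (w + h) \<ge> V w + q \<bullet> h + (Y h \<bullet> h) / 2 - \<gamma> * (norm h)\<^sup>2"
      using jV[OF \<gamma>(1)] by blast
    define \<epsilon> where "\<epsilon> = min (d / 2) (min (snd w - a) (b - snd w))"
    have \<epsilon>: "\<epsilon> > 0" using d ss by (simp add: \<epsilon>_def)
    have "v y s - (quad q Y w y s + quad 0 N' w y s) \<ge> v (fst w) (snd w) - (quad q Y w (fst w) (snd w) + quad 0 N' w (fst w) (snd w))"
      if "dist y (fst w) < \<epsilon>" "\<bar>s - snd w\<bar> < \<epsilon>" for y s
    proof -
      have sI: "s \<in> {a..b}" using that(2) unfolding \<epsilon>_def by auto
      have "norm ((y, s) - w) < d" by (rule nbh) (use that in \<open>auto simp: \<epsilon>_def\<close>)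
      from d(2)[OF this] have "V (y, s) \<ge> V w + q \<bullet> ((y,s) - w) + (Y ((y,s) - w) \<bullet> ((y,s) - w)) / 2 - \<gamma> * (norm ((y,s) - w))\<^sup>2" by simp
      thus ?thesis using sI ss linear_0[OF lY] unfolding quadN V_def by (simp add: quad_def cl_id)
    qed
    hence "\<exists>\<epsilon>>0. \<forall>y s. dist y (fst w) < \<epsilon> \<longrightarrow> \<bar>s - snd w\<bar> < \<epsilon> \<longrightarrow> v y s - (quad q Y w y s + quad 0 N' w y s) \<ge> v (fst w) (snd w) - (quad q Y w (fst w) (snd w) + quad 0 N' w (fst w) (snd w))"
      using \<epsilon> by blast
    moreover have "snd w > 0" using ss a by auto
    ultimately show ?thesis using super[unfolded par_super_def, rule_format, OF _ t2 _ \<kappa>8] by blast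
  qed
  then obtain \<theta> where "snd (q + sym_part Y ((fst w, snd w) - w)) + snd (0 + sym_part N' ((fst w, snd w) - w))
      - trace (Amat \<sigma> \<theta> (fst w) ** (xx_block Y + xx_block N'))
      + G2 \<theta> (fst w) (fst (q + sym_part Y ((fst w, snd w) - w)) + fst (0 + sym_part N' ((fst w, snd w) - w))) > - (\<kappa> / 8)" by blast
  moreover have "trace (Amat \<sigma> \<theta> (fst w) ** xx_block N') = 2 * - \<gamma> * (norm (\<sigma> \<theta> (fst w)))\<^sup>2"
    unfolding N'_def by (rule trace_Amat_xx_block_scale)
  ultimately have I2: "snd q - trace (Amat \<sigma> \<theta> (fst w) ** xx_block Y) + 2 * \<gamma> * (norm (\<sigma> \<theta> (fst w)))\<^sup>2 + G2 \<theta> (fst w) (fst q) > - (\<kappa> / 8)"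
    by (simp add: trace_Amat_add sp0[OF lY] sp0[OF lN'])
  \<comment> \<open>The matrix inequality is tested with the columns of \<sigma> at the two points,
    with time component 0, and summed.\<close>
  have T: "trace (Amat \<sigma> \<theta> (fst z) ** xx_block X) - trace (Amat \<sigma> \<theta> (fst w) ** xx_block Y) \<le> e * (C\<^sup>2 * K\<^sup>2)"
  proof -
    define c where "c = (\<lambda>j. column j (\<sigma> \<theta> (fst z)))"
    define d where "d = (\<lambda>j. column j (\<sigma> \<theta> (fst w)))"
    have "trace (Amat \<sigma> \<theta> (fst z) ** xx_block X) - trace (Amat \<sigma> \<theta> (fst w) ** xx_block Y)
        = (\<Sum>j\<in>UNIV. X (c j, 0) \<bullet> (c j, 0) - Y (d j, 0) \<bullet> (d j, 0))"
      by (simp add: trace_Amat_xx_block[OF lX] trace_Amat_xx_block[OF lY] c_def d_def sum_subtractf)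
    also have "\<dots> \<le> (\<Sum>j\<in>UNIV. (norm (c j - d j))\<^sup>2 / e)"
    proof (rule sum_mono)
      fix j
      show "X (c j, 0) \<bullet> (c j, 0) - Y (d j, 0) \<bullet> (d j, 0) \<le> (norm (c j - d j))\<^sup>2 / e"
        using mat[of "(c j, 0)" "(d j, 0)"] by (simp add: norm_Pair)
    qed
    also have "\<dots> = (\<Sum>j\<in>UNIV. (norm (column j (\<sigma> \<theta> (fst z) - \<sigma> \<theta> (fst w))))\<^sup>2) / e"
    proof -
      have "c j - d j = column j (\<sigma> \<theta> (fst z) - \<sigma> \<theta> (fst w))" for j by (simp add: c_def d_def column_def vec_eq_iff)
      thus ?thesis by (simp add: sum_divide_distrib)
    qed
    also have "\<dots> = (norm (\<sigma> \<theta> (fst z) - \<sigma> \<theta> (fst w)))\<^sup>2 / e" by (simp add: sum_column_norm)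
    also have "\<dots> \<le> (C * (e * K))\<^sup>2 / e"
    proof (intro divide_right_mono power_mono)
      have "norm (\<sigma> \<theta> (fst z) - \<sigma> \<theta> (fst w)) \<le> C * norm (fst z - fst w)" by (rule \<sigma>_lip)
      also have "\<dots> \<le> C * (e * K)" by (rule mult_left_mono[OF xy C0])
      finally show "norm (\<sigma> \<theta> (fst z) - \<sigma> \<theta> (fst w)) \<le> C * (e * K)" .
    qed (use e in auto)
    also have "\<dots> = e * (C\<^sup>2 * K\<^sup>2)" using e by (simp add: power2_eq_square field_simps)
    finally show ?thesis .
  qed
  let ?D = "D\<psi> (fst z) (snd z)"
  have Dn: "norm ?D \<le> norm (D\<psi> x0 t0) + 1"
  proof -
    have "dist ?D (D\<psi> x0 t0) < 1" using d0(2)[of z] zr'(1) by (simp add: dist_norm z0_def)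
    thus ?thesis using norm_triangle_ineq2[of ?D "D\<psi> x0 t0"] by (simp add: dist_norm)
  qed
  have n1: "norm ((2 * \<gamma>) *\<^sub>R fst (z - z0)) \<le> 2 * \<gamma>"
    using comp(1)[of "z - z0"] zr'(2) \<gamma> by (simp add: mult_left_le)
  have H1: "G1 \<theta> (fst z) (fst q + ?D) - G1 \<theta> (fst z) (?D + fst p + (2 * \<gamma>) *\<^sub>R fst (z - z0)) \<le> CR1 * (e + 2 * \<gamma>)"
  proof -
    have "norm (fst q + ?D) \<le> R" using norm_triangle_ineq[of "fst q" ?D] q_le Dn by (simp add: R_def)
    moreover have "norm (?D + fst p + (2 * \<gamma>) *\<^sub>R fst (z - z0)) \<le> R"
      using norm_triangle_ineq[of "?D + fst p" "(2 * \<gamma>) *\<^sub>R fst (z - z0)"] norm_triangle_ineq[of ?D "fst p"] p_le Dn n1 \<gamma> unfolding R_def by linarith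
    ultimately have "\<bar>G1 \<theta> (fst z) (fst q + ?D) - G1 \<theta> (fst z) (?D + fst p + (2 * \<gamma>) *\<^sub>R fst (z - z0))\<bar>
       \<le> CR1 * (norm (fst z - fst z) + norm (fst q + ?D - (?D + fst p + (2 * \<gamma>) *\<^sub>R fst (z - z0))))" by (rule CR1(2))
    also have "fst q + ?D - (?D + fst p + (2 * \<gamma>) *\<^sub>R fst (z - z0)) = (fst q - fst p) - (2 * \<gamma>) *\<^sub>R fst (z - z0)" by simp
    also have "CR1 * (norm (fst z - fst z) + norm ((fst q - fst p) - (2 * \<gamma>) *\<^sub>R fst (z - z0))) \<le> CR1 * (e + 2 * \<gamma>)"
      using norm_triangle_ineq4[of "fst q - fst p" "(2 * \<gamma>) *\<^sub>R fst (z - z0)"] pq1(1) n1 CR1(1)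
      by (intro mult_left_mono) (auto simp: norm_minus_commute)
    finally show ?thesis by linarith
  qed
  have H2: "G2 \<theta> (fst w) (fst q) - G2 \<theta> (fst z) (fst q) \<le> e * (CR2 * K)"
  proof -
    have "norm (fst q) \<le> R" using q_le norm_ge_zero[of "D\<psi> x0 t0"] unfolding R_def by linarith
    hence "\<bar>G2 \<theta> (fst w) (fst q) - G2 \<theta> (fst z) (fst q)\<bar> \<le> CR2 * (norm (fst w - fst z) + norm (fst q - fst q))" by (intro CR2(2))
    also have "\<dots> \<le> CR2 * (e * K)" using xy CR2(1) by (simp add: norm_minus_commute)
    finally show ?thesis by (simp add: mult_ac)
  qed
  have S: "\<gamma> * (norm (\<sigma> \<theta> x))\<^sup>2 \<le> \<gamma> * C\<^sup>2" for x using \<sigma>_bd[of \<theta> x] \<gamma> by (intro mult_left_mono power_mono) auto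
  have s1: "- (2 * \<gamma> * snd (z - z0)) \<le> 2 * \<gamma>"
  proof -
    have "\<bar>snd (z - z0)\<bar> \<le> 1" using comp(2)[of "z - z0"] zr'(2) by linarith
    hence "2 * \<gamma> * (- snd (z - z0)) \<le> 2 * \<gamma> * 1" using \<gamma> by (intro mult_left_mono) (auto simp: abs_le_iff)
    thus ?thesis by (simp only: mult_minus_right mult_1_right)
  qed
  have "\<psi>t (fst z) (snd z) - trace (Amat \<sigma> \<theta> (fst z) ** D2\<psi> (fst z) (snd z)) + G1 \<theta> (fst z) (fst q + ?D) - G2 \<theta> (fst z) (fst q) \<le> \<kappa>"
  proof -
    have "4 * \<gamma> * (norm (\<sigma> \<theta> (fst z)))\<^sup>2 \<le> 4 * (\<gamma> * C\<^sup>2)" "2 * \<gamma> * (norm (\<sigma> \<theta> (fst w)))\<^sup>2 \<le> 2 * (\<gamma> * C\<^sup>2)"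
      using S[of "fst z"] S[of "fst w"] by linarith+
    moreover have "CR1 * (e + 2 * \<gamma>) = e * CR1 + 2 * (\<gamma> * CR1)" by (simp add: algebra_simps)
    moreover have "snd q - snd p \<le> e" using pq1(2) by (simp add: abs_le_iff)
    ultimately show ?thesis
      using I1[of \<theta>] I2 T H1 H2 s1 eE \<gamma>sum \<gamma>pos \<kappa> \<gamma>(1) by linarith
  qed
  moreover have "norm (fst z - x0) < \<kappa>" "\<bar>snd z - t0\<bar> < \<kappa>" using comp[of "z - z0"] zr'(3) by (auto simp: z0_def)
  ultimately show ?thesis using q_le by blast
qed

section \<open>Periodicity, translation and scaling of solutions, time penalties\<close>

lemma lattice_reduce:
  fixes x :: "real^'n"
  obtains k where "int_vec k" "norm (x + k) \<le> real CARD('n)"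
proof -
  define k :: "real^'n" where "k = (\<chi> i. - of_int \<lfloor>x $ i\<rfloor>)"
  have k: "int_vec k" by (simp add: int_vec_def k_def)
  have b: "0 \<le> (x + k) $ i \<and> (x + k) $ i \<le> 1" for i
    by (simp add: k_def) linarith
  have "norm (x + k) \<le> (\<Sum>i\<in>UNIV. \<bar>(x + k) $ i\<bar>)" by (rule norm_le_l1_cart)
  also have "\<dots> \<le> (\<Sum>i\<in>(UNIV::'n set). 1)" by (rule sum_mono) (use b in auto)
  finally show thesis using that[OF k] by simp
qed

lemma periodic_fun_bounded:
  fixes f :: "real^'n \<Rightarrow> real \<Rightarrow> real"
  assumes cont: "continuous_on (UNIV \<times> {a..b}) (\<lambda>(x,t). f x t)" and per: "\<And>t. periodic_fun (\<lambda>x. f x t)"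
  shows "\<exists>B. \<forall>x. \<forall>t\<in>{a..b}. \<bar>f x t\<bar> \<le> B"
proof -
  let ?S = "cball (0::real^'n) (real CARD('n)) \<times> {a..b}"
  have "compact ((\<lambda>(x,t). f x t) ` ?S)"
    by (intro compact_continuous_image continuous_on_subset[OF cont] compact_Times) auto
  hence "bounded ((\<lambda>(x,t). f x t) ` ?S)" by (rule compact_imp_bounded)
  then obtain B where B: "\<forall>y\<in>(\<lambda>(x,t). f x t) ` ?S. norm y \<le> B" unfolding bounded_iff by blast
  have "\<bar>f x t\<bar> \<le> B" if "t \<in> {a..b}" for x t
  proof -
    obtain k where k: "int_vec k" "norm (x + k) \<le> real CARD('n)" by (rule lattice_reduce[of x])
    have "f x t = f (x + k) t" using per[of t] k(1) unfolding periodic_fun_def by simp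
    moreover have "(x + k, t) \<in> ?S" using k that by simp
    hence "norm ((\<lambda>(x,t). f x t) (x + k, t)) \<le> B" using B by (intro bspec[OF B] imageI)
    ultimately show ?thesis by simp
  qed
  thus ?thesis by blast
qed

lemma periodic_attains_max:
  fixes f :: "real^'n \<Rightarrow> real \<Rightarrow> real"
  assumes cont: "continuous_on (UNIV \<times> {a..b}) (\<lambda>(x,t). f x t)" and per: "\<And>t. periodic_fun (\<lambda>x. f x t)" and ab: "a \<le> b"
  shows "\<exists>x0. \<exists>t0\<in>{a..b}. \<forall>x. \<forall>t\<in>{a..b}. f x t \<le> f x0 t0"
proof -
  let ?S = "cball (0::real^'n) (real CARD('n)) \<times> {a..b}"
  have "\<exists>z\<in>?S. \<forall>y\<in>?S. (\<lambda>(x,t). f x t) y \<le> (\<lambda>(x,t). f x t) z"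
    by (rule continuous_attains_sup) (use ab in \<open>auto intro!: continuous_on_subset[OF cont] compact_Times\<close>)
  then obtain z where z': "z \<in> ?S" "\<And>y. y \<in> ?S \<Longrightarrow> (\<lambda>(x,t). f x t) y \<le> (\<lambda>(x,t). f x t) z" by blast
  obtain x0 t0 where z0: "z = (x0, t0)" by (cases z)
  have z: "t0 \<in> {a..b}" "f y t \<le> f x0 t0" if "norm y \<le> real CARD('n)" "t \<in> {a..b}" for y t
    using z'(1) z'(2)[of "(y, t)"] that by (auto simp: z0)
  have t0: "t0 \<in> {a..b}" using z'(1) by (auto simp: z0)
  have "f x t \<le> f x0 t0" if "t \<in> {a..b}" for x t
  proof -
    obtain k where k: "int_vec k" "norm (x + k) \<le> real CARD('n)" by (rule lattice_reduce[of x])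
    have "f x t = f (x + k) t" using per[of t] k(1) unfolding periodic_fun_def by simp
    thus ?thesis using z(2)[OF k(2) that] by simp
  qed
  thus ?thesis using t0 by blast
qed

lemma par_sub_translate:
  assumes u: "par_sub \<sigma> G u" and r: "r \<ge> 0"
  shows "par_sub \<sigma> G (\<lambda>x t. u x (t + r))"
  unfolding par_sub_def
proof (intro allI impI)
  fix x0 t0 \<phi> \<phi>t D\<phi> D2\<phi> \<theta>
  assume t0: "t0 > 0" and \<phi>: "C21_test \<phi> \<phi>t D\<phi> D2\<phi>"
    and "\<exists>\<epsilon>>0. \<forall>y s. dist y x0 < \<epsilon> \<longrightarrow> \<bar>s - t0\<bar> < \<epsilon> \<longrightarrow> u y (s + r) - \<phi> y s \<le> u x0 (t0 + r) - \<phi> x0 t0"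
  then obtain \<epsilon> where \<epsilon>: "\<epsilon> > 0" "\<And>y s. dist y x0 < \<epsilon> \<Longrightarrow> \<bar>s - t0\<bar> < \<epsilon> \<Longrightarrow> u y (s + r) - \<phi> y s \<le> u x0 (t0 + r) - \<phi> x0 t0" by blast
  have C: "C21_test (\<lambda>x t. 1 * \<phi> x (t + - r) + 0 * t) (\<lambda>x t. 1 * \<phi>t x (t + - r) + 0) (\<lambda>x t. 1 *\<^sub>R D\<phi> x (t + - r)) (\<lambda>x t. 1 *\<^sub>R D2\<phi> x (t + - r))"
    by (rule C21_test_affine[OF \<phi>])
  have "\<exists>\<epsilon>>0. \<forall>y s. dist y x0 < \<epsilon> \<longrightarrow> \<bar>s - (t0 + r)\<bar> < \<epsilon> \<longrightarrow> u y s - (1 * \<phi> y (s + - r) + 0 * s) \<le> u x0 (t0 + r) - (1 * \<phi> x0 (t0 + r + - r) + 0 * (t0 + r))"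
  proof (intro exI[of _ \<epsilon>] conjI \<epsilon>(1) allI impI)
    fix y s assume "dist y x0 < \<epsilon>" "\<bar>s - (t0 + r)\<bar> < \<epsilon>"
    thus "u y s - (1 * \<phi> y (s + - r) + 0 * s) \<le> u x0 (t0 + r) - (1 * \<phi> x0 (t0 + r + - r) + 0 * (t0 + r))"
      using \<epsilon>(2)[of y "s - r"] by (simp add: algebra_simps)
  qed
  from u[unfolded par_sub_def, rule_format, OF _ C this] t0 r
  show "\<phi>t x0 t0 - trace (Amat \<sigma> \<theta> x0 ** D2\<phi> x0 t0) + G \<theta> x0 (D\<phi> x0 t0) \<le> 0" by simp
qed

text \<open>The transformed function \<open>\<mu> v(\<cdot>, \<cdot> + r)\<close> of the Barles--Souganidis argument.\<close>

lemma par_super_affine: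
  assumes v: "par_super \<sigma> G v" and r: "r \<ge> 0" and \<mu>: "\<mu> > 0"
  shows "par_super \<sigma> (\<lambda>\<theta> x p. \<mu> * G \<theta> x ((1/\<mu>) *\<^sub>R p)) (\<lambda>x t. \<mu> * v x (t + r))"
  unfolding par_super_def
proof (intro allI impI)
  fix x0 t0 \<phi> \<phi>t D\<phi> D2\<phi> and \<kappa> :: real
  assume t0: "t0 > 0" and \<phi>: "C21_test \<phi> \<phi>t D\<phi> D2\<phi>" and \<kappa>: "\<kappa> > 0"
    and "\<exists>\<epsilon>>0. \<forall>y s. dist y x0 < \<epsilon> \<longrightarrow> \<bar>s - t0\<bar> < \<epsilon> \<longrightarrow> \<mu> * v y (s + r) - \<phi> y s \<ge> \<mu> * v x0 (t0 + r) - \<phi> x0 t0"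
  then obtain \<epsilon> where \<epsilon>: "\<epsilon> > 0" "\<And>y s. dist y x0 < \<epsilon> \<Longrightarrow> \<bar>s - t0\<bar> < \<epsilon> \<Longrightarrow> \<mu> * v y (s + r) - \<phi> y s \<ge> \<mu> * v x0 (t0 + r) - \<phi> x0 t0" by blast
  let ?m = "1/\<mu>"
  have C: "C21_test (\<lambda>x t. ?m * \<phi> x (t + - r) + 0 * t) (\<lambda>x t. ?m * \<phi>t x (t + - r) + 0) (\<lambda>x t. ?m *\<^sub>R D\<phi> x (t + - r)) (\<lambda>x t. ?m *\<^sub>R D2\<phi> x (t + - r))"
    by (rule C21_test_affine[OF \<phi>])
  have ex: "\<exists>\<epsilon>>0. \<forall>y s. dist y x0 < \<epsilon> \<longrightarrow> \<bar>s - (t0 + r)\<bar> < \<epsilon> \<longrightarrow> v y s - (?m * \<phi> y (s + - r) + 0 * s) \<ge> v x0 (t0 + r) - (?m * \<phi> x0 (t0 + r + - r) + 0 * (t0 + r))"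
  proof (intro exI[of _ \<epsilon>] conjI \<epsilon>(1) allI impI)
    fix y s assume "dist y x0 < \<epsilon>" "\<bar>s - (t0 + r)\<bar> < \<epsilon>"
    hence "\<mu> * v y s - \<phi> y (s - r) \<ge> \<mu> * v x0 (t0 + r) - \<phi> x0 t0" using \<epsilon>(2)[of y "s - r"] by (simp add: algebra_simps)
    hence "?m * (\<mu> * v y s - \<phi> y (s - r)) \<ge> ?m * (\<mu> * v x0 (t0 + r) - \<phi> x0 t0)" using \<mu> by (intro mult_left_mono) auto
    thus "v y s - (?m * \<phi> y (s + - r) + 0 * s) \<ge> v x0 (t0 + r) - (?m * \<phi> x0 (t0 + r + - r) + 0 * (t0 + r))"
      using \<mu> by (simp add: diff_divide_distrib)
  qed
  have "\<kappa> / \<mu> > 0" using \<kappa> \<mu> by simp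
  from v[unfolded par_super_def, rule_format, OF _ C ex this] t0 r obtain \<theta> where
    "?m * \<phi>t x0 t0 - trace (Amat \<sigma> \<theta> x0 ** (?m *\<^sub>R D2\<phi> x0 t0)) + G \<theta> x0 (?m *\<^sub>R D\<phi> x0 t0) > - (\<kappa> / \<mu>)" by auto
  moreover have "trace (Amat \<sigma> \<theta> x0 ** (?m *\<^sub>R D2\<phi> x0 t0)) = ?m * trace (Amat \<sigma> \<theta> x0 ** D2\<phi> x0 t0)"
    by (simp add: trace_Amat scaleR_matrix_vector_assoc[symmetric] sum_distrib_left)
  ultimately have "\<mu> * (?m * \<phi>t x0 t0 - ?m * trace (Amat \<sigma> \<theta> x0 ** D2\<phi> x0 t0) + G \<theta> x0 (?m *\<^sub>R D\<phi> x0 t0)) > \<mu> * (- (\<kappa> / \<mu>))"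
    using \<mu> by (intro mult_strict_left_mono) auto
  hence "\<phi>t x0 t0 - trace (Amat \<sigma> \<theta> x0 ** D2\<phi> x0 t0) + \<mu> * G \<theta> x0 (?m *\<^sub>R D\<phi> x0 t0) > - \<kappa>"
    using \<mu> by (simp add: distrib_left right_diff_distrib)
  thus "\<exists>\<theta>. \<phi>t x0 t0 - trace (Amat \<sigma> \<theta> x0 ** D2\<phi> x0 t0) + \<mu> * G \<theta> x0 ((1/\<mu>) *\<^sub>R D\<phi> x0 t0) > - \<kappa>" by blast
qed

lemma loc_lip_ham_scale:
  assumes G: "loc_lip_ham G" and \<mu>: "\<mu> > 0"
  shows "loc_lip_ham (\<lambda>\<theta> x p. \<mu> * G \<theta> x ((1/\<mu>) *\<^sub>R p))"
  unfolding loc_lip_ham_def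
proof (intro allI impI)
  fix R :: real assume R: "R > 0"
  have "R / \<mu> > 0" using R \<mu> by simp
  with G obtain CR where CR: "CR > 0" "\<And>\<theta> x y p q. norm p \<le> R / \<mu> \<Longrightarrow> norm q \<le> R / \<mu> \<Longrightarrow> \<bar>G \<theta> x p - G \<theta> y q\<bar> \<le> CR * (norm (x - y) + norm (p - q))"
    unfolding loc_lip_ham_def by metis
  show "\<exists>CR>0. \<forall>\<theta> x y p q. norm p \<le> R \<longrightarrow> norm q \<le> R \<longrightarrow>
      \<bar>\<mu> * G \<theta> x ((1/\<mu>) *\<^sub>R p) - \<mu> * G \<theta> y ((1/\<mu>) *\<^sub>R q)\<bar> \<le> CR * (norm (x - y) + norm (p - q))"
  proof (intro exI[of _ "(\<mu> + 1) * CR"] conjI allI impI)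
    fix \<theta> x y and p q :: "real^'b"
    assume "norm p \<le> R" "norm q \<le> R"
    hence "norm ((1/\<mu>) *\<^sub>R p) \<le> R / \<mu>" "norm ((1/\<mu>) *\<^sub>R q) \<le> R / \<mu>" using \<mu> by (simp_all add: divide_right_mono)
    from CR(2)[OF this] have "\<bar>G \<theta> x ((1/\<mu>) *\<^sub>R p) - G \<theta> y ((1/\<mu>) *\<^sub>R q)\<bar> \<le> CR * (norm (x - y) + norm ((1/\<mu>) *\<^sub>R (p - q)))"
      by (simp only: scaleR_right_diff_distrib)
    also have "norm ((1/\<mu>) *\<^sub>R (p - q)) = norm (p - q) / \<mu>" using \<mu> by simp
    finally have "\<mu> * \<bar>G \<theta> x ((1/\<mu>) *\<^sub>R p) - G \<theta> y ((1/\<mu>) *\<^sub>R q)\<bar> \<le> \<mu> * (CR * (norm (x - y) + norm (p - q) / \<mu>))"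
      using \<mu> by (intro mult_left_mono) auto
    also have "\<dots> = \<mu> * CR * norm (x - y) + CR * norm (p - q)" using \<mu> by (simp add: algebra_simps)
    also have "\<dots> \<le> (\<mu> + 1) * CR * norm (x - y) + (\<mu> + 1) * CR * norm (p - q)"
      using \<mu> CR(1) by (intro add_mono mult_right_mono) (auto simp: algebra_simps)
    also have "\<dots> = (\<mu> + 1) * CR * (norm (x - y) + norm (p - q))" by (simp add: distrib_left)
    finally show "\<bar>\<mu> * G \<theta> x ((1/\<mu>) *\<^sub>R p) - \<mu> * G \<theta> y ((1/\<mu>) *\<^sub>R q)\<bar> \<le> (\<mu> + 1) * CR * (norm (x - y) + norm (p - q))"
      using \<mu> by (simp add: right_diff_distrib[symmetric] abs_mult)
  qed (use CR \<mu> in auto)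
qed

lemma C21_test_time:
  assumes g: "\<And>t. (g has_real_derivative g' t) (at t)" and g': "continuous_on UNIV g'"
  shows "C21_test (\<lambda>x t. g t) (\<lambda>x t. g' t) (\<lambda>x t. 0) (\<lambda>x t. 0)"
  unfolding C21_test_def
proof (intro conjI allI)
  fix x :: "real^'n" and t :: real
  have "((\<lambda>z. g (snd z)) has_derivative (\<lambda>z. g' t * snd z)) (at (x, t))"
    using has_derivative_compose[OF has_derivative_snd[OF has_derivative_ident], of g "(*) (g' t)" "(x, t)" UNIV] g[of t]
    by (simp add: has_field_derivative_def)
  thus "((\<lambda>(y, s). g s) has_derivative (\<lambda>(h, k). 0 \<bullet> h + g' t * k)) (at (x, t))"
    by (simp add: case_prod_unfold)
  show "continuous_on UNIV (\<lambda>(x :: real^'n, t). g' t)"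
    unfolding case_prod_unfold by (rule continuous_on_compose2[OF g']) (auto intro!: continuous_intros)
  have "(\<lambda>h. (0 :: real^'n^'n) *v h) = (\<lambda>h. 0)" by (rule ext) simp
  thus "((\<lambda>y. 0) has_derivative (\<lambda>h. (0 :: real^'n^'n) *v h)) (at x)" by simp
qed (auto simp: case_prod_unfold)

text \<open>The penalty \<gamma> exp(\<Lambda>(t - t1)) costs only \<gamma> at t1 but exceeds a
  prescribed B at the end b: it keeps maxima away from the terminal time, so that they can be
  touched from above in an open time interval.\<close>

lemma exp_penalty:
  assumes "\<gamma> > (0::real)" "t1 < b"
  obtains \<Lambda> where "\<Lambda> > 0" "\<gamma> * exp (\<Lambda> * (b - t1)) > B"
proof -
  define \<Lambda> where "\<Lambda> = (\<bar>B\<bar> / \<gamma> + 1) / (b - t1)"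
  have "\<Lambda> > 0" using assms by (simp add: \<Lambda>_def add_nonneg_pos)
  moreover have "\<gamma> * exp (\<Lambda> * (b - t1)) > B"
  proof -
    have "\<Lambda> * (b - t1) = \<bar>B\<bar> / \<gamma> + 1" using assms by (simp add: \<Lambda>_def)
    hence "exp (\<Lambda> * (b - t1)) = exp (\<bar>B\<bar> / \<gamma> + 1)" by simp
    hence "exp (\<Lambda> * (b - t1)) > \<bar>B\<bar> / \<gamma>" using exp_ge_add_one_self[of "\<bar>B\<bar> / \<gamma> + 1"] by linarith
    hence "\<gamma> * exp (\<Lambda> * (b - t1)) > \<gamma> * (\<bar>B\<bar> / \<gamma>)" using assms by (intro mult_strict_left_mono) auto
    thus ?thesis using assms by simp
  qed
  ultimately show thesis by (rule that)
qed

lemma C21_test_exp_time: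
  "C21_test (\<lambda>x t. \<gamma> * exp (\<Lambda> * (t - t1))) (\<lambda>x t. \<gamma> * \<Lambda> * exp (\<Lambda> * (t - t1))) (\<lambda>x t. 0) (\<lambda>x t. 0)"
proof (rule C21_test_time)
  fix t :: real
  show "((\<lambda>t. \<gamma> * exp (\<Lambda> * (t - t1))) has_real_derivative \<gamma> * \<Lambda> * exp (\<Lambda> * (t - t1))) (at t)"
    by (auto intro!: derivative_eq_intros)
qed (intro continuous_intros)

section \<open>Comparison and the strong maximum principle\<close>

text \<open>Two Hamiltonians are carried along because v will be a rescaled translate \<mu> w(., . +
  r), a supersolution for \<mu> G(x, p/\<mu>). Through \<open>G21\<close> the Hamiltonian terms of u
  and v, taken at the same slope, can be subtracted with a sign.\<close>

locale visc_pair =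
  fixes \<sigma> :: "'th \<Rightarrow> real^'n \<Rightarrow> real^'n^'n" and G1 G2 :: "'th \<Rightarrow> real^'n \<Rightarrow> real^'n \<Rightarrow> real"
    and u v :: "real^'n \<Rightarrow> real \<Rightarrow> real" and C L :: real
  assumes \<sigma>_bd: "\<And>\<theta> x. norm (\<sigma> \<theta> x) \<le> C"
    and \<sigma>_lip: "\<And>\<theta> x y. norm (\<sigma> \<theta> x - \<sigma> \<theta> y) \<le> C * norm (x - y)"
    and G1: "loc_lip_ham G1" and G2: "loc_lip_ham G2" and G21: "\<And>\<theta> x p. G2 \<theta> x p \<le> G1 \<theta> x p"
    and sub: "par_sub \<sigma> G1 u" and super: "par_super \<sigma> G2 v"
    and cont: "continuous_on (UNIV \<times> {0..}) (\<lambda>(x,t). u x t)" "continuous_on (UNIV \<times> {0..}) (\<lambda>(x,t). v x t)"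
    and per: "\<And>t. periodic_fun (\<lambda>x. u x t)" "\<And>t. periodic_fun (\<lambda>x. v x t)"
    and lip: "\<And>x y t. t \<ge> 0 \<Longrightarrow> \<bar>u x t - u y t\<bar> \<le> L * norm (x - y)" "\<And>x y t. t \<ge> 0 \<Longrightarrow> \<bar>v x t - v y t\<bar> \<le> L * norm (x - y)"
begin

lemma L0: "L \<ge> 0"
  using lip(1)[of 0 "axis undefined 1" 0] by (auto simp: norm_axis_1)

lemma cont_sub: "0 \<le> a \<Longrightarrow> continuous_on (UNIV \<times> {a..b}) (\<lambda>(x,t). u x t)" "0 \<le> a \<Longrightarrow> continuous_on (UNIV \<times> {a..b}) (\<lambda>(x,t). v x t)"
  by (auto intro: continuous_on_subset[OF cont(1)] continuous_on_subset[OF cont(2)])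

lemma cont_diff: "0 \<le> a \<Longrightarrow> continuous_on (UNIV \<times> {a..b}) (\<lambda>(x,t). u x t - v x t)"
  using continuous_on_diff[OF cont_sub(1)[of a b] cont_sub(2)[of a b]] by (simp add: case_prod_unfold)

lemma per_diff: "periodic_fun (\<lambda>x. u x t - v x t)"
  using per unfolding periodic_fun_def by simp

lemma touching:
  assumes a: "0 \<le> a" "a < t0" "t0 < b"
    and \<psi>: "C21_test \<psi> \<psi>t D\<psi> D2\<psi>"
    and max: "\<And>x t. t \<in> {a..b} \<Longrightarrow> u x t - v x t - \<psi> x t \<le> u x0 t0 - v x0 t0 - \<psi> x0 t0"
    and \<kappa>: "\<kappa> > 0"
  shows "\<exists>x t p \<theta>. norm (x - x0) < \<kappa> \<and> \<bar>t - t0\<bar> < \<kappa> \<and> norm p \<le> L \<and>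
    \<psi>t x t - trace (Amat \<sigma> \<theta> x ** D2\<psi> x t) + G1 \<theta> x (p + D\<psi> x t) - G2 \<theta> x p \<le> \<kappa>"
proof -
  obtain B where B: "\<And>x t. t \<in> {a..b} \<Longrightarrow> \<bar>v x t\<bar> \<le> B"
    using periodic_fun_bounded[OF cont_sub(2)[OF a(1)] per(2), of b] by blast
  have l: "\<bar>v x t - v y t\<bar> \<le> L * norm (x - y)" if "t \<in> {a..b}" for x y t using lip(2)[of t x y] that a by simp
  show ?thesis
    by (rule visc_difference[OF \<sigma>_bd \<sigma>_lip G1 G2 sub super cont_sub(1)[OF a(1)] cont_sub(2)[OF a(1)] B l a \<psi> max \<kappa>])
qed

text \<open>A penalty increasing in time and independent of x is added. At the penalised maximum
  \<open>touching\<close> leaves the time derivative of the penalty at most \<kappa>, since G1 \<ge>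
  G2, whereas this derivative is bounded below by c1.\<close>

theorem comparison:
  assumes s: "0 \<le> s" "s \<le> t" and init: "\<And>x. u x s - v x s \<le> m"
  shows "u x t - v x t \<le> m"
proof (rule ccontr)
  assume "\<not> u x t - v x t \<le> m"
  hence gt: "u x t - v x t > m" by simp
  hence st: "s < t" using init[of x] s by (cases "s = t") auto
  define g where "g = (u x t - v x t - m) / 2"
  have g: "g > 0" using gt by (simp add: g_def)
  define b where "b = t + 1"
  obtain B where B: "\<And>y r. r \<in> {s..b} \<Longrightarrow> \<bar>u y r - v y r\<bar> \<le> B"
    using periodic_fun_bounded[OF cont_diff[OF s(1)] per_diff, of b] by blast
  have tb: "t < b" by (simp add: b_def)
  obtain \<Lambda> where \<Lambda>: "\<Lambda> > 0" "g * exp (\<Lambda> * (b - t)) > B - m"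
    by (rule exp_penalty[OF g tb])
  define \<psi> where "\<psi> = (\<lambda>(x::real^'n) r. g * exp (\<Lambda> * (r - t)))"
  have \<psi>: "C21_test \<psi> (\<lambda>x r. g * \<Lambda> * exp (\<Lambda> * (r - t))) (\<lambda>x r. 0) (\<lambda>x r. 0)"
    unfolding \<psi>_def by (rule C21_test_exp_time)
  have "\<exists>x0. \<exists>t0\<in>{s..b}. \<forall>x. \<forall>t\<in>{s..b}. u x t - v x t - \<psi> x t \<le> u x0 t0 - v x0 t0 - \<psi> x0 t0"
  proof (rule periodic_attains_max)
    have "continuous_on (UNIV \<times> {s..b}) (\<lambda>z :: (real^'n) \<times> real. g * exp (\<Lambda> * (snd z - t)))" by (intro continuous_intros)
    from continuous_on_diff[OF cont_diff[OF s(1)] this]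
    show "continuous_on (UNIV \<times> {s..b}) (\<lambda>(x,t). u x t - v x t - \<psi> x t)" by (simp add: case_prod_unfold \<psi>_def)
    show "periodic_fun (\<lambda>x. u x r - v x r - \<psi> x r)" for r using per_diff[of r] by (simp add: periodic_fun_def \<psi>_def)
    show "s \<le> b" using st tb by simp
  qed
  then obtain x0 t0 where m0: "t0 \<in> {s..b}" "\<And>x r. r \<in> {s..b} \<Longrightarrow> u x r - v x r - \<psi> x r \<le> u x0 t0 - v x0 t0 - \<psi> x0 t0" by blast
  have big: "u x0 t0 - v x0 t0 - \<psi> x0 t0 > m"
    using m0(2)[of t x] st tb g by (simp add: \<psi>_def g_def field_simps)
  have "\<psi> x0 t0 > 0" using g by (simp add: \<psi>_def)
  hence "t0 \<noteq> s" using big init[of x0] by auto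
  moreover have "t0 \<noteq> b" using big B[OF m0(1), of x0] \<Lambda>(2) by (auto simp: \<psi>_def)
  ultimately have t0: "s < t0" "t0 < b" using m0(1) by auto
  \<comment> \<open>The point supplied by \<open>touching\<close> may lie up to \<kappa> \<le> 1
    before t0, so the lower bound is taken at time s - 1.\<close>
  define c1 where "c1 = g * \<Lambda> * exp (\<Lambda> * (s - 1 - t))"
  have c1: "c1 > 0" using g \<Lambda> by (simp add: c1_def)
  define \<kappa> where "\<kappa> = min 1 (c1 / 2)"
  have \<kappa>: "\<kappa> > 0" "\<kappa> \<le> 1" "\<kappa> < c1" using c1 by (auto simp: \<kappa>_def)
  obtain x' t' p \<theta> where "\<bar>t' - t0\<bar> < \<kappa>"
    "g * \<Lambda> * exp (\<Lambda> * (t' - t)) - trace (Amat \<sigma> \<theta> x' ** 0) + G1 \<theta> x' (p + 0) - G2 \<theta> x' p \<le> \<kappa>"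
    using touching[OF s(1) t0 \<psi> m0(2) \<kappa>(1)] by blast
  moreover have "trace (Amat \<sigma> \<theta> x' ** 0) = 0" by (simp add: trace_def)
  ultimately have le: "g * \<Lambda> * exp (\<Lambda> * (t' - t)) \<le> \<kappa>" and t': "t' \<ge> s - 1" using G21[of \<theta> x' p] t0 \<kappa> by auto
  have "\<Lambda> * (s - 1 - t) \<le> \<Lambda> * (t' - t)" using t' \<Lambda> by (intro mult_left_mono) auto
  hence "c1 \<le> g * \<Lambda> * exp (\<Lambda> * (t' - t))" unfolding c1_def using g \<Lambda> by (intro mult_left_mono) auto
  thus False using le \<kappa> by linarith
qed

end

section \<open>The Gaussian barrier\<close>

definition rank_one :: "real^'n \<Rightarrow> real^'n^'n" where
  "rank_one y = (\<chi> i j. y $ i * y $ j)"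

lemma rank_one_mult: "rank_one y *v h = (y \<bullet> h) *\<^sub>R y"
  by (simp add: vec_eq_iff rank_one_def matrix_vector_mult_def inner_vec_def sum_distrib_left sum_distrib_right mult_ac)

lemma trace_Amat_rank_one: "trace (Amat \<sigma> \<theta> x ** rank_one y) = y \<bullet> (Amat \<sigma> \<theta> x *v y)"
  by (simp add: trace_def rank_one_def matrix_matrix_mult_def matrix_vector_mult_def inner_vec_def sum_distrib_left sum_distrib_right mult_ac)

lemma trace_Amat_mat_1: "trace (Amat \<sigma> \<theta> x ** mat 1) = (norm (\<sigma> \<theta> x))\<^sup>2"
  unfolding trace_Amat by (simp add: sum_column_norm[symmetric] power2_norm_eq_inner)

lemma trace_Amat_scaleR: "trace (Amat \<sigma> \<theta> x ** (k *\<^sub>R M)) = k * trace (Amat \<sigma> \<theta> x ** M)"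
  by (simp add: trace_Amat scaleR_matrix_vector_assoc[symmetric] sum_distrib_left)

text \<open>A Gaussian whose variance grows exponentially in time; it is a strict subsolution of the
  linearised equation away from its centre as soon as \<open>k\<close> is large.\<close>

definition bump :: "real \<Rightarrow> real \<Rightarrow> real \<Rightarrow> real^'n \<Rightarrow> real^'n \<Rightarrow> real \<Rightarrow> real" where
  "bump k \<beta> \<tau> x0 x t = exp (- (k * exp (- \<beta> * (t - \<tau>)) * (norm (x - x0))\<^sup>2))"

lemma C21_test_bump:
  fixes x0 :: "real^'n"
  shows
  "C21_test (bump k \<beta> \<tau> x0)
    (\<lambda>x t. bump k \<beta> \<tau> x0 x t * (k * \<beta> * exp (- \<beta> * (t - \<tau>)) * (norm (x - x0))\<^sup>2))
    (\<lambda>x t. (- 2 * k * exp (- \<beta> * (t - \<tau>)) * bump k \<beta> \<tau> x0 x t) *\<^sub>R (x - x0))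
    (\<lambda>x t. (bump k \<beta> \<tau> x0 x t * (2 * k * exp (- \<beta> * (t - \<tau>)))\<^sup>2) *\<^sub>R rank_one (x - x0)
        + (- 2 * k * exp (- \<beta> * (t - \<tau>)) * bump k \<beta> \<tau> x0 x t) *\<^sub>R mat 1)"
proof -
  have cb: "continuous_on UNIV (\<lambda>z. bump k \<beta> \<tau> x0 (fst z) (snd z))"
    unfolding bump_def by (intro continuous_intros)
  have cr: "continuous_on UNIV (\<lambda>z :: (real^'n) \<times> real. rank_one (fst z - x0))"
    unfolding rank_one_def by (intro continuous_on_vec_lambda continuous_intros)
  show ?thesis
    unfolding C21_test_def
  proof (intro conjI allI)
    fix x :: "real^'n" and t :: real
    have "((\<lambda>z. bump k \<beta> \<tau> x0 (fst z) (snd z)) has_derivative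
       (\<lambda>h. bump k \<beta> \<tau> x0 x t * (- (k * (exp (- \<beta> * (t - \<tau>)) * (- \<beta> * snd h)) * (norm (x - x0))\<^sup>2 + k * exp (- \<beta> * (t - \<tau>)) * (2 * ((x - x0) \<bullet> fst h)))))) (at (x, t))"
      unfolding bump_def power2_norm_eq_inner
      by (auto intro!: derivative_eq_intros simp: fun_eq_iff algebra_simps inner_commute)
    thus "((\<lambda>(y, s). bump k \<beta> \<tau> x0 y s) has_derivative
        (\<lambda>(h, s). ((- 2 * k * exp (- \<beta> * (t - \<tau>)) * bump k \<beta> \<tau> x0 x t) *\<^sub>R (x - x0)) \<bullet> h + bump k \<beta> \<tau> x0 x t * (k * \<beta> * exp (- \<beta> * (t - \<tau>)) * (norm (x - x0))\<^sup>2) * s)) (at (x, t))"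
      unfolding case_prod_unfold by (rule has_derivative_eq_rhs) (simp add: fun_eq_iff algebra_simps)
    have b1: "((\<lambda>y. bump k \<beta> \<tau> x0 y t) has_derivative (\<lambda>h. bump k \<beta> \<tau> x0 x t * (- (k * exp (- \<beta> * (t - \<tau>)) * (2 * ((x - x0) \<bullet> h)))))) (at x)"
      unfolding bump_def power2_norm_eq_inner
      by (auto intro!: derivative_eq_intros simp: fun_eq_iff algebra_simps inner_commute)
    have "((\<lambda>y. (- 2 * k * exp (- \<beta> * (t - \<tau>)) * bump k \<beta> \<tau> x0 y t) *\<^sub>R (y - x0)) has_derivative
       (\<lambda>h. (- 2 * k * exp (- \<beta> * (t - \<tau>)) * bump k \<beta> \<tau> x0 x t) *\<^sub>R (h - 0)
         + (- 2 * k * exp (- \<beta> * (t - \<tau>)) * (bump k \<beta> \<tau> x0 x t * (- (k * exp (- \<beta> * (t - \<tau>)) * (2 * ((x - x0) \<bullet> h)))))) *\<^sub>R (x - x0))) (at x)"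
      by (intro has_derivative_scaleR has_derivative_mult_right b1 has_derivative_diff has_derivative_ident has_derivative_const)
    thus "((\<lambda>y. (- 2 * k * exp (- \<beta> * (t - \<tau>)) * bump k \<beta> \<tau> x0 y t) *\<^sub>R (y - x0)) has_derivative
       (\<lambda>h. ((bump k \<beta> \<tau> x0 x t * (2 * k * exp (- \<beta> * (t - \<tau>)))\<^sup>2) *\<^sub>R rank_one (x - x0)
        + (- 2 * k * exp (- \<beta> * (t - \<tau>)) * bump k \<beta> \<tau> x0 x t) *\<^sub>R mat 1) *v h)) (at x)"
      unfolding matrix_vector_mult_add_rdistrib scaleR_matrix_vector_assoc[symmetric] rank_one_mult matrix_vector_mul_lid
      by (rule has_derivative_eq_rhs) (simp add: fun_eq_iff power2_eq_square mult_ac)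
  next
    show "continuous_on UNIV (\<lambda>(x :: real^'n, t). bump k \<beta> \<tau> x0 x t * (k * \<beta> * exp (- \<beta> * (t - \<tau>)) * (norm (x - x0))\<^sup>2))"
      "continuous_on UNIV (\<lambda>(x :: real^'n, t). (- 2 * k * exp (- \<beta> * (t - \<tau>)) * bump k \<beta> \<tau> x0 x t) *\<^sub>R (x - x0))"
      "continuous_on UNIV (\<lambda>(x :: real^'n, t). (bump k \<beta> \<tau> x0 x t * (2 * k * exp (- \<beta> * (t - \<tau>)))\<^sup>2) *\<^sub>R rank_one (x - x0)
        + (- 2 * k * exp (- \<beta> * (t - \<tau>)) * bump k \<beta> \<tau> x0 x t) *\<^sub>R mat 1)"
      unfolding case_prod_unfold by (intro continuous_intros cb cr)+
  qed
qed

context visc_pair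
begin

text \<open>The barrier \<psi>1 is below M exactly inside a ball about x0 in S that has radius
  \<delta> at time \<tau> and contains a whole period cell at time t1. Near S the strict inequality
  on S keeps u - v below the barrier; away from S ellipticity makes the barrier a strict
  supersolution of the linearised equation. Hence u - v stays below it and is less than M on the
  cell at t1.\<close>

theorem strong_maximum:
  assumes \<tau>: "0 \<le> \<tau>" "\<tau> < t1" "t1 < b"
    and le: "\<And>x t. t \<in> {\<tau>..b} \<Longrightarrow> u x t - v x t \<le> M"
    and S: "closed S" "periodic_set S" "x0 \<in> S"
    and lt: "\<And>x t. x \<in> S \<Longrightarrow> t \<in> {\<tau>..b} \<Longrightarrow> u x t - v x t < M"
    and ell: "\<And>\<delta>. \<delta> > 0 \<Longrightarrow> \<exists>\<nu>>0. \<forall>\<theta> x. infdist x S > \<delta> \<longrightarrow> (\<forall>\<xi>. \<xi> \<bullet> (Amat \<sigma> \<theta> x *v \<xi>) \<ge> \<nu> * (\<xi> \<bullet> \<xi>))"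
  shows "u x1 t1 - v x1 t1 < M"
proof -
  define R0 where "R0 = real CARD('n)"
  have R0: "R0 > 0" by (simp add: R0_def)
  have S_ne: "S \<noteq> {}" using S(3) by auto
  define \<Psi> where "\<Psi> = (\<lambda>x t. u x t - v x t)"
  have \<Psi>per: "\<Psi> (x + k) t = \<Psi> x t" if "int_vec k" for x k t
    using per_diff[of t] that unfolding \<Psi>_def periodic_fun_def by blast
  have c\<Psi>: "continuous_on (UNIV \<times> {\<tau>..b}) (\<lambda>(x,t). \<Psi> x t)" unfolding \<Psi>_def by (rule cont_diff[OF \<tau>(1)])
  \<comment> \<open>By periodicity a compact piece of S represents all of it, so the strict
    inequality on S is uniform.\<close>
  obtain \<rho> where \<rho>: "\<rho> > 0" "\<And>x t. x \<in> S \<Longrightarrow> t \<in> {\<tau>..b} \<Longrightarrow> \<Psi> x t \<le> M - 2 * \<rho>"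
  proof -
    let ?K = "(S \<inter> cball 0 R0) \<times> {\<tau>..b}"
    obtain k0 where k0: "int_vec k0" "norm (x0 + k0) \<le> real CARD('n)" by (rule lattice_reduce)
    have "x0 + k0 \<in> S" using S(2,3) k0(1) unfolding periodic_set_def by blast
    hence ne: "?K \<noteq> {}" using k0(2) \<tau> by (auto simp: R0_def)
    have "\<exists>z\<in>?K. \<forall>y\<in>?K. (\<lambda>(x,t). \<Psi> x t) y \<le> (\<lambda>(x,t). \<Psi> x t) z"
      by (rule continuous_attains_sup[OF _ ne])
        (auto intro!: continuous_on_subset[OF c\<Psi>] compact_Times closed_Int_compact S(1))
    then obtain z where z: "z \<in> ?K" "\<And>y. y \<in> ?K \<Longrightarrow> (\<lambda>(x,t). \<Psi> x t) y \<le> (\<lambda>(x,t). \<Psi> x t) z" by blast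
    have zM: "\<Psi> (fst z) (snd z) < M" using z(1) lt[of "fst z" "snd z"] by (auto simp: \<Psi>_def)
    define \<rho> where "\<rho> = (M - \<Psi> (fst z) (snd z)) / 2"
    have M2: "M - 2 * \<rho> = \<Psi> (fst z) (snd z)" unfolding \<rho>_def by (simp add: field_simps)
    have "\<Psi> x t \<le> M - 2 * \<rho>" if xt: "x \<in> S" "t \<in> {\<tau>..b}" for x t
    proof -
      obtain k where k: "int_vec k" "norm (x + k) \<le> real CARD('n)" by (rule lattice_reduce)
      have "x + k \<in> S" using S(2) xt(1) k(1) unfolding periodic_set_def by blast
      hence "(x + k, t) \<in> ?K" using k(2) xt(2) by (simp add: R0_def)
      from z(2)[OF this] show ?thesis using \<Psi>per[OF k(1)] M2 by (simp add: case_prod_unfold)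
    qed
    thus thesis using that[of \<rho>] zM by (simp add: \<rho>_def)
  qed
  \<comment> \<open>Both functions are L-Lipschitz, so half of the gap 2\<rho> survives within
    distance \<delta> of S.\<close>
  define \<delta> where "\<delta> = min 1 (\<rho> / (2 * L + 1))"
  have \<delta>: "\<delta> > 0" "\<delta> \<le> 1" using \<rho>(1) L0 by (auto simp: \<delta>_def)
  have L\<delta>: "2 * L * \<delta> \<le> \<rho>"
  proof -
    have "\<delta> \<le> \<rho> / (2 * L + 1)" by (simp add: \<delta>_def)
    hence "\<delta> * (2 * L + 1) \<le> \<rho>" using L0 by (subst (asm) pos_le_divide_eq) auto
    moreover have "2 * L * \<delta> \<le> \<delta> * (2 * L + 1)" using \<delta> by (simp add: algebra_simps)
    ultimately show ?thesis by linarith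
  qed
  have near: "\<Psi> x t \<le> M - \<rho>" if x: "infdist x S \<le> \<delta>" and t: "t \<in> {\<tau>..b}" for x t
  proof -
    obtain y where y: "y \<in> S" "infdist x S = dist x y" by (rule infdist_attains_inf[OF S(1) S_ne])
    have "norm (x - y) \<le> \<delta>" using x y(2) by (simp add: dist_norm)
    hence Ln: "L * norm (x - y) \<le> L * \<delta>" using L0 by (intro mult_left_mono) auto
    have "t \<ge> 0" using t \<tau> by auto
    from lip(1)[OF this, of x y] lip(2)[OF this, of x y]
    have "\<Psi> x t \<le> \<Psi> y t + 2 * (L * norm (x - y))" unfolding \<Psi>_def by (simp add: abs_le_iff)
    thus ?thesis using \<rho>(2)[OF y(1) t] L\<delta> Ln by linarith
  qed
  have "\<delta> / 2 > 0" using \<delta> by simp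
  from ell[OF this] obtain \<nu> where \<nu>: "\<nu> > 0" "\<And>\<theta> x \<xi>. infdist x S > \<delta> / 2 \<Longrightarrow> \<xi> \<bullet> (Amat \<sigma> \<theta> x *v \<xi>) \<ge> \<nu> * (\<xi> \<bullet> \<xi>)"
    by blast
  have "L + 1 > 0" using L0 by simp
  with G1 obtain CR where CR: "CR > 0" "\<And>\<theta> x y p q. norm p \<le> L + 1 \<Longrightarrow> norm q \<le> L + 1 \<Longrightarrow> \<bar>G1 \<theta> x p - G1 \<theta> y q\<bar> \<le> CR * (norm (x - y) + norm (p - q))"
    unfolding loc_lip_ham_def by metis
  have \<delta>2: "\<delta>\<^sup>2 > 0" using \<delta> by simp
  \<comment> \<open>The growth rate: the condition says that the squared radius of the ball,
    \<delta>^2 at time \<tau>, exceeds R0^2 at time t1.\<close>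
  obtain \<beta> where \<beta>: "\<beta> > 0" "\<delta>\<^sup>2 * exp (\<beta> * (t1 - \<tau>)) > R0\<^sup>2"
    by (rule exp_penalty[OF \<delta>2 \<tau>(2)])
  define g where "g = (\<lambda>t. exp (- \<beta> * (t - \<tau>)))"
  define gm where "gm = exp (- \<beta> * (b + 1 - \<tau>))"
  have g0: "g t > 0" for t by (simp add: g_def)
  have gm0: "gm > 0" by (simp add: gm_def)
  have gmin: "gm \<le> g t" if "t \<le> b + 1" for t using that \<beta> by (simp add: g_def gm_def)
  have gmax: "g t \<le> exp \<beta>" if "t \<ge> \<tau> - 1" for t
  proof -
    have "\<beta> * (\<tau> - t) \<le> \<beta> * 1" using that \<beta> by (intro mult_left_mono) auto
    thus ?thesis by (simp add: g_def algebra_simps)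
  qed
  \<comment> \<open>Q adds up what ellipticity must beat, namely the time derivative, the identity
    part of the Hessian and the first-order term, plus a surplus 1; k is then chosen so that 4 k g
    \<nu> r^2 \<ge> Q for r \<ge> \<delta>/2.\<close>
  define Q where "Q = \<beta> * (R0 + 1)\<^sup>2 + 2 * C\<^sup>2 + 2 * CR * (R0 + 1) + 1"
  have Q: "Q > 0" using \<beta> CR R0 by (auto simp: Q_def intro!: add_nonneg_pos add_nonneg_nonneg)
  define k where "k = Q / (gm * \<nu> * \<delta>\<^sup>2)"
  have gnd: "gm * \<nu> * \<delta>\<^sup>2 > 0" using gm0 \<nu> \<delta> by simp
  have k: "k > 0" using Q gnd by (simp add: k_def)
  have kQ: "k * (gm * \<nu> * \<delta>\<^sup>2) = Q" unfolding k_def using gnd by (metis less_irrefl nonzero_eq_divide_eq)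
  \<comment> \<open>\<epsilon> \<le> \<rho> keeps the barrier above M - \<rho>, the bound valid near
    S; the second bound keeps its gradient at most 1.\<close>
  define \<epsilon> where "\<epsilon> = min \<rho> (1 / (2 * k * exp \<beta> * (R0 + 1)))"
  have den: "2 * k * exp \<beta> * (R0 + 1) > 0" using k R0 by simp
  have \<epsilon>: "\<epsilon> > 0" "\<epsilon> \<le> \<rho>" using \<rho> den by (auto simp: \<epsilon>_def)
  have "\<epsilon> \<le> 1 / (2 * k * exp \<beta> * (R0 + 1))" by (simp add: \<epsilon>_def)
  hence \<epsilon>k: "\<epsilon> * (2 * k * exp \<beta> * (R0 + 1)) \<le> 1" using den by (simp only: pos_le_divide_eq)
  let ?\<phi> = "bump k \<beta> \<tau> x0"
  have \<phi>: "?\<phi> x t = exp (- (k * g t * (norm (x - x0))\<^sup>2))" for x t by (simp add: bump_def g_def)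
  have \<phi>pos: "?\<phi> x t > 0" and \<phi>1: "?\<phi> x t \<le> 1" for x t using k g0[of t] by (simp_all add: \<phi>)
  define \<phi>0 where "\<phi>0 = exp (- (k * \<delta>\<^sup>2))"
  have \<phi>00: "\<phi>0 > 0" by (simp add: \<phi>0_def)
  define \<psi>1 where "\<psi>1 = (\<lambda>x t. M + \<epsilon> * \<phi>0 - \<epsilon> * ?\<phi> x t)"
  have \<psi>1lo: "\<psi>1 x t > M - \<epsilon>" for x t
  proof -
    have "\<epsilon> * ?\<phi> x t \<le> \<epsilon> * 1" using \<phi>1 \<epsilon> by (intro mult_left_mono) auto
    moreover have "\<epsilon> * \<phi>0 > 0" using \<epsilon> \<phi>00 by simp
    ultimately show ?thesis by (simp add: \<psi>1_def)
  qed
  have main: "\<Psi> y t1 < M" if y: "norm (y - x0) \<le> R0" for y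
  proof (rule ccontr)
    assume "\<not> \<Psi> y t1 < M"
    hence yM: "\<Psi> y t1 \<ge> M" by simp
    have "g t1 * (norm (y - x0))\<^sup>2 \<le> g t1 * R0\<^sup>2" using y g0[of t1] by (intro mult_left_mono power_mono) auto
    also have "\<dots> < g t1 * (\<delta>\<^sup>2 * exp (\<beta> * (t1 - \<tau>)))" using \<beta>(2) g0[of t1] by (intro mult_strict_left_mono) auto
    also have "\<dots> = \<delta>\<^sup>2" by (simp add: g_def exp_minus field_simps flip: exp_add)
    finally have "k * g t1 * (norm (y - x0))\<^sup>2 < k * \<delta>\<^sup>2" using k by (simp add: mult.assoc)
    hence "\<phi>0 < ?\<phi> y t1" by (simp add: \<phi> \<phi>0_def)
    hence "\<epsilon> * \<phi>0 < \<epsilon> * ?\<phi> y t1" using \<epsilon> by simp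
    hence gap: "\<Psi> y t1 - \<psi>1 y t1 > 0" using yM by (simp add: \<psi>1_def)
    define \<gamma> where "\<gamma> = (\<Psi> y t1 - \<psi>1 y t1) / 2"
    have \<gamma>: "\<gamma> > 0" using gap by (simp add: \<gamma>_def)
    obtain \<Lambda> where \<Lambda>: "\<Lambda> > 0" "\<gamma> * exp (\<Lambda> * (b - t1)) > \<epsilon>" by (rule exp_penalty[OF \<gamma> \<tau>(3)])
    define F where "F = (\<lambda>x t. \<Psi> x t - \<psi>1 x t - \<gamma> * exp (\<Lambda> * (t - t1)))"
    have cF: "continuous_on (UNIV \<times> {\<tau>..b}) (\<lambda>(x,t). F x t)"
    proof -
      have "continuous_on (UNIV \<times> {\<tau>..b}) (\<lambda>z. \<psi>1 (fst z) (snd z) + \<gamma> * exp (\<Lambda> * (snd z - t1)))"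
        unfolding \<psi>1_def bump_def by (intro continuous_intros)
      from continuous_on_diff[OF c\<Psi> this] show ?thesis by (simp add: F_def case_prod_unfold algebra_simps)
    qed
    let ?K = "cball x0 R0 \<times> {\<tau>..b}"
    have "\<exists>z\<in>?K. \<forall>y\<in>?K. (\<lambda>(x,t). F x t) y \<le> (\<lambda>(x,t). F x t) z"
      by (rule continuous_attains_sup) (use R0 \<tau> in \<open>auto intro!: continuous_on_subset[OF cF] compact_Times\<close>)
    then obtain z where z: "z \<in> ?K" "\<And>y. y \<in> ?K \<Longrightarrow> (\<lambda>(x,t). F x t) y \<le> (\<lambda>(x,t). F x t) z" by blast
    define y0 s0 where "y0 = fst z" and "s0 = snd z"
    have y0: "norm (y0 - x0) \<le> R0" and s0: "s0 \<in> {\<tau>..b}" using z(1) by (auto simp: y0_def s0_def dist_norm norm_minus_commute)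
    have zF: "F x t \<le> F y0 s0" if "norm (x - x0) \<le> R0" "t \<in> {\<tau>..b}" for x t
      using z(2)[of "(x, t)"] that by (auto simp: y0_def s0_def dist_norm norm_minus_commute case_prod_unfold)
    \<comment> \<open>The bump is not periodic, but it decreases with the distance to x0 while u - v
      is periodic: a lattice translation into the ball of radius R0 can only increase F.\<close>
    have Fmax: "F x t \<le> F y0 s0" if t: "t \<in> {\<tau>..b}" for x t
    proof (cases "norm (x - x0) \<le> R0")
      case True thus ?thesis using zF t by blast
    next
      case False
      obtain k' where k': "int_vec k'" "norm (x - x0 + k') \<le> real CARD('n)" by (rule lattice_reduce)
      have n: "norm (x + k' - x0) \<le> R0" using k'(2) by (simp add: R0_def algebra_simps)
      hence "norm (x + k' - x0) \<le> norm (x - x0)" using False by linarith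
      hence "k * g t * (norm (x + k' - x0))\<^sup>2 \<le> k * g t * (norm (x - x0))\<^sup>2" using k g0[of t] by (intro mult_left_mono power_mono) auto
      hence "?\<phi> x t \<le> ?\<phi> (x + k') t" by (simp add: \<phi>)
      hence "\<epsilon> * ?\<phi> x t \<le> \<epsilon> * ?\<phi> (x + k') t" using \<epsilon> by simp
      hence "F x t \<le> F (x + k') t" by (simp add: F_def \<psi>1_def \<Psi>per[OF k'(1)])
      also have "\<dots> \<le> F y0 s0" by (rule zF[OF n t])
      finally show ?thesis .
    qed
    have "\<Psi> y t1 - \<psi>1 y t1 = 2 * \<gamma>" unfolding \<gamma>_def by simp
    hence "F y t1 = \<gamma>" by (simp add: F_def)
    hence Fpos: "F y0 s0 > 0" using Fmax[of t1 y] \<gamma> \<tau> by simp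
    have far: "infdist y0 S > \<delta>"
    proof (rule ccontr)
      assume "\<not> ?thesis"
      hence "\<Psi> y0 s0 \<le> M - \<rho>" using near[of y0 s0] s0 by simp
      moreover have "\<gamma> * exp (\<Lambda> * (s0 - t1)) > 0" using \<gamma> by simp
      ultimately show False using Fpos \<psi>1lo[of y0 s0] \<epsilon>(2) unfolding F_def by linarith
    qed
    have far0: "norm (y0 - x0) > \<delta>" using far infdist_le[OF S(3), of y0] by (simp add: dist_norm)
    have \<Psi>M: "\<Psi> y0 s0 \<le> M" using le[OF s0] by (simp add: \<Psi>_def)
    have "s0 \<noteq> \<tau>"
    proof
      assume s: "s0 = \<tau>"
      have "(norm (y0 - x0))\<^sup>2 \<ge> \<delta>\<^sup>2" using far0 \<delta> by (intro power_mono) auto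
      hence "k * \<delta>\<^sup>2 \<le> k * g s0 * (norm (y0 - x0))\<^sup>2" using k by (simp add: s g_def)
      hence "?\<phi> y0 s0 \<le> \<phi>0" by (simp add: \<phi> \<phi>0_def)
      hence "\<epsilon> * ?\<phi> y0 s0 \<le> \<epsilon> * \<phi>0" using \<epsilon> by simp
      moreover have "\<gamma> * exp (\<Lambda> * (s0 - t1)) > 0" using \<gamma> by simp
      ultimately show False using Fpos \<Psi>M unfolding F_def \<psi>1_def by linarith
    qed
    moreover have "s0 \<noteq> b" using Fpos \<Psi>M \<psi>1lo[of y0 s0] \<Lambda>(2) unfolding F_def by auto
    ultimately have s0': "\<tau> < s0" "s0 < b" using s0 by auto
    have ct: "C21_test (\<lambda>x t. M + \<epsilon> * \<phi>0 + \<gamma> * exp (\<Lambda> * (t - t1))) (\<lambda>x t. \<gamma> * \<Lambda> * exp (\<Lambda> * (t - t1))) (\<lambda>x t. 0 :: real^'n) (\<lambda>x t. 0)"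
    proof (rule C21_test_time)
      fix t :: real
      show "((\<lambda>t. M + \<epsilon> * \<phi>0 + \<gamma> * exp (\<Lambda> * (t - t1))) has_real_derivative \<gamma> * \<Lambda> * exp (\<Lambda> * (t - t1))) (at t)"
        by (auto intro!: derivative_eq_intros)
    qed (intro continuous_intros)
    \<comment> \<open>A lower bound for the factor W below that holds at every admissible point, so
      that \<kappa> can be fixed before the touching point is known.\<close>
    define c2 where "c2 = \<epsilon> * exp (- (k * exp \<beta> * (R0 + 1)\<^sup>2)) * k * gm"
    have c2: "c2 > 0" using \<epsilon> k gm0 by (simp add: c2_def)
    define \<kappa> where "\<kappa> = min (min 1 (\<delta> / 2)) (c2 / 2)"
    have \<kappa>: "\<kappa> > 0" "\<kappa> \<le> 1" "\<kappa> \<le> \<delta> / 2" "\<kappa> < c2" using c2 \<delta> by (auto simp: \<kappa>_def)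
    let ?Dp = "\<lambda>x t. (2 * \<epsilon> * k * g t * ?\<phi> x t) *\<^sub>R (x - x0)"
    have max': "u x t - v x t - (M + \<epsilon> * \<phi>0 + \<gamma> * exp (\<Lambda> * (t - t1)) - \<epsilon> * ?\<phi> x t) \<le> u y0 s0 - v y0 s0 - (M + \<epsilon> * \<phi>0 + \<gamma> * exp (\<Lambda> * (s0 - t1)) - \<epsilon> * ?\<phi> y0 s0)"
      if "t \<in> {\<tau>..b}" for x t
      using Fmax[OF that, of x] unfolding F_def \<Psi>_def \<psi>1_def by linarith
    obtain x t p \<theta> where x: "norm (x - y0) < \<kappa>" "\<bar>t - s0\<bar> < \<kappa>" "norm p \<le> L" and
      ineq: "\<gamma> * \<Lambda> * exp (\<Lambda> * (t - t1)) - \<epsilon> * (?\<phi> x t * (k * \<beta> * g t * (norm (x - x0))\<^sup>2))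
        + \<epsilon> * trace (Amat \<sigma> \<theta> x ** ((?\<phi> x t * (2 * k * g t)\<^sup>2) *\<^sub>R rank_one (x - x0) + (- 2 * k * g t * ?\<phi> x t) *\<^sub>R mat 1))
        + G1 \<theta> x (p + ?Dp x t) - G2 \<theta> x p \<le> \<kappa>"
    proof -
      obtain x t p \<theta> where x: "norm (x - y0) < \<kappa>" "\<bar>t - s0\<bar> < \<kappa>" "norm p \<le> L" and
        i: "- (\<epsilon> * (?\<phi> x t * (k * \<beta> * g t * (norm (x - x0))\<^sup>2))) + \<gamma> * \<Lambda> * exp (\<Lambda> * (t - t1))
         - trace (Amat \<sigma> \<theta> x ** ((- \<epsilon>) *\<^sub>R ((?\<phi> x t * (2 * k * g t)\<^sup>2) *\<^sub>R rank_one (x - x0) + (- 2 * k * g t * ?\<phi> x t) *\<^sub>R mat 1) + 0))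
         + G1 \<theta> x (p + ((- \<epsilon>) *\<^sub>R ((- 2 * k * g t * ?\<phi> x t) *\<^sub>R (x - x0)) + 0)) - G2 \<theta> x p \<le> \<kappa>"
      proof -
        have "C21_test (\<lambda>x t. - \<epsilon> * ?\<phi> x (t + 0) + 0 * t + (M + \<epsilon> * \<phi>0 + \<gamma> * exp (\<Lambda> * (t - t1))))
          (\<lambda>x t. - \<epsilon> * (?\<phi> x (t + 0) * (k * \<beta> * exp (- \<beta> * (t + 0 - \<tau>)) * (norm (x - x0))\<^sup>2)) + 0 + \<gamma> * \<Lambda> * exp (\<Lambda> * (t - t1)))
          (\<lambda>x t. (- \<epsilon>) *\<^sub>R ((- 2 * k * exp (- \<beta> * (t + 0 - \<tau>)) * ?\<phi> x (t + 0)) *\<^sub>R (x - x0)) + 0)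
          (\<lambda>x t. (- \<epsilon>) *\<^sub>R ((?\<phi> x (t + 0) * (2 * k * exp (- \<beta> * (t + 0 - \<tau>)))\<^sup>2) *\<^sub>R rank_one (x - x0) + (- 2 * k * exp (- \<beta> * (t + 0 - \<tau>)) * ?\<phi> x (t + 0)) *\<^sub>R mat 1) + 0)"
          by (rule C21_test_add[OF C21_test_affine[OF C21_test_bump] ct])
        from touching[OF \<tau>(1) s0' this _ \<kappa>(1), of y0] max'
        obtain x t p \<theta> where "norm (x - y0) < \<kappa>" "\<bar>t - s0\<bar> < \<kappa>" "norm p \<le> L"
          "- \<epsilon> * (?\<phi> x (t + 0) * (k * \<beta> * exp (- \<beta> * (t + 0 - \<tau>)) * (norm (x - x0))\<^sup>2)) + 0 + \<gamma> * \<Lambda> * exp (\<Lambda> * (t - t1))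
           - trace (Amat \<sigma> \<theta> x ** ((- \<epsilon>) *\<^sub>R ((?\<phi> x (t + 0) * (2 * k * exp (- \<beta> * (t + 0 - \<tau>)))\<^sup>2) *\<^sub>R rank_one (x - x0) + (- 2 * k * exp (- \<beta> * (t + 0 - \<tau>)) * ?\<phi> x (t + 0)) *\<^sub>R mat 1) + 0))
           + G1 \<theta> x (p + ((- \<epsilon>) *\<^sub>R ((- 2 * k * exp (- \<beta> * (t + 0 - \<tau>)) * ?\<phi> x (t + 0)) *\<^sub>R (x - x0)) + 0)) - G2 \<theta> x p \<le> \<kappa>"
          by (auto simp: algebra_simps)
        thus thesis by (intro that) (simp_all add: g_def)
      qed
      have eq: "(- \<epsilon>) *\<^sub>R ((- 2 * k * g t * ?\<phi> x t) *\<^sub>R (x - x0)) = ?Dp x t" by simp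
      show thesis
        by (rule that[OF x, of \<theta>], insert i[unfolded eq trace_Amat_scaleR[of _ _ _ "- \<epsilon>"] add_0_right]) linarith
    qed
    define r where "r = norm (x - x0)"
    define A where "A = ?\<phi> x t"
    have A0: "A > 0" using \<phi>pos by (simp add: A_def)
    have t: "t \<ge> \<tau> - 1" "t \<le> b + 1" using x(2) s0 \<kappa>(2) by auto
    have r: "r \<ge> \<delta> / 2" "r \<le> R0 + 1"
    proof -
      have "norm (y0 - x0) \<le> norm (x - y0) + r" using norm_triangle_ineq4[of "x - x0" "x - y0"] by (simp add: r_def)
      thus "r \<ge> \<delta> / 2" using far0 x(1) \<kappa>(3) by linarith
      have "r \<le> norm (x - y0) + norm (y0 - x0)" using norm_triangle_ineq[of "x - y0" "y0 - x0"] by (simp add: r_def)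
      thus "r \<le> R0 + 1" using y0 x(1) \<kappa>(2) by linarith
    qed
    have r0: "r > 0" using r(1) \<delta> by linarith
    have "infdist y0 S \<le> infdist x S + dist y0 x" by (rule infdist_triangle)
    hence "infdist x S > \<delta> / 2" using far x(1) \<kappa>(3) by (simp add: dist_norm norm_minus_commute)
    from \<nu>(2)[OF this, of "x - x0" \<theta>] have e1: "(x - x0) \<bullet> (Amat \<sigma> \<theta> x *v (x - x0)) \<ge> \<nu> * r\<^sup>2"
      by (simp add: r_def power2_norm_eq_inner)
    have tr: "trace (Amat \<sigma> \<theta> x ** ((A * (2 * k * g t)\<^sup>2) *\<^sub>R rank_one (x - x0) + (- 2 * k * g t * A) *\<^sub>R mat 1)) \<ge> A * (2 * k * g t)\<^sup>2 * (\<nu> * r\<^sup>2) - 2 * k * g t * A * C\<^sup>2"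
    proof -
      have "A * (2 * k * g t)\<^sup>2 * ((x - x0) \<bullet> (Amat \<sigma> \<theta> x *v (x - x0))) \<ge> A * (2 * k * g t)\<^sup>2 * (\<nu> * r\<^sup>2)"
        using e1 A0 by (intro mult_left_mono) auto
      moreover have "2 * k * g t * A * (norm (\<sigma> \<theta> x))\<^sup>2 \<le> 2 * k * g t * A * C\<^sup>2"
        using \<sigma>_bd[of \<theta> x] k g0[of t] A0 by (intro mult_left_mono power_mono) auto
      ultimately show ?thesis unfolding trace_Amat_add trace_Amat_scaleR trace_Amat_rank_one trace_Amat_mat_1 by linarith
    qed
    have Dn: "norm (?Dp x t) = 2 * \<epsilon> * k * g t * A * r" using \<epsilon> k g0[of t] A0 by (simp add: A_def r_def abs_mult)
    have "2 * \<epsilon> * k * g t * A * r \<le> 2 * \<epsilon> * k * exp \<beta> * 1 * (R0 + 1)"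
      using gmax[OF t(1)] \<phi>1[of x t] r(2) \<epsilon> k g0[of t] A0 r0 by (intro mult_mono) (auto simp: A_def)
    also have "\<dots> \<le> 1" using \<epsilon>k by (simp add: mult_ac)
    finally have Dn1: "norm (?Dp x t) \<le> 1" unfolding Dn .
    have H: "G1 \<theta> x (p + ?Dp x t) - G2 \<theta> x p \<ge> - (CR * (2 * \<epsilon> * k * g t * A * r))"
    proof -
      have "norm (p + ?Dp x t) \<le> L + 1" "norm p \<le> L + 1" using norm_triangle_ineq[of p "?Dp x t"] x(3) Dn1 by linarith+
      from CR(2)[OF this, of \<theta> x x] have "\<bar>G1 \<theta> x (p + ?Dp x t) - G1 \<theta> x p\<bar> \<le> CR * norm (?Dp x t)" by simp
      thus ?thesis using G21[of \<theta> x p] unfolding Dn by linarith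
    qed
    have pen: "\<gamma> * \<Lambda> * exp (\<Lambda> * (t - t1)) > 0" using \<gamma> \<Lambda> by simp
    \<comment> \<open>The common factor of all barrier terms; \<open>br\<close> shows that the
      remaining bracket is at least 1.\<close>
    define W where "W = \<epsilon> * A * k * g t"
    have W0: "W > 0" using \<epsilon> A0 k g0 by (simp add: W_def)
    have "\<epsilon> * (A * (2 * k * g t)\<^sup>2 * (\<nu> * r\<^sup>2) - 2 * k * g t * A * C\<^sup>2) \<le> \<epsilon> * trace (Amat \<sigma> \<theta> x ** ((A * (2 * k * g t)\<^sup>2) *\<^sub>R rank_one (x - x0) + (- 2 * k * g t * A) *\<^sub>R mat 1))"
      using tr \<epsilon> by (intro mult_left_mono) auto
    moreover have "\<epsilon> * (A * (2 * k * g t)\<^sup>2 * (\<nu> * r\<^sup>2) - 2 * k * g t * A * C\<^sup>2) = W * (4 * (k * g t * \<nu> * r\<^sup>2) - 2 * C\<^sup>2)"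
      by (simp add: W_def power2_eq_square algebra_simps)
    moreover have "\<epsilon> * (A * (k * \<beta> * g t * r\<^sup>2)) = W * (\<beta> * r\<^sup>2)" by (simp add: W_def mult_ac)
    moreover have "CR * (2 * \<epsilon> * k * g t * A * r) = W * (2 * CR * r)" by (simp add: W_def mult_ac)
    ultimately have WW: "W * (4 * (k * g t * \<nu> * r\<^sup>2) - 2 * C\<^sup>2) - W * (\<beta> * r\<^sup>2) - W * (2 * CR * r) \<le> \<kappa>"
      using ineq H pen unfolding A_def[symmetric] r_def[symmetric] by linarith
    have br: "4 * (k * g t * \<nu> * r\<^sup>2) - 2 * C\<^sup>2 - \<beta> * r\<^sup>2 - 2 * CR * r \<ge> 1"
    proof -
      have "(\<delta> / 2)\<^sup>2 \<le> r\<^sup>2" using r(1) \<delta> by (intro power_mono) auto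
      hence "k * gm * \<nu> * (\<delta> / 2)\<^sup>2 \<le> k * g t * \<nu> * r\<^sup>2"
        using gmin[OF t(2)] k \<nu> gm0 by (intro mult_mono) auto
      hence "Q \<le> 4 * (k * g t * \<nu> * r\<^sup>2)" using kQ by (simp add: power2_eq_square mult_ac)
      moreover have "\<beta> * r\<^sup>2 \<le> \<beta> * (R0 + 1)\<^sup>2" using r(2) r0 \<beta> by (intro mult_left_mono power_mono) auto
      moreover have "2 * CR * r \<le> 2 * CR * (R0 + 1)" using r(2) CR(1) by (intro mult_left_mono) auto
      ultimately show ?thesis by (simp add: Q_def)
    qed
    have "W * 1 \<le> W * (4 * (k * g t * \<nu> * r\<^sup>2) - 2 * C\<^sup>2 - \<beta> * r\<^sup>2 - 2 * CR * r)" using br W0 by (intro mult_left_mono) auto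
    hence "W \<le> \<kappa>" using WW by (simp add: right_diff_distrib)
    moreover have "c2 \<le> W"
    proof -
      have "k * g t * r\<^sup>2 \<le> k * exp \<beta> * (R0 + 1)\<^sup>2"
        using gmax[OF t(1)] r(2) r0 k g0[of t] by (intro mult_mono power_mono) auto
      hence "exp (- (k * exp \<beta> * (R0 + 1)\<^sup>2)) \<le> A" by (simp add: A_def \<phi> r_def)
      thus ?thesis unfolding c2_def W_def using \<epsilon> k gm0 gmin[OF t(2)] A0 by (intro mult_mono) auto
    qed
    ultimately show False using \<kappa>(4) by linarith
  qed
  obtain k' where k': "int_vec k'" "norm (x1 - x0 + k') \<le> real CARD('n)" by (rule lattice_reduce)
  have "norm (x1 + k' - x0) \<le> R0" using k'(2) by (simp add: R0_def algebra_simps)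
  from main[OF this] show ?thesis using \<Psi>per[OF k'(1)] by (simp add: \<Psi>_def)
qed

end

section \<open>Stability\<close>

lemma norm_matrix_vector_mult_le:
  fixes M :: "real^'n^'m"
  shows "norm (M *v x) \<le> norm M * norm x"
proof -
  have "norm (M *v x) = L2_set (\<lambda>i. \<bar>(M *v x) $ i\<bar>) UNIV" by (simp add: norm_vec_def)
  also have "\<dots> \<le> L2_set (\<lambda>i. norm (M $ i) * norm x) UNIV"
    by (rule L2_set_mono) (auto simp: matrix_vector_mul_component intro: Cauchy_Schwarz_ineq2)
  also have "\<dots> = norm M * norm x" by (simp add: L2_set_left_distrib norm_vec_def)
  finally show ?thesis .
qed

text \<open>Apart from the uniform bound C, the index enters the estimate through |\<sigma>(x) -
  \<sigma>(y)|, so the second-order term is continuous uniformly in \<theta>.\<close>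

lemma trace_Amat_diff_le:
  assumes x: "norm (\<sigma> \<theta> x) \<le> C" and y: "norm (\<sigma> \<theta> y) \<le> C"
  shows "\<bar>trace (Amat \<sigma> \<theta> x ** M) - trace (Amat \<sigma> \<theta> y ** N)\<bar>
    \<le> C\<^sup>2 * norm (M - N) + real CARD('n) * (2 * norm N * C * norm (\<sigma> \<theta> x - \<sigma> \<theta> y :: real^'n^'n))"
proof -
  define c where "c = (\<lambda>j. column j (\<sigma> \<theta> x))"
  define d where "d = (\<lambda>j. column j (\<sigma> \<theta> y))"
  have col: "norm (column j A) \<le> norm A" for j and A :: "real^'n^'n"
  proof -
    have "(norm (column j A))\<^sup>2 \<le> (\<Sum>j\<in>UNIV. (norm (column j A))\<^sup>2)" by (rule member_le_sum) auto
    thus ?thesis unfolding sum_column_norm by (simp add: power2_le_iff_abs_le)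
  qed
  have cd: "c j - d j = column j (\<sigma> \<theta> x - \<sigma> \<theta> y)" for j by (simp add: c_def d_def column_def vec_eq_iff)
  have ineq: "\<bar>(M *v c j) \<bullet> c j - (N *v d j) \<bullet> d j\<bar> \<le> norm (M - N) * (norm (c j))\<^sup>2 + 2 * norm N * C * norm (\<sigma> \<theta> x - \<sigma> \<theta> y)" for j
  proof -
    have eq: "(M *v c j) \<bullet> c j - (N *v d j) \<bullet> d j = ((M - N) *v c j) \<bullet> c j + (N *v c j) \<bullet> (c j - d j) + (N *v (c j - d j)) \<bullet> d j"
      by (simp add: matrix_vector_mult_diff_rdistrib matrix_vector_mult_diff_distrib inner_diff_left inner_diff_right)
    have 1: "\<bar>((M - N) *v c j) \<bullet> c j\<bar> \<le> norm (M - N) * (norm (c j))\<^sup>2"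
      using order_trans[OF Cauchy_Schwarz_ineq2 mult_right_mono[OF norm_matrix_vector_mult_le[of "M - N" "c j"] norm_ge_zero]]
      by (simp add: power2_eq_square mult.assoc)
    have cn: "norm (c j) \<le> C" "norm (d j) \<le> C" "norm (c j - d j) \<le> norm (\<sigma> \<theta> x - \<sigma> \<theta> y)"
      using col[of j "\<sigma> \<theta> x"] col[of j "\<sigma> \<theta> y"] x y col[of j "\<sigma> \<theta> x - \<sigma> \<theta> y"] cd[of j] unfolding c_def d_def by auto
    have C0: "C \<ge> 0" using x norm_ge_zero order_trans by blast
    have 2: "\<bar>(N *v c j) \<bullet> (c j - d j)\<bar> \<le> (norm N * C) * norm (\<sigma> \<theta> x - \<sigma> \<theta> y)"
    proof -
      have "\<bar>(N *v c j) \<bullet> (c j - d j)\<bar> \<le> norm (N *v c j) * norm (c j - d j)" by (rule Cauchy_Schwarz_ineq2)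
      also have "\<dots> \<le> (norm N * C) * norm (\<sigma> \<theta> x - \<sigma> \<theta> y)"
        using order_trans[OF norm_matrix_vector_mult_le[of N "c j"] mult_left_mono[OF cn(1) norm_ge_zero]] cn C0 by (intro mult_mono) auto
      finally show ?thesis .
    qed
    have 3: "\<bar>(N *v (c j - d j)) \<bullet> d j\<bar> \<le> (norm N * norm (\<sigma> \<theta> x - \<sigma> \<theta> y)) * C"
    proof -
      have "\<bar>(N *v (c j - d j)) \<bullet> d j\<bar> \<le> norm (N *v (c j - d j)) * norm (d j)" by (rule Cauchy_Schwarz_ineq2)
      also have "\<dots> \<le> (norm N * norm (\<sigma> \<theta> x - \<sigma> \<theta> y)) * C"
        using order_trans[OF norm_matrix_vector_mult_le[of N "c j - d j"] mult_left_mono[OF cn(3) norm_ge_zero]] cn C0 by (intro mult_mono) auto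
      finally show ?thesis .
    qed
    show ?thesis unfolding eq using 1 2 3 by (simp add: mult_ac)
  qed
  have "\<bar>trace (Amat \<sigma> \<theta> x ** M) - trace (Amat \<sigma> \<theta> y ** N)\<bar> = \<bar>\<Sum>j\<in>UNIV. (M *v c j) \<bullet> c j - (N *v d j) \<bullet> d j\<bar>"
    by (simp add: trace_Amat c_def d_def sum_subtractf)
  also have "\<dots> \<le> (\<Sum>j\<in>UNIV. norm (M - N) * (norm (c j))\<^sup>2 + 2 * norm N * C * norm (\<sigma> \<theta> x - \<sigma> \<theta> y))"
    by (rule order_trans[OF sum_abs sum_mono]) (rule ineq)
  also have "\<dots> = norm (M - N) * (norm (\<sigma> \<theta> x))\<^sup>2 + real CARD('n) * (2 * norm N * C * norm (\<sigma> \<theta> x - \<sigma> \<theta> y))"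
    by (simp add: sum.distrib sum_distrib_left[symmetric] c_def sum_column_norm)
  also have "\<dots> \<le> C\<^sup>2 * norm (M - N) + real CARD('n) * (2 * norm N * C * norm (\<sigma> \<theta> x - \<sigma> \<theta> y))"
    using mult_left_mono[OF power_mono[OF x norm_ge_zero, of 2] norm_ge_zero[of "M - N"]] by (simp add: mult.commute)
  finally show ?thesis .
qed

text \<open>The penalty \<eta>|z - z0|^2 makes the maximum strict: on the sphere of radius r it
  costs \<eta> r^2, so an approximation within \<eta> r^2/4 has its penalised maximiser in the
  interior.\<close>

lemma stable_touch:
  fixes w :: "real^'n \<Rightarrow> real \<Rightarrow> real"
  assumes cont: "\<And>n. continuous_on (UNIV \<times> {0..}) (\<lambda>(x,t). wn n x t)"
    and conv: "\<And>\<epsilon>. \<epsilon> > 0 \<Longrightarrow> \<exists>n::nat. \<forall>x. \<forall>t\<ge>0. \<bar>wn n x t - w x t\<bar> < \<epsilon>"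
    and \<phi>: "C21_test \<phi> \<phi>t D\<phi> D2\<phi>" and t0: "t0 > 0"
    and max: "\<exists>\<epsilon>>0. \<forall>y s. dist y x0 < \<epsilon> \<longrightarrow> \<bar>s - t0\<bar> < \<epsilon> \<longrightarrow> w y s - \<phi> y s \<le> w x0 t0 - \<phi> x0 t0"
    and \<eta>: "\<eta> > 0" and d: "d > 0"
  shows "\<exists>n x t. norm ((x, t) - (x0, t0)) < d \<and> t > 0 \<and>
    (\<exists>\<epsilon>>0. \<forall>y s. dist y x < \<epsilon> \<longrightarrow> \<bar>s - t\<bar> < \<epsilon> \<longrightarrow>
      wn n y s - (\<phi> y s + \<eta> * (norm ((y, s) - (x0, t0)))\<^sup>2) \<le> wn n x t - (\<phi> x t + \<eta> * (norm ((x, t) - (x0, t0)))\<^sup>2))"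
proof -
  define z0 where "z0 = (x0, t0)"
  obtain \<epsilon> where \<epsilon>: "\<epsilon> > 0" "\<And>y s. dist y x0 < \<epsilon> \<Longrightarrow> \<bar>s - t0\<bar> < \<epsilon> \<Longrightarrow> w y s - \<phi> y s \<le> w x0 t0 - \<phi> x0 t0" using max by blast
  define r where "r = min (min (\<epsilon> / 2) (t0 / 2)) (d / 2)"
  have r: "r > 0" "r < \<epsilon>" "r < t0" "r < d" using \<epsilon> t0 d by (auto simp: r_def)
  have comp: "dist y x0 \<le> norm ((y, s) - z0)" "\<bar>s - t0\<bar> \<le> norm ((y, s) - z0)" for y s
    using norm_fst_le[where x="y - x0" and y="s - t0"] norm_snd_le[where x="y - x0" and y="s - t0"] by (auto simp: z0_def dist_norm)
  have "\<eta> * r\<^sup>2 / 4 > 0" using \<eta> r by simp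
  from conv[OF this] obtain n where n: "\<And>x t. t \<ge> 0 \<Longrightarrow> \<bar>wn n x t - w x t\<bar> < \<eta> * r\<^sup>2 / 4" by blast
  define f where "f = (\<lambda>z. wn n (fst z) (snd z) - (\<phi> (fst z) (snd z) + \<eta> * (norm (z - z0))\<^sup>2))"
  have tpos: "snd z > 0" if "z \<in> cball z0 r" for z
    using comp(2)[of "snd z" "fst z"] that r by (simp add: dist_norm norm_minus_commute)
  have c\<phi>: "continuous_on UNIV (\<lambda>(x,t). \<phi> x t)"
    using \<phi> unfolding C21_test_def by (metis (no_types, lifting) UNIV_I continuous_at_imp_continuous_on has_derivative_continuous surj_pair)
  have "continuous_on (cball z0 r) f"
  proof -
    have "continuous_on (cball z0 r) (\<lambda>z. wn n (fst z) (snd z))"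
      using continuous_on_subset[OF cont[of n], of "cball z0 r"] tpos by (auto simp: case_prod_unfold less_imp_le mem_Times_iff subset_iff)
    moreover have "continuous_on (cball z0 r) (\<lambda>z. \<phi> (fst z) (snd z))"
      using continuous_on_subset[OF c\<phi>, of "cball z0 r"] by (simp add: case_prod_unfold)
    ultimately show ?thesis unfolding f_def by (intro continuous_intros)
  qed
  hence "\<exists>z\<in>cball z0 r. \<forall>y\<in>cball z0 r. f y \<le> f z"
    using r by (intro continuous_attains_sup) auto
  then obtain z where z: "z \<in> cball z0 r" "\<And>y. y \<in> cball z0 r \<Longrightarrow> f y \<le> f z" by blast
  have zlt: "norm (z - z0) < r"
  proof (rule ccontr)
    assume "\<not> ?thesis"
    hence "r\<^sup>2 \<le> (norm (z - z0))\<^sup>2" using r by (intro power_mono) auto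
    hence ge: "\<eta> * r\<^sup>2 \<le> \<eta> * (norm (z - z0))\<^sup>2" using \<eta> by simp
    have "w (fst z) (snd z) - \<phi> (fst z) (snd z) \<le> w x0 t0 - \<phi> x0 t0"
    proof (rule \<epsilon>(2))
      have "norm ((fst z, snd z) - z0) \<le> r" using z(1) by (metis dist_commute dist_norm mem_cball prod.collapse)
      thus "dist (fst z) x0 < \<epsilon>" "\<bar>snd z - t0\<bar> < \<epsilon>" using comp(1)[of "fst z" "snd z"] comp(2)[of "snd z" "fst z"] r by linarith+
    qed
    moreover have "f z0 \<le> f z" using z(2)[of z0] r by simp
    moreover have "f z0 = wn n x0 t0 - \<phi> x0 t0" by (simp add: f_def z0_def)
    moreover have "\<bar>wn n (fst z) (snd z) - w (fst z) (snd z)\<bar> < \<eta> * r\<^sup>2 / 4" using n tpos[OF z(1)] by simp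
    moreover have "\<bar>wn n x0 t0 - w x0 t0\<bar> < \<eta> * r\<^sup>2 / 4" using n t0 by simp
    moreover have "\<eta> * r\<^sup>2 > 0" using \<eta> r by simp
    ultimately show False using ge unfolding f_def abs_less_iff by linarith
  qed
  define \<epsilon>' where "\<epsilon>' = (r - norm (z - z0)) / 2"
  have \<epsilon>': "\<epsilon>' > 0" using zlt by (simp add: \<epsilon>'_def)
  have "wn n y s - (\<phi> y s + \<eta> * (norm ((y, s) - z0))\<^sup>2) \<le> wn n (fst z) (snd z) - (\<phi> (fst z) (snd z) + \<eta> * (norm (z - z0))\<^sup>2)"
    if "dist y (fst z) < \<epsilon>'" "\<bar>s - snd z\<bar> < \<epsilon>'" for y s
  proof -
    have "norm ((y, s) - z) \<le> norm (y - fst z) + norm (s - snd z)"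
      using norm_Pair_le[of "y - fst z" "s - snd z"] by (metis fst_diff snd_diff fst_conv snd_conv prod.collapse)
    hence "norm ((y, s) - z) < 2 * \<epsilon>'" using that by (simp add: dist_norm)
    hence "norm ((y, s) - z0) < r" using norm_triangle_ineq[of "(y, s) - z" "z - z0"] by (simp add: \<epsilon>'_def)
    hence "(y, s) \<in> cball z0 r" by (simp add: dist_norm norm_minus_commute)
    from z(2)[OF this] show ?thesis by (simp add: f_def)
  qed
  thus ?thesis using zlt r(4) tpos[OF z(1)] \<epsilon>' unfolding z0_def
    by (intro exI[of _ n] exI[of _ "fst z"] exI[of _ "snd z"]) (auto intro!: exI[of _ \<epsilon>'])
qed

section \<open>The Bellman operator in terms of single indices, and passage to limits\<close>

locale hj_setting =
  fixes \<sigma> :: "'th \<Rightarrow> real^'n \<Rightarrow> real^'n^'n" and H :: "'th \<Rightarrow> real^'n \<Rightarrow> real^'n \<Rightarrow> real" and C c :: real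
  assumes C_pos: "C > 0"
    and sigma_bd: "\<And>\<theta> x. norm (\<sigma> \<theta> x) \<le> C"
    and sigma_lip: "\<And>\<theta> x y. norm (\<sigma> \<theta> x - \<sigma> \<theta> y) \<le> C * norm (x - y)"
    and H_zero: "\<And>\<theta> x. \<bar>H \<theta> x 0\<bar> \<le> C"
    and H_lip: "loc_lip_ham H"
begin

definition Hc :: "'th \<Rightarrow> real^'n \<Rightarrow> real^'n \<Rightarrow> real" where
  "Hc \<theta> x p = H \<theta> x p - c"

lemma Hc_lip: "loc_lip_ham Hc"
  using H_lip unfolding loc_lip_ham_def Hc_def by simp

lemma H_bound: "\<exists>B. \<forall>\<theta>. \<bar>H \<theta> x p\<bar> \<le> B"
proof -
  have "norm p + 1 > 0" by (simp add: add_nonneg_pos)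
  with H_lip obtain CR where CR: "\<And>\<theta> x y p' q. norm p' \<le> norm p + 1 \<Longrightarrow> norm q \<le> norm p + 1 \<Longrightarrow> \<bar>H \<theta> x p' - H \<theta> y q\<bar> \<le> CR * (norm (x - y) + norm (p' - q))"
    unfolding loc_lip_ham_def by metis
  have "\<bar>H \<theta> x p\<bar> \<le> C + CR * norm p" for \<theta>
    using CR[of p 0 \<theta> x x] H_zero[of \<theta> x] by (simp add: abs_le_iff)
  thus ?thesis by blast
qed

text \<open>A supremum of reals carries information only for a bounded family; this bound, uniform
  in \<theta>, makes \<open>Bellman\<close> equivalent to conditions on the single indices.\<close>

lemma Bellman_bdd: "bdd_above (range (\<lambda>\<theta>. - trace (Amat \<sigma> \<theta> x ** X) + H \<theta> x p))"
proof -
  obtain B where B: "\<And>\<theta>. \<bar>H \<theta> x p\<bar> \<le> B" using H_bound by blast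
  have "trace (0 :: real^'n^'n) = 0" by (simp add: trace_def)
  hence "- trace (Amat \<sigma> \<theta> x ** X) \<le> C\<^sup>2 * norm X" for \<theta>
    using trace_Amat_diff_le[where \<sigma>=\<sigma> and \<theta>=\<theta> and x=x and y=x and M=X and N=0, OF sigma_bd sigma_bd] by (simp add: abs_le_iff)
  hence "- trace (Amat \<sigma> \<theta> x ** X) + H \<theta> x p \<le> C\<^sup>2 * norm X + B" for \<theta>
    using B[of \<theta>] by (intro add_mono) (auto simp: abs_le_iff)
  thus ?thesis by (intro bdd_aboveI2)
qed

lemma Bellman_le_iff: "Bellman \<sigma> H x p X \<le> b \<longleftrightarrow> (\<forall>\<theta>. - trace (Amat \<sigma> \<theta> x ** X) + H \<theta> x p \<le> b)"
  unfolding Bellman_def by (subst cSUP_le_iff[OF _ Bellman_bdd]) auto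

lemma Bellman_ge_iff: "Bellman \<sigma> H x p X \<ge> b \<longleftrightarrow> (\<forall>\<kappa>>0. \<exists>\<theta>. - trace (Amat \<sigma> \<theta> x ** X) + H \<theta> x p > b - \<kappa>)"
proof
  assume ge: "Bellman \<sigma> H x p X \<ge> b"
  show "\<forall>\<kappa>>0. \<exists>\<theta>. - trace (Amat \<sigma> \<theta> x ** X) + H \<theta> x p > b - \<kappa>"
  proof (intro allI impI)
    fix \<kappa> :: real assume "\<kappa> > 0"
    hence "\<not> Bellman \<sigma> H x p X \<le> b - \<kappa>" using ge by linarith
    thus "\<exists>\<theta>. - trace (Amat \<sigma> \<theta> x ** X) + H \<theta> x p > b - \<kappa>" unfolding Bellman_le_iff by (auto simp: not_le)
  qed
next
  assume r: "\<forall>\<kappa>>0. \<exists>\<theta>. - trace (Amat \<sigma> \<theta> x ** X) + H \<theta> x p > b - \<kappa>"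
  show "Bellman \<sigma> H x p X \<ge> b"
  proof (rule ccontr)
    assume "\<not> ?thesis"
    hence lt: "Bellman \<sigma> H x p X < b" by simp
    define \<kappa> where "\<kappa> = b - Bellman \<sigma> H x p X"
    have "\<kappa> > 0" using lt by (simp add: \<kappa>_def)
    then obtain \<theta> where "- trace (Amat \<sigma> \<theta> x ** X) + H \<theta> x p > b - \<kappa>" using r by blast
    moreover have "- trace (Amat \<sigma> \<theta> x ** X) + H \<theta> x p \<le> Bellman \<sigma> H x p X" using Bellman_le_iff[of x p X "Bellman \<sigma> H x p X"] by blast
    ultimately show False by (simp add: \<kappa>_def)
  qed
qed

text \<open>A test function for u + c t becomes one for u after subtracting c t, which moves c into
  the Hamiltonian.\<close>

lemma cauchy_sol_par:
  assumes "cauchy_sol \<sigma> H u0 u"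
  shows "par_sub \<sigma> Hc (\<lambda>x t. u x t + c * t)" "par_super \<sigma> Hc (\<lambda>x t. u x t + c * t)"
proof -
  note cs = assms[unfolded cauchy_sol_def]
  have aff: "C21_test (\<lambda>x t. 1 * \<phi> x (t + 0) + (-c) * t) (\<lambda>x t. 1 * \<phi>t x (t + 0) + (-c)) (\<lambda>x t. 1 *\<^sub>R D\<phi> x (t + 0)) (\<lambda>x t. 1 *\<^sub>R D2\<phi> x (t + 0))"
    if "C21_test \<phi> \<phi>t D\<phi> D2\<phi>" for \<phi> \<phi>t D\<phi> D2\<phi> by (rule C21_test_affine[OF that])
  show "par_sub \<sigma> Hc (\<lambda>x t. u x t + c * t)"
    unfolding par_sub_def
  proof (intro allI impI)
    fix x0 t0 \<phi> \<phi>t D\<phi> D2\<phi> \<theta>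
    assume t0: "t0 > 0" and \<phi>: "C21_test \<phi> \<phi>t D\<phi> D2\<phi>"
      and "\<exists>\<epsilon>>0. \<forall>y s. dist y x0 < \<epsilon> \<longrightarrow> \<bar>s - t0\<bar> < \<epsilon> \<longrightarrow> u y s + c * s - \<phi> y s \<le> u x0 t0 + c * t0 - \<phi> x0 t0"
    then obtain \<epsilon> where \<epsilon>: "\<epsilon> > 0" "\<And>y s. dist y x0 < \<epsilon> \<Longrightarrow> \<bar>s - t0\<bar> < \<epsilon> \<Longrightarrow> u y s + c * s - \<phi> y s \<le> u x0 t0 + c * t0 - \<phi> x0 t0" by blast
    have "\<exists>\<epsilon>>0. \<forall>y s. dist y x0 < \<epsilon> \<and> \<bar>s - t0\<bar> < \<epsilon> \<and> s > 0 \<longrightarrow> u y s - (1 * \<phi> y (s + 0) + (-c) * s) \<le> u x0 t0 - (1 * \<phi> x0 (t0 + 0) + (-c) * t0)"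
      using \<epsilon> by (intro exI[of _ \<epsilon>]) (auto simp: algebra_simps)
    hence "1 * \<phi>t x0 (t0 + 0) + (-c) + Bellman \<sigma> H x0 (1 *\<^sub>R D\<phi> x0 (t0 + 0)) (1 *\<^sub>R D2\<phi> x0 (t0 + 0)) \<le> 0"
      using cs t0 aff[OF \<phi>] by blast
    hence "Bellman \<sigma> H x0 (D\<phi> x0 t0) (D2\<phi> x0 t0) \<le> c - \<phi>t x0 t0" by simp
    hence "- trace (Amat \<sigma> \<theta> x0 ** D2\<phi> x0 t0) + H \<theta> x0 (D\<phi> x0 t0) \<le> c - \<phi>t x0 t0" unfolding Bellman_le_iff by blast
    thus "\<phi>t x0 t0 - trace (Amat \<sigma> \<theta> x0 ** D2\<phi> x0 t0) + Hc \<theta> x0 (D\<phi> x0 t0) \<le> 0" by (simp add: Hc_def)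
  qed
  show "par_super \<sigma> Hc (\<lambda>x t. u x t + c * t)"
    unfolding par_super_def
  proof (intro allI impI)
    fix x0 t0 \<phi> \<phi>t D\<phi> D2\<phi> and \<kappa> :: real
    assume t0: "t0 > 0" and \<phi>: "C21_test \<phi> \<phi>t D\<phi> D2\<phi>" and \<kappa>: "\<kappa> > 0"
      and "\<exists>\<epsilon>>0. \<forall>y s. dist y x0 < \<epsilon> \<longrightarrow> \<bar>s - t0\<bar> < \<epsilon> \<longrightarrow> u y s + c * s - \<phi> y s \<ge> u x0 t0 + c * t0 - \<phi> x0 t0"
    then obtain \<epsilon> where \<epsilon>: "\<epsilon> > 0" "\<And>y s. dist y x0 < \<epsilon> \<Longrightarrow> \<bar>s - t0\<bar> < \<epsilon> \<Longrightarrow> u y s + c * s - \<phi> y s \<ge> u x0 t0 + c * t0 - \<phi> x0 t0" by blast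
    have "\<exists>\<epsilon>>0. \<forall>y s. dist y x0 < \<epsilon> \<and> \<bar>s - t0\<bar> < \<epsilon> \<and> s > 0 \<longrightarrow> u y s - (1 * \<phi> y (s + 0) + (-c) * s) \<ge> u x0 t0 - (1 * \<phi> x0 (t0 + 0) + (-c) * t0)"
      using \<epsilon> by (intro exI[of _ \<epsilon>]) (auto simp: algebra_simps)
    hence "1 * \<phi>t x0 (t0 + 0) + (-c) + Bellman \<sigma> H x0 (1 *\<^sub>R D\<phi> x0 (t0 + 0)) (1 *\<^sub>R D2\<phi> x0 (t0 + 0)) \<ge> 0"
      using cs t0 aff[OF \<phi>] by blast
    hence "Bellman \<sigma> H x0 (D\<phi> x0 t0) (D2\<phi> x0 t0) \<ge> c - \<phi>t x0 t0" by simp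
    then obtain \<theta> where "- trace (Amat \<sigma> \<theta> x0 ** D2\<phi> x0 t0) + H \<theta> x0 (D\<phi> x0 t0) > c - \<phi>t x0 t0 - \<kappa>"
      unfolding Bellman_ge_iff using \<kappa> by blast
    thus "\<exists>\<theta>. \<phi>t x0 t0 - trace (Amat \<sigma> \<theta> x0 ** D2\<phi> x0 t0) + Hc \<theta> x0 (D\<phi> x0 t0) > - \<kappa>"
      by (intro exI[of _ \<theta>]) (simp add: Hc_def)
  qed
qed

lemma C21_test_slice:
  assumes \<phi>: "C21_test \<phi> \<phi>t D\<phi> D2\<phi>"
  shows "C2_test (\<lambda>x. \<phi> x t) (\<lambda>x. D\<phi> x t) (\<lambda>x. D2\<phi> x t)" "((\<lambda>s. \<phi> x s) has_real_derivative \<phi>t x t) (at t)"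
proof -
  have d: "((\<lambda>(y,s). \<phi> y s) has_derivative (\<lambda>(h,k). D\<phi> x t \<bullet> h + \<phi>t x t * k)) (at (x,t))" for x t
    using \<phi> unfolding C21_test_def by blast
  have "((\<lambda>s. (\<lambda>(y,s). \<phi> y s) (x, s)) has_derivative (\<lambda>k. (\<lambda>(h,k). D\<phi> x t \<bullet> h + \<phi>t x t * k) (0, k))) (at t)"
  proof -
    have 1: "((\<lambda>s. (x, s)) has_derivative (\<lambda>k. (0, k))) (at t)" by (auto intro!: derivative_eq_intros)
    show ?thesis
      by (rule has_derivative_compose[OF 1, where g="\<lambda>(y,s). \<phi> y s" and g'="\<lambda>(h,k). D\<phi> x t \<bullet> h + \<phi>t x t * k"]) (rule d)
  qed
  thus "((\<lambda>s. \<phi> x s) has_real_derivative \<phi>t x t) (at t)" by (simp add: has_field_derivative_def)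
  have "((\<lambda>y. (\<lambda>(y,s). \<phi> y s) (y, t)) has_derivative (\<lambda>h. (\<lambda>(h,k). D\<phi> x t \<bullet> h + \<phi>t x t * k) (h, 0))) (at x)" for x
  proof -
    have 1: "((\<lambda>y. (y, t)) has_derivative (\<lambda>h. (h, 0))) (at x)" by (auto intro!: derivative_eq_intros)
    show ?thesis
      by (rule has_derivative_compose[OF 1, where g="\<lambda>(y,s). \<phi> y s" and g'="\<lambda>(h,k). D\<phi> x t \<bullet> h + \<phi>t x t * k"]) (rule d)
  qed
  hence 1: "((\<lambda>y. \<phi> y t) has_derivative (\<lambda>h. D\<phi> x t \<bullet> h)) (at x)" for x by simp
  have "continuous_on UNIV (\<lambda>(x,t). D2\<phi> x t)" using \<phi> unfolding C21_test_def by blast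
  from continuous_on_compose2[OF this, of UNIV "\<lambda>x. (x, t)"]
  have 2: "continuous_on UNIV (\<lambda>x. D2\<phi> x t)" by (simp add: continuous_on_Pair continuous_on_id)
  show "C2_test (\<lambda>x. \<phi> x t) (\<lambda>x. D\<phi> x t) (\<lambda>x. D2\<phi> x t)"
    unfolding C2_test_def using 1 2 \<phi> by (auto simp: C21_test_def)
qed

text \<open>v does not depend on time, so a test function touching v + m has a local extremum in t
  at the contact point: its time derivative vanishes there, and its time slice is a test function
  for the stationary equation.\<close>

lemma ergodic_sol_par:
  assumes v: "ergodic_sol \<sigma> H c v"
  shows "par_sub \<sigma> Hc (\<lambda>x t. v x + m)" "par_super \<sigma> Hc (\<lambda>x t. v x + m)"
proof -
  note sb = v[unfolded ergodic_sol_def visc_sol_def, THEN conjunct1, unfolded visc_sub_def]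
  note sp = v[unfolded ergodic_sol_def visc_sol_def, THEN conjunct2, unfolded visc_super_def]
  show "par_sub \<sigma> Hc (\<lambda>x t. v x + m)"
    unfolding par_sub_def
  proof (intro allI impI)
    fix x0 t0 \<phi> \<phi>t D\<phi> D2\<phi> \<theta>
    assume t0: "t0 > 0" and \<phi>: "C21_test \<phi> \<phi>t D\<phi> D2\<phi>"
      and "\<exists>\<epsilon>>0. \<forall>y s. dist y x0 < \<epsilon> \<longrightarrow> \<bar>s - t0\<bar> < \<epsilon> \<longrightarrow> v y + m - \<phi> y s \<le> v x0 + m - \<phi> x0 t0"
    then obtain \<epsilon> where \<epsilon>: "\<epsilon> > 0" "\<And>y s. dist y x0 < \<epsilon> \<Longrightarrow> \<bar>s - t0\<bar> < \<epsilon> \<Longrightarrow> v y + m - \<phi> y s \<le> v x0 + m - \<phi> x0 t0" by blast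
    have t: "\<phi>t x0 t0 = 0"
      by (rule DERIV_local_min[OF C21_test_slice(2)[OF \<phi>] \<epsilon>(1)]) (use \<epsilon>(1) \<epsilon>(2)[of x0] in \<open>auto simp: abs_minus_commute\<close>)
    have "\<exists>\<epsilon>>0. \<forall>y. dist y x0 < \<epsilon> \<longrightarrow> v y - \<phi> y t0 \<le> v x0 - \<phi> x0 t0"
      using \<epsilon>(1) \<epsilon>(2)[of _ t0] by (intro exI[of _ \<epsilon>]) auto
    hence "Bellman \<sigma> H x0 (D\<phi> x0 t0) (D2\<phi> x0 t0) - c \<le> 0" using sb C21_test_slice(1)[OF \<phi>, of t0] by blast
    hence "- trace (Amat \<sigma> \<theta> x0 ** D2\<phi> x0 t0) + H \<theta> x0 (D\<phi> x0 t0) \<le> c" using Bellman_le_iff by simp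
    thus "\<phi>t x0 t0 - trace (Amat \<sigma> \<theta> x0 ** D2\<phi> x0 t0) + Hc \<theta> x0 (D\<phi> x0 t0) \<le> 0" by (simp add: Hc_def t)
  qed
  show "par_super \<sigma> Hc (\<lambda>x t. v x + m)"
    unfolding par_super_def
  proof (intro allI impI)
    fix x0 t0 \<phi> \<phi>t D\<phi> D2\<phi> and \<kappa> :: real
    assume t0: "t0 > 0" and \<phi>: "C21_test \<phi> \<phi>t D\<phi> D2\<phi>" and \<kappa>: "\<kappa> > 0"
      and "\<exists>\<epsilon>>0. \<forall>y s. dist y x0 < \<epsilon> \<longrightarrow> \<bar>s - t0\<bar> < \<epsilon> \<longrightarrow> v y + m - \<phi> y s \<ge> v x0 + m - \<phi> x0 t0"
    then obtain \<epsilon> where \<epsilon>: "\<epsilon> > 0" "\<And>y s. dist y x0 < \<epsilon> \<Longrightarrow> \<bar>s - t0\<bar> < \<epsilon> \<Longrightarrow> v y + m - \<phi> y s \<ge> v x0 + m - \<phi> x0 t0" by blast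
    have t: "\<phi>t x0 t0 = 0"
      by (rule DERIV_local_max[OF C21_test_slice(2)[OF \<phi>] \<epsilon>(1)]) (use \<epsilon>(1) \<epsilon>(2)[of x0] in \<open>auto simp: abs_minus_commute\<close>)
    have "\<exists>\<epsilon>>0. \<forall>y. dist y x0 < \<epsilon> \<longrightarrow> v y - \<phi> y t0 \<ge> v x0 - \<phi> x0 t0"
      using \<epsilon>(1) \<epsilon>(2)[of _ t0] by (intro exI[of _ \<epsilon>]) auto
    hence "Bellman \<sigma> H x0 (D\<phi> x0 t0) (D2\<phi> x0 t0) - c \<ge> 0" using sp C21_test_slice(1)[OF \<phi>, of t0] by blast
    then obtain \<theta> where "- trace (Amat \<sigma> \<theta> x0 ** D2\<phi> x0 t0) + H \<theta> x0 (D\<phi> x0 t0) > c - \<kappa>"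
      using Bellman_ge_iff[of c] \<kappa> by auto
    thus "\<exists>\<theta>. \<phi>t x0 t0 - trace (Amat \<sigma> \<theta> x0 ** D2\<phi> x0 t0) + Hc \<theta> x0 (D\<phi> x0 t0) > - \<kappa>"
      by (intro exI[of _ \<theta>]) (simp add: Hc_def t)
  qed
qed

lemma par_ergodic_sol:
  assumes w: "continuous_on UNIV w" "periodic_fun w"
    and sb: "par_sub \<sigma> Hc (\<lambda>x t. w x)" and sp: "par_super \<sigma> Hc (\<lambda>x t. w x)"
  shows "ergodic_sol \<sigma> H c w"
proof -
  have test: "C21_test (\<lambda>x t. \<phi> x) (\<lambda>x t. 0) (\<lambda>x t. D\<phi> x) (\<lambda>x t. D2\<phi> x)" if "C2_test \<phi> D\<phi> D2\<phi>" for \<phi> :: "real^'n \<Rightarrow> real" and D\<phi> D2\<phi>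
    unfolding C21_test_def
  proof (intro conjI allI)
    fix x :: "real^'n" and t :: real
    have p: "(\<phi> has_derivative (\<lambda>h. D\<phi> x \<bullet> h)) (at x)" "(D\<phi> has_derivative (\<lambda>h. D2\<phi> x *v h)) (at x)" for x
      using that unfolding C2_test_def by auto
    have "((\<lambda>z. \<phi> (fst z)) has_derivative (\<lambda>z. D\<phi> x \<bullet> fst z)) (at (x, t))"
      by (rule has_derivative_compose[OF has_derivative_fst[OF has_derivative_ident]]) (simp add: p)
    thus "((\<lambda>(y, s). \<phi> y) has_derivative (\<lambda>(h, k). D\<phi> x \<bullet> h + 0 * k)) (at (x, t))"
      by (simp add: case_prod_unfold)
    show "(D\<phi> has_derivative (\<lambda>h. D2\<phi> x *v h)) (at x)" by (rule p)
    have c: "continuous_on UNIV D2\<phi>" "continuous_on UNIV D\<phi>" using that p(2) unfolding C2_test_def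
      by (auto intro!: continuous_at_imp_continuous_on has_derivative_continuous)
    show "continuous_on UNIV (\<lambda>(x :: real^'n, t :: real). D2\<phi> x)" "continuous_on UNIV (\<lambda>(x :: real^'n, t :: real). D\<phi> x)"
      unfolding case_prod_unfold by (rule continuous_on_compose2[OF c(1)] continuous_on_compose2[OF c(2)], auto intro: continuous_intros)+
  qed auto
  have "visc_sub (\<lambda>x r p X. Bellman \<sigma> H x p X - c) w"
    unfolding visc_sub_def
  proof (intro conjI w allI impI; elim conjE exE)
    fix x0 \<phi> D\<phi> D2\<phi> \<epsilon>
    assume \<phi>: "C2_test \<phi> D\<phi> D2\<phi>" and \<epsilon>: "\<epsilon> > 0" "\<forall>y. dist y x0 < \<epsilon> \<longrightarrow> w y - \<phi> y \<le> w x0 - \<phi> x0"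
    have "0 - trace (Amat \<sigma> \<theta> x0 ** D2\<phi> x0) + Hc \<theta> x0 (D\<phi> x0) \<le> 0" for \<theta>
      using sb[unfolded par_sub_def, rule_format, OF zero_less_one test[OF \<phi>], of x0 \<theta>] \<epsilon> by blast
    thus "Bellman \<sigma> H x0 (D\<phi> x0) (D2\<phi> x0) - c \<le> 0" using Bellman_le_iff[of x0 "D\<phi> x0" "D2\<phi> x0" c] by (simp add: Hc_def algebra_simps)
  qed
  moreover have "visc_super (\<lambda>x r p X. Bellman \<sigma> H x p X - c) w"
    unfolding visc_super_def
  proof (intro conjI w allI impI; elim conjE exE)
    fix x0 \<phi> D\<phi> D2\<phi> \<epsilon>
    assume \<phi>: "C2_test \<phi> D\<phi> D2\<phi>" and \<epsilon>: "\<epsilon> > 0" "\<forall>y. dist y x0 < \<epsilon> \<longrightarrow> w y - \<phi> y \<ge> w x0 - \<phi> x0"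
    have "\<forall>\<kappa>>0. \<exists>\<theta>. 0 - trace (Amat \<sigma> \<theta> x0 ** D2\<phi> x0) + Hc \<theta> x0 (D\<phi> x0) > - \<kappa>"
      using sp[unfolded par_super_def, rule_format, OF zero_less_one test[OF \<phi>], of x0] \<epsilon> by blast
    hence "\<forall>\<kappa>>0. \<exists>\<theta>. - trace (Amat \<sigma> \<theta> x0 ** D2\<phi> x0) + H \<theta> x0 (D\<phi> x0) > c - \<kappa>" by (simp add: Hc_def algebra_simps)
    thus "Bellman \<sigma> H x0 (D\<phi> x0) (D2\<phi> x0) - c \<ge> 0" using Bellman_ge_iff[of c x0 "D\<phi> x0" "D2\<phi> x0"] by simp
  qed
  ultimately show ?thesis by (simp add: ergodic_sol_def visc_sol_def)
qed

text \<open>Uniformity in \<open>\<theta>\<close> lets supersolutions pass to the limit although their index \<open>\<theta>\<close> varies.\<close>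

lemma operator_continuous:
  assumes \<phi>: "C21_test \<phi> \<phi>t D\<phi> D2\<phi>" and \<kappa>: "\<kappa> > 0"
  shows "\<exists>d>0. \<forall>x t \<theta>. norm ((x, t) - (x0, t0)) < d \<longrightarrow>
    \<bar>(\<phi>t x t - trace (Amat \<sigma> \<theta> x ** D2\<phi> x t) + Hc \<theta> x (D\<phi> x t)) - (\<phi>t x0 t0 - trace (Amat \<sigma> \<theta> x0 ** D2\<phi> x0 t0) + Hc \<theta> x0 (D\<phi> x0 t0))\<bar> < \<kappa>"
proof -
  define z0 where "z0 = (x0, t0)"
  define R where "R = norm (D\<phi> x0 t0) + 1"
  have R: "R > 0" by (simp add: R_def add_nonneg_pos)
  obtain CR where CR: "CR > 0" "\<And>\<theta> x y p q. norm p \<le> R \<Longrightarrow> norm q \<le> R \<Longrightarrow> \<bar>Hc \<theta> x p - Hc \<theta> y q\<bar> \<le> CR * (norm (x - y) + norm (p - q))"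
    using Hc_lip R unfolding loc_lip_ham_def by metis
  define E where "E = 1 + C\<^sup>2 + real CARD('n) * (2 * norm (D2\<phi> x0 t0) * C * C) + 2 * CR"
  have E: "E > 0" unfolding E_def using CR C_pos by (intro add_pos_nonneg add_pos_pos mult_nonneg_nonneg) auto
  define \<epsilon> where "\<epsilon> = min 1 (\<kappa> / (2 * E))"
  have \<epsilon>: "\<epsilon> > 0" "\<epsilon> \<le> 1" using \<kappa> E by (auto simp: \<epsilon>_def)
  have "\<epsilon> \<le> \<kappa> / (2 * E)" by (simp add: \<epsilon>_def)
  hence \<epsilon>E: "\<epsilon> * E \<le> \<kappa> / 2" using E by (simp add: pos_le_divide_eq)
  have cs: "isCont (\<lambda>z. \<phi>t (fst z) (snd z)) z0" "isCont (\<lambda>z. D\<phi> (fst z) (snd z)) z0" "isCont (\<lambda>z. D2\<phi> (fst z) (snd z)) z0"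
    using \<phi> unfolding C21_test_def case_prod_unfold z0_def by (auto simp: continuous_on_eq_continuous_at)
  obtain d1 where d1: "d1 > 0" "\<And>z. dist z z0 < d1 \<Longrightarrow> dist (\<phi>t (fst z) (snd z)) (\<phi>t (fst z0) (snd z0)) < \<epsilon>"
    using cs(1) \<epsilon>(1) unfolding continuous_at_eps_delta by metis
  obtain d2 where d2: "d2 > 0" "\<And>z. dist z z0 < d2 \<Longrightarrow> dist (D\<phi> (fst z) (snd z)) (D\<phi> (fst z0) (snd z0)) < \<epsilon>"
    using cs(2) \<epsilon>(1) unfolding continuous_at_eps_delta by metis
  obtain d3 where d3: "d3 > 0" "\<And>z. dist z z0 < d3 \<Longrightarrow> dist (D2\<phi> (fst z) (snd z)) (D2\<phi> (fst z0) (snd z0)) < \<epsilon>"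
    using cs(3) \<epsilon>(1) unfolding continuous_at_eps_delta by metis
  show ?thesis
  proof (intro exI[of _ "min (min d1 d2) (min d3 \<epsilon>)"] conjI allI impI)
    fix x t \<theta> assume n: "norm ((x, t) - (x0, t0)) < min (min d1 d2) (min d3 \<epsilon>)"
    have 1: "\<bar>\<phi>t x t - \<phi>t x0 t0\<bar> < \<epsilon>" and 2: "norm (D\<phi> x t - D\<phi> x0 t0) < \<epsilon>" and 3: "norm (D2\<phi> x t - D2\<phi> x0 t0) < \<epsilon>"
      using d1(2)[of "(x, t)"] d2(2)[of "(x, t)"] d3(2)[of "(x, t)"] n by (auto simp: dist_norm z0_def)
    have 4: "norm (x - x0) < \<epsilon>" using norm_fst_le[where x="x - x0" and y="t - t0"] n by simp
    have "\<bar>trace (Amat \<sigma> \<theta> x ** D2\<phi> x t) - trace (Amat \<sigma> \<theta> x0 ** D2\<phi> x0 t0)\<bar>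
        \<le> C\<^sup>2 * norm (D2\<phi> x t - D2\<phi> x0 t0) + real CARD('n) * (2 * norm (D2\<phi> x0 t0) * C * norm (\<sigma> \<theta> x - \<sigma> \<theta> x0))"
      by (rule trace_Amat_diff_le[where \<sigma>=\<sigma>]; rule sigma_bd)
    also have "\<dots> \<le> C\<^sup>2 * \<epsilon> + real CARD('n) * (2 * norm (D2\<phi> x0 t0) * C * (C * \<epsilon>))"
      using 3 4 C_pos order_trans[OF sigma_lip[of \<theta> x x0] mult_left_mono[of "norm (x - x0)" \<epsilon> C]]
      by (intro add_mono mult_left_mono) auto
    finally have 5: "\<bar>trace (Amat \<sigma> \<theta> x ** D2\<phi> x t) - trace (Amat \<sigma> \<theta> x0 ** D2\<phi> x0 t0)\<bar> \<le> \<epsilon> * (C\<^sup>2 + real CARD('n) * (2 * norm (D2\<phi> x0 t0) * C * C))"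
      by (simp add: algebra_simps)
    have "norm (D\<phi> x t) \<le> R" "norm (D\<phi> x0 t0) \<le> R" using 2 \<epsilon> norm_triangle_ineq2[of "D\<phi> x t" "D\<phi> x0 t0"] by (auto simp: R_def)
    from CR(2)[OF this, of \<theta> x x0] have "\<bar>Hc \<theta> x (D\<phi> x t) - Hc \<theta> x0 (D\<phi> x0 t0)\<bar> \<le> CR * (norm (x - x0) + norm (D\<phi> x t - D\<phi> x0 t0))" .
    also have "\<dots> \<le> CR * (\<epsilon> + \<epsilon>)" using 2 4 CR(1) by (intro mult_left_mono) auto
    finally have 6: "\<bar>Hc \<theta> x (D\<phi> x t) - Hc \<theta> x0 (D\<phi> x0 t0)\<bar> \<le> \<epsilon> * (2 * CR)" by (simp add: algebra_simps)
    have "\<epsilon> * E = \<epsilon> + \<epsilon> * (C\<^sup>2 + real CARD('n) * (2 * norm (D2\<phi> x0 t0) * C * C)) + \<epsilon> * (2 * CR)"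
      by (simp add: E_def algebra_simps)
    thus "\<bar>(\<phi>t x t - trace (Amat \<sigma> \<theta> x ** D2\<phi> x t) + Hc \<theta> x (D\<phi> x t)) - (\<phi>t x0 t0 - trace (Amat \<sigma> \<theta> x0 ** D2\<phi> x0 t0) + Hc \<theta> x0 (D\<phi> x0 t0))\<bar> < \<kappa>"
      using 1 5 6 \<epsilon>E \<kappa> by linarith
  qed (use d1 d2 d3 \<epsilon> in auto)
qed

lemma C21_test_penalised:
  assumes \<phi>: "C21_test \<phi> \<phi>t D\<phi> D2\<phi>"
  shows "C21_test (\<lambda>x t. \<phi> x t + \<eta> * (norm ((x, t) - z0))\<^sup>2) (\<lambda>x t. \<phi>t x t + 2 * \<eta> * snd ((x, t) - z0))
     (\<lambda>x t. D\<phi> x t + (2 * \<eta>) *\<^sub>R fst ((x, t) - z0)) (\<lambda>x t. D2\<phi> x t + xx_block (\<lambda>h. (2 * \<eta>) *\<^sub>R h))"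
  using C21_test_add[OF \<phi> C21_test_quad[OF linear_scale_self[of "2 * \<eta>"], of 0 z0]]
  unfolding quad_scale sym_part_scale by simp

text \<open>By \<open>stable_touch\<close> a slightly penalised test function touches some
  approximant near the contact point, and \<open>operator_continuous\<close> moves the inequality to
  the contact point with the same \<theta>. The supersolution part touches -w from above.\<close>

lemma stability:
  assumes cont: "\<And>n. continuous_on (UNIV \<times> {0..}) (\<lambda>(x,t). wn n x t)"
    and conv: "\<And>\<epsilon>. \<epsilon> > 0 \<Longrightarrow> \<exists>n::nat. \<forall>x. \<forall>t\<ge>0. \<bar>wn n x t - w x t\<bar> < \<epsilon>"
  shows "(\<And>n. par_sub \<sigma> Hc (wn n)) \<Longrightarrow> par_sub \<sigma> Hc w" "(\<And>n. par_super \<sigma> Hc (wn n)) \<Longrightarrow> par_super \<sigma> Hc w"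
proof -
  have small: "\<exists>\<eta>>0. 2 * \<eta> * C\<^sup>2 \<le> \<kappa>" if "\<kappa> > 0" for \<kappa> :: real
    using that C_pos by (intro exI[of _ "\<kappa> / (2 * C\<^sup>2)"]) auto
  show "par_sub \<sigma> Hc w" if sub: "\<And>n. par_sub \<sigma> Hc (wn n)"
    unfolding par_sub_def
  proof (intro allI impI)
    fix x0 t0 \<phi> \<phi>t D\<phi> D2\<phi> \<theta>
    assume t0: "t0 > 0" and \<phi>: "C21_test \<phi> \<phi>t D\<phi> D2\<phi>"
      and max: "\<exists>\<epsilon>>0. \<forall>y s. dist y x0 < \<epsilon> \<longrightarrow> \<bar>s - t0\<bar> < \<epsilon> \<longrightarrow> w y s - \<phi> y s \<le> w x0 t0 - \<phi> x0 t0"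
    show "\<phi>t x0 t0 - trace (Amat \<sigma> \<theta> x0 ** D2\<phi> x0 t0) + Hc \<theta> x0 (D\<phi> x0 t0) \<le> 0"
    proof (rule field_le_epsilon)
      fix \<kappa> :: real assume "\<kappa> > 0"
      hence \<kappa>: "\<kappa> / 2 > 0" by simp
      obtain \<eta> where \<eta>: "\<eta> > 0" "2 * \<eta> * C\<^sup>2 \<le> \<kappa> / 2" using small[OF \<kappa>] by blast
      note T = C21_test_penalised[OF \<phi>, of \<eta> "(x0, t0)"]
      obtain d where d: "d > 0" "\<And>x t. norm ((x, t) - (x0, t0)) < d \<Longrightarrow>
        \<bar>(\<phi>t x t + 2 * \<eta> * snd ((x, t) - (x0, t0)) - trace (Amat \<sigma> \<theta> x ** (D2\<phi> x t + xx_block (\<lambda>h. (2 * \<eta>) *\<^sub>R h))) + Hc \<theta> x (D\<phi> x t + (2 * \<eta>) *\<^sub>R fst ((x, t) - (x0, t0))))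
         - (\<phi>t x0 t0 + 2 * \<eta> * snd ((x0, t0) - (x0, t0)) - trace (Amat \<sigma> \<theta> x0 ** (D2\<phi> x0 t0 + xx_block (\<lambda>h. (2 * \<eta>) *\<^sub>R h))) + Hc \<theta> x0 (D\<phi> x0 t0 + (2 * \<eta>) *\<^sub>R fst ((x0, t0) - (x0, t0))))\<bar> < \<kappa> / 2"
        using operator_continuous[OF T \<kappa>, of x0 t0] by blast
      obtain n x t where xt: "norm ((x, t) - (x0, t0)) < d" "t > 0"
        "\<exists>\<epsilon>>0. \<forall>y s. dist y x < \<epsilon> \<longrightarrow> \<bar>s - t\<bar> < \<epsilon> \<longrightarrow>
          wn n y s - (\<phi> y s + \<eta> * (norm ((y, s) - (x0, t0)))\<^sup>2) \<le> wn n x t - (\<phi> x t + \<eta> * (norm ((x, t) - (x0, t0)))\<^sup>2)"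
        using stable_touch[OF cont conv \<phi> t0 max \<eta>(1) d(1)] by blast
      have "\<phi>t x t + 2 * \<eta> * snd ((x, t) - (x0, t0)) - trace (Amat \<sigma> \<theta> x ** (D2\<phi> x t + xx_block (\<lambda>h. (2 * \<eta>) *\<^sub>R h))) + Hc \<theta> x (D\<phi> x t + (2 * \<eta>) *\<^sub>R fst ((x, t) - (x0, t0))) \<le> 0"
        using sub[unfolded par_sub_def, rule_format, OF xt(2) T xt(3)] .
      moreover have "2 * \<eta> * (norm (\<sigma> \<theta> x0))\<^sup>2 \<le> 2 * \<eta> * C\<^sup>2" using sigma_bd[of \<theta> x0] \<eta> by (intro mult_left_mono power_mono) auto
      moreover have "\<phi>t x0 t0 + 2 * \<eta> * snd ((x0, t0) - (x0, t0)) - trace (Amat \<sigma> \<theta> x0 ** (D2\<phi> x0 t0 + xx_block (\<lambda>h. (2 * \<eta>) *\<^sub>R h))) + Hc \<theta> x0 (D\<phi> x0 t0 + (2 * \<eta>) *\<^sub>R fst ((x0, t0) - (x0, t0)))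
         = \<phi>t x0 t0 - trace (Amat \<sigma> \<theta> x0 ** D2\<phi> x0 t0) - 2 * \<eta> * (norm (\<sigma> \<theta> x0))\<^sup>2 + Hc \<theta> x0 (D\<phi> x0 t0)"
        unfolding trace_Amat_add trace_Amat_xx_block_scale by simp
      ultimately show "\<phi>t x0 t0 - trace (Amat \<sigma> \<theta> x0 ** D2\<phi> x0 t0) + Hc \<theta> x0 (D\<phi> x0 t0) \<le> 0 + \<kappa>"
        using d(2)[OF xt(1)] \<eta>(2) unfolding abs_less_iff by linarith
    qed
  qed
  show "par_super \<sigma> Hc w" if super: "\<And>n. par_super \<sigma> Hc (wn n)"
    unfolding par_super_def
  proof (intro allI impI)
    fix x0 t0 \<phi> \<phi>t D\<phi> D2\<phi> and \<kappa> :: real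
    assume t0: "t0 > 0" and \<phi>: "C21_test \<phi> \<phi>t D\<phi> D2\<phi>" and "\<kappa> > 0"
      and "\<exists>\<epsilon>>0. \<forall>y s. dist y x0 < \<epsilon> \<longrightarrow> \<bar>s - t0\<bar> < \<epsilon> \<longrightarrow> w y s - \<phi> y s \<ge> w x0 t0 - \<phi> x0 t0"
    then obtain \<epsilon> where \<epsilon>: "\<epsilon> > 0" "\<And>y s. dist y x0 < \<epsilon> \<Longrightarrow> \<bar>s - t0\<bar> < \<epsilon> \<Longrightarrow> w y s - \<phi> y s \<ge> w x0 t0 - \<phi> x0 t0" by blast
    have \<kappa>: "\<kappa> / 3 > 0" using \<open>\<kappa> > 0\<close> by simp
    obtain \<eta> where \<eta>: "\<eta> > 0" "2 * \<eta> * C\<^sup>2 \<le> \<kappa> / 3" using small[OF \<kappa>] by blast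
    note T = C21_test_penalised[OF \<phi>, of "- \<eta>" "(x0, t0)"]
    have neg: "C21_test (\<lambda>x t. - \<phi> x t) (\<lambda>x t. - \<phi>t x t) (\<lambda>x t. - D\<phi> x t) (\<lambda>x t. - D2\<phi> x t)"
      using C21_test_affine[OF \<phi>, of "-1" 0 0] by simp
    obtain d where d: "d > 0" "\<And>x t \<theta>. norm ((x, t) - (x0, t0)) < d \<Longrightarrow>
        \<bar>(\<phi>t x t + 2 * - \<eta> * snd ((x, t) - (x0, t0)) - trace (Amat \<sigma> \<theta> x ** (D2\<phi> x t + xx_block (\<lambda>h. (2 * - \<eta>) *\<^sub>R h))) + Hc \<theta> x (D\<phi> x t + (2 * - \<eta>) *\<^sub>R fst ((x, t) - (x0, t0))))
         - (\<phi>t x0 t0 + 2 * - \<eta> * snd ((x0, t0) - (x0, t0)) - trace (Amat \<sigma> \<theta> x0 ** (D2\<phi> x0 t0 + xx_block (\<lambda>h. (2 * - \<eta>) *\<^sub>R h))) + Hc \<theta> x0 (D\<phi> x0 t0 + (2 * - \<eta>) *\<^sub>R fst ((x0, t0) - (x0, t0))))\<bar> < \<kappa> / 3"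
      using operator_continuous[OF T \<kappa>, of x0 t0] by blast
    have cont': "continuous_on (UNIV \<times> {0..}) (\<lambda>(x,t). - wn n x t)" for n
      using continuous_on_minus[OF cont[of n]] by (simp add: case_prod_unfold)
    have conv': "\<exists>n. \<forall>x. \<forall>t\<ge>0. \<bar>- wn n x t - - w x t\<bar> < \<epsilon>" if "\<epsilon> > 0" for \<epsilon>
      using conv[OF that] by (simp add: abs_minus_commute)
    have max': "\<exists>\<epsilon>>0. \<forall>y s. dist y x0 < \<epsilon> \<longrightarrow> \<bar>s - t0\<bar> < \<epsilon> \<longrightarrow> - w y s - - \<phi> y s \<le> - w x0 t0 - - \<phi> x0 t0"
      using \<epsilon> by (intro exI[of _ \<epsilon>]) (auto simp: algebra_simps)
    obtain n x t where xt: "norm ((x, t) - (x0, t0)) < d" "t > 0"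
      "\<exists>\<epsilon>>0. \<forall>y s. dist y x < \<epsilon> \<longrightarrow> \<bar>s - t\<bar> < \<epsilon> \<longrightarrow>
        - wn n y s - (- \<phi> y s + \<eta> * (norm ((y, s) - (x0, t0)))\<^sup>2) \<le> - wn n x t - (- \<phi> x t + \<eta> * (norm ((x, t) - (x0, t0)))\<^sup>2)"
      using stable_touch[OF cont' conv' neg t0 max' \<eta>(1) d(1)] by blast
    have min: "\<exists>\<epsilon>>0. \<forall>y s. dist y x < \<epsilon> \<longrightarrow> \<bar>s - t\<bar> < \<epsilon> \<longrightarrow>
        wn n y s - (\<phi> y s + - \<eta> * (norm ((y, s) - (x0, t0)))\<^sup>2) \<ge> wn n x t - (\<phi> x t + - \<eta> * (norm ((x, t) - (x0, t0)))\<^sup>2)"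
      using xt(3) by (simp add: algebra_simps)
    obtain \<theta> where "\<phi>t x t + 2 * - \<eta> * snd ((x, t) - (x0, t0)) - trace (Amat \<sigma> \<theta> x ** (D2\<phi> x t + xx_block (\<lambda>h. (2 * - \<eta>) *\<^sub>R h))) + Hc \<theta> x (D\<phi> x t + (2 * - \<eta>) *\<^sub>R fst ((x, t) - (x0, t0))) > - (\<kappa> / 3)"
      using super[unfolded par_super_def, rule_format, OF xt(2) T min \<kappa>] by blast
    moreover have "2 * \<eta> * (norm (\<sigma> \<theta> x0))\<^sup>2 \<le> 2 * \<eta> * C\<^sup>2" using sigma_bd[of \<theta> x0] \<eta> by (intro mult_left_mono power_mono) auto
    moreover have "\<phi>t x0 t0 + 2 * - \<eta> * snd ((x0, t0) - (x0, t0)) - trace (Amat \<sigma> \<theta> x0 ** (D2\<phi> x0 t0 + xx_block (\<lambda>h. (2 * - \<eta>) *\<^sub>R h))) + Hc \<theta> x0 (D\<phi> x0 t0 + (2 * - \<eta>) *\<^sub>R fst ((x0, t0) - (x0, t0)))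
         = \<phi>t x0 t0 - trace (Amat \<sigma> \<theta> x0 ** D2\<phi> x0 t0) + 2 * \<eta> * (norm (\<sigma> \<theta> x0))\<^sup>2 + Hc \<theta> x0 (D\<phi> x0 t0)"
      unfolding trace_Amat_add trace_Amat_xx_block_scale by simp
    ultimately have "\<phi>t x0 t0 - trace (Amat \<sigma> \<theta> x0 ** D2\<phi> x0 t0) + Hc \<theta> x0 (D\<phi> x0 t0) > - \<kappa>"
      using d(2)[OF xt(1), of \<theta>] \<eta>(2) \<open>\<kappa> > 0\<close> unfolding abs_less_iff by linarith
    thus "\<exists>\<theta>. \<phi>t x0 t0 - trace (Amat \<sigma> \<theta> x0 ** D2\<phi> x0 t0) + Hc \<theta> x0 (D\<phi> x0 t0) > - \<kappa>" by blast
  qed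
qed

end

section \<open>Degenerate points\<close>

text \<open>Used as a Hessian, it generates through \<open>quad\<close> the penalties in x and in t
  with separate weights.\<close>

definition diag :: "real \<Rightarrow> real \<Rightarrow> (real^'n) \<times> real \<Rightarrow> (real^'n) \<times> real" where
  "diag a b = (\<lambda>(h, s). (a *\<^sub>R h, b * s))"

lemma diag:
  shows linear_diag: "linear (diag a b)" and sym_part_diag: "sym_part (diag a b) = diag a b"
    and trace_diag: "trace (Amat \<sigma> \<theta> x ** xx_block (diag a b)) = a * (norm (\<sigma> \<theta> x))\<^sup>2"
    and quad_diag: "quad p (diag a b) \<zeta> x t = p \<bullet> ((x, t) - \<zeta>) + (a * (norm (x - fst \<zeta>))\<^sup>2 + b * (t - snd \<zeta>)\<^sup>2) / 2"
proof -
  show l: "linear (diag a b)" by (auto simp: diag_def linear_iff scaleR_add_right algebra_simps)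
  have adj: "adjoint (diag a b) = diag a b"
    by (rule adjoint_unique) (auto simp: diag_def inner_prod_def)
  show "sym_part (diag a b) = diag a b" unfolding sym_part_def adj by (rule ext) (simp flip: scaleR_2)
  show "trace (Amat \<sigma> \<theta> x ** xx_block (diag a b)) = a * (norm (\<sigma> \<theta> x))\<^sup>2"
    unfolding trace_Amat_xx_block[OF l] by (simp add: diag_def sum_column_norm[symmetric] sum_distrib_left power2_norm_eq_inner)
  show "quad p (diag a b) \<zeta> x t = p \<bullet> ((x, t) - \<zeta>) + (a * (norm (x - fst \<zeta>))\<^sup>2 + b * (t - snd \<zeta>)\<^sup>2) / 2"
    by (cases \<zeta>) (simp add: quad_def diag_def inner_prod_def dot_square_norm power2_eq_square)
qed

context hj_setting
begin

text \<open>The trace of A = \<sigma> \<sigma>^T is |\<sigma>|^2, so \<sigma> itself vanishes at a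
  degenerate point; the Lipschitz bound then gives linear growth around it.\<close>

lemma sigma_zero:
  assumes "x0 \<in> Sigma_set \<sigma>"
  shows "norm (\<sigma> \<theta> x) \<le> C * norm (x - x0)"
proof -
  have "Amat \<sigma> \<theta> x0 = 0" using assms by (simp add: Sigma_set_def)
  hence "trace (Amat \<sigma> \<theta> x0 ** mat 1) = 0" by (simp add: trace_def)
  hence "\<sigma> \<theta> x0 = 0" unfolding trace_Amat_mat_1 by simp
  thus ?thesis using sigma_lip[of \<theta> x x0] by simp
qed

lemma sigma_zero_sq:
  assumes "x0 \<in> Sigma_set \<sigma>" "norm (x - x0) \<le> r"
  shows "(norm (\<sigma> \<theta> x))\<^sup>2 \<le> C\<^sup>2 * r\<^sup>2"
proof -
  have "norm (\<sigma> \<theta> x) \<le> C * r" using order_trans[OF sigma_zero[OF assms(1)] mult_left_mono[OF assms(2)]] C_pos by simp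
  hence "(norm (\<sigma> \<theta> x))\<^sup>2 \<le> (C * r)\<^sup>2" by (intro power_mono) auto
  thus ?thesis by (simp add: power_mult_distrib)
qed

text \<open>Doubling only the state against a fixed degenerate point \<open>x0\<close>: the penalisation confines
  the maximiser to distance \<open>O(e)\<close> of \<open>x0\<close>, where the diffusion is \<open>O(e\<^sup>2)\<close>.\<close>

lemma nonincreasing_at_degenerate:
  assumes sub: "par_sub \<sigma> Hc w" and cont: "continuous_on (UNIV \<times> {0..}) (\<lambda>(x,t). w x t)"
    and lip: "\<And>x y t. t \<ge> 0 \<Longrightarrow> \<bar>w x t - w y t\<bar> \<le> L * norm (x - y)"
    and x0: "x0 \<in> Sigma_set \<sigma>" and H0: "\<And>\<theta> p. H \<theta> x0 p \<ge> c"
    and st: "0 \<le> s" "s \<le> t1"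
  shows "w x0 t1 \<le> w x0 s"
proof (rule ccontr)
  assume "\<not> w x0 t1 \<le> w x0 s"
  hence gt: "w x0 t1 > w x0 s" by simp
  hence s_t: "s < t1" using st by (cases "s = t1") auto
  have L0: "L \<ge> 0" using lip[of 0 "axis undefined 1" 0] by (auto simp: norm_axis_1)
  define g where "g = (w x0 t1 - w x0 s) / 2"
  have g: "g > 0" using gt by (simp add: g_def)
  define b where "b = t1 + 1"
  have "continuous_on {s..b} (\<lambda>t. w x0 t)"
  proof -
    have "(\<lambda>t. (x0, t)) ` {s..b} \<subseteq> UNIV \<times> {0..}" using st by auto
    moreover have "continuous_on {s..b} (\<lambda>t. (x0, t))" by (intro continuous_intros)
    ultimately show ?thesis using continuous_on_compose2[OF cont, of "{s..b}" "\<lambda>t. (x0, t)"] by simp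
  qed
  hence "bounded ((\<lambda>t. w x0 t) ` {s..b})" by (intro compact_imp_bounded compact_continuous_image) auto
  then obtain B where B: "\<forall>y\<in>(\<lambda>t. w x0 t) ` {s..b}. norm y \<le> B" unfolding bounded_iff by blast
  have tb: "t1 < b" by (simp add: b_def)
  \<comment> \<open>At b the penalty beats the bound B of w at x0 plus the localisation error, which
    is at most 1.\<close>
  obtain \<Lambda> where \<Lambda>: "\<Lambda> > 0" "g * exp (\<Lambda> * (b - t1)) > B + 1 - w x0 s"
    by (rule exp_penalty[OF g tb])
  obtain CR where CR: "CR > 0" "\<And>\<theta> x y p q. norm p \<le> 2 * L + 1 \<Longrightarrow> norm q \<le> 2 * L + 1 \<Longrightarrow> \<bar>Hc \<theta> x p - Hc \<theta> y q\<bar> \<le> CR * (norm (x - y) + norm (p - q))"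
    using Hc_lip L0 unfolding loc_lip_ham_def by (metis add_nonneg_pos mult_nonneg_nonneg zero_le_numeral zero_less_one)
  define c1 where "c1 = g * \<Lambda> * exp (\<Lambda> * (s - t1))"
  have c1: "c1 > 0" using g \<Lambda> by (simp add: c1_def)
  define E where "E = 2 * C\<^sup>2 * L\<^sup>2 + CR * L + L\<^sup>2 + L + 1"
  have E: "E > 0" unfolding E_def using CR L0 by (intro add_nonneg_pos add_nonneg_nonneg mult_nonneg_nonneg) auto
  define e where "e = min 1 (min (g / 2) (c1 / 2)) / E"
  have e: "e > 0" using g c1 E by (simp add: e_def)
  have eE: "e * E \<le> 1" "e * E < g" "e * E < c1" using g c1 E by (auto simp: e_def)
  have e_parts: "e * (2 * C\<^sup>2 * L\<^sup>2 + CR * L) \<le> e * E" "e * L\<^sup>2 \<le> e * E" "e * L + e \<le> e * E"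
  proof -
    have nn: "0 \<le> C\<^sup>2 * L\<^sup>2" "0 \<le> CR * L" "0 \<le> L\<^sup>2" using CR L0 by auto
    show "e * (2 * C\<^sup>2 * L\<^sup>2 + CR * L) \<le> e * E" "e * L\<^sup>2 \<le> e * E" using nn L0 e by (auto simp: E_def intro!: mult_left_mono)
    have "e * (L + 1) \<le> e * E" using nn L0 e by (intro mult_left_mono) (auto simp: E_def)
    thus "e * L + e \<le> e * E" by (simp add: distrib_left)
  qed
  define F where "F = (\<lambda>x t. w x t - (norm (x - x0))\<^sup>2 / e - g * exp (\<Lambda> * (t - t1)))"
  let ?K = "cball x0 1 \<times> {s..b}"
  have "continuous_on ?K (\<lambda>z. F (fst z) (snd z))"
  proof -
    have "continuous_on ?K (\<lambda>z. w (fst z) (snd z))"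
    proof -
      have "?K \<subseteq> UNIV \<times> {0..}" using st by auto
      from continuous_on_subset[OF cont this] show ?thesis by (simp add: case_prod_unfold)
    qed
    thus ?thesis unfolding F_def by (intro continuous_intros) (use e in auto)
  qed
  hence "\<exists>z\<in>?K. \<forall>y\<in>?K. F (fst y) (snd y) \<le> F (fst z) (snd z)"
    using s_t tb by (intro continuous_attains_sup) (auto intro!: compact_Times)
  then obtain z where z: "z \<in> ?K" "\<And>y. y \<in> ?K \<Longrightarrow> F (fst y) (snd y) \<le> F (fst z) (snd z)" by blast
  define x t where "x = fst z" and "t = snd z"
  have xt: "norm (x - x0) \<le> 1" "t \<in> {s..b}" using z(1) by (auto simp: x_def t_def dist_norm norm_minus_commute)
  have max: "F y r \<le> F x t" if "norm (y - x0) \<le> 1" "r \<in> {s..b}" for y r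
    using z(2)[of "(y, r)"] that by (auto simp: x_def t_def dist_norm norm_minus_commute)
  have t0: "t \<ge> 0" using xt st by simp
  have wl: "w x t \<le> w x0 t + L * norm (x - x0)" using lip[OF t0, of x x0] by (simp add: abs_le_iff)
  \<comment> \<open>Comparison with the competitor (x0, t): the penalty is at most the Lipschitz
    gain, whence |x - x0| \<le> L e.\<close>
  have "(norm (x - x0))\<^sup>2 / e \<le> L * norm (x - x0)"
    using max[of x0 t] xt wl unfolding F_def by simp
  hence "(norm (x - x0))\<^sup>2 \<le> (L * e) * norm (x - x0)" using e by (simp add: pos_divide_le_eq mult_ac)
  hence nx: "norm (x - x0) \<le> L * e" unfolding power2_eq_square using L0 e
    by (cases "norm (x - x0) = 0") (auto simp: mult_le_cancel_right)
  have Le: "L * e < 1" using e_parts(3) eE(1) e by (simp add: mult.commute)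
  have nx1: "norm (x - x0) < 1" using nx Le by linarith
  have big: "F x t \<ge> w x0 s + g"
  proof -
    have "F x0 t1 = w x0 s + g" unfolding F_def g_def by (simp add: field_simps)
    thus ?thesis using max[of x0 t1] s_t tb by simp
  qed
  have Fle: "F x t \<le> w x0 t + e * L\<^sup>2 - g * exp (\<Lambda> * (t - t1))"
  proof -
    have "L * norm (x - x0) \<le> L * (L * e)" using nx L0 by (intro mult_left_mono) auto
    moreover have "(norm (x - x0))\<^sup>2 / e \<ge> 0" using e by simp
    ultimately show ?thesis using wl unfolding F_def by (simp add: power2_eq_square mult_ac)
  qed
  have "g * exp (\<Lambda> * (t - t1)) > 0" using g by simp
  hence "t \<noteq> s" using big Fle e_parts(2) eE(2) by auto
  moreover have "t \<noteq> b"
  proof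
    assume tb: "t = b"
    have "\<bar>w x0 b\<bar> \<le> B" using B xt(2) tb by auto
    hence "w x0 b \<le> B" by linarith
    thus False using big Fle e_parts(2) eE(1) \<Lambda>(2) g unfolding tb by linarith
  qed
  ultimately have tI: "s < t" "t < b" using xt by auto
  note T = C21_test_add[OF C21_test_quad[OF linear_diag[of "2 / e" 0], of 0 "(x0, 0)"] C21_test_exp_time[of g \<Lambda> t1]]
  have q: "quad 0 (diag (2 / e) 0) (x0, 0) y r = (norm (y - x0))\<^sup>2 / e" for y r by (simp add: quad_diag)
  have "\<exists>\<epsilon>>0. \<forall>y r. dist y x < \<epsilon> \<longrightarrow> \<bar>r - t\<bar> < \<epsilon> \<longrightarrow> w y r - (quad 0 (diag (2 / e) 0) (x0, 0) y r + g * exp (\<Lambda> * (r - t1)))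
      \<le> w x t - (quad 0 (diag (2 / e) 0) (x0, 0) x t + g * exp (\<Lambda> * (t - t1)))"
  proof (intro exI[of _ "min (1 - norm (x - x0)) (min (t - s) (b - t))"] conjI allI impI)
    fix y r assume a: "dist y x < min (1 - norm (x - x0)) (min (t - s) (b - t))" "\<bar>r - t\<bar> < min (1 - norm (x - x0)) (min (t - s) (b - t))"
    have "norm (y - x0) \<le> 1" using norm_triangle_ineq[of "y - x" "x - x0"] a(1) by (simp add: dist_norm)
    moreover have "r \<in> {s..b}" using a(2) by auto
    ultimately show "w y r - (quad 0 (diag (2 / e) 0) (x0, 0) y r + g * exp (\<Lambda> * (r - t1))) \<le> w x t - (quad 0 (diag (2 / e) 0) (x0, 0) x t + g * exp (\<Lambda> * (t - t1)))"
      using max[of y r] unfolding F_def q by linarith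
  qed (use nx1 tI in auto)
  from sub[unfolded par_sub_def, rule_format, OF _ T this] tI st
  have "snd (0 + sym_part (diag (2 / e) 0) ((x, t) - (x0, 0))) + g * \<Lambda> * exp (\<Lambda> * (t - t1)) - trace (Amat \<sigma> \<theta> x ** (xx_block (diag (2 / e) 0) + 0))
     + Hc \<theta> x (fst (0 + sym_part (diag (2 / e) 0) ((x, t) - (x0, 0))) + 0) \<le> 0" for \<theta> by simp
  hence ineq: "g * \<Lambda> * exp (\<Lambda> * (t - t1)) - (2 / e) * (norm (\<sigma> \<theta> x))\<^sup>2 + Hc \<theta> x ((2 / e) *\<^sub>R (x - x0)) \<le> 0" for \<theta>
    unfolding sym_part_diag by (simp add: trace_diag) (simp add: diag_def)
  \<comment> \<open>The subsolution inequality and the lower bound of H at x0 hold for every index,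
    so one arbitrary \<theta> leads to the contradiction.\<close>
  fix \<theta> :: 'th
  define p where "p = (2 / e) *\<^sub>R (x - x0)"
  have "norm p = (2 / e) * norm (x - x0)" using e by (simp add: p_def)
  also have "\<dots> \<le> (2 / e) * (L * e)" using nx e by (intro mult_left_mono) auto
  finally have pn: "norm p \<le> 2 * L + 1" using e by simp
  have "Hc \<theta> x0 p \<ge> 0" using H0 by (simp add: Hc_def)
  moreover have "\<bar>Hc \<theta> x p - Hc \<theta> x0 p\<bar> \<le> CR * norm (x - x0)" using CR(2)[OF pn pn, of \<theta> x x0] by simp
  moreover have "CR * norm (x - x0) \<le> CR * (L * e)" using nx CR by (intro mult_left_mono) auto
  ultimately have Hlo: "Hc \<theta> x p \<ge> - (CR * (L * e))" by linarith
  have "(2 / e) * (norm (\<sigma> \<theta> x))\<^sup>2 \<le> (2 / e) * (C\<^sup>2 * (L * e)\<^sup>2)" using sigma_zero_sq[OF x0 nx, of \<theta>] e by (intro mult_left_mono) auto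
  also have "\<dots> = e * (2 * C\<^sup>2 * L\<^sup>2)" using e by (simp add: power2_eq_square field_simps)
  finally have "g * \<Lambda> * exp (\<Lambda> * (t - t1)) \<le> e * (2 * C\<^sup>2 * L\<^sup>2 + CR * L)"
    using ineq[of \<theta>] Hlo unfolding p_def by (simp add: algebra_simps)
  moreover have "c1 \<le> g * \<Lambda> * exp (\<Lambda> * (t - t1))"
  proof -
    have "\<Lambda> * (s - t1) \<le> \<Lambda> * (t - t1)" using tI \<Lambda> by (intro mult_left_mono) auto
    thus ?thesis unfolding c1_def using g \<Lambda> by (intro mult_left_mono) auto
  qed
  ultimately show False using e_parts(1) eE(3) by linarith
qed

text \<open>The two times are separate variables already, so only the state is doubled. At a
  degenerate point explicit quadratic test functions suffice: x and y lie within O(1/k^2) of x0 and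
  the penalty has weight k^3, so the second-order terms are O(1/k). Both inequalities see the same
  slope, once as p and once as p/\<mu>.\<close>

lemma degenerate_touch_approx:
  assumes sub: "par_sub \<sigma> Hc w" and super: "par_super \<sigma> Hc w" and cont: "continuous_on (UNIV \<times> {0..}) (\<lambda>(x,t). w x t)"
    and lip: "\<And>x y t. t \<ge> 0 \<Longrightarrow> \<bar>w x t - w y t\<bar> \<le> L * norm (x - y)"
    and x0: "x0 \<in> Sigma_set \<sigma>" and \<mu>: "\<mu> > 0" and ts: "0 < t0" "t0 < s0"
    and max: "\<And>x t s. 0 \<le> t \<Longrightarrow> t \<le> s \<Longrightarrow> w x t - \<mu> * w x s - \<eta> * (s - t) \<le> w x0 t0 - \<mu> * w x0 s0 - \<eta> * (s0 - t0)"
    and \<kappa>: "\<kappa> > 0"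
  shows "\<exists>p. norm p \<le> 2 * (\<mu> * L) \<and> (\<forall>\<theta>. Hc \<theta> x0 p \<le> \<eta> + \<kappa>) \<and> (\<exists>\<theta>. \<mu> * Hc \<theta> x0 ((1/\<mu>) *\<^sub>R p) \<ge> \<eta> - \<kappa>)"
proof -
  have L0: "L \<ge> 0" using lip[of 0 "axis undefined 1" 0] by (auto simp: norm_axis_1)
  define \<Lambda> where "\<Lambda> = \<mu> * L"
  have \<Lambda>0: "\<Lambda> \<ge> 0" using \<mu> L0 by (simp add: \<Lambda>_def)
  define R where "R = max (4 * \<Lambda> + 1) (2 * L + 1)"
  have R: "R > 0" using L0 by (simp add: R_def)
  obtain CR where CR: "CR > 0" "\<And>\<theta> x y p q. norm p \<le> R \<Longrightarrow> norm q \<le> R \<Longrightarrow> \<bar>Hc \<theta> x p - Hc \<theta> y q\<bar> \<le> CR * (norm (x - y) + norm (p - q))"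
    using Hc_lip R unfolding loc_lip_ham_def by metis
  \<comment> \<open>Keeps t positive and t before s, which is the region where \<open>max\<close> is
    available.\<close>
  define \<rho> where "\<rho> = min 1 (min (t0 / 2) ((s0 - t0) / 4))"
  have \<rho>: "\<rho> > 0" "\<rho> \<le> 1" "\<rho> < t0" "2 * \<rho> < s0 - t0" using ts by (auto simp: \<rho>_def min_def)
  define E where "E = 2 * \<Lambda> + 8 * (C\<^sup>2 * \<Lambda>\<^sup>2) + 3 * (CR * \<Lambda>) + 2 * (\<mu> * (CR * \<Lambda>))"
  have nnE: "0 \<le> C\<^sup>2 * \<Lambda>\<^sup>2" "0 \<le> CR * \<Lambda>" "0 \<le> \<mu> * (CR * \<Lambda>)" using CR \<Lambda>0 \<mu> by auto
  obtain k :: real where k: "k \<ge> 1" "2 * \<Lambda> < k * \<rho>" "2 * E \<le> k * \<kappa>"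
  proof
    show "max 1 (max ((2 * \<Lambda> + 1) / \<rho>) (2 * E / \<kappa>)) \<ge> (1::real)" by simp
    have "(2 * \<Lambda> + 1) / \<rho> * \<rho> \<le> max 1 (max ((2 * \<Lambda> + 1) / \<rho>) (2 * E / \<kappa>)) * \<rho>" using \<rho> by (intro mult_right_mono) auto
    thus "2 * \<Lambda> < max 1 (max ((2 * \<Lambda> + 1) / \<rho>) (2 * E / \<kappa>)) * \<rho>" using \<rho> by simp
    have "2 * E / \<kappa> * \<kappa> \<le> max 1 (max ((2 * \<Lambda> + 1) / \<rho>) (2 * E / \<kappa>)) * \<kappa>" using \<kappa> by (intro mult_right_mono) auto
    thus "2 * E \<le> max 1 (max ((2 * \<Lambda> + 1) / \<rho>) (2 * E / \<kappa>)) * \<kappa>" using \<kappa> by simp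
  qed
  have k0: "k > 0" using k(1) by linarith
  \<comment> \<open>The weight k^3 is strong enough for |x - y| \<le> \<Lambda> e to improve the
    localisation to |x - x0| \<le> \<Lambda>/k^2, and weak enough for k^3 |\<sigma>|^2 = O(k^3/k^4)
    to vanish.\<close>
  define e where "e = 1 / k ^ 3"
  have e: "e > 0" using k0 by (simp add: e_def)
  have ek: "e * k ^ 3 = 1" using k0 by (simp add: e_def)
  have k2: "k \<le> k\<^sup>2" "k\<^sup>2 \<le> k ^ 3" "1 \<le> k\<^sup>2" using k(1) by (auto intro: self_le_power power_increasing one_le_power)
  have e_le: "e \<le> 1 / k\<^sup>2" "e \<le> 1 / k" unfolding e_def using k2 k0 by (auto intro!: divide_left_mono mult_pos_pos)
  define D where "D = (\<lambda>x t y s. w x t - \<mu> * w y s - \<eta> * (s - t) - (norm (x - y))\<^sup>2 / e - k * (norm (x - x0))\<^sup>2 - (t - t0)\<^sup>2 - (s - s0)\<^sup>2)"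
  let ?K = "cball x0 1 \<times> {t0 - \<rho>..t0 + \<rho>} \<times> cball x0 1 \<times> {s0 - \<rho>..s0 + \<rho>}"
  have "continuous_on ?K (\<lambda>z. D (fst z) (fst (snd z)) (fst (snd (snd z))) (snd (snd (snd z))))"
  proof -
    have "continuous_on ?K (\<lambda>z. w (fst z) (fst (snd z)))"
    proof -
      have "(\<lambda>z. (fst z, fst (snd z))) ` ?K \<subseteq> UNIV \<times> {0..}" using \<rho> ts by auto
      moreover have "continuous_on ?K (\<lambda>z. (fst z, fst (snd z)))" by (intro continuous_intros)
      ultimately show ?thesis using continuous_on_compose2[OF cont, of ?K "\<lambda>z. (fst z, fst (snd z))"] by simp
    qed
    moreover have "continuous_on ?K (\<lambda>z. w (fst (snd (snd z))) (snd (snd (snd z))))"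
    proof -
      have "(\<lambda>z. (fst (snd (snd z)), snd (snd (snd z)))) ` ?K \<subseteq> UNIV \<times> {0..}" using \<rho> ts by auto
      moreover have "continuous_on ?K (\<lambda>z. (fst (snd (snd z)), snd (snd (snd z))))" by (intro continuous_intros)
      ultimately show ?thesis using continuous_on_compose2[OF cont, of ?K "\<lambda>z. (fst (snd (snd z)), snd (snd (snd z)))"] by (simp add: case_prod_unfold)
    qed
    ultimately show ?thesis unfolding D_def by (intro continuous_intros) (use e in auto)
  qed
  hence "\<exists>z\<in>?K. \<forall>y\<in>?K. D (fst y) (fst (snd y)) (fst (snd (snd y))) (snd (snd (snd y))) \<le> D (fst z) (fst (snd z)) (fst (snd (snd z))) (snd (snd (snd z)))"
    using \<rho> by (intro continuous_attains_sup) (auto intro!: compact_Times)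
  then obtain z where z: "z \<in> ?K" "\<And>y. y \<in> ?K \<Longrightarrow> D (fst y) (fst (snd y)) (fst (snd (snd y))) (snd (snd (snd y))) \<le> D (fst z) (fst (snd z)) (fst (snd (snd z))) (snd (snd (snd z)))" by blast
  define x t y s where "x = fst z" and "t = fst (snd z)" and "y = fst (snd (snd z))" and "s = snd (snd (snd z))"
  have K: "norm (x - x0) \<le> 1" "\<bar>t - t0\<bar> \<le> \<rho>" "norm (y - x0) \<le> 1" "\<bar>s - s0\<bar> \<le> \<rho>"
    using z(1) by (auto simp: x_def t_def y_def s_def dist_norm norm_minus_commute mem_Times_iff)
  have Dmax: "D x' t' y' s' \<le> D x t y s" if "norm (x' - x0) \<le> 1" "\<bar>t' - t0\<bar> \<le> \<rho>" "norm (y' - x0) \<le> 1" "\<bar>s' - s0\<bar> \<le> \<rho>" for x' t' y' s'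
  proof -
    have "(x', t', y', s') \<in> ?K" using that by (auto simp: dist_norm norm_minus_commute)
    from z(2)[OF this] show ?thesis by (simp add: x_def t_def y_def s_def)
  qed
  have t_s: "0 \<le> t" "t \<le> s" "0 < t" "0 < s" using K \<rho> ts by auto
  define P where "P = norm (x - y)"
  have P0: "P \<ge> 0" by (simp add: P_def)
  \<comment> \<open>Compare with the competitor (x0, t0, x0, s0), apply \<open>max\<close> at the
    common state x, and pay for replacing y by x in w(., s) with the Lipschitz constant.\<close>
  have low: "P\<^sup>2 / e + k * (norm (x - x0))\<^sup>2 + (t - t0)\<^sup>2 + (s - s0)\<^sup>2 \<le> \<Lambda> * P"
  proof -
    have "D x0 t0 x0 s0 \<le> D x t y s" by (rule Dmax) (use \<rho> in auto)
    moreover have "w x t - \<mu> * w x s - \<eta> * (s - t) \<le> w x0 t0 - \<mu> * w x0 s0 - \<eta> * (s0 - t0)" by (rule max[OF t_s(1,2)])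
    moreover have "\<mu> * (w x s - w y s) \<le> \<Lambda> * P"
    proof -
      have "s \<ge> 0" using t_s by simp
      hence "w x s - w y s \<le> L * P" using lip[of s x y] by (simp add: P_def abs_le_iff)
      thus ?thesis using \<mu> mult_left_mono[of "w x s - w y s" "L * P" \<mu>] by (simp add: \<Lambda>_def mult.assoc)
    qed
    ultimately show ?thesis unfolding D_def P_def by (simp add: right_diff_distrib)
  qed
  have nn: "0 \<le> P\<^sup>2 / e" "0 \<le> k * (norm (x - x0))\<^sup>2" "0 \<le> (t - t0)\<^sup>2" "0 \<le> (s - s0)\<^sup>2" using e k0 by auto
  have "P\<^sup>2 / e \<le> \<Lambda> * P" using low nn by linarith
  hence "P * P \<le> (\<Lambda> * e) * P" using e by (simp add: pos_divide_le_eq power2_eq_square mult_ac)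
  hence Pe: "P \<le> \<Lambda> * e" using P0 \<Lambda>0 e by (cases "P = 0") (auto simp: mult_le_cancel_right)
  have LP: "\<Lambda> * P \<le> \<Lambda>\<^sup>2 * e" using mult_left_mono[OF Pe \<Lambda>0] by (simp add: power2_eq_square mult.assoc)
  have "k * (norm (x - x0))\<^sup>2 \<le> \<Lambda>\<^sup>2 * e" using low nn LP by linarith
  hence "k ^ 4 * (norm (x - x0))\<^sup>2 \<le> \<Lambda>\<^sup>2 * (e * k ^ 3)"
    using mult_left_mono[of "k * (norm (x - x0))\<^sup>2" "\<Lambda>\<^sup>2 * e" "k ^ 3"] k0 by (simp add: power3_eq_cube power4_eq_xxxx mult_ac)
  hence "(k\<^sup>2 * norm (x - x0))\<^sup>2 \<le> \<Lambda>\<^sup>2" unfolding ek by (simp add: power_mult_distrib flip: power_mult)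
  hence "k\<^sup>2 * norm (x - x0) \<le> \<Lambda>" by (rule power2_le_imp_le) (rule \<Lambda>0)
  hence nx: "norm (x - x0) \<le> \<Lambda> / k\<^sup>2" using k0 by (simp add: pos_le_divide_eq mult.commute)
  have tsq: "\<bar>r\<bar> \<le> \<Lambda> / k" if "r\<^sup>2 \<le> \<Lambda>\<^sup>2 * e" for r
  proof -
    have "r\<^sup>2 \<le> \<Lambda>\<^sup>2 * (1 / k\<^sup>2)" using that mult_left_mono[OF e_le(1), of "\<Lambda>\<^sup>2"] by simp
    also have "\<dots> = (\<Lambda> / k)\<^sup>2" by (simp add: power_divide)
    finally show ?thesis using \<Lambda>0 k0 by (simp add: abs_le_square_iff[symmetric])
  qed
  have nt: "\<bar>t - t0\<bar> \<le> \<Lambda> / k" and ns: "\<bar>s - s0\<bar> \<le> \<Lambda> / k" using low nn LP by (intro tsq; linarith)+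
  have Lk: "\<Lambda> / k < \<rho> / 2" using k(2) k0 by (simp add: pos_divide_less_eq mult.commute)
  have Lk2: "\<Lambda> / k\<^sup>2 \<le> \<Lambda> / k" using k2 k0 \<Lambda>0 by (intro divide_left_mono) auto
  have Le: "\<Lambda> * e \<le> \<Lambda> / k\<^sup>2" using mult_left_mono[OF e_le(1) \<Lambda>0] by simp
  have ny: "norm (y - x0) \<le> 2 * (\<Lambda> / k\<^sup>2)"
    using norm_triangle_ineq[of "y - x" "x - x0"] nx Pe Le by (simp add: P_def norm_minus_commute)
  have inside: "norm (x - x0) < 1" "norm (y - x0) < 1" "\<bar>t - t0\<bar> < \<rho>" "\<bar>s - s0\<bar> < \<rho>"
    using nx ny nt ns Lk Lk2 \<rho> by linarith+
  define r where "r = min (min (1 - norm (x - x0)) (1 - norm (y - x0))) (min (\<rho> - \<bar>t - t0\<bar>) (\<rho> - \<bar>s - s0\<bar>))"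
  have r: "r > 0" using inside by (simp add: r_def)
  define p where "p = (2 / e) *\<^sub>R (x - y)"
  have pn: "norm p \<le> 2 * \<Lambda>"
  proof -
    have "norm p = (2 / e) * P" using e by (simp add: p_def P_def)
    also have "\<dots> \<le> (2 / e) * (\<Lambda> * e)" using Pe e by (intro mult_left_mono) auto
    finally show ?thesis using e by simp
  qed
  have k_e: "2 * k * norm (x - x0) \<le> 2 * (\<Lambda> / k)"
    using mult_left_mono[OF nx, of "2 * k"] k0 by (simp add: power2_eq_square)
  have Lk1: "\<Lambda> / k \<le> \<Lambda>" using k(1) \<Lambda>0 by (simp add: divide_le_eq mult_left_mono[of 1 k \<Lambda>, simplified])
  note T1 = C21_test_add[OF C21_test_quad[OF linear_diag[of "2 / e" 0], of "(0, - \<eta>)" "(y, 0)"] C21_test_quad[OF linear_diag[of "2 * k" 2], of 0 "(x0, t0)"]]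
  have q1: "quad (0, - \<eta>) (diag (2 / e) 0) (y, 0) x' t' + quad 0 (diag (2 * k) 2) (x0, t0) x' t' = - \<eta> * t' + (norm (x' - y))\<^sup>2 / e + k * (norm (x' - x0))\<^sup>2 + (t' - t0)\<^sup>2" for x' t'
    by (simp add: quad_diag inner_prod_def add_divide_distrib)
  have "\<exists>\<epsilon>>0. \<forall>x' t'. dist x' x < \<epsilon> \<longrightarrow> \<bar>t' - t\<bar> < \<epsilon> \<longrightarrow> w x' t' - (quad (0, - \<eta>) (diag (2 / e) 0) (y, 0) x' t' + quad 0 (diag (2 * k) 2) (x0, t0) x' t')
     \<le> w x t - (quad (0, - \<eta>) (diag (2 / e) 0) (y, 0) x t + quad 0 (diag (2 * k) 2) (x0, t0) x t)"
  proof (intro exI[of _ r] conjI r allI impI)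
    fix x' t' assume a: "dist x' x < r" "\<bar>t' - t\<bar> < r"
    have "norm (x' - x0) \<le> 1" using norm_triangle_ineq[of "x' - x" "x - x0"] a(1) by (simp add: dist_norm r_def)
    moreover have "\<bar>t' - t0\<bar> \<le> \<rho>" using a(2) unfolding r_def by linarith
    ultimately have "D x' t' y s \<le> D x t y s" using K by (intro Dmax)
    thus "w x' t' - (quad (0, - \<eta>) (diag (2 / e) 0) (y, 0) x' t' + quad 0 (diag (2 * k) 2) (x0, t0) x' t')
     \<le> w x t - (quad (0, - \<eta>) (diag (2 / e) 0) (y, 0) x t + quad 0 (diag (2 * k) 2) (x0, t0) x t)"
      unfolding q1 D_def by (simp add: right_diff_distrib)
  qed
  from sub[unfolded par_sub_def, rule_format, OF t_s(3) T1 this]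
  have I1: "- \<eta> + 2 * (t - t0) - (2 / e + 2 * k) * (norm (\<sigma> \<theta> x))\<^sup>2 + Hc \<theta> x (p + (2 * k) *\<^sub>R (x - x0)) \<le> 0" for \<theta>
    unfolding sym_part_diag trace_Amat_add trace_diag by (simp add: diag_def p_def distrib_right)
  have e2: "(2 / e) * (\<Lambda> / k\<^sup>2)\<^sup>2 = 2 * (\<Lambda>\<^sup>2 / k)" "k * (\<Lambda> / k\<^sup>2)\<^sup>2 \<le> \<Lambda>\<^sup>2 / k"
  proof -
    show "(2 / e) * (\<Lambda> / k\<^sup>2)\<^sup>2 = 2 * (\<Lambda>\<^sup>2 / k)" using k0 by (simp add: e_def power2_eq_square power3_eq_cube)
    have "k * (\<Lambda> / k\<^sup>2)\<^sup>2 = \<Lambda>\<^sup>2 / k ^ 3" using k0 by (simp add: power2_eq_square power3_eq_cube)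
    also have "\<dots> \<le> \<Lambda>\<^sup>2 / k" using k2 k0 by (intro divide_left_mono) auto
    finally show "k * (\<Lambda> / k\<^sup>2)\<^sup>2 \<le> \<Lambda>\<^sup>2 / k" .
  qed
  have tr1: "(2 / e + 2 * k) * (norm (\<sigma> \<theta> x))\<^sup>2 \<le> 4 * (C\<^sup>2 * \<Lambda>\<^sup>2 / k)" for \<theta>
  proof -
    have "(2 / e + 2 * k) * (norm (\<sigma> \<theta> x))\<^sup>2 \<le> (2 / e + 2 * k) * (C\<^sup>2 * (\<Lambda> / k\<^sup>2)\<^sup>2)"
      using sigma_zero_sq[OF x0 nx] e k0 by (intro mult_left_mono) auto
    also have "\<dots> = C\<^sup>2 * ((2 / e) * (\<Lambda> / k\<^sup>2)\<^sup>2 + 2 * (k * (\<Lambda> / k\<^sup>2)\<^sup>2))" by (simp add: algebra_simps)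
    also have "\<dots> \<le> C\<^sup>2 * (2 * (\<Lambda>\<^sup>2 / k) + 2 * (\<Lambda>\<^sup>2 / k))" using e2 by (intro mult_left_mono add_mono) auto
    finally show ?thesis by (simp add: mult_ac)
  qed
  have Ek: "E / k \<le> \<kappa> / 2" using k(3) k0 by (simp add: pos_divide_le_eq mult.commute)
  have Esum: "E / k = 2 * (\<Lambda> / k) + 8 * (C\<^sup>2 * \<Lambda>\<^sup>2 / k) + 3 * (CR * (\<Lambda> / k)) + 2 * (\<mu> * (CR * (\<Lambda> / k)))"
    by (simp add: E_def add_divide_distrib)
  have nnk: "0 \<le> C\<^sup>2 * \<Lambda>\<^sup>2 / k" "0 \<le> CR * (\<Lambda> / k)" "0 \<le> \<mu> * (CR * (\<Lambda> / k))" "0 \<le> \<Lambda> / k" using nnE k0 \<Lambda>0 CR \<mu> by auto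
  have A: "Hc \<theta> x0 p \<le> \<eta> + \<kappa>" for \<theta>
  proof -
    have "norm (p + (2 * k) *\<^sub>R (x - x0)) \<le> R"
      using norm_triangle_ineq[of p "(2 * k) *\<^sub>R (x - x0)"] pn k_e Lk1 \<Lambda>0 k0 by (simp add: R_def)
    moreover have "norm p \<le> R" using pn \<Lambda>0 by (simp add: R_def)
    ultimately have "\<bar>Hc \<theta> x (p + (2 * k) *\<^sub>R (x - x0)) - Hc \<theta> x0 p\<bar> \<le> CR * (norm (x - x0) + norm (p + (2 * k) *\<^sub>R (x - x0) - p))"
      by (rule CR(2))
    also have "\<dots> \<le> CR * (\<Lambda> / k + 2 * (\<Lambda> / k))"
      using nx Lk2 k_e k0 CR(1) by (intro mult_left_mono add_mono) auto
    finally have "\<bar>Hc \<theta> x (p + (2 * k) *\<^sub>R (x - x0)) - Hc \<theta> x0 p\<bar> \<le> 3 * (CR * (\<Lambda> / k))" by (simp add: algebra_simps)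
    \<comment> \<open>E / k \<le> \<kappa>/2 is the sum of all errors; a, b, d and l stand for its
      four parts in \<open>Esum\<close>.\<close>
    moreover have "h0 \<le> \<eta> + \<kappa>" if "\<bar>h - h0\<bar> \<le> 3 * b" "- \<eta> + 2 * \<tau> - T + h \<le> 0" "T \<le> 4 * a" "\<bar>\<tau>\<bar> \<le> l"
      "2 * l + 8 * a + 3 * b + 2 * d \<le> \<kappa> / 2" "0 \<le> a" "0 \<le> b" "0 \<le> d" "0 \<le> l" for h h0 a b d l \<tau> T :: real
      using that \<kappa> by linarith
    ultimately show ?thesis using I1[of \<theta>] tr1[of \<theta>] nt(1) Ek nnk unfolding Esum by blast
  qed
  define q where "q = (1/\<mu>) *\<^sub>R p"
  \<comment> \<open>The test function is divided by \<mu>, since it must touch w and not \<mu> w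
    from below; so the slope seen by the equation is p/\<mu>.\<close>
  note T2 = C21_test_add[OF C21_test_quad[OF linear_diag[of "- (2 / (\<mu> * e))" 0], of "(0, - \<eta> / \<mu>)" "(x, 0)"] C21_test_quad[OF linear_diag[of 0 "- (2 / \<mu>)"], of 0 "(x0, s0)"]]
  have q2: "quad (0, - \<eta> / \<mu>) (diag (- (2 / (\<mu> * e))) 0) (x, 0) y' s' + quad 0 (diag 0 (- (2 / \<mu>))) (x0, s0) y' s' = - (\<eta> * s' + (norm (y' - x))\<^sup>2 / e + (s' - s0)\<^sup>2) / \<mu>" for y' s'
    using \<mu> e by (simp add: quad_diag inner_prod_def field_simps)
  have mn: "\<exists>\<epsilon>>0. \<forall>y' s'. dist y' y < \<epsilon> \<longrightarrow> \<bar>s' - s\<bar> < \<epsilon> \<longrightarrow> w y' s' - (quad (0, - \<eta> / \<mu>) (diag (- (2 / (\<mu> * e))) 0) (x, 0) y' s' + quad 0 (diag 0 (- (2 / \<mu>))) (x0, s0) y' s')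
     \<ge> w y s - (quad (0, - \<eta> / \<mu>) (diag (- (2 / (\<mu> * e))) 0) (x, 0) y s + quad 0 (diag 0 (- (2 / \<mu>))) (x0, s0) y s)"
  proof (intro exI[of _ r] conjI r allI impI)
    fix y' s' assume a: "dist y' y < r" "\<bar>s' - s\<bar> < r"
    have "norm (y' - x0) \<le> 1" using norm_triangle_ineq[of "y' - y" "y - x0"] a(1) by (simp add: dist_norm r_def)
    moreover have "\<bar>s' - s0\<bar> \<le> \<rho>" using a(2) unfolding r_def by linarith
    ultimately have "D x t y' s' \<le> D x t y s" using K by (intro Dmax)
    hence "\<mu> * w y s + (\<eta> * s + (norm (y - x))\<^sup>2 / e + (s - s0)\<^sup>2) \<le> \<mu> * w y' s' + (\<eta> * s' + (norm (y' - x))\<^sup>2 / e + (s' - s0)\<^sup>2)"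
      unfolding D_def by (simp add: right_diff_distrib norm_minus_commute)
    hence "(\<mu> * w y s + (\<eta> * s + (norm (y - x))\<^sup>2 / e + (s - s0)\<^sup>2)) / \<mu> \<le> (\<mu> * w y' s' + (\<eta> * s' + (norm (y' - x))\<^sup>2 / e + (s' - s0)\<^sup>2)) / \<mu>"
      using \<mu> by (intro divide_right_mono) auto
    thus "w y' s' - (quad (0, - \<eta> / \<mu>) (diag (- (2 / (\<mu> * e))) 0) (x, 0) y' s' + quad 0 (diag 0 (- (2 / \<mu>))) (x0, s0) y' s')
     \<ge> w y s - (quad (0, - \<eta> / \<mu>) (diag (- (2 / (\<mu> * e))) 0) (x, 0) y s + quad 0 (diag 0 (- (2 / \<mu>))) (x0, s0) y s)"
      unfolding q2 using \<mu> by (simp add: add_divide_distrib diff_divide_distrib)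
  qed
  have \<kappa>2: "\<kappa> / (2 * \<mu>) > 0" using \<kappa> \<mu> by simp
  from super[unfolded par_super_def, rule_format, OF t_s(4) T2 mn \<kappa>2]
  obtain \<theta> where "- \<eta> / \<mu> - 2 / \<mu> * (s - s0) + 2 / (\<mu> * e) * (norm (\<sigma> \<theta> y))\<^sup>2 + Hc \<theta> y (- (2 / (\<mu> * e)) *\<^sub>R (y - x)) > - (\<kappa> / (2 * \<mu>))"
    unfolding sym_part_diag trace_Amat_add trace_diag by (auto simp: diag_def)
  moreover have "- (2 / (\<mu> * e)) *\<^sub>R (y - x) = q" by (simp add: q_def p_def algebra_simps)
  ultimately have "- \<eta> / \<mu> - 2 / \<mu> * (s - s0) + 2 / (\<mu> * e) * (norm (\<sigma> \<theta> y))\<^sup>2 + Hc \<theta> y q > - (\<kappa> / (2 * \<mu>))" by simp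
  hence "\<mu> * (- \<eta> / \<mu> - 2 / \<mu> * (s - s0) + 2 / (\<mu> * e) * (norm (\<sigma> \<theta> y))\<^sup>2 + Hc \<theta> y q) > \<mu> * - (\<kappa> / (2 * \<mu>))"
    using \<mu> by (intro mult_strict_left_mono) auto
  moreover have "\<mu> * (- \<eta> / \<mu> - 2 / \<mu> * (s - s0) + 2 / (\<mu> * e) * (norm (\<sigma> \<theta> y))\<^sup>2 + Hc \<theta> y q) = - \<eta> - 2 * (s - s0) + (2 / e) * (norm (\<sigma> \<theta> y))\<^sup>2 + \<mu> * Hc \<theta> y q"
    using \<mu> e by (simp add: field_simps)
  moreover have "\<mu> * - (\<kappa> / (2 * \<mu>)) = - (\<kappa> / 2)" using \<mu> by simp
  ultimately have I2: "- \<eta> - 2 * (s - s0) + (2 / e) * (norm (\<sigma> \<theta> y))\<^sup>2 + \<mu> * Hc \<theta> y q > - (\<kappa> / 2)" by simp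
  have tr2: "(2 / e) * (norm (\<sigma> \<theta> y))\<^sup>2 \<le> 8 * (C\<^sup>2 * \<Lambda>\<^sup>2 / k)"
  proof -
    have "(2 / e) * (norm (\<sigma> \<theta> y))\<^sup>2 \<le> (2 / e) * (C\<^sup>2 * (2 * (\<Lambda> / k\<^sup>2))\<^sup>2)"
      using sigma_zero_sq[OF x0 ny] e by (intro mult_left_mono) auto
    also have "\<dots> = 4 * C\<^sup>2 * ((2 / e) * (\<Lambda> / k\<^sup>2)\<^sup>2)" by (simp add: power2_eq_square)
    also have "\<dots> = 8 * (C\<^sup>2 * \<Lambda>\<^sup>2 / k)" unfolding e2(1) by simp
    finally show ?thesis .
  qed
  have B: "\<mu> * Hc \<theta> x0 q \<ge> \<eta> - \<kappa>"
  proof -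
    have "norm q \<le> R"
    proof -
      have "norm q = norm p / \<mu>" using \<mu> by (simp add: q_def)
      also have "\<dots> \<le> 2 * \<Lambda> / \<mu>" using pn \<mu> by (intro divide_right_mono) auto
      also have "\<dots> = 2 * L" using \<mu> by (simp add: \<Lambda>_def)
      finally show ?thesis by (simp add: R_def)
    qed
    from CR(2)[OF this this, of \<theta> y x0] have "\<bar>Hc \<theta> y q - Hc \<theta> x0 q\<bar> \<le> CR * norm (y - x0)" by simp
    also have "\<dots> \<le> CR * (2 * (\<Lambda> / k))" using ny Lk2 CR(1) by (intro mult_left_mono) auto
    finally have "Hc \<theta> y q - Hc \<theta> x0 q \<le> CR * (2 * (\<Lambda> / k))" by (simp add: abs_le_iff)
    hence "\<mu> * (Hc \<theta> y q - Hc \<theta> x0 q) \<le> \<mu> * (CR * (2 * (\<Lambda> / k)))" using \<mu> by (intro mult_left_mono) auto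
    hence "\<mu> * Hc \<theta> y q - \<mu> * Hc \<theta> x0 q \<le> 2 * (\<mu> * (CR * (\<Lambda> / k)))" by (simp add: right_diff_distrib mult_ac)
    moreover have "\<eta> - \<kappa> \<le> h0" if "h - h0 \<le> 2 * d" "- \<eta> - 2 * \<tau> + T + h > - (\<kappa> / 2)" "T \<le> 8 * a" "\<bar>\<tau>\<bar> \<le> l"
      "2 * l + 8 * a + 3 * b + 2 * d \<le> \<kappa> / 2" "0 \<le> b" for h h0 a b d l \<tau> T :: real
      using that \<kappa> by linarith
    ultimately show ?thesis using I2 tr2 ns(1) Ek nnk unfolding Esum by blast
  qed
  show ?thesis using pn A B unfolding q_def \<Lambda>_def by blast
qed

end

section \<open>Large-time behaviour\<close>

text \<open>Arzela--Ascoli on a ball that contains a representative of every point modulo the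
  lattice. The conclusion is a uniform Cauchy property, the form that contraction in time can
  propagate.\<close>

lemma periodic_equi_lipschitz_subsequence:
  fixes g :: "nat \<Rightarrow> real^'n \<Rightarrow> real"
  assumes per: "\<And>n. periodic_fun (g n)" and lip: "\<And>n x y. \<bar>g n x - g n y\<bar> \<le> L * norm (x - y)"
    and bd: "\<And>n x. \<bar>g n x\<bar> \<le> B"
  shows "\<exists>f::nat \<Rightarrow> nat. strict_mono f \<and> (\<forall>\<epsilon>>0. \<exists>N. \<forall>m\<ge>N. \<forall>n\<ge>N. \<forall>x. \<bar>g (f m) x - g (f n) x\<bar> < \<epsilon>)"
proof -
  let ?S = "cball (0::real^'n) (real CARD('n))"
  have L0: "L \<ge> 0" using lip[of 0 "axis undefined 1" 0] by (auto simp: norm_axis_1)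
  have M: "norm (g n x) \<le> B" for n x using bd by simp
  have equi: "\<exists>d. 0 < d \<and> (\<forall>n y. y \<in> ?S \<and> norm (x - y) < d \<longrightarrow> norm (g n x - g n y) < e)" if e: "0 < e" for x e
  proof (intro exI[of _ "e / (L + 1)"] conjI allI impI)
    fix n y assume "y \<in> ?S \<and> norm (x - y) < e / (L + 1)"
    hence "norm (x - y) * (L + 1) < e" using L0 by (simp add: pos_less_divide_eq)
    moreover have "L * norm (x - y) \<le> norm (x - y) * (L + 1)" by (simp add: algebra_simps)
    ultimately show "norm (g n x - g n y) < e" using lip[of n x y] by simp
  qed (use e L0 in auto)
  have "\<exists>h k. strict_mono (k :: nat \<Rightarrow> nat) \<and> (\<forall>e>0. \<exists>N. \<forall>n x. n \<ge> N \<and> x \<in> ?S \<longrightarrow> norm (g (k n) x - h x) < e)"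
  proof (rule Arzela_Ascoli[of ?S g B])
    show "compact ?S" by simp
    show "norm (g n x) \<le> B" for n x by (rule M)
    show "\<exists>d. 0 < d \<and> (\<forall>n y. y \<in> ?S \<and> norm (x - y) < d \<longrightarrow> norm (g n x - g n y) < e)" if "0 < e" for x e by (rule equi[OF that])
  qed blast
  then obtain h k where k: "strict_mono (k :: nat \<Rightarrow> nat)"
    "\<And>e. 0 < e \<Longrightarrow> \<exists>N. \<forall>n x. n \<ge> N \<and> x \<in> ?S \<longrightarrow> norm (g (k n) x - h x) < e" by blast
  have "\<exists>N. \<forall>m\<ge>N. \<forall>n\<ge>N. \<forall>x. \<bar>g (k m) x - g (k n) x\<bar> < \<epsilon>" if "\<epsilon> > 0" for \<epsilon>
  proof -
    have "\<epsilon> / 2 > 0" using that by simp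
    then obtain N where N: "\<And>n x. n \<ge> N \<Longrightarrow> x \<in> ?S \<Longrightarrow> \<bar>g (k n) x - h x\<bar> < \<epsilon> / 2" using k(2) unfolding real_norm_def by meson
    have "\<bar>g (k m) x - g (k n) x\<bar> < \<epsilon>" if mn: "m \<ge> N" "n \<ge> N" for m n x
    proof -
      obtain l where l: "int_vec l" "norm (x + l) \<le> real CARD('n)" by (rule lattice_reduce[of x])
      hence "x + l \<in> ?S" by simp
      hence "\<bar>g (k m) (x + l) - g (k n) (x + l)\<bar> < \<epsilon>" using N[OF mn(1), of "x + l"] N[OF mn(2), of "x + l"] by linarith
      thus ?thesis using per l(1) unfolding periodic_fun_def by simp
    qed
    thus ?thesis by blast
  qed
  thus ?thesis using k(1) by blast
qed

lemma continuous_translate: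
  assumes cont: "continuous_on (UNIV \<times> {0..}) (\<lambda>(x,t). w x t)" and r: "(r::real) \<ge> 0"
  shows "continuous_on (UNIV \<times> {0..}) (\<lambda>(x,t). w x (t + r))"
proof -
  have "(\<lambda>z. (fst z, snd z + r)) ` (UNIV \<times> {0..}) \<subseteq> UNIV \<times> {0..}" using r by auto
  moreover have "continuous_on (UNIV \<times> {0..}) (\<lambda>z. (fst z, snd z + r))" by (intro continuous_intros)
  ultimately show ?thesis
    using continuous_on_compose2[OF cont, of "UNIV \<times> {0..}" "\<lambda>z. (fst z, snd z + r)"] by (simp add: case_prod_unfold)
qed

context hj_setting
begin

definition lip_sol :: "real \<Rightarrow> (real^'n \<Rightarrow> real \<Rightarrow> real) \<Rightarrow> bool" where
  "lip_sol L w \<longleftrightarrow> par_sub \<sigma> Hc w \<and> par_super \<sigma> Hc w \<and> continuous_on (UNIV \<times> {0..}) (\<lambda>(x,t). w x t) \<and>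
     (\<forall>t. periodic_fun (\<lambda>x. w x t)) \<and> (\<forall>x y. \<forall>t\<ge>0. \<bar>w x t - w y t\<bar> \<le> L * norm (x - y))"

lemma lip_solD:
  assumes "lip_sol L w"
  shows "par_sub \<sigma> Hc w" "par_super \<sigma> Hc w" "continuous_on (UNIV \<times> {0..}) (\<lambda>(x,t). w x t)"
    "periodic_fun (\<lambda>x. w x t)" "t \<ge> 0 \<Longrightarrow> \<bar>w x t - w y t\<bar> \<le> L * norm (x - y)" "L \<ge> 0"
proof -
  show "L \<ge> 0"
  proof -
    have "\<bar>w (axis undefined 1) 0 - w 0 0\<bar> \<le> L * norm (axis undefined 1 - 0 :: real^'n)" using assms unfolding lip_sol_def by blast
    thus ?thesis by (simp add: norm_axis_1)
  qed
qed (use assms in \<open>auto simp: lip_sol_def\<close>)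

lemma lip_sol_mono:
  assumes "lip_sol L w" "L \<le> L'"
  shows "lip_sol L' w"
proof -
  have "\<bar>w x t - w y t\<bar> \<le> L' * norm (x - y)" if "t \<ge> 0" for x y t
    using order_trans[OF lip_solD(5)[OF assms(1) that, of x y] mult_right_mono[OF assms(2) norm_ge_zero]] .
  thus ?thesis using assms(1) unfolding lip_sol_def by blast
qed

lemma lip_sol_translate:
  assumes w: "lip_sol L w" and r: "r \<ge> 0"
  shows "lip_sol L (\<lambda>x t. w x (t + r))"
  using par_sub_translate[OF lip_solD(1)[OF w] r] par_super_affine[OF lip_solD(2)[OF w] r zero_less_one]
    continuous_translate[OF lip_solD(3)[OF w] r] lip_solD(4)[OF w] lip_solD(5)[OF w] r
  unfolding lip_sol_def by simp

text \<open>\<open>str\<close> says that the rescaled Hamiltonian is the smaller one; since \<mu>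
  \<ge> 1, the constant \<mu> L serves both functions.\<close>

lemma scaled_pair:
  assumes w: "lip_sol L w" and v: "lip_sol L v" and \<mu>: "1 \<le> \<mu>" and r: "0 \<le> r"
    and str: "\<And>\<theta> x p. \<mu> * Hc \<theta> x ((1/\<mu>) *\<^sub>R p) \<le> Hc \<theta> x p"
  shows "visc_pair \<sigma> Hc (\<lambda>\<theta> x p. \<mu> * Hc \<theta> x ((1/\<mu>) *\<^sub>R p)) w (\<lambda>x t. \<mu> * v x (t + r)) C (\<mu> * L)"
proof
  have \<mu>0: "\<mu> > 0" using \<mu> by simp
  have L: "L \<ge> 0" by (rule lip_solD(6)[OF w])
  show "loc_lip_ham (\<lambda>\<theta> x p. \<mu> * Hc \<theta> x ((1/\<mu>) *\<^sub>R p))" by (rule loc_lip_ham_scale[OF Hc_lip \<mu>0])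
  show "par_super \<sigma> (\<lambda>\<theta> x p. \<mu> * Hc \<theta> x ((1/\<mu>) *\<^sub>R p)) (\<lambda>x t. \<mu> * v x (t + r))"
    by (rule par_super_affine[OF lip_solD(2)[OF v] r \<mu>0])
  show "continuous_on (UNIV \<times> {0..}) (\<lambda>(x,t). \<mu> * v x (t + r))"
    using continuous_on_mult_left[OF continuous_translate[OF lip_solD(3)[OF v] r], of \<mu>] by (simp add: case_prod_unfold)
  show "periodic_fun (\<lambda>x. \<mu> * v x (t + r))" for t
    using lip_solD(4)[OF v, of "t + r"] unfolding periodic_fun_def by simp
  fix x y :: "real^'n" and t :: real assume t: "t \<ge> 0"
  have "L * norm (x - y) \<le> \<mu> * L * norm (x - y)" using mult_right_mono[OF \<mu>, of "L * norm (x - y)"] L by (simp add: mult_ac)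
  thus "\<bar>w x t - w y t\<bar> \<le> \<mu> * L * norm (x - y)" using lip_solD(5)[OF w t, of x y] by linarith
  have "\<mu> * \<bar>v x (t + r) - v y (t + r)\<bar> \<le> \<mu> * (L * norm (x - y))"
    using lip_solD(5)[OF v, of "t + r" x y] t r \<mu>0 by (intro mult_left_mono) auto
  moreover have "\<bar>\<mu> * v x (t + r) - \<mu> * v y (t + r)\<bar> = \<mu> * \<bar>v x (t + r) - v y (t + r)\<bar>"
    using \<mu>0 by (simp flip: right_diff_distrib add: abs_mult)
  ultimately show "\<bar>\<mu> * v x (t + r) - \<mu> * v y (t + r)\<bar> \<le> \<mu> * L * norm (x - y)" by (simp add: mult.assoc)
qed (use sigma_bd sigma_lip Hc_lip str lip_solD[OF w] in auto)

lemma lip_sol_comparison: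
  assumes w: "lip_sol L w" and v: "lip_sol L' v" and st: "0 \<le> s" "s \<le> t" and init: "\<And>x. w x s - v x s \<le> m"
  shows "w x t - v x t \<le> m"
proof -
  have "visc_pair \<sigma> Hc (\<lambda>\<theta> x p. 1 * Hc \<theta> x ((1/1) *\<^sub>R p)) w (\<lambda>x t. 1 * v x (t + 0)) C (1 * max L L')"
    by (rule scaled_pair[OF lip_sol_mono[OF w] lip_sol_mono[OF v]]) auto
  from visc_pair.comparison[OF this st, of m x] init show ?thesis by simp
qed

text \<open>Time translates solve the same equation, so comparison makes the flow nonexpansive in
  the supremum norm.\<close>

lemma lip_sol_contraction:
  assumes w: "lip_sol L w" and h: "0 \<le> s" "0 \<le> t" "0 \<le> h" and e: "\<And>x. \<bar>w x t - w x s\<bar> \<le> e"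
  shows "\<bar>w x (t + h) - w x (s + h)\<bar> \<le> e"
proof -
  have "w x (h + t) - w x (h + s) \<le> e"
    by (rule lip_sol_comparison[OF lip_sol_translate[OF w h(2)] lip_sol_translate[OF w h(1)] order_refl h(3)]) (use e in \<open>simp add: abs_le_iff\<close>)
  moreover have "w x (h + s) - w x (h + t) \<le> e"
    by (rule lip_sol_comparison[OF lip_sol_translate[OF w h(1)] lip_sol_translate[OF w h(2)] order_refl h(3)]) (use e in \<open>simp add: abs_le_iff\<close>)
  ultimately show ?thesis by (simp add: abs_le_iff add.commute)
qed

text \<open>The Lipschitz ergodic solution is a stationary solution of the equation of w; comparison
  with it in both directions bounds w for all times.\<close>

lemma lip_sol_bounded:
  assumes w: "lip_sol L w" and v: "ergodic_sol \<sigma> H c v" "\<And>x y. \<bar>v x - v y\<bar> \<le> L' * norm (x - y)"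
  shows "\<exists>B. \<forall>x. \<forall>t\<ge>0. \<bar>w x t\<bar> \<le> B"
proof -
  have cv: "continuous_on UNIV v" "periodic_fun v" using v(1) by (auto simp: ergodic_sol_def visc_sol_def visc_sub_def)
  have cv2: "continuous_on A (\<lambda>(x, t::real). v x)" for A
    using continuous_on_compose2[OF cv(1) continuous_on_fst[OF continuous_on_id[of A]]] by (simp add: case_prod_unfold)
  have vs: "lip_sol L' (\<lambda>x t. v x)"
    using ergodic_sol_par[OF v(1), of 0] cv2 cv(2) v(2) unfolding lip_sol_def by simp
  obtain B1 where B1: "\<And>x. \<bar>v x\<bar> \<le> B1"
    using periodic_fun_bounded[OF cv2[of "UNIV \<times> {0..0}"] cv(2)] by auto
  have "continuous_on (UNIV \<times> {0..0}) (\<lambda>(x,t). w x t)" by (rule continuous_on_subset[OF lip_solD(3)[OF w]]) auto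
  from periodic_fun_bounded[OF this lip_solD(4)[OF w]] obtain B2 where B2: "\<And>x. \<bar>w x 0\<bar> \<le> B2" by auto
  have "\<bar>w x t\<bar> \<le> B1 + B2 + B1" if "t \<ge> 0" for x t
  proof -
    have d: "w x 0 - v x \<le> B1 + B2" "v x - w x 0 \<le> B1 + B2" for x using B1[of x] B2[of x] by linarith+
    have "w x t - v x \<le> B1 + B2" by (rule lip_sol_comparison[OF w vs order_refl that d(1)])
    moreover have "v x - w x t \<le> B1 + B2" by (rule lip_sol_comparison[OF vs w order_refl that d(2)])
    ultimately show ?thesis using B1[of x] by linarith
  qed
  thus ?thesis by blast
qed

text \<open>Along a subsequence the profiles at integer times are uniformly Cauchy; contraction
  makes the translates Cauchy uniformly over all later times, so stability gives the limit the same
  equation.\<close>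

lemma omega_limit:
  assumes w: "lip_sol L w" and bd: "\<And>x t. t \<ge> 0 \<Longrightarrow> \<bar>w x t\<bar> \<le> B"
  shows "\<exists>f Z. strict_mono (f :: nat \<Rightarrow> nat) \<and> lip_sol L Z \<and> (\<forall>x. \<forall>t\<ge>0. \<bar>Z x t\<bar> \<le> B) \<and>
    (\<forall>\<epsilon>>0. \<exists>N. \<forall>n\<ge>N. \<forall>x. \<forall>t\<ge>0. \<bar>w x (t + real (f n)) - Z x t\<bar> < \<epsilon>)"
proof -
  obtain f :: "nat \<Rightarrow> nat" where f: "strict_mono f"
    and Cf: "\<And>\<epsilon>. \<epsilon> > 0 \<Longrightarrow> \<exists>N. \<forall>m\<ge>N. \<forall>n\<ge>N. \<forall>x. \<bar>w x (real (f m)) - w x (real (f n))\<bar> < \<epsilon>"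
    using periodic_equi_lipschitz_subsequence[of "\<lambda>n x. w x (real n)" L B] lip_solD(4,5)[OF w] bd by auto
  have Cauchy: "\<exists>N. \<forall>m\<ge>N. \<forall>n\<ge>N. \<forall>x. \<forall>t\<ge>0. \<bar>w x (t + real (f m)) - w x (t + real (f n))\<bar> \<le> \<epsilon>" if e: "\<epsilon> > 0" for \<epsilon>
  proof -
    from Cf[OF e] obtain N where N: "\<And>m n x. m \<ge> N \<Longrightarrow> n \<ge> N \<Longrightarrow> \<bar>w x (real (f m)) - w x (real (f n))\<bar> < \<epsilon>" by blast
    have "\<bar>w x (real (f m) + t) - w x (real (f n) + t)\<bar> \<le> \<epsilon>" if "m \<ge> N" "n \<ge> N" "t \<ge> 0" for m n x t
      by (rule lip_sol_contraction[OF w]) (use that N in \<open>auto intro: less_imp_le\<close>)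
    thus ?thesis by (intro exI[of _ N]) (simp add: add.commute)
  qed
  define Z where "Z = (\<lambda>x t. lim (\<lambda>n. w x (t + real (f n))))"
  have lim: "(\<lambda>n. w x (t + real (f n))) \<longlonglongrightarrow> Z x t" if t: "t \<ge> 0" for x t
  proof -
    have "Cauchy (\<lambda>n. w x (t + real (f n)))"
    proof (rule metric_CauchyI)
      fix e :: real assume "0 < e"
      hence "e / 2 > 0" by simp
      from Cauchy[OF this] obtain N where N: "\<And>m n. m \<ge> N \<Longrightarrow> n \<ge> N \<Longrightarrow> \<bar>w x (t + real (f m)) - w x (t + real (f n))\<bar> \<le> e / 2" using t by blast
      show "\<exists>M. \<forall>m\<ge>M. \<forall>n\<ge>M. dist (w x (t + real (f m))) (w x (t + real (f n))) < e"
      proof (intro exI[of _ N] allI impI)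
        fix m n assume "N \<le> m" "N \<le> n"
        from N[OF this] show "dist (w x (t + real (f m))) (w x (t + real (f n))) < e"
          using \<open>0 < e\<close> unfolding dist_real_def by linarith
      qed
    qed
    hence "convergent (\<lambda>n. w x (t + real (f n)))" by (rule Cauchy_convergent)
    thus ?thesis unfolding Z_def by (simp add: convergent_LIMSEQ_iff)
  qed
  have unif: "\<exists>N. \<forall>n\<ge>N. \<forall>x. \<forall>t\<ge>0. \<bar>w x (t + real (f n)) - Z x t\<bar> < \<epsilon>" if e: "\<epsilon> > 0" for \<epsilon>
  proof -
    have e2: "\<epsilon> / 2 > 0" using e by simp
    from Cauchy[OF e2] obtain N where N: "\<And>m n x t. m \<ge> N \<Longrightarrow> n \<ge> N \<Longrightarrow> t \<ge> 0 \<Longrightarrow> \<bar>w x (t + real (f m)) - w x (t + real (f n))\<bar> \<le> \<epsilon> / 2" by blast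
    have "\<bar>w x (t + real (f n)) - Z x t\<bar> < \<epsilon>" if nt: "n \<ge> N" "t \<ge> 0" for n x t
    proof -
      have "(\<lambda>m. \<bar>w x (t + real (f n)) - w x (t + real (f m))\<bar>) \<longlonglongrightarrow> \<bar>w x (t + real (f n)) - Z x t\<bar>"
        by (intro tendsto_intros lim nt)
      moreover have "\<forall>m\<ge>N. \<bar>w x (t + real (f n)) - w x (t + real (f m))\<bar> \<le> \<epsilon> / 2" using N nt by blast
      ultimately have "\<bar>w x (t + real (f n)) - Z x t\<bar> \<le> \<epsilon> / 2" by (intro LIMSEQ_le_const2) auto
      thus ?thesis using e by linarith
    qed
    thus ?thesis by blast
  qed
  have tr: "lip_sol L (\<lambda>x t. w x (t + real (f n)))" for n by (rule lip_sol_translate[OF w]) simp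
  have conv: "\<exists>n. \<forall>x. \<forall>t\<ge>0. \<bar>w x (t + real (f n)) - Z x t\<bar> < \<epsilon>" if "\<epsilon> > 0" for \<epsilon> using unif[OF that] by blast
  note stab = stability[of "\<lambda>n x t. w x (t + real (f n))" Z, OF lip_solD(3)[OF tr] conv]
  have "lip_sol L Z" unfolding lip_sol_def
  proof (intro conjI allI impI)
    show "par_sub \<sigma> Hc Z" by (rule stab(1)) (auto intro: lip_solD(1)[OF tr])
    show "par_super \<sigma> Hc Z" by (rule stab(2)) (auto intro: lip_solD(2)[OF tr])
    have "uniform_limit (UNIV \<times> {0..}) (\<lambda>n (x,t). w x (t + real (f n))) (\<lambda>(x,t). Z x t) sequentially"
    proof (rule uniform_limitI)
      fix e :: real assume "e > 0"
      from unif[OF this] obtain N where N: "\<And>n x t. n \<ge> N \<Longrightarrow> t \<ge> 0 \<Longrightarrow> \<bar>w x (t + real (f n)) - Z x t\<bar> < e" by blast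
      show "\<forall>\<^sub>F n in sequentially. \<forall>z\<in>UNIV \<times> {0..}. dist (case z of (x, t) \<Rightarrow> w x (t + real (f n))) (case z of (x, t) \<Rightarrow> Z x t) < e"
        unfolding eventually_sequentially by (intro exI[of _ N] allI impI ballI) (use N in \<open>auto simp: dist_real_def\<close>)
    qed
    thus "continuous_on (UNIV \<times> {0..}) (\<lambda>(x,t). Z x t)"
      by (rule uniform_limit_theorem[rotated]) (use lip_solD(3)[OF tr] in auto)
    show "periodic_fun (\<lambda>x. Z x t)" for t
      using lip_solD(4)[OF w] unfolding Z_def periodic_fun_def by simp
    fix x y :: "real^'n" and t :: real assume t: "t \<ge> 0"
    have "(\<lambda>n. \<bar>w x (t + real (f n)) - w y (t + real (f n))\<bar>) \<longlonglongrightarrow> \<bar>Z x t - Z y t\<bar>" by (intro tendsto_intros lim t)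
    thus "\<bar>Z x t - Z y t\<bar> \<le> L * norm (x - y)"
      by (rule LIMSEQ_le_const2) (use lip_solD(5)[OF w] t in auto)
  qed
  moreover have "\<bar>Z x t\<bar> \<le> B" if t: "t \<ge> 0" for x t
  proof -
    have "(\<lambda>n. \<bar>w x (t + real (f n))\<bar>) \<longlonglongrightarrow> \<bar>Z x t\<bar>" by (intro tendsto_intros lim t)
    thus ?thesis by (rule LIMSEQ_le_const2) (use bd t in auto)
  qed
  ultimately show ?thesis using f unif by blast
qed

text \<open>The maximum M(s) for w is nonincreasing by comparison and bounded below, hence has a
  limit l. The maximum for Z at time s is the limit of M(s + f n) along the subsequence, thus equal
  to l whatever s is.\<close>

lemma max_difference_constant:
  assumes w: "lip_sol L w" and bd: "\<And>x t. t \<ge> 0 \<Longrightarrow> \<bar>w x t\<bar> \<le> B"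
    and f: "strict_mono (f :: nat \<Rightarrow> nat)" and Z: "lip_sol L Z"
    and unif: "\<And>\<epsilon>. \<epsilon> > 0 \<Longrightarrow> \<exists>N. \<forall>n\<ge>N. \<forall>x. \<forall>t\<ge>0. \<bar>w x (t + real (f n)) - Z x t\<bar> < \<epsilon>"
    and \<mu>: "1 \<le> \<mu>" and r: "0 \<le> r"
    and str: "\<And>\<theta> x p. \<mu> * Hc \<theta> x ((1/\<mu>) *\<^sub>R p) \<le> Hc \<theta> x p"
  shows "\<exists>m. \<forall>s\<ge>0. (\<forall>x. Z x s - \<mu> * Z x (s + r) \<le> m) \<and> (\<exists>x. Z x s - \<mu> * Z x (s + r) = m)"
proof -
  interpret P: visc_pair \<sigma> Hc "\<lambda>\<theta> x p. \<mu> * Hc \<theta> x ((1/\<mu>) *\<^sub>R p)" w "\<lambda>x t. \<mu> * w x (t + r)" C "\<mu> * L"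
    by (rule scaled_pair[OF w w \<mu> r str])
  interpret Q: visc_pair \<sigma> Hc "\<lambda>\<theta> x p. \<mu> * Hc \<theta> x ((1/\<mu>) *\<^sub>R p)" Z "\<lambda>x t. \<mu> * Z x (t + r)" C "\<mu> * L"
    by (rule scaled_pair[OF Z Z \<mu> r str])
  have attain: "\<exists>x0. \<forall>x. g x s - h x s \<le> g x0 s - h x0 s" if "visc_pair \<sigma> G1 G2 g h C L'" "s \<ge> 0" for G1 G2 g h L' s
    using periodic_attains_max[OF visc_pair.cont_diff[OF that, of s] visc_pair.per_diff[OF that(1)] order_refl] by auto
  obtain X where X: "\<And>s x. s \<ge> 0 \<Longrightarrow> w x s - \<mu> * w x (s + r) \<le> w (X s) s - \<mu> * w (X s) (s + r)"
    using attain[OF P.visc_pair_axioms] by metis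
  obtain Y where Y: "\<And>s x. s \<ge> 0 \<Longrightarrow> Z x s - \<mu> * Z x (s + r) \<le> Z (Y s) s - \<mu> * Z (Y s) (s + r)"
    using attain[OF Q.visc_pair_axioms] by metis
  define M where "M = (\<lambda>s. w (X s) s - \<mu> * w (X s) (s + r))"
  define N where "N = (\<lambda>s. Z (Y s) s - \<mu> * Z (Y s) (s + r))"
  have M_mono: "M t \<le> M s" if "0 \<le> s" "s \<le> t" for s t
    unfolding M_def by (rule P.comparison[OF that X[OF that(1)]])
  have M_bd: "M s \<ge> - (B + \<mu> * B)" if "s \<ge> 0" for s
  proof -
    have "\<mu> * w (X s) (s + r) \<le> \<mu> * B" using bd[of "s + r" "X s"] that r \<mu> by (intro mult_left_mono) (auto simp: abs_le_iff)
    thus ?thesis using bd[OF that, of "X s"] unfolding M_def by (simp add: abs_le_iff)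
  qed
  define l where "l = Inf (M ` {0..})"
  have bdd: "bdd_below (M ` {0..})" using M_bd by (intro bdd_belowI2[where m="- (B + \<mu> * B)"]) auto
  have l_le: "l \<le> M s" if "s \<ge> 0" for s unfolding l_def using that by (intro cInf_lower bdd) auto
  have N_eq: "N s = l" if s: "s \<ge> 0" for s
  proof -
    have ineq: "\<bar>N s - l\<bar> \<le> 0 + e" if e: "e > 0" for e
    proof -
      \<comment> \<open>The error e/2 is shared between w and \<mu> w, hence the factor 1 +
        \<mu>.\<close>
      have e1: "e / (2 * (1 + \<mu>)) > 0" using e \<mu> by simp
      have "Inf (M ` {0..}) < l + e / 2" using e by (simp add: l_def)
      then obtain s1 where s1: "s1 \<ge> 0" "M s1 < l + e / 2"
        using cInf_lessD[of "M ` {0..}"] by auto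
      obtain N0 where N0: "\<And>n x t. n \<ge> N0 \<Longrightarrow> t \<ge> 0 \<Longrightarrow> \<bar>w x (t + real (f n)) - Z x t\<bar> < e / (2 * (1 + \<mu>))" using unif[OF e1] by blast
      obtain n where n: "n \<ge> N0" "real n \<ge> s1" using real_nat_ceiling_ge[of s1] by (metis max.cobounded1 max.cobounded2 of_nat_mono order_trans)
      have "real (f n) \<ge> s1" using n(2) strict_mono_imp_increasing[OF f, of n] by linarith
      hence fs: "s + real (f n) \<ge> 0" "s1 \<le> s + real (f n)" using s s1 by auto
      have close: "\<bar>(w x (s + real (f n)) - \<mu> * w x (s + real (f n) + r)) - (Z x s - \<mu> * Z x (s + r))\<bar> \<le> e / 2" for x
      proof -
        have a: "\<bar>w x (s + real (f n)) - Z x s\<bar> \<le> e / (2 * (1 + \<mu>))" using N0[OF n(1) s, of x] by simp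
        have b: "\<mu> * \<bar>w x (s + r + real (f n)) - Z x (s + r)\<bar> \<le> \<mu> * (e / (2 * (1 + \<mu>)))"
          using N0[OF n(1), of "s + r" x] s r \<mu> by (intro mult_left_mono) auto
        have b': "\<bar>\<mu> * w x (s + real (f n) + r) - \<mu> * Z x (s + r)\<bar> \<le> \<mu> * (e / (2 * (1 + \<mu>)))"
          using b \<mu> by (simp flip: right_diff_distrib add: abs_mult add_ac)
        have sm: "e / (2 * (1 + \<mu>)) + \<mu> * (e / (2 * (1 + \<mu>))) = e / 2"
        proof -
          have "a * (e / (2 * a)) = e / 2" if "a > 0" for a :: real using that by simp
          from this[of "1 + \<mu>"] have "(1 + \<mu>) * (e / (2 * (1 + \<mu>))) = e / 2" using \<mu> by linarith
          thus ?thesis by (simp only: distrib_right mult_1)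
        qed
        show ?thesis using a b' sm by linarith
      qed
      have "N s \<le> M (s + real (f n)) + e / 2"
        using close[of "Y s"] X[OF fs(1), of "Y s"] unfolding N_def M_def abs_le_iff by linarith
      moreover have "M (s + real (f n)) \<le> N s + e / 2"
        using close[of "X (s + real (f n))"] Y[OF s, of "X (s + real (f n))"] unfolding N_def M_def abs_le_iff by linarith
      ultimately show ?thesis using l_le[OF fs(1)] M_mono[OF s1(1) fs(2)] s1(2) unfolding abs_le_iff by linarith
    qed
    have "\<bar>N s - l\<bar> \<le> 0" by (rule field_le_epsilon) (rule ineq)
    thus ?thesis by simp
  qed
  show ?thesis
  proof (intro exI[of _ l] allI impI conjI)
    fix s :: real assume s: "0 \<le> s"
    show "Z x s - \<mu> * Z x (s + r) \<le> l" for x using Y[OF s, of x] N_eq[OF s] by (simp add: N_def)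
    show "\<exists>x. Z x s - \<mu> * Z x (s + r) = l" using N_eq[OF s] by (auto simp: N_def)
  qed
qed

end

section \<open>Use of the structural hypotheses\<close>

locale hj_structured = hj_setting \<sigma> H C c
  for \<sigma> :: "'th \<Rightarrow> real^'n \<Rightarrow> real^'n^'n" and H :: "'th \<Rightarrow> real^'n \<Rightarrow> real^'n \<Rightarrow> real" and C c :: real +
  fixes \<mu>0 :: real and K :: "(real^'n) set"
  assumes sigma_per: "\<And>\<theta>. periodic_fun (\<sigma> \<theta>)"
    and elliptic: "\<And>\<delta>. \<delta> > 0 \<Longrightarrow> \<exists>\<nu>>0. \<forall>\<theta> x. dist_gt x (Sigma_set \<sigma>) \<delta> \<longrightarrow>
                   (\<forall>\<xi>. \<xi> \<bullet> (Amat \<sigma> \<theta> x *v \<xi>) \<ge> \<nu> * (\<xi> \<bullet> \<xi>))"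
    and mu0: "\<mu>0 > 1"
    and superlinear: "\<And>\<theta> x p \<mu>. 1 < \<mu> \<Longrightarrow> \<mu> < \<mu>0 \<Longrightarrow> H \<theta> x (\<mu> *\<^sub>R p) - \<mu> * H \<theta> x p \<ge> (1 - \<mu>) * c"
    and K_closed: "closed K" and K_sub: "K \<subseteq> Sigma_set \<sigma>"
    and H_on_K: "\<And>\<theta> x p. x \<in> K \<Longrightarrow> H \<theta> x p \<ge> c"
    and strictly_superlinear: "\<And>x p \<mu>. x \<in> Sigma_set \<sigma> \<Longrightarrow> (K = {} \<or> infdist x K \<noteq> 0) \<Longrightarrow> p \<noteq> 0 \<Longrightarrow>
                   1 < \<mu> \<Longrightarrow> \<mu> \<le> \<mu>0 \<Longrightarrow> (INF \<theta>. H \<theta> x (\<mu> *\<^sub>R p) - \<mu> * H \<theta> x p) > (1 - \<mu>) * c"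
begin

lemma Hc_scaled:
  assumes "1 \<le> \<mu>" "\<mu> < \<mu>0"
  shows "\<mu> * Hc \<theta> x ((1/\<mu>) *\<^sub>R p) \<le> Hc \<theta> x p"
proof (cases "\<mu> = 1")
  case False
  hence \<mu>: "1 < \<mu>" using assms by simp
  have "\<mu> *\<^sub>R ((1/\<mu>) *\<^sub>R p) = p" using \<mu> by simp
  with superlinear[OF \<mu> assms(2), of \<theta> x "(1/\<mu>) *\<^sub>R p"] have "H \<theta> x p - \<mu> * H \<theta> x ((1/\<mu>) *\<^sub>R p) \<ge> (1 - \<mu>) * c" by metis
  thus ?thesis by (simp add: Hc_def algebra_simps)
qed simp

text \<open>At p = 0 hypothesis (ii)(a) reads (1 - \<mu>) H(x,0) \<ge> (1 - \<mu>) c with \<mu> > 1.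
  It excludes a vanishing limit slope in \<open>no_degenerate_touch\<close>.\<close>

lemma Hc_zero: "Hc \<theta> x 0 \<le> 0"
proof -
  define \<mu> where "\<mu> = (1 + \<mu>0) / 2"
  have \<mu>: "1 < \<mu>" "\<mu> < \<mu>0" using mu0 by (auto simp: \<mu>_def)
  have "(\<mu> - 1) * Hc \<theta> x 0 \<le> 0" using superlinear[OF \<mu>, of \<theta> x 0] by (simp add: Hc_def algebra_simps)
  thus ?thesis using \<mu> by (simp add: mult_le_0_iff)
qed

lemma Sigma_iff: "x \<in> Sigma_set \<sigma> \<longleftrightarrow> (\<forall>\<theta>. \<sigma> \<theta> x = 0)"
proof
  assume "x \<in> Sigma_set \<sigma>"
  from sigma_zero[OF this, of _ x] show "\<forall>\<theta>. \<sigma> \<theta> x = 0" by simp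
next
  assume "\<forall>\<theta>. \<sigma> \<theta> x = 0"
  thus "x \<in> Sigma_set \<sigma>" by (simp add: Sigma_set_def Amat_def matrix_matrix_mult_def vec_eq_iff)
qed

lemma closed_Sigma: "closed (Sigma_set \<sigma>)"
proof -
  have "continuous_on UNIV (\<sigma> \<theta>)" for \<theta>
    by (rule lipschitz_on_continuous_on[of C]) (use sigma_lip C_pos in \<open>auto simp: lipschitz_on_def dist_norm\<close>)
  hence "closed {x. \<sigma> \<theta> x = 0}" for \<theta> by (intro closed_Collect_eq) (auto intro: continuous_intros)
  moreover have "Sigma_set \<sigma> = (\<Inter>\<theta>. {x. \<sigma> \<theta> x = 0})" using Sigma_iff by auto
  ultimately show ?thesis by auto
qed

lemma periodic_Sigma: "periodic_set (Sigma_set \<sigma>)"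
  using sigma_per by (auto simp: periodic_set_def Sigma_set_def periodic_fun_def Amat_def)

text \<open>On K the function w is nonincreasing in time, and for any s and t the shifted time s + f
  n eventually passes t + f N. So Z(x, s) \<le> Z(x, t) regardless of the order of s and t.\<close>

lemma limit_constant_on_K:
  assumes w: "lip_sol L w" and f: "strict_mono (f :: nat \<Rightarrow> nat)" and Z: "lip_sol L Z"
    and unif: "\<And>\<epsilon>. \<epsilon> > 0 \<Longrightarrow> \<exists>N. \<forall>n\<ge>N. \<forall>x. \<forall>t\<ge>0. \<bar>w x (t + real (f n)) - Z x t\<bar> < \<epsilon>"
    and x: "x \<in> K" and st: "0 \<le> s" "0 \<le> t"
  shows "Z x s = Z x t"
proof -
  have x': "x \<in> Sigma_set \<sigma>" using x K_sub by auto
  have "Z x s \<le> Z x t" if st: "0 \<le> s" "0 \<le> t" for s t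
  proof (rule field_le_epsilon)
    fix e :: real assume "e > 0"
    hence e: "e / 2 > 0" by simp
    obtain N where N: "\<And>n x t. n \<ge> N \<Longrightarrow> t \<ge> 0 \<Longrightarrow> \<bar>w x (t + real (f n)) - Z x t\<bar> < e / 2" using unif[OF e] by blast
    obtain k where k: "real k \<ge> t + real (f N)" using real_arch_simple by blast
    define n where "n = max k N"
    have "real n \<ge> t + real (f N)" using k by (simp add: n_def)
    hence le: "t + real (f N) \<le> s + real (f n)" using strict_mono_imp_increasing[OF f, of n] st by linarith
    have "w x (s + real (f n)) \<le> w x (t + real (f N))"
      by (rule nonincreasing_at_degenerate[OF lip_solD(1)[OF w] lip_solD(3)[OF w] lip_solD(5)[OF w] x' H_on_K[OF x] _ le]) (use st in auto)
    moreover have "\<bar>w x (s + real (f n)) - Z x s\<bar> < e / 2" using N[of n s x] st by (simp add: n_def)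
    moreover have "\<bar>w x (t + real (f N)) - Z x t\<bar> < e / 2" using N[of N t x] st by simp
    ultimately show "Z x s \<le> Z x t + e" by linarith
  qed
  thus ?thesis using st by (intro antisym) auto
qed

text \<open>The slopes of \<open>degenerate_touch_approx\<close> accumulate at some q such that, up
  to any error, Hc(x0, q) \<le> \<eta> for all indices and \<mu> Hc(x0, q/\<mu>) \<ge> \<eta> for
  one. If q = 0 this contradicts Hc(x0, 0) \<le> 0; otherwise (ii)(b) at q/\<mu> supplies a gap
  \<delta> that is uniform in \<theta>.\<close>

lemma no_degenerate_touch:
  assumes Z: "lip_sol L Z" and x0: "x0 \<in> Sigma_set \<sigma>" "x0 \<notin> K" and \<mu>: "1 < \<mu>" "\<mu> < \<mu>0" and \<eta>: "\<eta> > 0"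
    and ts: "0 < t0" "t0 < s0"
    and max: "\<And>x t s. 0 \<le> t \<Longrightarrow> t \<le> s \<Longrightarrow> Z x t - \<mu> * Z x s - \<eta> * (s - t) \<le> Z x0 t0 - \<mu> * Z x0 s0 - \<eta> * (s0 - t0)"
  shows False
proof -
  have \<mu>pos: "\<mu> > 0" using \<mu> by simp
  have L0: "L \<ge> 0" by (rule lip_solD(6)[OF Z])
  define R where "R = 2 * (\<mu> * L) + 1"
  have R: "R > 0" using L0 \<mu>pos by (simp add: R_def add_nonneg_pos)
  define \<kappa> where "\<kappa> = (\<lambda>n::nat. 1 / (real n + 1))"
  have "\<exists>p. norm p \<le> 2 * (\<mu> * L) \<and> (\<forall>\<theta>. Hc \<theta> x0 p \<le> \<eta> + \<kappa> n) \<and> (\<exists>\<theta>. \<mu> * Hc \<theta> x0 ((1/\<mu>) *\<^sub>R p) \<ge> \<eta> - \<kappa> n)" for n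
    by (rule degenerate_touch_approx[OF lip_solD(1,2,3)[OF Z] lip_solD(5)[OF Z] x0(1) \<mu>pos ts max]) (auto simp: \<kappa>_def add_nonneg_pos)
  then obtain p where p: "\<And>n. norm (p n) \<le> 2 * (\<mu> * L)" "\<And>n \<theta>. Hc \<theta> x0 (p n) \<le> \<eta> + \<kappa> n"
    "\<And>n. \<exists>\<theta>. \<mu> * Hc \<theta> x0 ((1/\<mu>) *\<^sub>R p n) \<ge> \<eta> - \<kappa> n" by metis
  have "\<forall>n. p n \<in> cball 0 (2 * (\<mu> * L))" using p(1) by simp
  then obtain q g where g: "q \<in> cball 0 (2 * (\<mu> * L))" "strict_mono (g :: nat \<Rightarrow> nat)" "(p \<circ> g) \<longlonglongrightarrow> q"
    using compact_cball[of 0 "2 * (\<mu> * L)"] unfolding compact_def by metis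
  obtain CR where CR: "CR > 0" "\<And>\<theta> x y p q. norm p \<le> R \<Longrightarrow> norm q \<le> R \<Longrightarrow> \<bar>Hc \<theta> x p - Hc \<theta> y q\<bar> \<le> CR * (norm (x - y) + norm (p - q))"
    using Hc_lip R unfolding loc_lip_ham_def by metis
  have nb: "norm v \<le> R" "norm ((1/\<mu>) *\<^sub>R v) \<le> R" if "norm v \<le> 2 * (\<mu> * L)" for v :: "real^'n"
  proof -
    show 1: "norm v \<le> R" using that by (simp add: R_def)
    have "norm v / \<mu> \<le> norm v / 1" using \<mu> by (intro divide_left_mono) auto
    thus "norm ((1/\<mu>) *\<^sub>R v) \<le> R" using 1 \<mu>pos by simp
  qed
  have q: "norm q \<le> 2 * (\<mu> * L)" using g(1) by simp
  have approx: "(\<forall>\<theta>. Hc \<theta> x0 q \<le> \<eta> + e) \<and> (\<exists>\<theta>. \<mu> * Hc \<theta> x0 ((1/\<mu>) *\<^sub>R q) \<ge> \<eta> - e)" if e: "e > 0" for e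
  proof -
    have "(\<lambda>n. \<kappa> (g n) + CR * norm ((p \<circ> g) n - q)) \<longlonglongrightarrow> 0 + CR * norm (q - q)"
    proof (intro tendsto_intros g(3))
      have "\<kappa> \<longlonglongrightarrow> 0" unfolding \<kappa>_def using LIMSEQ_inverse_real_of_nat by (simp add: inverse_eq_divide add.commute)
      from LIMSEQ_subseq_LIMSEQ[OF this g(2)] show "(\<lambda>n. \<kappa> (g n)) \<longlonglongrightarrow> 0" by (simp add: o_def)
    qed
    hence "\<forall>\<^sub>F n in sequentially. \<kappa> (g n) + CR * norm ((p \<circ> g) n - q) < e" by (rule order_tendstoD(2)) (use e in simp)
    then obtain n where n: "\<kappa> (g n) + CR * norm (p (g n) - q) < e" unfolding eventually_sequentially by auto
    have d1: "\<bar>Hc \<theta> x0 (p (g n)) - Hc \<theta> x0 q\<bar> \<le> CR * norm (p (g n) - q)" for \<theta>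
      using CR(2)[OF nb(1)[OF p(1)[of "g n"]] nb(1)[OF q], of \<theta> x0 x0] by simp
    have d2: "\<mu> * \<bar>Hc \<theta> x0 ((1/\<mu>) *\<^sub>R p (g n)) - Hc \<theta> x0 ((1/\<mu>) *\<^sub>R q)\<bar> \<le> CR * norm (p (g n) - q)" for \<theta>
    proof -
      have "\<bar>Hc \<theta> x0 ((1/\<mu>) *\<^sub>R p (g n)) - Hc \<theta> x0 ((1/\<mu>) *\<^sub>R q)\<bar> \<le> CR * norm ((1/\<mu>) *\<^sub>R p (g n) - (1/\<mu>) *\<^sub>R q)"
        using CR(2)[OF nb(2)[OF p(1)[of "g n"]] nb(2)[OF q], of \<theta> x0 x0] by simp
      also have "\<dots> = CR * norm (p (g n) - q) / \<mu>" using \<mu>pos by (simp flip: scaleR_diff_right)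
      finally show ?thesis using \<mu>pos by (simp add: pos_le_divide_eq mult.commute)
    qed
    have "Hc \<theta> x0 q \<le> \<eta> + e" for \<theta> using d1[of \<theta>] p(2)[of \<theta> "g n"] n unfolding abs_le_iff by linarith
    moreover obtain \<theta> where \<theta>: "\<mu> * Hc \<theta> x0 ((1/\<mu>) *\<^sub>R p (g n)) \<ge> \<eta> - \<kappa> (g n)" using p(3) by blast
    have "\<mu> * (Hc \<theta> x0 ((1/\<mu>) *\<^sub>R p (g n)) - Hc \<theta> x0 ((1/\<mu>) *\<^sub>R q)) \<le> CR * norm (p (g n) - q)"
      by (rule order_trans[OF mult_left_mono d2[of \<theta>]]) (use \<mu>pos in auto)
    hence "\<mu> * Hc \<theta> x0 ((1/\<mu>) *\<^sub>R q) \<ge> \<eta> - e" using \<theta> n by (simp add: right_diff_distrib)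
    ultimately show ?thesis by blast
  qed
  show False
  proof (cases "q = 0")
    case True
    have "\<eta> / 2 > 0" using \<eta> by simp
    from approx[OF this] obtain \<theta> where "\<mu> * Hc \<theta> x0 0 \<ge> \<eta> - \<eta> / 2" using True by auto
    moreover have "\<mu> * Hc \<theta> x0 0 \<le> 0" using Hc_zero \<mu>pos by (simp add: mult_le_0_iff)
    ultimately show False using \<eta> by simp
  next
    case False
    define p' where "p' = (1/\<mu>) *\<^sub>R q"
    have p': "p' \<noteq> 0" "\<mu> *\<^sub>R p' = q" using False \<mu>pos by (auto simp: p'_def)
    have Kx: "K = {} \<or> infdist x0 K \<noteq> 0" using x0(2) K_closed by (metis in_closed_iff_infdist_zero)
    define \<delta> where "\<delta> = (INF \<theta>. H \<theta> x0 (\<mu> *\<^sub>R p') - \<mu> * H \<theta> x0 p') - (1 - \<mu>) * c"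
    have \<delta>: "\<delta> > 0" using strictly_superlinear[OF x0(1) Kx p'(1) \<mu>(1) less_imp_le[OF \<mu>(2)]] by (simp add: \<delta>_def)
    obtain B1 B2 where B: "\<And>\<theta>. \<bar>H \<theta> x0 q\<bar> \<le> B1" "\<And>\<theta>. \<bar>H \<theta> x0 p'\<bar> \<le> B2" using H_bound by metis
    have "bdd_below (range (\<lambda>\<theta>. H \<theta> x0 (\<mu> *\<^sub>R p') - \<mu> * H \<theta> x0 p'))"
    proof (rule bdd_belowI2[where m="- B1 - \<mu> * B2"])
      fix \<theta>
      have "\<mu> * H \<theta> x0 p' \<le> \<mu> * B2" using B(2)[of \<theta>] \<mu>pos by (simp add: abs_le_iff)
      thus "- B1 - \<mu> * B2 \<le> H \<theta> x0 (\<mu> *\<^sub>R p') - \<mu> * H \<theta> x0 p'" unfolding p'(2) using B(1)[of \<theta>] by (simp add: abs_le_iff)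
    qed
    hence inf: "(INF \<theta>. H \<theta> x0 (\<mu> *\<^sub>R p') - \<mu> * H \<theta> x0 p') \<le> H \<theta> x0 (\<mu> *\<^sub>R p') - \<mu> * H \<theta> x0 p'" for \<theta>
      by (rule cINF_lower) simp
    have gap: "Hc \<theta> x0 q - \<mu> * Hc \<theta> x0 p' \<ge> \<delta>" for \<theta>
      using inf[of \<theta>] unfolding p'(2) \<delta>_def by (simp add: Hc_def algebra_simps)
    have "\<delta> / 4 > 0" using \<delta> by simp
    from approx[OF this] obtain \<theta> where "\<mu> * Hc \<theta> x0 p' \<ge> \<eta> - \<delta> / 4" "Hc \<theta> x0 q \<le> \<eta> + \<delta> / 4" unfolding p'_def by blast
    thus False using gap[of \<theta>] \<delta> by linarith
  qed
qed

text \<open>When the degenerate set is empty, \<open>dist_gt\<close> holds everywhere by its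
  convention, so ellipticity is uniform and S may be any set.\<close>

lemma elliptic_off:
  assumes "S = Sigma_set \<sigma> \<or> Sigma_set \<sigma> = {}" "\<delta> > 0"
  shows "\<exists>\<nu>>0. \<forall>\<theta> x. infdist x S > \<delta> \<longrightarrow> (\<forall>\<xi>. \<xi> \<bullet> (Amat \<sigma> \<theta> x *v \<xi>) \<ge> \<nu> * (\<xi> \<bullet> \<xi>))"
  using elliptic[OF assms(2)] assms(1) unfolding dist_gt_def by metis

text \<open>(\<mu> - 1) B is the most that r = 0 can contribute, so a larger value of m r - \<eta> r
  forces the maximum to a positive r, and there the difference attains its maximum m r at every
  time.\<close>

lemma difference_bound:
  assumes Z: "lip_sol L Z" and bd: "\<And>x t. t \<ge> 0 \<Longrightarrow> \<bar>Z x t\<bar> \<le> B"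
    and stat: "\<And>x s t. x \<in> K \<Longrightarrow> 0 \<le> s \<Longrightarrow> 0 \<le> t \<Longrightarrow> Z x s = Z x t"
    and \<mu>: "1 < \<mu>" "\<mu> < \<mu>0"
    and m: "\<And>r s x. 0 \<le> r \<Longrightarrow> 0 \<le> s \<Longrightarrow> Z x s - \<mu> * Z x (s + r) \<le> m r"
      "\<And>r s. 0 \<le> r \<Longrightarrow> 0 \<le> s \<Longrightarrow> \<exists>x. Z x s - \<mu> * Z x (s + r) = m r"
    and \<eta>: "\<eta> > 0" and r1: "r1 \<ge> 0"
  shows "m r1 - \<eta> * r1 \<le> (\<mu> - 1) * B"
proof (rule ccontr)
  assume "\<not> ?thesis"
  hence gt: "m r1 - \<eta> * r1 > (\<mu> - 1) * B" by simp
  have B0: "B \<ge> 0" using bd[of 0 0] by simp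
  have \<mu>B: "(\<mu> - 1) * B \<ge> 0" using \<mu> B0 by simp
  \<comment> \<open>Beyond (B + \<mu> B)/\<eta> the penalty \<eta> r exceeds every possible
    difference, so the maximum over r may be sought on a compact interval.\<close>
  define R where "R = max r1 ((B + \<mu> * B) / \<eta>)"
  have R0: "0 \<le> R" using r1 by (simp add: R_def)
  have "continuous_on (UNIV \<times> {0..R}) (\<lambda>(x,r). Z x 1 - \<mu> * Z x (1 + r) - \<eta> * r)"
  proof -
    have "(\<lambda>z. (fst z, 1::real)) ` (UNIV \<times> {0..R}) \<subseteq> UNIV \<times> {0..}" "(\<lambda>z. (fst z, 1 + snd z)) ` (UNIV \<times> {0..R}) \<subseteq> UNIV \<times> {0..}" by auto
    moreover have "continuous_on (UNIV \<times> {0..R}) (\<lambda>z. (fst z, 1 :: real))" "continuous_on (UNIV \<times> {0..R}) (\<lambda>z. (fst z, 1 + snd z))"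
      by (intro continuous_intros)+
    ultimately have "continuous_on (UNIV \<times> {0..R}) (\<lambda>z. Z (fst z) 1)" "continuous_on (UNIV \<times> {0..R}) (\<lambda>z. Z (fst z) (1 + snd z))"
      using continuous_on_compose2[OF lip_solD(3)[OF Z], of "UNIV \<times> {0..R}" "\<lambda>z. (fst z, 1)"]
        continuous_on_compose2[OF lip_solD(3)[OF Z], of "UNIV \<times> {0..R}" "\<lambda>z. (fst z, 1 + snd z)"] by simp_all
    thus ?thesis unfolding case_prod_unfold by (intro continuous_intros)
  qed
  moreover have "periodic_fun (\<lambda>x. Z x 1 - \<mu> * Z x (1 + r) - \<eta> * r)" for r
    using lip_solD(4)[OF Z] unfolding periodic_fun_def by simp
  ultimately obtain xs rs where rs: "rs \<in> {0..R}"
    "\<And>x r. r \<in> {0..R} \<Longrightarrow> Z x 1 - \<mu> * Z x (1 + r) - \<eta> * r \<le> Z xs 1 - \<mu> * Z xs (1 + rs) - \<eta> * rs"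
    using periodic_attains_max[of 0 R "\<lambda>x r. Z x 1 - \<mu> * Z x (1 + r) - \<eta> * r"] R0 by blast
  \<comment> \<open>Time 1 represents all times because m r does not depend on time, and it leaves
    room on both sides for the strong maximum principle.\<close>
  define M where "M = Z xs 1 - \<mu> * Z xs (1 + rs) - \<eta> * rs"
  have M1: "m r - \<eta> * r \<le> M" if r: "r \<in> {0..R}" for r
  proof -
    obtain x where "Z x 1 - \<mu> * Z x (1 + r) = m r" using m(2)[of r 1] r by auto
    thus ?thesis using rs(2)[OF r, of x] unfolding M_def by simp
  qed
  have M_gt: "M > (\<mu> - 1) * B" using M1[of r1] gt r1 by (simp add: R_def)
  have M2: "m r - \<eta> * r \<le> M" if r: "r \<ge> 0" for r
  proof (cases "r \<le> R")
    case False
    hence "(B + \<mu> * B) / \<eta> < r" by (simp add: R_def)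
    hence "B + \<mu> * B < \<eta> * r" using \<eta> by (simp add: pos_divide_less_eq mult.commute)
    moreover obtain x where x: "Z x 1 - \<mu> * Z x (1 + r) = m r" using m(2)[OF r, of 1] by auto
    moreover have "\<mu> * Z x (1 + r) \<ge> \<mu> * (- B)" using bd[of "1 + r" x] r \<mu> by (intro mult_left_mono) (auto simp: abs_le_iff)
    moreover have "Z x 1 \<le> B" using bd[of 1 x] by (simp add: abs_le_iff)
    ultimately show ?thesis using M_gt \<mu>B by simp
  qed (use M1 r in simp)
  have self: "Z x s - \<mu> * Z x s \<le> (\<mu> - 1) * B" if "s \<ge> 0" for x s
  proof -
    have "(\<mu> - 1) * (- Z x s) \<le> (\<mu> - 1) * B" using bd[OF that, of x] \<mu> by (intro mult_left_mono) (auto simp: abs_le_iff)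
    thus ?thesis by (simp add: algebra_simps)
  qed
  have "rs \<noteq> 0" using self[of 1 xs] M_gt by (auto simp: M_def)
  hence rs0: "rs > 0" using rs(1) by simp
  have mrs: "m rs = M + \<eta> * rs" using M2[of rs] m(1)[of rs 1 xs] rs0 by (simp add: M_def)
  have mrs_gt: "m rs > (\<mu> - 1) * B" using mrs M_gt mult_pos_pos[OF \<eta> rs0] by linarith
  have str: "\<mu> * Hc \<theta> x ((1/\<mu>) *\<^sub>R p) \<le> Hc \<theta> x p" for \<theta> x p using Hc_scaled \<mu> by simp
  interpret P: visc_pair \<sigma> Hc "\<lambda>\<theta> x p. \<mu> * Hc \<theta> x ((1/\<mu>) *\<^sub>R p)" Z "\<lambda>x t. \<mu> * Z x (t + rs)" C "\<mu> * L"
    by (rule scaled_pair[OF Z Z _ _ str]) (use \<mu> rs0 in auto)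
  have le: "Z x t - \<mu> * Z x (t + rs) \<le> m rs" if "t \<ge> 0" for x t using m(1)[of rs t x] rs0 that by simp
  show False
  proof (cases "Sigma_set \<sigma> = {}")
    case True
    \<comment> \<open>For r = 0 the difference is (1 - \<mu>) Z, so x0 minimises Z at time 1. As m 0
      does not depend on time, neither does the minimum of Z; hence Z at x0 is no smaller at time 1
      + rs, and the difference for rs at x0 is below m rs.\<close>
    obtain x0 where x0: "Z x0 1 - \<mu> * Z x0 (1 + 0) = m 0" using m(2)[of 0 1] by auto
    have "Z x0 1 \<le> Z x0 (1 + rs)"
    proof -
      have "Z x0 (1 + rs) - \<mu> * Z x0 (1 + rs) \<le> Z x0 1 - \<mu> * Z x0 1" using m(1)[of 0 "1 + rs" x0] x0 rs0 by simp
      hence "(\<mu> - 1) * (Z x0 1 - Z x0 (1 + rs)) \<le> 0" by (simp add: algebra_simps)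
      thus ?thesis using \<mu> by (simp add: mult_le_0_iff)
    qed
    hence "\<mu> * Z x0 1 \<le> \<mu> * Z x0 (1 + rs)" using \<mu> by simp
    hence low: "Z x0 1 - \<mu> * Z x0 (1 + rs) < m rs" using self[of 1 x0] mrs_gt by simp
    define \<rho> where "\<rho> = m rs - (Z x0 1 - \<mu> * Z x0 (1 + rs))"
    have \<rho>: "\<rho> > 0" using low by (simp add: \<rho>_def)
    have cx: "continuous_on {0..2} (\<lambda>t. Z x0 t - \<mu> * Z x0 (t + rs))"
    proof -
      have "Pair x0 ` {0..2} \<subseteq> UNIV \<times> {0..2}" by auto
      moreover have "continuous_on {0..2} (Pair x0)" by (intro continuous_intros)
      ultimately show ?thesis using continuous_on_compose2[OF P.cont_diff[OF order_refl, of 2], of "{0..2}" "Pair x0"] by simp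
    qed
    have \<rho>2: "\<rho> / 2 > 0" using \<rho> by simp
    have "1 \<in> {0..2::real}" by simp
    from cx[unfolded continuous_on_iff, rule_format, OF this \<rho>2] obtain d where d: "d > 0"
      "\<And>t. t \<in> {0..2} \<Longrightarrow> \<bar>t - 1\<bar> < d \<Longrightarrow> \<bar>(Z x0 t - \<mu> * Z x0 (t + rs)) - (Z x0 1 - \<mu> * Z x0 (1 + rs))\<bar> < \<rho> / 2"
      unfolding dist_real_def by blast
    define h where "h = min (d / 2) (1 / 2)"
    have h: "0 < h" "h < d" "h < 1" using d(1) by (auto simp: h_def)
    \<comment> \<open>The strong maximum principle asks for strict inequality on S during a whole
      time interval, so S is a sublevel set over a window about 1; continuity in time places x0 in
      it.\<close>
    define S where "S = {x. \<forall>t\<in>{1-h..1+h}. Z x t - \<mu> * Z x (t + rs) \<le> m rs - \<rho> / 2}"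
    have cZ: "continuous_on UNIV (\<lambda>x. Z x t)" if "t \<ge> 0" for t
      by (rule lipschitz_on_continuous_on[of L]) (use lip_solD(5,6)[OF Z] that in \<open>auto simp: lipschitz_on_def dist_norm\<close>)
    have "closed {x. Z x t - \<mu> * Z x (t + rs) \<le> m rs - \<rho> / 2}" if "t \<in> {1-h..1+h}" for t
      using that h rs0 by (intro closed_Collect_le continuous_intros cZ) auto
    moreover have "S = (\<Inter>t\<in>{1-h..1+h}. {x. Z x t - \<mu> * Z x (t + rs) \<le> m rs - \<rho> / 2})" by (auto simp: S_def)
    ultimately have S1: "closed S" by auto
    have S2: "periodic_set S" using lip_solD(4)[OF Z] by (simp add: periodic_set_def S_def periodic_fun_def)
    have S3: "x0 \<in> S" unfolding S_def
    proof (intro CollectI ballI)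
      fix t assume t: "t \<in> {1-h..1+h}"
      hence "\<bar>t - 1\<bar> < d" "t \<in> {0..2}" using h by auto
      from d(2)[OF this(2,1)] show "Z x0 t - \<mu> * Z x0 (t + rs) \<le> m rs - \<rho> / 2" unfolding abs_less_iff \<rho>_def by argo
    qed
    have lt: "Z x t - \<mu> * Z x (t + rs) < m rs" if "x \<in> S" "t \<in> {1-h..1+h}" for x t
    proof -
      have "Z x t - \<mu> * Z x (t + rs) \<le> m rs - \<rho> / 2" using that unfolding S_def by blast
      thus ?thesis using \<rho>2 by linarith
    qed
    have le': "Z x t - \<mu> * Z x (t + rs) \<le> m rs" if "t \<in> {1-h..1+h}" for x t using le[of t x] that h by simp
    have h1: "0 \<le> 1 - h" "1 - h < 1" "1 < 1 + h" using h by auto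
    have "Z xs 1 - \<mu> * Z xs (1 + rs) < m rs"
      by (rule P.strong_maximum[OF h1 le' S1 S2 S3 lt elliptic_off[OF disjI2[OF True]]])
    thus False using mrs by (simp add: M_def)
  next
    case False
    then obtain z where z: "z \<in> Sigma_set \<sigma>" by blast
    \<comment> \<open>Time 2 is interior to [1, 3]: strict inequality on the degenerate set
      throughout [1, 3] would contradict the attainment of m rs at xm.\<close>
    obtain xm where xm: "Z xm 2 - \<mu> * Z xm (2 + rs) = m rs" using m(2)[of rs 2] rs0 by auto
    have "\<exists>x0\<in>Sigma_set \<sigma>. \<exists>t0\<in>{1..3}. \<not> Z x0 t0 - \<mu> * Z x0 (t0 + rs) < m rs"
    proof (rule ccontr)
      assume n: "\<not> ?thesis"
      have "Z xm 2 - \<mu> * Z xm (2 + rs) < m rs"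
      proof (rule P.strong_maximum[OF _ _ _ _ closed_Sigma periodic_Sigma z _ elliptic_off[OF disjI1[OF refl]]])
        show "Z x t - \<mu> * Z x (t + rs) \<le> m rs" if "t \<in> {1..3}" for x t using le[of t x] that by simp
        show "Z x t - \<mu> * Z x (t + rs) < m rs" if "x \<in> Sigma_set \<sigma>" "t \<in> {1..3}" for x t using n that by blast
      qed simp_all
      thus False using xm by simp
    qed
    then obtain x0 t0 where x0: "x0 \<in> Sigma_set \<sigma>" and t0: "t0 \<in> {1..3}" and ge: "Z x0 t0 - \<mu> * Z x0 (t0 + rs) \<ge> m rs" by force
    have eq: "Z x0 t0 - \<mu> * Z x0 (t0 + rs) - \<eta> * rs \<ge> M" using ge mrs by linarith
    have "x0 \<notin> K"
    proof
      assume "x0 \<in> K"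
      hence "Z x0 (t0 + rs) = Z x0 t0" using stat[of x0 "t0 + rs" t0] t0 rs0 by auto
      thus False using self[of t0 x0] t0 ge mrs_gt by auto
    qed
    \<comment> \<open>Every pair t \<le> s is reached through r = s - t, because m bounds the
      difference at all times at once.\<close>
    moreover have "Z x t - \<mu> * Z x s - \<eta> * (s - t) \<le> Z x0 t0 - \<mu> * Z x0 (t0 + rs) - \<eta> * (t0 + rs - t0)" if "0 \<le> t" "t \<le> s" for x t s
      using M2[of "s - t"] m(1)[of "s - t" t x] that eq by simp
    ultimately show False using no_degenerate_touch[OF Z x0 _ \<mu> \<eta>, of t0 "t0 + rs"] t0 rs0 by auto
  qed
qed

text \<open>\<open>difference_bound\<close> holds for all \<mu> near 1 and all \<eta> > 0 while Z
  stays fixed, so both error terms can be made small after s and r are chosen.\<close>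

lemma limit_nondecreasing:
  assumes w: "lip_sol L w" and bd: "\<And>x t. t \<ge> 0 \<Longrightarrow> \<bar>w x t\<bar> \<le> B"
    and f: "strict_mono (f :: nat \<Rightarrow> nat)" and Z: "lip_sol L Z" and bdZ: "\<And>x t. t \<ge> 0 \<Longrightarrow> \<bar>Z x t\<bar> \<le> B"
    and unif: "\<And>\<epsilon>. \<epsilon> > 0 \<Longrightarrow> \<exists>N. \<forall>n\<ge>N. \<forall>x. \<forall>t\<ge>0. \<bar>w x (t + real (f n)) - Z x t\<bar> < \<epsilon>"
    and st: "0 \<le> s" "0 \<le> r"
  shows "Z x s \<le> Z x (s + r)"
proof (rule field_le_epsilon)
  fix e :: real assume e: "e > 0"
  have B0: "B \<ge> 0" using bdZ[of 0 0] by simp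
  \<comment> \<open>(\<mu> - 1) B is at most e/4 and is spent twice, once in the bound for m r and
    once in replacing \<mu> Z by Z; \<eta> r takes the remaining e/2.\<close>
  define \<mu> where "\<mu> = 1 + min ((\<mu>0 - 1) / 2) (e / (4 * (B + 1)))"
  define \<eta> where "\<eta> = e / (2 * (r + 1))"
  have "e / (4 * (B + 1)) > 0" using e B0 by simp
  hence "1 < \<mu>" using mu0 by (simp add: \<mu>_def)
  moreover have "\<mu> \<le> 1 + (\<mu>0 - 1) / 2" unfolding \<mu>_def by (intro add_left_mono min.cobounded1)
  hence "\<mu> < \<mu>0" using mu0 by argo
  ultimately have \<mu>: "1 < \<mu>" "\<mu> < \<mu>0" by auto
  have \<eta>: "\<eta> > 0" using e st by (simp add: \<eta>_def)
  have str: "\<mu> * Hc \<theta> x ((1/\<mu>) *\<^sub>R p) \<le> Hc \<theta> x p" for \<theta> x p using Hc_scaled \<mu> by simp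
  have "\<exists>m. \<forall>s\<ge>0. (\<forall>x. Z x s - \<mu> * Z x (s + r) \<le> m) \<and> (\<exists>x. Z x s - \<mu> * Z x (s + r) = m)" if "0 \<le> r" for r
    by (rule max_difference_constant[OF w bd f Z unif _ that str]) (use \<mu> in auto)
  then obtain m where m: "\<And>r s x. 0 \<le> r \<Longrightarrow> 0 \<le> s \<Longrightarrow> Z x s - \<mu> * Z x (s + r) \<le> m r"
      "\<And>r s. 0 \<le> r \<Longrightarrow> 0 \<le> s \<Longrightarrow> \<exists>x. Z x s - \<mu> * Z x (s + r) = m r" by metis
  have "m r - \<eta> * r \<le> (\<mu> - 1) * B"
    by (rule difference_bound[OF Z bdZ limit_constant_on_K[OF w f Z unif] \<mu> m \<eta> st(2)])
  hence "Z x s - \<mu> * Z x (s + r) \<le> (\<mu> - 1) * B + \<eta> * r" using m(1)[OF st(2,1), of x] by linarith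
  moreover have "(\<mu> - 1) * Z x (s + r) \<le> (\<mu> - 1) * B" using bdZ[of "s + r" x] st \<mu> by (intro mult_left_mono) (auto simp: abs_le_iff)
  moreover have "(\<mu> - 1) * Z x (s + r) = \<mu> * Z x (s + r) - Z x (s + r)" by (simp add: algebra_simps)
  moreover have "(\<mu> - 1) * B \<le> e / 4"
  proof -
    have "(\<mu> - 1) * B \<le> e / (4 * (B + 1)) * (B + 1)" using B0 e \<mu> by (intro mult_mono) (auto simp: \<mu>_def)
    also have "\<dots> = e / 4" using B0 by (simp add: field_simps)
    finally show ?thesis .
  qed
  moreover have "\<eta> * r \<le> e / 2"
  proof -
    have "\<eta> * r \<le> \<eta> * (r + 1)" using \<eta> by simp
    also have "\<dots> = e / 2" using st by (simp add: \<eta>_def field_simps)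
    finally show ?thesis .
  qed
  ultimately show "Z x s \<le> Z x (s + r) + e" by linarith
qed

text \<open>Z is monotone in time and uniformly Cauchy along some integer times; monotonicity turns
  this into uniform convergence to its supremum v. Then w(., t) is close to Z(., t - f n), hence to
  v, and stability applied to the translates of w makes v a stationary solution.\<close>

theorem convergence:
  assumes w: "lip_sol L w" and bd: "\<And>x t. t \<ge> 0 \<Longrightarrow> \<bar>w x t\<bar> \<le> B"
  shows "\<exists>w_inf. ergodic_sol \<sigma> H c w_inf \<and> (\<forall>\<epsilon>>0. \<exists>T. \<forall>t\<ge>T. \<forall>x. \<bar>w x t - w_inf x\<bar> < \<epsilon>)"
proof -
  obtain f Z where f: "strict_mono (f :: nat \<Rightarrow> nat)" and Z: "lip_sol L Z" and bdZ: "\<And>x t. t \<ge> 0 \<Longrightarrow> \<bar>Z x t\<bar> \<le> B"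
    and unif: "\<And>\<epsilon>. \<epsilon> > 0 \<Longrightarrow> \<exists>N. \<forall>n\<ge>N. \<forall>x. \<forall>t\<ge>0. \<bar>w x (t + real (f n)) - Z x t\<bar> < \<epsilon>"
    using omega_limit[OF w bd] by metis
  have mono: "Z x s \<le> Z x t" if "0 \<le> s" "s \<le> t" for x s t
    using limit_nondecreasing[OF w bd f Z bdZ unif that(1), of "t - s" x] that by simp
  obtain g :: "nat \<Rightarrow> nat" where g: "strict_mono g"
    and Cg: "\<And>\<epsilon>. \<epsilon> > 0 \<Longrightarrow> \<exists>N. \<forall>m\<ge>N. \<forall>n\<ge>N. \<forall>x. \<bar>Z x (real (g m)) - Z x (real (g n))\<bar> < \<epsilon>"
    using periodic_equi_lipschitz_subsequence[of "\<lambda>n x. Z x (real n)" L B] lip_solD(4,5)[OF Z] bdZ by auto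
  define v where "v = (\<lambda>x. SUP t\<in>{0..}. Z x t)"
  have bdd: "bdd_above (Z x ` {0..})" for x using bdZ by (intro bdd_aboveI2[where M=B]) (auto simp: abs_le_iff)
  have Zv: "\<exists>T\<ge>0. \<forall>t\<ge>T. \<forall>x. \<bar>Z x t - v x\<bar> \<le> \<epsilon>" if e: "\<epsilon> > 0" for \<epsilon>
  proof -
    obtain N where N: "\<And>m n x. m \<ge> N \<Longrightarrow> n \<ge> N \<Longrightarrow> \<bar>Z x (real (g m)) - Z x (real (g n))\<bar> < \<epsilon>" using Cg[OF e] by blast
    have "\<bar>Z x t - v x\<bar> \<le> \<epsilon>" if t: "t \<ge> real (g N)" for x t
    proof -
      have t0: "t \<ge> 0" using t by linarith
      have "Z x t \<le> v x" unfolding v_def using t0 by (intro cSUP_upper bdd) auto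
      moreover have "v x \<le> Z x (real (g N)) + \<epsilon>" unfolding v_def
      proof (rule cSUP_least)
        fix s :: real assume s: "s \<in> {0..}"
        obtain k where k: "real k \<ge> s" using real_arch_simple by blast
        define n where "n = max k N"
        have "real n \<ge> s" using k by (simp add: n_def)
        hence "s \<le> real (g n)" using strict_mono_imp_increasing[OF g, of n] by linarith
        hence "Z x s \<le> Z x (real (g n))" using s by (intro mono) auto
        moreover have "\<bar>Z x (real (g n)) - Z x (real (g N))\<bar> < \<epsilon>" by (rule N) (auto simp: n_def)
        ultimately show "Z x s \<le> Z x (real (g N)) + \<epsilon>" by linarith
      qed simp
      moreover have "Z x (real (g N)) \<le> Z x t" using t by (intro mono) auto
      ultimately show ?thesis by (simp add: abs_le_iff)
    qed
    thus ?thesis by (intro exI[of _ "real (g N)"]) auto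
  qed
  have conv: "\<exists>T\<ge>0. \<forall>t\<ge>T. \<forall>x. \<bar>w x t - v x\<bar> < \<epsilon>" if e: "\<epsilon> > 0" for \<epsilon>
  proof -
    have e2: "\<epsilon> / 2 > 0" using e by simp
    obtain T where T: "T \<ge> 0" "\<And>t x. t \<ge> T \<Longrightarrow> \<bar>Z x t - v x\<bar> \<le> \<epsilon> / 2" using Zv[OF e2] by blast
    obtain n where n: "\<And>t x. t \<ge> 0 \<Longrightarrow> \<bar>w x (t + real (f n)) - Z x t\<bar> < \<epsilon> / 2" using unif[OF e2] by blast
    have "\<bar>w x t - v x\<bar> < \<epsilon>" if t: "t \<ge> T + real (f n)" for t x
    proof -
      have "\<bar>w x t - Z x (t - real (f n))\<bar> < \<epsilon> / 2" using n[of "t - real (f n)" x] T(1) t by simp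
      moreover have "\<bar>Z x (t - real (f n)) - v x\<bar> \<le> \<epsilon> / 2" using T(2) t by simp
      ultimately show ?thesis by linarith
    qed
    thus ?thesis using T(1) by (intro exI[of _ "T + real (f n)"]) auto
  qed
  have vlip: "\<bar>v x - v y\<bar> \<le> L * norm (x - y)" for x y
  proof (rule field_le_epsilon)
    fix e :: real assume "e > 0"
    hence "e / 2 > 0" by simp
    then obtain T where T: "T \<ge> 0" "\<And>t x. t \<ge> T \<Longrightarrow> \<bar>Z x t - v x\<bar> \<le> e / 2" using Zv by blast
    show "\<bar>v x - v y\<bar> \<le> L * norm (x - y) + e"
      using T(2)[OF order_refl, of x] T(2)[OF order_refl, of y] lip_solD(5)[OF Z T(1), of x y] by linarith
  qed
  have vper: "periodic_fun v" using lip_solD(4)[OF Z] unfolding v_def periodic_fun_def by simp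
  have vcont: "continuous_on UNIV v"
    by (rule lipschitz_on_continuous_on[of L]) (use vlip lip_solD(6)[OF Z] in \<open>auto simp: lipschitz_on_def dist_norm\<close>)
  have tr: "lip_sol L (\<lambda>x t. w x (t + real n))" for n by (rule lip_sol_translate[OF w]) simp
  have conv': "\<exists>n::nat. \<forall>x. \<forall>t\<ge>0. \<bar>w x (t + real n) - v x\<bar> < \<epsilon>" if e: "\<epsilon> > 0" for \<epsilon>
  proof -
    obtain T where T: "\<And>t x. t \<ge> T \<Longrightarrow> \<bar>w x t - v x\<bar> < \<epsilon>" using conv[OF e] by blast
    obtain n where "real n \<ge> T" using real_arch_simple by blast
    thus ?thesis using T by (intro exI[of _ n]) auto
  qed
  note stab = stability[of "\<lambda>n x t. w x (t + real n)" "\<lambda>x t. v x", OF lip_solD(3)[OF tr] conv']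
  have "par_sub \<sigma> Hc (\<lambda>x t. v x)" by (rule stab(1)) (auto intro: lip_solD(1)[OF tr])
  moreover have "par_super \<sigma> Hc (\<lambda>x t. v x)" by (rule stab(2)) (auto intro: lip_solD(2)[OF tr])
  ultimately have "ergodic_sol \<sigma> H c v" by (rule par_ergodic_sol[OF vcont vper])
  thus ?thesis using conv by blast
qed

end

theorem theorem2p2:
  fixes \<sigma> :: "'th::metric_space \<Rightarrow> real^'n \<Rightarrow> real^'n^'n"
    and H :: "'th \<Rightarrow> real^'n \<Rightarrow> real^'n \<Rightarrow> real"
    and C c \<mu>0 :: real
    and u0 :: "real^'n \<Rightarrow> real"
    and u :: "real^'n \<Rightarrow> real \<Rightarrow> real"
    and K :: "(real^'n) set"
  assumes C_pos: "C > 0"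
    and sigma_per: "\<And>\<theta>. periodic_fun (\<sigma> \<theta>)"
    and sigma_bd: "\<And>\<theta> x. norm (\<sigma> \<theta> x) \<le> C"
    and sigma_lip: "\<And>\<theta> x y. norm (\<sigma> \<theta> x - \<sigma> \<theta> y) \<le> C * norm (x - y)"
    and H_per: "\<And>\<theta> p. periodic_fun (\<lambda>x. H \<theta> x p)"
    and H_zero: "\<And>\<theta> x. \<bar>H \<theta> x 0\<bar> \<le> C"
    and H_lip: "\<And>R. R > 0 \<Longrightarrow> \<exists>CR>0. \<forall>\<theta> x y p q. norm p \<le> R \<longrightarrow> norm q \<le> R \<longrightarrow>
                   \<bar>H \<theta> x p - H \<theta> y q\<bar> \<le> CR * (norm (x - y) + norm (p - q))"
    and u_sol: "cauchy_sol \<sigma> H u0 u"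
    and u_lip: "\<And>x y t. t \<ge> 0 \<Longrightarrow> \<bar>u x t - u y t\<bar> \<le> C * norm (x - y)"
    and v_lambda: "\<And>lam. lam > 0 \<Longrightarrow> \<exists>v. discounted_sol \<sigma> H lam v \<and>
                   (\<forall>x y. \<bar>v x - v y\<bar> \<le> C * norm (x - y))"
    and c_ergodic: "\<exists>v. ergodic_sol \<sigma> H c v \<and> (\<exists>L. \<forall>x y. \<bar>v x - v y\<bar> \<le> L * norm (x - y))"
    and hyp_i: "\<And>\<delta>. \<delta> > 0 \<Longrightarrow> \<exists>\<nu>>0. \<forall>\<theta> x. dist_gt x (Sigma_set \<sigma>) \<delta> \<longrightarrow>
                   (\<forall>\<xi>. \<xi> \<bullet> (Amat \<sigma> \<theta> x *v \<xi>) \<ge> \<nu> * (\<xi> \<bullet> \<xi>))"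
    and mu0: "\<mu>0 > 1"
    and hyp_iia: "\<And>\<theta> x p \<mu>. 1 < \<mu> \<Longrightarrow> \<mu> < \<mu>0 \<Longrightarrow> H \<theta> x (\<mu> *\<^sub>R p) - \<mu> * H \<theta> x p \<ge> (1 - \<mu>) * c"
    and K_closed: "closed K" and K_per: "periodic_set K" and K_sub: "K \<subseteq> Sigma_set \<sigma>"
    and hyp_iib1: "\<And>\<theta> x p. x \<in> K \<Longrightarrow> H \<theta> x p \<ge> c"
    and hyp_iib2: "\<And>x p \<mu>. x \<in> Sigma_set \<sigma> \<Longrightarrow> (K = {} \<or> infdist x K \<noteq> 0) \<Longrightarrow> p \<noteq> 0 \<Longrightarrow>
                   1 < \<mu> \<Longrightarrow> \<mu> \<le> \<mu>0 \<Longrightarrow>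
                   (INF \<theta>. H \<theta> x (\<mu> *\<^sub>R p) - \<mu> * H \<theta> x p) > (1 - \<mu>) * c"
  shows "\<exists>u_inf. ergodic_sol \<sigma> H c u_inf \<and>
           (\<forall>\<epsilon>>0. \<exists>T. \<forall>t\<ge>T. \<forall>x. \<bar>u x t + c * t - u_inf x\<bar> < \<epsilon>)"
proof -
  have H: "loc_lip_ham H" unfolding loc_lip_ham_def by (intro allI impI H_lip)
  interpret hj_structured \<sigma> H C c \<mu>0 K
    by unfold_locales (fact C_pos sigma_bd sigma_lip H_zero H sigma_per hyp_i mu0 hyp_iia K_closed K_sub hyp_iib1 hyp_iib2)+
  \<comment> \<open>Adding c t turns the problem for H into one for H - c, in which the ergodic
    solutions are stationary.\<close>
  define w where "w = (\<lambda>x t. u x t + c * t)"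
  have "continuous_on (UNIV \<times> {0..}) (\<lambda>(x,t). w x t)"
  proof -
    have "continuous_on (UNIV \<times> {0..}) (\<lambda>z. u (fst z) (snd z))" using u_sol by (simp add: cauchy_sol_def case_prod_unfold)
    thus ?thesis unfolding w_def case_prod_unfold by (intro continuous_intros)
  qed
  moreover have "periodic_fun (\<lambda>x. w x t)" for t using u_sol by (simp add: cauchy_sol_def periodic_fun_def w_def)
  moreover have "\<bar>w x t - w y t\<bar> \<le> C * norm (x - y)" if "t \<ge> 0" for x y t using u_lip[OF that, of x y] by (simp add: w_def)
  ultimately have w: "lip_sol C w" using cauchy_sol_par[OF u_sol] unfolding lip_sol_def w_def by blast
  obtain v L where v: "ergodic_sol \<sigma> H c v" "\<And>x y. \<bar>v x - v y\<bar> \<le> L * norm (x - y)" using c_ergodic by blast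
  obtain B where B: "\<And>x t. t \<ge> 0 \<Longrightarrow> \<bar>w x t\<bar> \<le> B" using lip_sol_bounded[OF w v] by blast
  show ?thesis using convergence[OF w B] unfolding w_def by simp
qed

end
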